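(* Let $N\geq 3$ and let $V:(0,+\infty)\to[0,+\infty)$ and $K:(0,+\infty)\to(0,+\infty)$ be continuous functions such that there exists $C>0$ with $V(r)\leq C/r^2$ for all $r\in(0,1)$. Assume: (i) there exist $R_1>0$, $\beta_0\in[0,1]$, $\alpha_0\in\mathbb{R}$ with $\sup_{r\in(0,R_1)}\frac{K(r)}{r^{\alpha_0}V(r)^{\beta_0}}<+\infty$, and $R_2>0$, $\beta_\infty\in[0,1]$, $\alpha_\infty\in\mathbb{R}$ with $\sup_{r>R_2}\frac{K(r)}{r^{\alpha_\infty}V(r)^{\beta_\infty}}<+\infty$; (ii) $q_1,q_2\in\mathbb{R}$ satisfy $4<q_1<2q_0^*(\alpha_0,\beta_0)$ and $q_2>\max\{4,\,2q_\infty^*(\alpha_\infty,\beta_\infty)\}$, where $q_0^*(\alpha,\beta)=\frac{2\alpha+2N-\beta(N+2)}{N-2}$ and $q_\infty^*(\alpha,\beta)=\frac{2(\alpha+N-2\beta)}{N-2}$. Let $g:\mathbb{R}\to\mathbb{R}$ be continuous, let $G(t)=\int_0^t g(s)\,ds$, and assume: there exists $\theta>2$ with $0\leq 2\theta G(t)\leq g(t)t$ for all $t\in\mathbb{R}$; there exists $t_0>0$ with $G(t_0)>0$; there exists $C>0$ with $|g(t)|\leq C\min\{|t|^{q_1-1},|t|^{q_2-1}\}$ for all $t\in\mathbb{R}$. Define $I:E\to\mathbb{R}$ by $$I(u)=\frac12\int_{\mathbb{R}^N}|\nabla u|^2dx+\frac12\int_{\mathbb{R}^N}V(|x|)f^2(u)\,dx-\int_{\mathbb{R}^N}K(|x|)G(f(u))\,dx.$$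 Then $I$ has a nonnegative critical point $u\in E$ with $u\neq 0$.
   Context: Convention: $V(r)^0=1$ for every $r$, even if $V(r)=0$. Let $f:\mathbb{R}\to\mathbb{R}$ be the unique solution of the Cauchy problem $f'(t)=\frac{1}{\sqrt{1+2f(t)^2}}$, $f(0)=0$ (it is smooth, odd, strictly increasing and bijective). $D_r^{1,2}(\mathbb{R}^N)$ is the closure of the space of radial $C^\infty$ compactly supported functions on $\mathbb{R}^N$ with respect to the norm $\|u\|_{1,2}=(\int_{\mathbb{R}^N}|\nabla u|^2dx)^{1/2}$. $E=\{u\in D_r^{1,2}(\mathbb{R}^N):\int_{\mathbb{R}^N}V(|x|)f^2(u)\,dx<+\infty\}$, normed by $\|u\|=\|u\|_{1,2}+\|u\|_o$, where $\|u\|_o=\inf_{k>0}\frac1k\big[1+\int_{\mathbb{R}^N}V(|x|)f^2(ku)\,dx\big]$; it is a Banach space. $I$ is of class $C^1$ on $E$, and a critical point means $I'(u)=0$ in the dual of $E$. Such a critical point corresponds, via $w=f(u)$, to a solution of $-\Delta w+V(|x|)w-w\Delta(w^2)=K(|x|)g(w)$ in $\mathbb{R}^N$. *)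

theory Defs
  imports "HOL-Analysis.Analysis"
begin

definition fODE :: "real \<Rightarrow> real" where
  "fODE = (THE f. (\<forall>t. (f has_real_derivative 1 / sqrt (1 + 2 * (f t)\<^sup>2)) (at t)) \<and> f 0 = 0)"

text \<open>Power with the convention V^0 = 1 even when V = 0.\<close>
definition vpow :: "real \<Rightarrow> real \<Rightarrow> real" where
  "vpow x b = (if b = 0 then 1 else x powr b)"

definition prim :: "(real \<Rightarrow> real) \<Rightarrow> real \<Rightarrow> real" where
  "prim g t = (if 0 \<le> t then integral {0..t} g else - integral {t..0} g)"

coinductive smooth_fun :: "('a::euclidean_space \<Rightarrow> real) \<Rightarrow> bool" where
  "(\<forall>x. f differentiable (at x)) \<Longrightarrow>
   (\<forall>b\<in>Basis. smooth_fun (\<lambda>x. frechet_derivative f (at x) b)) \<Longrightarrow> smooth_fun f"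

definition grad :: "('a::euclidean_space \<Rightarrow> real) \<Rightarrow> 'a \<Rightarrow> 'a" where
  "grad \<phi> x = (\<Sum>b\<in>Basis. frechet_derivative \<phi> (at x) b *\<^sub>R b)"

definition radial_test :: "('a::euclidean_space \<Rightarrow> real) \<Rightarrow> bool" where
  "radial_test \<phi> \<longleftrightarrow> smooth_fun \<phi> \<and> bounded {x. \<phi> x \<noteq> 0} \<and>
     (\<forall>x y. norm x = norm y \<longrightarrow> \<phi> x = \<phi> y)"

text \<open>u belongs to D_r^{1,2} with gradient Gr: u is the (a.e.) limit of a sequence of radial
  test functions whose gradients converge to Gr in L^2. (Elements of the completion are
  identified with functions via the Sobolev embedding.)\<close>
definition in_D :: "('a::euclidean_space \<Rightarrow> real) \<Rightarrow> ('a \<Rightarrow> 'a) \<Rightarrow> bool" where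
  "in_D u Gr \<longleftrightarrow> u \<in> borel_measurable lebesgue \<and> Gr \<in> borel_measurable lebesgue \<and>
     (\<exists>\<phi>::nat \<Rightarrow> 'a \<Rightarrow> real. (\<forall>k. radial_test (\<phi> k)) \<and>
        (\<lambda>k. \<integral>\<^sup>+ x. ennreal ((norm (grad (\<phi> k) x - Gr x))\<^sup>2) \<partial>lebesgue) \<longlonglongrightarrow> 0 \<and>
        (AE x in lebesgue. (\<lambda>k. \<phi> k x) \<longlonglongrightarrow> u x))"

definition Dspace :: "('a::euclidean_space \<Rightarrow> real) set" where
  "Dspace = {u. \<exists>Gr. in_D u Gr}"

definition wgrad :: "('a::euclidean_space \<Rightarrow> real) \<Rightarrow> 'a \<Rightarrow> 'a" where
  "wgrad u = (SOME Gr. in_D u Gr)"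

definition Dnorm :: "('a::euclidean_space \<Rightarrow> real) \<Rightarrow> real" where
  "Dnorm u = sqrt (enn2real (\<integral>\<^sup>+ x. ennreal ((norm (wgrad u x))\<^sup>2) \<partial>lebesgue))"

definition Vint :: "(real \<Rightarrow> real) \<Rightarrow> ('a::euclidean_space \<Rightarrow> real) \<Rightarrow> ennreal" where
  "Vint V u = (\<integral>\<^sup>+ x. ennreal (V (norm x) * (fODE (u x))\<^sup>2) \<partial>lebesgue)"

definition Espace :: "(real \<Rightarrow> real) \<Rightarrow> ('a::euclidean_space \<Rightarrow> real) set" where
  "Espace V = {u \<in> Dspace. Vint V u < \<infinity>}"

definition Onorm :: "(real \<Rightarrow> real) \<Rightarrow> ('a::euclidean_space \<Rightarrow> real) \<Rightarrow> real" where
  "Onorm V u = enn2real (INF k\<in>{0<..}. ennreal (1 / k) * (1 + Vint V (\<lambda>x. k * u x)))"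

definition Enorm :: "(real \<Rightarrow> real) \<Rightarrow> ('a::euclidean_space \<Rightarrow> real) \<Rightarrow> real" where
  "Enorm V u = Dnorm u + Onorm V u"

definition Ifun :: "(real \<Rightarrow> real) \<Rightarrow> (real \<Rightarrow> real) \<Rightarrow> (real \<Rightarrow> real) \<Rightarrow>
    ('a::euclidean_space \<Rightarrow> real) \<Rightarrow> real" where
  "Ifun V K g u = 1/2 * enn2real (\<integral>\<^sup>+ x. ennreal ((norm (wgrad u x))\<^sup>2) \<partial>lebesgue)
     + 1/2 * enn2real (Vint V u)
     - (\<integral> x. K (norm x) * prim g (fODE (u x)) \<partial>lebesgue)"

definition critical_point :: "(real \<Rightarrow> real) \<Rightarrow> (real \<Rightarrow> real) \<Rightarrow> (real \<Rightarrow> real) \<Rightarrow>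
    ('a::euclidean_space \<Rightarrow> real) \<Rightarrow> bool" where
  "critical_point V K g u \<longleftrightarrow> u \<in> Espace V \<and>
     (\<forall>\<epsilon>>0. \<exists>\<delta>>0. \<forall>h\<in>Espace V. Enorm V h < \<delta> \<longrightarrow>
        \<bar>Ifun V K g (\<lambda>x. u x + h x) - Ifun V K g u\<bar> \<le> \<epsilon> * Enorm V h)"

definition q0star :: "real \<Rightarrow> real \<Rightarrow> real \<Rightarrow> real" where
  "q0star N \<alpha> \<beta> = (2 * \<alpha> + 2 * N - \<beta> * (N + 2)) / (N - 2)"

definition qinfstar :: "real \<Rightarrow> real \<Rightarrow> real \<Rightarrow> real" where
  "qinfstar N \<alpha> \<beta> = 2 * (\<alpha> + N - 2 * \<beta>) / (N - 2)"

end

theory Submission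
 imports Defs "HOL-Complex_Analysis.Great_Picard"
begin

text \<open>
 For radial functions the problem is one-dimensional. On each interval \<open>[a, b]\<close> a mountain-pass
 argument produces almost critical points of the reduced functional, with a uniform positive lower
 bound for their energy; along \<open>a \<rightarrow> 0\<close>, \<open>b \<rightarrow> \<infinity>\<close> a subsequence converges locally uniformly to a
 solution \<open>U\<close> of \<open>(r^(N-1) U')' = r^(N-1) (V f f'(U) - K g(f(U)) f'(U))\<close>. The growth hypotheses on \<open>K\<close>, together with
 the radial bound \<open>|U(r)| \<le> S r^(-(N-2)/2)\<close>, make the \<open>K\<close>-term uniformly small near \<open>0\<close> and \<open>\<infinity>\<close>, so
 that \<open>U \<noteq> 0\<close>. Truncating \<open>g\<close> at \<open>0\<close> forces \<open>U \<ge> 0\<close>. Integrating the equation against test functions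
 on shells, whose boundary terms vanish along suitable radii, gives the weak equation on all of \<open>E\<close>, and a direct
 second-order estimate of \<open>I(u + h) - I(u)\<close> turns it into \<open>I'(u) = 0\<close>.
\<close>

text \<open>The substitution w = f(u) removes the quasilinear term. As f grows like a square root,
  powers q of w become powers q/2 of u, and the constant 2 \<theta> of the superlinearity condition
  becomes \<theta> > 2. The price is the V-term: f^2 is quadratic near 0 but linear at infinity, so
  E carries an Orlicz-type norm. On an interval [a, b] inside the half-line this obstacle
  disappears: the unknown is p = -U', a continuous function free of boundary conditions, the
  gradient of the functional for the weighted L^2 product is explicit, and the deformation is the
  iteration of a single continuous map. All levels and bounds must be independent of a and b. This
  decides the sphere, taken for the Dirichlet energy plus the integral of V f^2(U), and the path,
  built from one fixed profile supported in [1, 2]. The way back to E has its own obstacle: the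
  gradient in the definition of I is picked by choice. It has to be unique almost everywhere before
  I(u + h) can be expanded, and u itself must be approximated by smooth radial functions to belong
  to E.\<close>

lemmas vector_derivative_simps = has_real_derivative_iff_has_vector_derivative[symmetric]
 has_field_derivative_at_within

section \<open>The change of variable f and its elementary estimates\<close>

definition fprimitive :: "real \<Rightarrow> real" where
 "fprimitive y = y * sqrt (1 + 2 * y\<^sup>2) / 2 + arsinh (sqrt 2 * y) / (2 * sqrt 2)"

text \<open>Separation of variables: the equation of f says that the integral of sqrt(1 + 2 y^2)
  from 0 to f(t) equals t. \<open>fprimitive\<close> is that integral in closed form, so every fact
  about f comes from inverting it.\<close>

lemma fprimitive_deriv:
 "(fprimitive has_real_derivative sqrt (1 + 2 * y\<^sup>2)) (at y)"
proof -
 have pos: "1 + 2 * y\<^sup>2 > 0" by (intro add_pos_nonneg) auto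
 have s2: "(sqrt 2 * y)\<^sup>2 + 1 = 1 + 2 * y\<^sup>2" by (simp add: power_mult_distrib)
 define s where "s = sqrt (1 + 2 * y\<^sup>2)"
 have s: "s > 0" "s\<^sup>2 = 1 + 2 * y\<^sup>2" using pos by (auto simp: s_def)
 have "((\<lambda>y. sqrt (1 + 2 * y\<^sup>2)) has_real_derivative 4 * y * (inverse s / 2)) (at y)"
 proof -
  have "((\<lambda>y. 1 + 2 * y\<^sup>2) has_real_derivative 4 * y) (at y)"
   by (auto intro!: derivative_eq_intros)
  from DERIV_chain2[where f=sqrt, OF DERIV_real_sqrt[OF pos] this] show ?thesis
   by (simp add: s_def mult.commute)
 qed
 hence d1: "((\<lambda>y. y * sqrt (1 + 2 * y\<^sup>2)) has_real_derivative 1 * s + 4 * y * (inverse s / 2) * y) (at y)"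
  using DERIV_mult[OF DERIV_ident] unfolding s_def by blast
 have "((\<lambda>y. arsinh (sqrt 2 * y)) has_real_derivative 1 / s * sqrt 2) (at y)"
  unfolding s_def s2[symmetric]
  using DERIV_chain2[where f=arsinh and g="\<lambda>y. sqrt 2 * y", OF arsinh_real_has_field_derivative
   DERIV_cmult_Id] by blast
 from DERIV_add[OF DERIV_cdivide[OF d1, of 2] DERIV_cdivide[OF this, of "2 * sqrt 2"]]
 have "(fprimitive has_real_derivative
   (s + y * (2 * y / s)) / 2 + 1 / (2 * s)) (at y)"
  unfolding fprimitive_def[abs_def] by (simp add: field_simps)
 moreover have "(s + y * (2 * y / s)) / 2 + 1 / (2 * s) = s"
  using s by (simp add: field_simps power2_eq_square)
 ultimately show ?thesis by (simp add: s_def)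
qed

lemma fprimitive_0 [simp]: "fprimitive 0 = 0"
 by (simp add: fprimitive_def)

lemma fprimitive_minus [simp]: "fprimitive (- y) = - fprimitive y"
 by (simp add: fprimitive_def)

lemma sqrt_1_plus_ge_1: "1 \<le> sqrt (1 + 2 * (y::real)\<^sup>2)"
 by simp

lemma sqrt_1_plus_pos: "sqrt (1 + 2 * (y::real)\<^sup>2) \<noteq> 0"
 using sqrt_1_plus_ge_1[of y] by linarith

lemma fprimitive_mono: "x < y \<Longrightarrow> fprimitive x < fprimitive y"
 by (rule DERIV_pos_imp_increasing)
  (use fprimitive_deriv sqrt_1_plus_ge_1 in \<open>force intro: less_le_trans[OF zero_less_one]\<close>)+

lemma inj_fprimitive: "inj fprimitive"
 by (metis fprimitive_mono injI linorder_neqE_linordered_idom order_less_irrefl)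

lemma isCont_fprimitive: "isCont fprimitive y"
 using fprimitive_deriv DERIV_isCont by blast

lemma fprimitive_ge: assumes "y \<ge> 0" shows "y \<le> fprimitive y"
proof -
 have "fprimitive 0 - 0 \<le> fprimitive y - y"
  by (rule DERIV_nonneg_imp_nondecreasing[OF assms])
   (force intro!: exI[of _ "sqrt _ - 1"] DERIV_diff fprimitive_deriv DERIV_ident)
 thus ?thesis by simp
qed

lemma surj_fprimitive: "\<exists>y. fprimitive y = t"
proof -
 have *: "\<exists>y. fprimitive y = t" if "t \<ge> 0" for t
  using IVT[of fprimitive 0 t t] that fprimitive_ge[OF that] isCont_fprimitive by auto
 show ?thesis
 proof (cases "t \<ge> 0")
  case False
  then obtain y where "fprimitive y = -t" using *[of "-t"] by auto
  hence "fprimitive (-y) = t" by simp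
  thus ?thesis ..
 qed (rule *)
qed

definition finv :: "real \<Rightarrow> real" where "finv = inv fprimitive"

lemma fprimitive_finv [simp]: "fprimitive (finv t) = t"
 unfolding finv_def by (metis f_inv_into_f surj_fprimitive rangeI)

lemma finv_fprimitive [simp]: "finv (fprimitive y) = y"
 by (simp add: finv_def inj_fprimitive)

lemma isCont_finv: "isCont finv t"
 using isCont_inverse_function[of 1 "finv t" finv fprimitive] isCont_fprimitive by simp

lemma finv_deriv: "(finv has_real_derivative 1 / sqrt (1 + 2 * (finv t)\<^sup>2)) (at t)"
 using DERIV_inverse_function[of fprimitive "sqrt (1 + 2 * (finv t)\<^sup>2)" finv t "t-1" "t+1"]
  fprimitive_deriv[of "finv t"] sqrt_1_plus_pos[of "finv t"] isCont_finv
 by (simp add: inverse_eq_divide del: real_sqrt_eq_zero_cancel_iff)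

text \<open>A definite description is usable only after existence and uniqueness. For uniqueness,
  \<open>fprimitive (f t) - t\<close> has derivative 0 for any solution f and vanishes at 0, which
  makes f the inverse of \<open>fprimitive\<close>.\<close>

lemma fODE_eq_finv: "fODE = finv"
 unfolding fODE_def
proof (rule the_equality)
 show "(\<forall>t. (finv has_real_derivative 1 / sqrt (1 + 2 * (finv t)\<^sup>2)) (at t)) \<and> finv 0 = 0"
  using finv_deriv finv_fprimitive[of 0] by simp
next
 fix f :: "real \<Rightarrow> real"
 assume f: "(\<forall>t. (f has_real_derivative 1 / sqrt (1 + 2 * (f t)\<^sup>2)) (at t)) \<and> f 0 = 0"
 have "((\<lambda>t. fprimitive (f t) - t) has_real_derivative 0) (at t)" for t
  using DERIV_chain2[OF fprimitive_deriv, of f _ t UNIV] f sqrt_1_plus_pos[of "f t"]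
  by (auto intro!: derivative_eq_intros simp del: real_sqrt_eq_zero_cancel_iff)
 hence "fprimitive (f t) - t = fprimitive (f 0) - 0" for t
  using DERIV_const_ratio_const2 DERIV_isconst_all by blast
 hence "fprimitive (f t) = t" for t using f by simp
 thus "f = finv" by (metis finv_fprimitive ext)
qed

lemma fprimitive_fODE [simp]: "fprimitive (fODE t) = t"
 and fODE_fprimitive [simp]: "fODE (fprimitive y) = y"
 by (simp_all add: fODE_eq_finv)

lemma fODE_deriv: "(fODE has_real_derivative 1 / sqrt (1 + 2 * (fODE t)\<^sup>2)) (at t)"
 by (simp add: fODE_eq_finv finv_deriv)

lemma fODE_0 [simp]: "fODE 0 = 0"
 by (metis fODE_fprimitive fprimitive_0)

lemma fODE_minus [simp]: "fODE (- t) = - fODE t"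
 by (metis fODE_fprimitive fprimitive_fODE fprimitive_minus)

lemma fODE_mono: "s \<le> t \<Longrightarrow> fODE s \<le> fODE t"
 by (metis fprimitive_fODE fprimitive_mono linorder_not_less)

lemma fODE_nonneg: "0 \<le> t \<Longrightarrow> 0 \<le> fODE t"
 using fODE_mono[of 0 t] by simp

lemma fODE_le: "0 \<le> t \<Longrightarrow> fODE t \<le> t"
 by (metis fODE_nonneg fprimitive_ge fprimitive_fODE)

lemma fODE_abs: "fODE \<bar>t\<bar> = \<bar>fODE t\<bar>"
 using fODE_nonneg[of t] fODE_nonneg[of "-t"] by (cases "t \<ge> 0") auto

lemma fODE_sq_abs: "(fODE \<bar>t\<bar>)\<^sup>2 = (fODE t)\<^sup>2"
 by (simp add: fODE_abs)

text \<open>This is f f', half the derivative of f^2: the nonlinearity that V contributes to the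
  Euler-Lagrange equation.\<close>

definition kfun :: "real \<Rightarrow> real" where
 "kfun t = fODE t / sqrt (1 + 2 * (fODE t)\<^sup>2)"

lemma fODE_sq_deriv: "((\<lambda>t. (fODE t)\<^sup>2) has_real_derivative 2 * kfun t) (at t)"
 unfolding kfun_def by (rule derivative_eq_intros fODE_deriv refl | simp)+

text \<open>The derivative lies in (0, 1], so f f' is increasing and 1-Lipschitz. Hence f^2 is
  convex with second derivative at most 2.\<close>

lemma kfun_deriv: "(kfun has_real_derivative 1 / (1 + 2 * (fODE t)\<^sup>2)\<^sup>2) (at t)"
proof -
 define s where "s = sqrt (1 + 2 * (fODE t)\<^sup>2)"
 have pos: "1 + 2 * (fODE t)\<^sup>2 > 0" by (intro add_pos_nonneg) auto
 have s: "s > 0" "s\<^sup>2 = 1 + 2 * (fODE t)\<^sup>2" using pos by (auto simp: s_def)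
 have "(kfun has_real_derivative (1/s * s - fODE t * (2 * fODE t * (1/s) / s)) / s\<^sup>2) (at t)"
 proof -
  have "((\<lambda>t. 1 + 2 * (fODE t)\<^sup>2) has_real_derivative 2 * (2 * fODE t * (1/s))) (at t)"
   unfolding s_def by (auto intro!: derivative_eq_intros fODE_deriv)
  from DERIV_chain2[where f=sqrt, OF DERIV_real_sqrt[OF pos] this]
  have "((\<lambda>t. sqrt (1 + 2 * (fODE t)\<^sup>2)) has_real_derivative (2 * fODE t * (1/s) / s)) (at t)"
   by (rule DERIV_cong) (use s in \<open>simp add: s_def[symmetric] field_simps\<close>)
  from DERIV_divide[OF fODE_deriv this] s(1) show ?thesis
   unfolding kfun_def[abs_def] s_def[symmetric] by (simp add: power2_eq_square)
 qed
 moreover have "(1/s * s - fODE t * (2 * fODE t * (1/s) / s)) / s\<^sup>2 = 1 / (s\<^sup>2)\<^sup>2"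
 proof -
  have "fODE t * (2 * fODE t * (1/s) / s) = (2 * (fODE t)\<^sup>2) / s\<^sup>2" by (simp add: power2_eq_square)
  also have "\<dots> = (s\<^sup>2 - 1) / s\<^sup>2" by (simp add: s(2))
  finally have "1/s * s - fODE t * (2 * fODE t * (1/s) / s) = 1 - (s\<^sup>2 - 1) / s\<^sup>2" using s(1) by simp
  also have "\<dots> = 1 / s\<^sup>2" using s(1) by (simp add: diff_divide_distrib)
  finally show ?thesis by (simp add: power2_eq_square)
 qed
 ultimately show ?thesis using s(2) by simp
qed

lemma kfun_minus [simp]: "kfun (-t) = - kfun t"
 by (simp add: kfun_def)

lemma kfun_0 [simp]: "kfun 0 = 0"
 by (simp add: kfun_def)

lemma kfun_nonneg: "0 \<le> t \<Longrightarrow> 0 \<le> kfun t"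
 by (simp add: kfun_def fODE_nonneg)

lemma kfun_nonpos: "t \<le> 0 \<Longrightarrow> kfun t \<le> 0"
 using kfun_nonneg[of "-t"] by simp

lemma isCont_fODE: "isCont fODE t" using fODE_deriv DERIV_isCont by blast
lemma isCont_kfun: "isCont kfun t" using kfun_deriv DERIV_isCont by blast

lemma kfun_deriv_bounds: "0 < 1 / (1 + 2 * (fODE t)\<^sup>2)\<^sup>2" "1 / (1 + 2 * (fODE t)\<^sup>2)\<^sup>2 \<le> 1"
proof -
 have 1: "1 \<le> 1 + 2 * (fODE t)\<^sup>2" by simp
 hence "1 \<le> (1 + 2 * (fODE t)\<^sup>2)\<^sup>2" by (simp add: one_le_power)
 thus "0 < 1 / (1 + 2 * (fODE t)\<^sup>2)\<^sup>2" "1 / (1 + 2 * (fODE t)\<^sup>2)\<^sup>2 \<le> 1"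
  by (smt (verit) divide_le_eq_1 zero_less_divide_1_iff)+
qed

lemma kfun_diff: assumes "s \<le> t" shows "0 \<le> kfun t - kfun s" "kfun t - kfun s \<le> t - s"
proof -
 show "0 \<le> kfun t - kfun s"
  using DERIV_nonneg_imp_nondecreasing[OF assms, of kfun] kfun_deriv kfun_deriv_bounds(1)
  by (smt (verit))
 have "((\<lambda>t. t - kfun t) has_real_derivative 1 - 1 / (1 + 2 * (fODE x)\<^sup>2)\<^sup>2) (at x)" for x
  by (rule derivative_eq_intros kfun_deriv refl)+
 hence "s - kfun s \<le> t - kfun t"
  using DERIV_nonneg_imp_nondecreasing[OF assms, of "\<lambda>t. t - kfun t"] kfun_deriv_bounds(2)
  by (smt (verit))
 thus "kfun t - kfun s \<le> t - s" by simp
qed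

lemma kfun_abs_le: "\<bar>kfun t\<bar> \<le> \<bar>t\<bar>"
 using kfun_diff[of 0 t] kfun_diff[of t 0] by (cases "t \<ge> 0") auto

text \<open>Convexity of f^2 gives the lower bound, the Lipschitz bound of \<open>kfun\<close> at a
  mean value point the upper one. Both are the second-order control of the V-term in I(u + h) -
  I(u).\<close>

lemma fODE_sq_remainder:
 "0 \<le> (fODE (t+h))\<^sup>2 - (fODE t)\<^sup>2 - 2 * kfun t * h" (is ?A)
 "(fODE (t+h))\<^sup>2 - (fODE t)\<^sup>2 - 2 * kfun t * h \<le> 2 * h\<^sup>2" (is ?B)
proof -
 have "?A \<and> ?B"
 proof (cases "h = 0")
  case False
  \<comment> \<open>The third conjunct records that z lies on the side of t to which h points; it
    fixes the sign of h (kfun z - kfun t).\<close>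
  have "\<exists>z. (fODE (t+h))\<^sup>2 - (fODE t)\<^sup>2 = h * (2 * kfun z) \<and> \<bar>z - t\<bar> \<le> \<bar>h\<bar> \<and> (z - t) * h \<ge> 0"
  proof (cases "h > 0")
   case True
   then obtain z where "z > t" "z < t + h"
    "(fODE (t+h))\<^sup>2 - (fODE t)\<^sup>2 = (t + h - t) * (2 * kfun z)"
    using MVT2[of t "t+h" "\<lambda>t. (fODE t)\<^sup>2" "\<lambda>t. 2 * kfun t"] fODE_sq_deriv by force
   thus ?thesis using True by (intro exI[of _ z]) auto
  next
   case F: False
   then obtain z where "z < t" "z > t + h"
    "(fODE t)\<^sup>2 - (fODE (t+h))\<^sup>2 = (t - (t+h)) * (2 * kfun z)"
    using MVT2[of "t+h" t "\<lambda>t. (fODE t)\<^sup>2" "\<lambda>t. 2 * kfun t"] fODE_sq_deriv False by force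
   thus ?thesis using F False by (intro exI[of _ z]) (auto intro: mult_nonpos_nonpos)
  qed
  then obtain z where z: "(fODE (t+h))\<^sup>2 - (fODE t)\<^sup>2 = h * (2 * kfun z)" "\<bar>z - t\<bar> \<le> \<bar>h\<bar>"
   "(z - t) * h \<ge> 0" by blast
  have eq: "(fODE (t+h))\<^sup>2 - (fODE t)\<^sup>2 - 2 * kfun t * h = 2 * (h * (kfun z - kfun t))"
   using z(1) by (simp add: algebra_simps)
  have "h * (kfun z - kfun t) \<ge> 0 \<and> h * (kfun z - kfun t) \<le> h * (z - t)"
  proof (cases "h > 0")
   case True
   hence "z \<ge> t" using z(3) by (simp add: zero_le_mult_iff)
   thus ?thesis using kfun_diff[of t z] True by simp
  next
   case F: False
   hence "z \<le> t" using z(3) False by (simp add: zero_le_mult_iff)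
   thus ?thesis using kfun_diff[of z t] F
    by (auto intro: mult_nonpos_nonpos mult_left_mono_neg)
  qed
  moreover have "h * (z - t) \<le> h\<^sup>2"
  proof -
   have "h * (z - t) \<le> \<bar>h\<bar> * \<bar>z - t\<bar>" by (metis abs_ge_self abs_mult)
   also have "\<dots> \<le> \<bar>h\<bar> * \<bar>h\<bar>" using z(2) by (intro mult_left_mono) auto
   finally show ?thesis by (simp add: power2_eq_square)
  qed
  ultimately show ?thesis unfolding eq by simp
 qed simp
 thus ?A ?B by auto
qed

lemma fODE_sq_le: "(fODE t)\<^sup>2 \<le> t\<^sup>2"
 using power_mono[OF fODE_le[of "\<bar>t\<bar>"] fODE_nonneg, of 2] by (simp add: fODE_sq_abs)

lemma arsinh_le_self: "y \<ge> 0 \<Longrightarrow> arsinh (y::real) \<le> y"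
proof -
 assume y: "y \<ge> 0"
 have "0 - arsinh 0 \<le> y - arsinh y"
 proof (rule DERIV_nonneg_imp_nondecreasing[OF y])
  fix x :: real
  have "((\<lambda>x. x - arsinh x) has_real_derivative 1 - 1 / sqrt (x\<^sup>2 + 1)) (at x)"
   by (rule derivative_eq_intros refl | simp add: field_simps)+
  moreover have "1 \<le> sqrt (x\<^sup>2 + 1)" by simp
  hence "0 \<le> 1 - 1 / sqrt (x\<^sup>2 + 1)" by (smt (verit) divide_le_eq_1)
  ultimately show "\<exists>y. ((\<lambda>x. x - arsinh x) has_real_derivative y) (at x) \<and> 0 \<le> y" by blast
 qed
 thus ?thesis by simp
qed

text \<open>The arsinh summand lies between 0 and y/2, and y/2 is at most the other summand; hence
  the factor 2 between the bounds.\<close>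

lemma fprimitive_bounds:
 assumes "y \<ge> 0"
 shows "y * sqrt (1 + 2 * y\<^sup>2) / 2 \<le> fprimitive y" "fprimitive y \<le> y * sqrt (1 + 2 * y\<^sup>2)"
proof -
 show "y * sqrt (1 + 2 * y\<^sup>2) / 2 \<le> fprimitive y"
  using assms by (auto simp: fprimitive_def le_less)
 have "arsinh (sqrt 2 * y) \<le> sqrt 2 * y" using assms by (intro arsinh_le_self) auto
 hence "arsinh (sqrt 2 * y) / (2 * sqrt 2) \<le> y / 2" by (simp add: field_simps)
 also have "\<dots> \<le> y * sqrt (1 + 2 * y\<^sup>2) / 2"
  using mult_left_mono[OF sqrt_1_plus_ge_1[of y] assms] by simp
 finally show "fprimitive y \<le> y * sqrt (1 + 2 * y\<^sup>2)" by (simp add: fprimitive_def)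
qed

lemma kfun_mult_abs: "kfun \<bar>t\<bar> * \<bar>t\<bar> = kfun t * t"
 by (cases "t \<ge> 0") auto

text \<open>With y = f(t) and s = sqrt(1 + 2 y^2) the product is y t / s, and t lies between y s / 2
  and y s. The factor 1/2 is what halves the superlinearity constant in
  \<open>mfun_AR\<close>.\<close>

lemma kfun_mult_bounds: "(fODE t)\<^sup>2 / 2 \<le> kfun t * t" "kfun t * t \<le> (fODE t)\<^sup>2"
proof -
 have *: "(fODE t)\<^sup>2 / 2 \<le> kfun t * t \<and> kfun t * t \<le> (fODE t)\<^sup>2" if "t \<ge> 0" for t
 proof -
  define y where "y = fODE t"
  define s where "s = sqrt (1 + 2 * y\<^sup>2)"
  have y: "y \<ge> 0" and s: "s \<ge> 1" using fODE_nonneg[OF that] by (simp_all add: y_def s_def)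
  have b: "y * s / 2 \<le> t" "t \<le> y * s"
   using fprimitive_bounds[OF y] by (simp_all add: s_def y_def)
  have "kfun t * t = y * t / s" by (simp add: kfun_def y_def s_def)
  moreover have "y * (y * s / 2) \<le> y * t" "y * t \<le> y * (y * s)"
   using b y by (intro mult_left_mono; simp)+
  moreover have "y * (y * s / 2) / s = y\<^sup>2 / 2" "y * (y * s) / s = y\<^sup>2"
   using s by (simp_all add: power2_eq_square)
  ultimately show ?thesis using s unfolding y_def[symmetric]
   by (metis divide_right_mono order_trans zero_le_one)
 qed
 show "(fODE t)\<^sup>2 / 2 \<le> kfun t * t" "kfun t * t \<le> (fODE t)\<^sup>2"
  using *[of "\<bar>t\<bar>"] by (auto simp: fODE_sq_abs kfun_mult_abs)
qed

lemma kfun_le_1: "\<bar>kfun t\<bar> \<le> 1"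
proof -
 have "\<bar>fODE t\<bar> \<le> sqrt (1 + 2 * (fODE t)\<^sup>2)"
  by (rule real_le_rsqrt) simp
 moreover have "sqrt (1 + 2 * (fODE t)\<^sup>2) > 0" using sqrt_1_plus_ge_1[of "fODE t"] by linarith
 ultimately show ?thesis unfolding kfun_def abs_divide by (simp add: divide_le_eq_1 del: real_sqrt_gt_0_iff)
qed

text \<open>The square-root growth of f at infinity, and the reason why exponents are halved in
  passing from w to u.\<close>

lemma fODE_sq_le_2abs: "(fODE t)\<^sup>2 \<le> 2 * \<bar>t\<bar>"
proof -
 have "(fODE t)\<^sup>2 / 2 \<le> \<bar>kfun t\<bar> * \<bar>t\<bar>"
  using kfun_mult_bounds(1)[of t] abs_ge_self[of "kfun t * t"] by (simp add: abs_mult)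
 also have "\<dots> \<le> 1 * \<bar>t\<bar>" using kfun_le_1 by (intro mult_right_mono) auto
 finally show ?thesis by simp
qed

text \<open>On bounded arguments f^2 is comparable with t^2. For |x| \<ge> 1, where functions of
  finite Dirichlet energy are bounded, the integral of V f^2 thus controls a weighted L^2
  norm.\<close>

lemma sq_le_fODE_sq: assumes "\<bar>t\<bar> \<le> T" shows "t\<^sup>2 \<le> (1 + 2 * T\<^sup>2) * (fODE t)\<^sup>2"
proof -
 define y where "y = fODE \<bar>t\<bar>"
 have y: "y \<ge> 0" "y \<le> T" using fODE_nonneg[of "\<bar>t\<bar>"] fODE_le[of "\<bar>t\<bar>"] assms by (auto simp: y_def)
 have "\<bar>t\<bar> \<le> y * sqrt (1 + 2 * y\<^sup>2)" using fprimitive_bounds(2)[OF y(1)] by (simp add: y_def)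
 hence "\<bar>t\<bar>\<^sup>2 \<le> (y * sqrt (1 + 2 * y\<^sup>2))\<^sup>2" by (intro power_mono) auto
 also have "\<dots> = y\<^sup>2 * (1 + 2 * y\<^sup>2)" by (simp add: power_mult_distrib)
 also have "\<dots> \<le> y\<^sup>2 * (1 + 2 * T\<^sup>2)" using y by (intro mult_left_mono) (auto intro: power_mono)
 finally show ?thesis by (simp add: y_def fODE_sq_abs mult.commute)
qed

text \<open>If f^2 were below t/3, then t^2 \<le> f^2 (1 + 2 f^2) would give t^2 \<le> t/3 + 2 t^2 /
  9, which is impossible for t \<ge> 1.\<close>

lemma fODE_sq_ge_third: assumes "t \<ge> 1" shows "t / 3 \<le> (fODE t)\<^sup>2"
proof -
 define y where "y = fODE t"
 have y: "y \<ge> 0" using fODE_nonneg assms by (simp add: y_def)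
 have "t \<le> y * sqrt (1 + 2 * y\<^sup>2)" using fprimitive_bounds(2)[OF y] by (simp add: y_def)
 hence t: "t\<^sup>2 \<le> y\<^sup>2 * (1 + 2 * y\<^sup>2)"
  using power_mono[of t "y * sqrt (1 + 2 * y\<^sup>2)" 2] assms by (simp add: power_mult_distrib)
 show ?thesis
 proof (rule ccontr)
  assume "\<not> ?thesis"
  hence "y\<^sup>2 < t / 3" by (simp add: y_def)
  hence "y\<^sup>2 * (1 + 2 * y\<^sup>2) \<le> t / 3 * (1 + 2 * (t / 3))"
   using assms by (intro mult_mono) auto
  also have "\<dots> < t\<^sup>2" using assms
  proof -
   have "t \<le> t * t" using assms mult_left_mono[of 1 t t] by simp
   thus ?thesis using assms by (simp add: power2_eq_square field_simps)
  qed
  finally show False using t by simp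
 qed
qed

text \<open>Convexity of \<open>f\<^sup>2\<close> together with \<open>f 0 = 0\<close>.\<close>
lemma fODE_sq_scale: assumes "0 \<le> l" "l \<le> 1" shows "(fODE (l * t))\<^sup>2 \<le> l * (fODE t)\<^sup>2"
proof -
 \<comment> \<open>The tangent at l t is evaluated at t here and at 0 below; the combination with
   weights l and 1 - l cancels the slope.\<close>
 have "0 \<le> (fODE (l*t + (1-l)*t))\<^sup>2 - (fODE (l*t))\<^sup>2 - 2 * kfun (l*t) * ((1-l)*t)"
  by (rule fODE_sq_remainder)
 hence 1: "(fODE (l*t))\<^sup>2 + 2 * kfun (l*t) * ((1-l)*t) \<le> (fODE t)\<^sup>2"
  by (simp add: algebra_simps)
 have "0 \<le> (fODE (l*t + - (l*t)))\<^sup>2 - (fODE (l*t))\<^sup>2 - 2 * kfun (l*t) * (- (l*t))"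
  by (rule fODE_sq_remainder)
 hence 2: "(fODE (l*t))\<^sup>2 \<le> 2 * kfun (l*t) * (l*t)" by simp
 have "l * ((fODE (l*t))\<^sup>2 + 2 * kfun (l*t) * ((1-l)*t)) \<le> l * (fODE t)\<^sup>2"
  using mult_left_mono[OF 1 assms(1)] .
 moreover have "(1-l) * (fODE (l*t))\<^sup>2 \<le> (1-l) * (2 * kfun (l*t) * (l*t))"
  using 2 assms by (intro mult_left_mono) auto
 ultimately show ?thesis by (simp add: algebra_simps)
qed

section \<open>An abstract mountain pass lemma with approximate critical points\<close>

text \<open>The endpoints of the path \<open>t \<mapsto> t e\<close> stay on different sides of the level set \<open>Q = r\<close> under the
 descent map \<open>T\<close>, which lowers \<open>J\<close> by a fixed amount at each point with \<open>J \<ge> a\<close>; after finitely many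
 steps the image of the path would avoid \<open>Q = r\<close>.\<close>
lemma mountain_pass_approx:
 fixes J Q w :: "'v::real_normed_vector \<Rightarrow> real" and Gr :: "'v \<Rightarrow> 'v"
 assumes contJ: "continuous_on UNIV J" and contQ: "continuous_on UNIV Q"
  and contG: "continuous_on UNIV Gr" and contw: "continuous_on UNIV w"
  and w0: "\<And>u. 0 \<le> w u" and wtri: "\<And>u v. w (u - v) \<le> w u + w v"
  and wsc: "\<And>c u. w (c *\<^sub>R u) = \<bar>c\<bar> * w u"
  and J0: "J 0 \<le> 0" and Q0: "Q 0 < r" and Je: "J e \<le> 0" and Qe: "r < Q e"
  and a: "0 < a" and \<delta>: "0 < \<delta>"
  and sphere: "\<And>u. Q u = r \<Longrightarrow> a \<le> J u"
  and path: "\<And>t. 0 \<le> t \<Longrightarrow> t \<le> 1 \<Longrightarrow> J (t *\<^sub>R e) \<le> b"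
  and descent: "\<And>R. \<exists>s>0. \<forall>u c. w u \<le> R \<longrightarrow> 0 \<le> c \<longrightarrow> c * w (Gr u) \<le> s \<longrightarrow>
    J (u - c *\<^sub>R Gr u) \<le> J u - c * w (Gr u) * (w (Gr u) - \<delta> / 2)"
 shows "\<exists>u. a / 2 \<le> J u \<and> J u \<le> b \<and> w (Gr u) \<le> \<delta>"
proof (rule ccontr)
 assume "\<not> ?thesis"
 hence big: "w (Gr u) > \<delta>" if "a / 2 \<le> J u" "J u \<le> b" for u using that by force
 have b: "0 \<le> b - J (t *\<^sub>R e)" if "0 \<le> t" "t \<le> 1" for t using path that by simp
 \<comment> \<open>A step increases w by at most 2/\<delta> times the loss of J. As long as J is
   positive the total loss is at most b, so all iterates stay in the ball of radius R, on which one
   step size s works.\<close>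
 define R where "R = w e + 2 / \<delta> * b"
 obtain s where s: "s > 0" and desc: "\<And>u c. w u \<le> R \<Longrightarrow> 0 \<le> c \<Longrightarrow> c * w (Gr u) \<le> s \<Longrightarrow>
    J (u - c *\<^sub>R Gr u) \<le> J u - c * w (Gr u) * (w (Gr u) - \<delta> / 2)"
  using descent[of R] by blast
 \<comment> \<open>The cut-off freezes the points with J \<le> a/2, in particular 0 and e. The
   maximum with \<delta> in the denominator of T keeps T continuous where Gr degenerates; where the
   cut-off is active on levels up to b it equals w (Gr u).\<close>
 define cut where "cut u = min 1 (max 0 ((J u - a / 2) / (a / 2)))" for u
 define T where "T u = u - (s * cut u / max (w (Gr u)) \<delta>) *\<^sub>R Gr u" for u
 have cut01: "0 \<le> cut u" "cut u \<le> 1" for u by (auto simp: cut_def)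
 have cut0: "cut u = 0" if "J u \<le> a / 2" for u using that a by (auto simp: cut_def divide_le_0_iff)
 have cut1: "cut u = 1" if "a \<le> J u" for u using that a by (auto simp: cut_def field_simps)
 define Inv where "Inv u \<longleftrightarrow> J u \<le> b \<and> w u \<le> w e + 2 / \<delta> * (b - J u)" for u
 have step: "J (T u) \<le> J u - s * cut u * (\<delta> / 2) \<and> Inv (T u)" if "Inv u" for u
 proof (cases "J u \<le> a / 2")
  case True
  hence "T u = u" by (simp add: T_def cut0)
  thus ?thesis using that True by (simp add: cut0)
 next
  case False
  hence wG: "w (Gr u) > \<delta>" using big[of u] that by (auto simp: Inv_def)
  define c where "c = s * cut u / max (w (Gr u)) \<delta>"
  have c: "0 \<le> c" "c * w (Gr u) = s * cut u"
   using s cut01[of u] wG \<delta> by (auto simp: c_def)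
  have "2 / \<delta> * (b - J u) \<le> 2 / \<delta> * b" using False a \<delta> by (intro mult_left_mono) auto
  hence "w u \<le> R" using that by (simp add: Inv_def R_def)
  moreover have "s * cut u \<le> s" using s cut01 by simp
  ultimately have "J (T u) \<le> J u - s * cut u * (w (Gr u) - \<delta> / 2)"
   using desc[of u c] c(1) unfolding c(2) by (simp add: T_def flip: c_def)
  moreover have "s * cut u * (\<delta> / 2) \<le> s * cut u * (w (Gr u) - \<delta> / 2)"
   using s cut01 wG by (intro mult_left_mono) auto
  ultimately have 1: "J (T u) \<le> J u - s * cut u * (\<delta> / 2)" by linarith
  have "w (T u) \<le> w u + w (c *\<^sub>R Gr u)" unfolding T_def c_def by (rule wtri)
  also have "w (c *\<^sub>R Gr u) = s * cut u" using c by (simp add: wsc)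
  also have "w u + s * cut u \<le> w e + 2 / \<delta> * (b - J u) + 2 / \<delta> * (J u - J (T u))"
  proof -
   have "s * cut u = 2 / \<delta> * (s * cut u * (\<delta> / 2))" using \<delta> by simp
   also have "\<dots> \<le> 2 / \<delta> * (J u - J (T u))" using 1 \<delta> by (intro mult_left_mono) auto
   finally show ?thesis using that by (simp add: Inv_def)
  qed
  also have "\<dots> = w e + 2 / \<delta> * (b - J (T u))" by (simp add: right_diff_distrib)
  finally have 2: "w (T u) \<le> w e + 2 / \<delta> * (b - J (T u))" .
  have "0 \<le> s * cut u * (\<delta> / 2)" using s cut01 \<delta> by simp
  hence "J (T u) \<le> b" using 1 that by (simp add: Inv_def)
  thus ?thesis using 1 2 by (simp add: Inv_def)
 qed
 have contwG: "continuous_on UNIV (\<lambda>u. w (Gr u))"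
  by (rule continuous_on_compose2[OF contw contG]) auto
 have contT: "continuous_on UNIV T"
  unfolding T_def cut_def using \<delta> a
  by (intro continuous_intros contJ contG contwG) auto
 have contTn: "continuous_on UNIV (T ^^ n)" for n
 proof (induction n)
  case (Suc n)
  thus ?case using continuous_on_compose[OF Suc continuous_on_subset[OF contT]] by (simp add: o_def)
 qed auto
 have T0: "(T ^^ n) 0 = 0" for n
  by (induction n) (use J0 a in \<open>auto simp: T_def cut0\<close>)
 have Te: "(T ^^ n) e = e" for n
  by (induction n) (use Je a in \<open>auto simp: T_def cut0\<close>)
 have Inv0: "Inv (t *\<^sub>R e)" if "0 \<le> t" "t \<le> 1" for t
 proof -
  have "t * w e \<le> 1 * w e" using that w0 by (intro mult_right_mono) auto
  moreover have "0 \<le> 2 / \<delta> * (b - J (t *\<^sub>R e))" using b[OF that] \<delta> by simp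
  ultimately show ?thesis using path[OF that] that by (simp add: Inv_def wsc)
 qed
 have dec: "Inv ((T ^^ n) u) \<and> (a \<le> J ((T ^^ n) u) \<longrightarrow> J ((T ^^ n) u) \<le> J u - real n * (s * (\<delta> / 2)))"
  if "Inv u" for n u
 proof (induction n)
  case (Suc n)
  let ?v = "(T ^^ n) u"
  have st: "J (T ?v) \<le> J ?v - s * cut ?v * (\<delta> / 2)" "Inv (T ?v)" using step Suc by auto
  have "J (T ?v) \<le> J u - real (Suc n) * (s * (\<delta> / 2))" if "a \<le> J (T ?v)"
  proof -
   have "0 \<le> s * cut ?v * (\<delta> / 2)" using s cut01 \<delta> by simp
   hence aJ: "a \<le> J ?v" using st(1) that by linarith
   have "real (Suc n) * (s * (\<delta> / 2)) = real n * (s * (\<delta> / 2)) + s * (\<delta> / 2)"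
    by (simp add: algebra_simps)
   moreover have "cut ?v = 1" using aJ by (rule cut1)
   moreover have "J ?v \<le> J u - real n * (s * (\<delta> / 2))" using Suc aJ by blast
   ultimately show ?thesis using st(1) by (simp only: mult_1_right)
  qed
  thus ?case using st by simp
 qed (use that in auto)
 obtain n where n: "real n * (s * (\<delta> / 2)) > b - a"
  using ex_less_of_nat_mult[of "s * (\<delta> / 2)" "b - a"] s \<delta> by auto
 have "continuous_on {0..1} (\<lambda>t. Q ((T ^^ n) (t *\<^sub>R e)))"
  by (rule continuous_on_compose2[OF contQ continuous_on_compose2[OF contTn]])
   (auto intro!: continuous_intros)
 then obtain t where t: "0 \<le> t" "t \<le> 1" "Q ((T ^^ n) (t *\<^sub>R e)) = r"
  using IVT'[of "\<lambda>t. Q ((T ^^ n) (t *\<^sub>R e))" 0 r 1] Q0 Qe T0 Te by fastforce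
 have "J ((T ^^ n) (t *\<^sub>R e)) \<le> b - real n * (s * (\<delta> / 2))"
  using dec[OF Inv0[OF t(1,2)], of n] sphere[OF t(3)] path[OF t(1,2)] by linarith
 thus False using n sphere[OF t(3)] by linarith
qed

section \<open>Radial weights and one-dimensional energy estimates\<close>

definition om :: "nat \<Rightarrow> real \<Rightarrow> real" where "om N r = r ^ (N - 1)"
text \<open>The decay rate of radial functions of finite Dirichlet energy; its square r^(2-N) bounds
  the integral of 1 / r^(N-1) from r outwards.\<close>

definition ew :: "nat \<Rightarrow> real \<Rightarrow> real" where "ew N r = r powr (- (real N - 2) / 2)"
text \<open>The function U with U(b) = 0 and U' = -p. Taking p as the unknown makes the condition at
  b automatic and leaves a space of continuous functions without constraints.\<close>

definition Ub :: "real \<Rightarrow> (real \<Rightarrow> real) \<Rightarrow> real \<Rightarrow> real" where "Ub b p r = integral {r..b} p"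
definition nsq :: "nat \<Rightarrow> real \<Rightarrow> real \<Rightarrow> (real \<Rightarrow> real) \<Rightarrow> real" where
 "nsq N a b p = integral {a..b} (\<lambda>s. (p s)\<^sup>2 * om N s)"

lemma om_pos: "0 < r \<Longrightarrow> 0 < om N r" by (simp add: om_def)
lemma ew_pos: "0 < r \<Longrightarrow> 0 < ew N r" by (simp add: ew_def)
lemma continuous_on_om [continuous_intros]: "continuous_on S f \<Longrightarrow> continuous_on S (\<lambda>x. om N (f x))"
 unfolding om_def by (intro continuous_intros)
lemma om_powr: "0 < r \<Longrightarrow> N \<ge> 1 \<Longrightarrow> om N r = r powr (real N - 1)"
 by (simp add: om_def powr_realpow[symmetric] of_nat_diff)
lemma ew_sq: "0 < r \<Longrightarrow> (ew N r)\<^sup>2 = r powr (2 - real N)"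
 by (simp add: ew_def power2_eq_square powr_add[symmetric])
lemma ew_antimono: "0 < r \<Longrightarrow> r \<le> s \<Longrightarrow> N \<ge> 2 \<Longrightarrow> ew N s \<le> ew N r"
 unfolding ew_def by (rule powr_mono2') auto

text \<open>Discriminant of the nonnegative polynomial obtained by integrating (t g - f)^2.\<close>

lemma Cauchy_Schwarz_integral:
 fixes f g :: "real \<Rightarrow> real"
 assumes f: "continuous_on {a..b} f" and g: "continuous_on {a..b} g"
 shows "(integral {a..b} (\<lambda>x. f x * g x))\<^sup>2
  \<le> integral {a..b} (\<lambda>x. (f x)\<^sup>2) * integral {a..b} (\<lambda>x. (g x)\<^sup>2)"
proof -
 let ?A = "integral {a..b} (\<lambda>x. (g x)\<^sup>2)" and ?B = "integral {a..b} (\<lambda>x. f x * g x)"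
  and ?C = "integral {a..b} (\<lambda>x. (f x)\<^sup>2)"
 note ii = integrable_continuous_real continuous_intros f g
 have q: "0 \<le> ?A * t\<^sup>2 + (- 2 * ?B) * t + ?C" for t
 proof -
  have "0 \<le> integral {a..b} (\<lambda>x. (t * g x - f x)\<^sup>2)"
   by (rule integral_nonneg) (auto intro!: ii)
  also have "(\<lambda>x. (t * g x - f x)\<^sup>2) = (\<lambda>x. t\<^sup>2 * (g x)\<^sup>2 - (2 * t) * (f x * g x) + (f x)\<^sup>2)"
   by (auto simp: power2_eq_square algebra_simps)
  also have "integral {a..b} \<dots> = t\<^sup>2 * ?A - (2 * t) * ?B + ?C"
   by (subst integral_add integral_diff integral_mult_right; (intro ii integrable_diff)?)+ simp
  finally show ?thesis by (simp add: algebra_simps)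
 qed
 have C: "0 \<le> ?C" by (rule integral_nonneg) (auto intro!: ii)
 have A: "0 \<le> ?A" by (rule integral_nonneg) (auto intro!: ii)
 show ?thesis
 proof (cases "?A = 0")
  case True
  have "?B = 0"
  proof (rule ccontr)
   assume "?B \<noteq> 0"
   \<comment> \<open>With \<open>?A = 0\<close> the polynomial is linear in t and takes the value -1
     at this point.\<close>
   thus False using q[of "(?C + 1) / (2 * ?B)"] True by simp
  qed
  thus ?thesis using True by simp
 next
  case False
  hence Ap: "?A > 0" using A by simp
  have "0 \<le> ?A * (?B / ?A)\<^sup>2 + (- 2 * ?B) * (?B / ?A) + ?C" by (rule q)
  hence "?B\<^sup>2 / ?A \<le> ?C" using Ap by (simp add: power2_eq_square field_simps)
  thus ?thesis using Ap by (simp add: field_simps)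
 qed
qed

lemma nsq_nonneg: "0 < a \<Longrightarrow> 0 \<le> nsq N a b p"
 unfolding nsq_def
 by (cases "(\<lambda>s. (p s)\<^sup>2 * om N s) integrable_on {a..b}")
  (auto intro!: integral_nonneg mult_nonneg_nonneg less_imp_le[OF om_pos] simp: not_integrable_integral)

text \<open>An antiderivative is s^(2-N) / (2-N); the factor 1 / (N-2) is at most 1 because N \<ge>
  3.\<close>

lemma integral_om_inverse:
 assumes "3 \<le> N" "0 < r" "r \<le> b"
 shows "integral {r..b} (\<lambda>s. 1 / om N s) \<le> (ew N r)\<^sup>2"
proof -
 let ?F = "\<lambda>s. s powr (2 - real N) / (2 - real N)"
 have d: "(?F has_real_derivative 1 / om N s) (at s within {r..b})" if "s \<in> {r..b}" for s
 proof -
  have s: "s > 0" using that assms by simp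
  have "(?F has_real_derivative (2 - real N) * s powr (2 - real N - 1) / (2 - real N)) (at s)"
   using s assms by (intro DERIV_cdivide has_real_derivative_powr) auto
  moreover have "(2 - real N) * s powr (2 - real N - 1) / (2 - real N) = 1 / om N s"
   using assms s by (simp add: om_powr powr_minus[symmetric] divide_inverse)
  ultimately show ?thesis by (simp add: has_field_derivative_at_within)
 qed
 have "((\<lambda>s. 1 / om N s) has_integral ?F b - ?F r) {r..b}"
  using assms d by (intro fundamental_theorem_of_calculus)
   (auto simp: has_real_derivative_iff_has_vector_derivative)
 hence "integral {r..b} (\<lambda>s. 1 / om N s) = ?F b - ?F r" by (rule integral_unique)
 also have "\<dots> = (r powr (2 - real N) - b powr (2 - real N)) / (real N - 2)"
 proof -
  have *: "x / (2 - real N) - y / (2 - real N) = (y - x) / (real N - 2)" for x y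
   unfolding diff_divide_distrib[symmetric] using minus_divide_divide[of "x - y" "2 - real N"] by simp
  show ?thesis by (rule *)
 qed
 also have "\<dots> \<le> (r powr (2 - real N) - b powr (2 - real N)) / 1"
  using assms by (intro divide_left_mono) (auto intro!: powr_mono2')
 also have "\<dots> \<le> r powr (2 - real N)" by simp
 finally show ?thesis using assms by (simp add: ew_sq)
qed

text \<open>The radial lemma: Cauchy-Schwarz for p sqrt(om) times 1 / sqrt(om). The constant does
  not depend on b, so the bound survives b \<rightarrow> \<infinity>.\<close>

lemma integral_le_nsq:
 assumes N: "3 \<le> N" and r: "0 < r" "r \<le> b" and p: "continuous_on {r..b} p"
 shows "\<bar>integral {r..b} p\<bar> \<le> sqrt (nsq N r b p) * ew N r"
proof -
 have omne: "om N s \<noteq> 0" "om N s > 0" if "s \<in> {r..b}" for s using that r om_pos[of s N] by auto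
 have c1: "continuous_on {r..b} (\<lambda>s. p s * sqrt (om N s))"
  by (intro continuous_intros p)
 have c2: "continuous_on {r..b} (\<lambda>s. 1 / sqrt (om N s))"
  using omne by (intro continuous_intros) auto
 have "(integral {r..b} (\<lambda>s. (p s * sqrt (om N s)) * (1 / sqrt (om N s))))\<^sup>2 \<le>
   integral {r..b} (\<lambda>s. (p s * sqrt (om N s))\<^sup>2) * integral {r..b} (\<lambda>s. (1 / sqrt (om N s))\<^sup>2)"
  by (rule Cauchy_Schwarz_integral[OF c1 c2])
 moreover have "integral {r..b} (\<lambda>s. (p s * sqrt (om N s)) * (1 / sqrt (om N s))) = integral {r..b} p"
  by (rule integral_cong) (use omne in auto)
 moreover have "integral {r..b} (\<lambda>s. (p s * sqrt (om N s))\<^sup>2) = nsq N r b p"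
  unfolding nsq_def by (rule integral_cong) (use omne in \<open>auto simp: power_mult_distrib less_imp_le\<close>)
 moreover have "integral {r..b} (\<lambda>s. (1 / sqrt (om N s))\<^sup>2) = integral {r..b} (\<lambda>s. 1 / om N s)"
  by (rule integral_cong) (use omne in \<open>auto simp: power_divide less_imp_le\<close>)
 ultimately have "(integral {r..b} p)\<^sup>2 \<le> nsq N r b p * integral {r..b} (\<lambda>s. 1 / om N s)" by simp
 also have "\<dots> \<le> nsq N r b p * (ew N r)\<^sup>2"
  using integral_om_inverse[OF N r] nsq_nonneg[OF r(1)] by (intro mult_left_mono) auto
 finally have "sqrt ((integral {r..b} p)\<^sup>2) \<le> sqrt (nsq N r b p * (ew N r)\<^sup>2)" by (rule real_sqrt_le_mono)
 thus ?thesis using ew_pos[OF r(1), of N] by (simp add: real_sqrt_mult)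
qed

lemma nsq_mono_left:
 assumes "0 < a" "a \<le> r" "continuous_on {a..b} p"
 shows "nsq N r b p \<le> nsq N a b p"
 unfolding nsq_def using assms
 by (intro integral_subset_le integrable_continuous_real continuous_intros)
  (auto intro!: mult_nonneg_nonneg less_imp_le[OF om_pos] intro: continuous_on_subset)

lemma Ub_le_nsq:
 assumes N: "3 \<le> N" and r: "0 < a" "r \<in> {a..b}" and p: "continuous_on {a..b} p"
 shows "\<bar>Ub b p r\<bar> \<le> sqrt (nsq N a b p) * ew N r"
proof -
 have "\<bar>Ub b p r\<bar> \<le> sqrt (nsq N r b p) * ew N r"
  unfolding Ub_def using r by (intro integral_le_nsq[OF N] continuous_on_subset[OF p]) auto
 also have "\<dots> \<le> sqrt (nsq N a b p) * ew N r"
  using r ew_pos[of r N] nsq_mono_left[OF r(1) _ p, of r] by (intro mult_right_mono) auto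
 finally show ?thesis .
qed

lemma nsq_scale: "nsq N a b (\<lambda>s. c * p s) = c\<^sup>2 * nsq N a b p"
 unfolding nsq_def integral_mult_right[symmetric] by (simp add: power_mult_distrib mult.assoc)

lemma nsq_add:
 assumes "0 < a" "continuous_on {a..b} p" "continuous_on {a..b} q"
 shows "nsq N a b (\<lambda>s. p s + q s) = nsq N a b p + 2 * integral {a..b} (\<lambda>s. p s * q s * om N s) + nsq N a b q"
proof -
 note ii = integrable_continuous_real continuous_intros assms(2,3)
 have "(\<lambda>s. (p s + q s)\<^sup>2 * om N s) = (\<lambda>s. (p s)\<^sup>2 * om N s + 2 * (p s * q s * om N s) + (q s)\<^sup>2 * om N s)"
  by (auto simp: power2_eq_square algebra_simps)
 moreover have "integral {a..b} \<dots> = nsq N a b p + 2 * integral {a..b} (\<lambda>s. p s * q s * om N s) + nsq N a b q"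
  unfolding nsq_def
  by (subst integral_add integral_mult_right; (intro ii integrable_add)?)+ simp
 ultimately show ?thesis by (simp add: nsq_def)
qed

lemma inner_le_nsq:
 assumes "0 < a" "continuous_on {a..b} p" "continuous_on {a..b} q"
 shows "\<bar>integral {a..b} (\<lambda>s. p s * q s * om N s)\<bar> \<le> sqrt (nsq N a b p) * sqrt (nsq N a b q)"
proof -
 have om: "om N s \<ge> 0" if "s \<in> {a..b}" for s using that assms(1) om_pos[of s N] by auto
 have "(integral {a..b} (\<lambda>s. (p s * sqrt (om N s)) * (q s * sqrt (om N s))))\<^sup>2 \<le>
   integral {a..b} (\<lambda>s. (p s * sqrt (om N s))\<^sup>2) * integral {a..b} (\<lambda>s. (q s * sqrt (om N s))\<^sup>2)"
  by (rule Cauchy_Schwarz_integral) (intro continuous_intros assms(2,3))+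
 moreover have "integral {a..b} (\<lambda>s. (p s * sqrt (om N s)) * (q s * sqrt (om N s))) = integral {a..b} (\<lambda>s. p s * q s * om N s)"
  by (rule integral_cong) (use om in \<open>auto simp: algebra_simps\<close>)
 moreover have "integral {a..b} (\<lambda>s. (f s * sqrt (om N s))\<^sup>2) = nsq N a b f" for f
  unfolding nsq_def by (rule integral_cong) (use om in \<open>auto simp: power_mult_distrib\<close>)
 ultimately have "(integral {a..b} (\<lambda>s. p s * q s * om N s))\<^sup>2 \<le> nsq N a b p * nsq N a b q" by simp
 from real_sqrt_le_mono[OF this] show ?thesis by (simp add: real_sqrt_mult)
qed

lemma nsq_triangle:
 assumes "0 < a" "continuous_on {a..b} p" "continuous_on {a..b} q"
 shows "sqrt (nsq N a b (\<lambda>s. p s + q s)) \<le> sqrt (nsq N a b p) + sqrt (nsq N a b q)"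
proof (rule real_le_lsqrt)
 show "nsq N a b (\<lambda>s. p s + q s) \<le> (sqrt (nsq N a b p) + sqrt (nsq N a b q))\<^sup>2"
  unfolding nsq_add[OF assms] power2_sum
  using inner_le_nsq[OF assms, of N] nsq_nonneg[OF assms(1), of N b] by simp
qed (use nsq_nonneg[OF assms(1), of N b] in auto)

lemma nsq_cong: "(\<And>s. s \<in> {a..b} \<Longrightarrow> p s = q s) \<Longrightarrow> nsq N a b p = nsq N a b q"
 unfolding nsq_def by (rule integral_cong) auto

lemma Ub_cong: "(\<And>s. s \<in> {a..b} \<Longrightarrow> p s = q s) \<Longrightarrow> r \<in> {a..b} \<Longrightarrow> Ub b p r = Ub b q r"
 unfolding Ub_def by (rule integral_cong) auto

lemma Ub_add:
 assumes "continuous_on {a..b} p" "continuous_on {a..b} q" "r \<in> {a..b}"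
 shows "Ub b (\<lambda>s. p s + q s) r = Ub b p r + Ub b q r"
 unfolding Ub_def using assms
 by (intro integral_add integrable_continuous_real) (auto intro: continuous_on_subset)

lemma Ub_scale: "Ub b (\<lambda>s. c * p s) r = c * Ub b p r"
 unfolding Ub_def by simp

lemma Ub_deriv:
 assumes "continuous_on {a..b} p" "r \<in> {a..b}"
 shows "(Ub b p has_real_derivative - p r) (at r within {a..b})"
 unfolding Ub_def[abs_def] by (rule integral_has_real_derivative'[OF assms])

lemma Ub_cont: "continuous_on {a..b} p \<Longrightarrow> continuous_on {a..b} (Ub b p)"
 using Ub_deriv by (intro DERIV_continuous_on)

lemma segment_bounds:
 fixes a b r t :: real
 assumes "a \<le> r" "r \<le> b" "0 \<le> t" "t \<le> 1"
 shows "a \<le> r + (b - r) * t \<and> r + (b - r) * t \<le> b"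
proof
 have "0 \<le> (b - r) * t" using assms by simp
 thus "a \<le> r + (b - r) * t" using assms(1) by linarith
 have "(b - r) * t \<le> (b - r) * 1" using assms by (intro mult_left_mono) auto
 thus "r + (b - r) * t \<le> b" by simp
qed

text \<open>Rescaling [r, b] to [0, 1] moves the variable endpoint into the integrand. Joint
  continuity in the function and the endpoint is what makes J and its gradient continuous on a
  function space.\<close>

lemma continuous_on_integral_upper:
 fixes f :: "'x::topological_space \<Rightarrow> real \<Rightarrow> real"
 assumes f: "continuous_on (S \<times> {a..b}) (\<lambda>(x,t). f x t)"
 shows "continuous_on (S \<times> {a..b}) (\<lambda>(x,r). integral {r..b} (f x))"
proof -
 have "continuous_on (S \<times> {a..b}) (\<lambda>z. (b - snd z) * integral (cbox 0 1) (\<lambda>t. f (fst z) (snd z + (b - snd z) * t)))"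
 proof (intro continuous_intros integral_continuous_on_param)
  have "continuous_on ((S \<times> {a..b}) \<times> cbox 0 1)
    ((\<lambda>(x,t). f x t) \<circ> (\<lambda>w. (fst (fst w), snd (fst w) + (b - snd (fst w)) * snd w)))"
  proof (rule continuous_on_compose[OF _ continuous_on_subset[OF f]])
   show "(\<lambda>w. (fst (fst w), snd (fst w) + (b - snd (fst w)) * snd w)) ` ((S \<times> {a..b}) \<times> cbox 0 1) \<subseteq> S \<times> {a..b}"
   proof (clarsimp)
    fix x and r t :: real assume h: "a \<le> r" "r \<le> b" "0 \<le> t" "t \<le> 1"
    thus "a \<le> r + (b - r) * t \<and> r + (b - r) * t \<le> b" by (rule segment_bounds)
   qed
  qed (intro continuous_intros)
  thus "continuous_on ((S \<times> {a..b}) \<times> cbox 0 1) (\<lambda>(z, t). f (fst z) (snd z + (b - snd z) * t))"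
   by (simp add: o_def case_prod_beta)
 qed
 moreover have "(b - r) * integral (cbox 0 1) (\<lambda>t. f x (r + (b - r) * t)) = integral {r..b} (f x)"
  if "x \<in> S" "r \<in> {a..b}" for x r
 proof -
  have c: "continuous_on {a..b} (f x)"
   using continuous_on_compose2[OF f continuous_on_Pair[OF continuous_on_const continuous_on_id], of x "{a..b}"] that(1)
   by auto
  have "((\<lambda>t. (b - r) *\<^sub>R f x (r + (b - r) * t)) has_integral
    (integral {r + (b - r) * 0..r + (b - r) * 1} (f x))) {0..1}"
  proof (rule has_integral_substitution[where c = a and d = b])
   show "(\<lambda>t. r + (b - r) * t) ` {0..1} \<subseteq> {a..b}"
   proof clarsimp
    fix t :: real assume h: "0 \<le> t" "t \<le> 1"
    thus "a \<le> r + (b - r) * t \<and> r + (b - r) * t \<le> b" using that by (auto intro: segment_bounds[THEN conjunct1] segment_bounds[THEN conjunct2])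
   qed
   show "((\<lambda>t. r + (b - r) * t) has_field_derivative (b - r)) (at t within {0..1})" if "t \<in> {0..1}" for t
    by (auto intro!: derivative_eq_intros)
  qed (use that c in auto)
  from integral_unique[OF this] show ?thesis by simp
 qed
 ultimately show ?thesis
  by (subst continuous_on_cong[OF refl]) (auto simp: case_prod_beta)
qed

lemma continuous_on_integral_lower:
 fixes f :: "'x::topological_space \<Rightarrow> real \<Rightarrow> real"
 assumes f: "continuous_on (S \<times> {a..b}) (\<lambda>(x,t). f x t)"
 shows "continuous_on (S \<times> {a..b}) (\<lambda>(x,r). integral {a..r} (f x))"
proof (cases "a \<le> b")
 case True
 have "continuous_on (S \<times> {a..b}) (\<lambda>z. integral {a..b} (f (fst z)))"
 proof -
  have "continuous_on S (\<lambda>x. integral (cbox a b) (f x))"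
   by (rule integral_continuous_on_param) (use f in simp)
  from continuous_on_compose2[OF this continuous_on_fst[OF continuous_on_id], of "S \<times> {a..b}"]
  show ?thesis by auto
 qed
 hence "continuous_on (S \<times> {a..b}) (\<lambda>z. integral {a..b} (f (fst z)) - integral {snd z..b} (f (fst z)))"
  using continuous_on_integral_upper[OF f] by (intro continuous_intros) (auto simp: case_prod_beta)
 moreover have "integral {a..b} (f x) - integral {r..b} (f x) = integral {a..r} (f x)"
  if "x \<in> S" "r \<in> {a..b}" for x r
 proof -
  have c: "continuous_on {a..b} (f x)"
   using continuous_on_compose2[OF f continuous_on_Pair[OF continuous_on_const continuous_on_id], of x "{a..b}"] that(1)
   by auto
  have "integral {a..r} (f x) + integral {r..b} (f x) = integral {a..b} (f x)"
   by (rule Henstock_Kurzweil_Integration.integral_combine)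
    (use that integrable_continuous_real[OF c] in auto)
  thus ?thesis by simp
 qed
 ultimately show ?thesis
  by (subst continuous_on_cong[OF refl]) (auto simp: case_prod_beta)
qed simp

section \<open>The functional on an interval [a, b] and its descent\<close>

locale one_dim =
 fixes N :: nat and a b :: real and w \<Phi> :: "real \<Rightarrow> real \<Rightarrow> real"
 assumes N: "3 \<le> N" and a: "0 < a" and ab: "a < b"
  and w_cont: "continuous_on ({a..b} \<times> UNIV) (\<lambda>(r, y). w r y)"
  and \<Phi>_cont: "continuous_on ({a..b} \<times> UNIV) (\<lambda>(r, y). \<Phi> r y)"
  and \<Phi>_deriv: "\<And>r y. r \<in> {a..b} \<Longrightarrow> (\<Phi> r has_real_derivative w r y) (at y)"
  and \<Phi>_0: "\<And>r. r \<in> {a..b} \<Longrightarrow> \<Phi> r 0 = 0"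
begin

definition J :: "(real \<Rightarrow> real) \<Rightarrow> real" where
 "J p = nsq N a b p / 2 + integral {a..b} (\<lambda>r. \<Phi> r (Ub b p r))"

definition Ws :: "(real \<Rightarrow> real) \<Rightarrow> real \<Rightarrow> real" where
 "Ws p s = integral {a..s} (\<lambda>r. w r (Ub b p r))"

text \<open>The gradient of \<open>J\<close> for the inner product \<open>\<integral> p q s^(N-1) ds\<close>.\<close>
definition Gd :: "(real \<Rightarrow> real) \<Rightarrow> real \<Rightarrow> real" where
 "Gd p s = p s + Ws p s / om N s"

lemma cont_comp:
 assumes "continuous_on ({a..b} \<times> UNIV) (\<lambda>(r, y). F r y)" "continuous_on {a..b} u"
 shows "continuous_on {a..b} (\<lambda>r. F r (u r))"
 using continuous_on_compose2[OF assms(1) continuous_on_Pair[OF continuous_on_id assms(2)]] by auto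

lemma wU_cont: "continuous_on {a..b} p \<Longrightarrow> continuous_on {a..b} (\<lambda>r. w r (Ub b p r))"
 by (rule cont_comp[OF w_cont Ub_cont])

lemma \<Phi>U_cont: "continuous_on {a..b} p \<Longrightarrow> continuous_on {a..b} (\<lambda>r. \<Phi> r (Ub b p r))"
 by (rule cont_comp[OF \<Phi>_cont Ub_cont])

lemma Ws_deriv: "continuous_on {a..b} p \<Longrightarrow> s \<in> {a..b} \<Longrightarrow>
  (Ws p has_real_derivative w s (Ub b p s)) (at s within {a..b})"
 unfolding Ws_def[abs_def] by (rule integral_has_real_derivative[OF wU_cont])

lemma Ws_cont: "continuous_on {a..b} p \<Longrightarrow> continuous_on {a..b} (Ws p)"
 using Ws_deriv by (intro DERIV_continuous_on)

lemma om_ne: "s \<in> {a..b} \<Longrightarrow> om N s \<noteq> 0"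
 using om_pos[of s N] a by auto

lemma Gd_cont: "continuous_on {a..b} p \<Longrightarrow> continuous_on {a..b} (Gd p)"
 unfolding Gd_def[abs_def] using om_ne by (intro continuous_intros Ws_cont) auto

text \<open>Integration by parts of \<open>Ws p\<close> against \<open>Ub b q\<close>: the boundary
  terms vanish because \<open>Ws p\<close> is 0 at a and \<open>Ub b q\<close> is 0 at b. A zero of
  the gradient therefore satisfies r^(N-1) U' = \<open>Ws p\<close>, the radial equation with the
  natural condition U'(a) = 0.\<close>

lemma Gd_inner:
 assumes p: "continuous_on {a..b} p" and q: "continuous_on {a..b} q"
 shows "integral {a..b} (\<lambda>s. Gd p s * q s * om N s) =
  integral {a..b} (\<lambda>s. p s * q s * om N s) + integral {a..b} (\<lambda>r. w r (Ub b p r) * Ub b q r)"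
proof -
 note ii = integrable_continuous_real continuous_intros p q Ws_cont[OF p] wU_cont[OF p] Ub_cont[OF q]
 have "((\<lambda>s. w s (Ub b p s) * Ub b q s + - q s * Ws p s) has_integral (Ws p b * Ub b q b - Ws p a * Ub b q a)) {a..b}"
  by (rule fundamental_theorem_of_calculus)
   (use ab DERIV_mult[OF Ws_deriv[OF p] Ub_deriv[OF q]]
    in \<open>auto simp: has_real_derivative_iff_has_vector_derivative[symmetric]\<close>)
 moreover have "Ws p a = 0" "Ub b q b = 0" by (simp_all add: Ws_def Ub_def)
 ultimately have "integral {a..b} (\<lambda>s. w s (Ub b p s) * Ub b q s + - q s * Ws p s) = 0"
  by (simp add: integral_unique)
 also have "integral {a..b} (\<lambda>s. w s (Ub b p s) * Ub b q s + - q s * Ws p s) =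
   integral {a..b} (\<lambda>s. w s (Ub b p s) * Ub b q s) - integral {a..b} (\<lambda>s. q s * Ws p s)"
  by (subst integral_diff[symmetric]) (auto intro!: ii)
 finally have *: "integral {a..b} (\<lambda>s. w s (Ub b p s) * Ub b q s) = integral {a..b} (\<lambda>s. q s * Ws p s)" by simp
 have "integral {a..b} (\<lambda>s. Gd p s * q s * om N s) = integral {a..b} (\<lambda>s. p s * q s * om N s + q s * Ws p s)"
  by (rule integral_cong) (use om_ne in \<open>auto simp: Gd_def field_simps\<close>)
 also have "\<dots> = integral {a..b} (\<lambda>s. p s * q s * om N s) + integral {a..b} (\<lambda>s. q s * Ws p s)"
  by (rule integral_add) (intro ii)+
 finally show ?thesis by (simp add: *)
qed

text \<open>The mean value theorem and the uniform continuity of w on a compact rectangle. The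
  rectangle exceeds R by 1, and \<sigma> \<le> 1 keeps the mean value point inside it.\<close>

lemma \<Phi>_remainder:
 assumes "0 < eps"
 shows "\<exists>\<sigma>>0. \<forall>r\<in>{a..b}. \<forall>y z. \<bar>y\<bar> \<le> R \<longrightarrow> \<bar>z\<bar> \<le> \<sigma> \<longrightarrow> \<Phi> r (y + z) - \<Phi> r y - w r y * z \<le> eps * \<bar>z\<bar>"
proof -
 have "uniformly_continuous_on ({a..b} \<times> {-\<bar>R\<bar>-1..\<bar>R\<bar>+1}) (\<lambda>(r, y). w r y)"
  by (intro compact_uniformly_continuous compact_Times continuous_on_subset[OF w_cont]) auto
 then obtain d where d: "d > 0" and D: "\<And>x x'. x \<in> {a..b} \<times> {-\<bar>R\<bar>-1..\<bar>R\<bar>+1} \<Longrightarrow>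
   x' \<in> {a..b} \<times> {-\<bar>R\<bar>-1..\<bar>R\<bar>+1} \<Longrightarrow> dist x' x < d \<Longrightarrow> dist (case_prod w x') (case_prod w x) < eps"
  unfolding uniformly_continuous_on_def using assms by metis
 define \<sigma> where "\<sigma> = min 1 (d / 2)"
 have "\<Phi> r (y + z) - \<Phi> r y - w r y * z \<le> eps * \<bar>z\<bar>"
  if r: "r \<in> {a..b}" and y: "\<bar>y\<bar> \<le> R" and z: "\<bar>z\<bar> \<le> \<sigma>" for r y z
 proof -
  have "\<exists>\<xi>. \<bar>\<xi> - y\<bar> \<le> \<bar>z\<bar> \<and> \<Phi> r (y + z) - \<Phi> r y = z * w r \<xi>"
  proof (cases z "0::real" rule: linorder_cases)
   case less
   then obtain \<xi> where "y + z < \<xi>" "\<xi> < y" "\<Phi> r y - \<Phi> r (y + z) = (y - (y + z)) * w r \<xi>"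
    using MVT2[of "y + z" y "\<Phi> r" "w r"] \<Phi>_deriv[OF r] by auto
   thus ?thesis by (intro exI[of _ \<xi>]) auto
  next
   case greater
   then obtain \<xi> where "y < \<xi>" "\<xi> < y + z" "\<Phi> r (y + z) - \<Phi> r y = (y + z - y) * w r \<xi>"
    using MVT2[of y "y + z" "\<Phi> r" "w r"] \<Phi>_deriv[OF r] by auto
   thus ?thesis by (intro exI[of _ \<xi>]) auto
  qed auto
  then obtain \<xi> where \<xi>: "\<bar>\<xi> - y\<bar> \<le> \<bar>z\<bar>" "\<Phi> r (y + z) - \<Phi> r y = z * w r \<xi>" by blast
  have "dist (r, \<xi>) (r, y) < d" using \<xi>(1) z d by (auto simp: \<sigma>_def dist_Pair_Pair dist_real_def)
  moreover have "(r, \<xi>) \<in> {a..b} \<times> {-\<bar>R\<bar>-1..\<bar>R\<bar>+1}" "(r, y) \<in> {a..b} \<times> {-\<bar>R\<bar>-1..\<bar>R\<bar>+1}"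
   using r y z \<xi>(1) by (auto simp: \<sigma>_def)
  ultimately have "\<bar>w r \<xi> - w r y\<bar> \<le> eps" using D[of "(r, y)" "(r, \<xi>)"] by (auto simp: dist_real_def)
  hence "\<bar>w r \<xi> - w r y\<bar> * \<bar>z\<bar> \<le> eps * \<bar>z\<bar>" by (intro mult_right_mono) auto
  moreover have "\<Phi> r (y + z) - \<Phi> r y - w r y * z = (w r \<xi> - w r y) * z" using \<xi>(2) by (simp add: algebra_simps)
  ultimately show ?thesis using abs_ge_self[of "(w r \<xi> - w r y) * z"] by (simp add: abs_mult)
 qed
 moreover have "\<sigma> > 0" using d by (simp add: \<sigma>_def)
 ultimately show ?thesis by blast
qed

text \<open>With |G| the norm of the gradient, a step of size c changes J by -c |G|^2 + c^2 |G|^2 /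
  2 plus the remainder of \<open>\<Phi>_remainder\<close>. The bound c |G| \<le> s makes each of the
  last two at most c |G| \<delta> / 4, and s depends on p only through R.\<close>

lemma J_descent:
 assumes \<delta>: "0 < \<delta>"
 shows "\<exists>s>0. \<forall>p c. continuous_on {a..b} p \<longrightarrow> sqrt (nsq N a b p) \<le> R \<longrightarrow> 0 \<le> c \<longrightarrow>
   c * sqrt (nsq N a b (Gd p)) \<le> s \<longrightarrow>
   J (\<lambda>x. p x - c * Gd p x) \<le> J p - c * sqrt (nsq N a b (Gd p)) * (sqrt (nsq N a b (Gd p)) - \<delta> / 2)"
proof -
 define A where "A = (b - a) * ew N a"
 have ea: "ew N a > 0" using ew_pos a by blast
 hence A: "A > 0" using ab by (simp add: A_def)
 obtain \<sigma> where \<sigma>: "\<sigma> > 0" and rem: "\<And>r y z. r \<in> {a..b} \<Longrightarrow> \<bar>y\<bar> \<le> R * ew N a \<Longrightarrow> \<bar>z\<bar> \<le> \<sigma> \<Longrightarrow>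
   \<Phi> r (y + z) - \<Phi> r y - w r y * z \<le> \<delta> / (4 * A) * \<bar>z\<bar>"
  using \<Phi>_remainder[of "\<delta> / (4 * A)" "R * ew N a"] \<delta> A by auto
 define s where "s = min (\<delta> / 2) (\<sigma> / ew N a)"
 have s: "s > 0" using \<delta> \<sigma> ea by (simp add: s_def)
 moreover have "J (\<lambda>x. p x - c * Gd p x) \<le> J p - c * g * (g - \<delta> / 2)"
  if p: "continuous_on {a..b} p" and pR: "sqrt (nsq N a b p) \<le> R" and c: "0 \<le> c"
   and g: "g = sqrt (nsq N a b (Gd p))" and cs: "c * g \<le> s" for p c g
 proof -
  define q where "q = (\<lambda>x. - c * Gd p x)"
  have q: "continuous_on {a..b} q" unfolding q_def by (intro continuous_intros Gd_cont p)
  note ii = integrable_continuous_real continuous_intros p q Ub_cont[OF p] Ub_cont[OF q] wU_cont[OF p] \<Phi>U_cont[OF p]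
  have nG: "nsq N a b (Gd p) = g\<^sup>2" unfolding g using nsq_nonneg[OF a] by simp
  have g0: "g \<ge> 0" unfolding g by (simp add: nsq_nonneg[OF a])
  have nq: "nsq N a b q = (c * g)\<^sup>2" unfolding q_def nsq_scale nG by (simp add: power_mult_distrib)
  have cg0: "c * g \<ge> 0" using c g0 by simp
  have Uq: "\<bar>Ub b q r\<bar> \<le> c * g * ew N a" if r: "r \<in> {a..b}" for r
  proof -
   have "\<bar>Ub b q r\<bar> \<le> c * g * ew N r"
    using Ub_le_nsq[OF N a r q] unfolding nq using c g0 by simp
   also have "\<dots> \<le> c * g * ew N a"
    using ew_antimono[OF a, of r N] r N cg0 by (intro mult_left_mono) auto
   finally show ?thesis .
  qed
  have Up: "\<bar>Ub b p r\<bar> \<le> R * ew N a" if r: "r \<in> {a..b}" for r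
  proof -
   have "\<bar>Ub b p r\<bar> \<le> sqrt (nsq N a b p) * ew N r" by (rule Ub_le_nsq[OF N a r p])
   also have "\<dots> \<le> R * ew N a"
    using ew_antimono[OF a, of r N] r N pR ea nsq_nonneg[OF a, of N b p] ew_pos[of r N] a
    by (intro mult_mono) (auto intro: order_trans[OF real_sqrt_ge_zero])
   finally show ?thesis .
  qed
  have small: "c * g * ew N a \<le> \<sigma>" using cs ea by (simp add: s_def field_simps)
  have pt: "\<Phi> r (Ub b p r + Ub b q r) \<le> \<Phi> r (Ub b p r) + w r (Ub b p r) * Ub b q r + \<delta> / 4 * (c * g / (b - a))"
   if r: "r \<in> {a..b}" for r
  proof -
   have "\<Phi> r (Ub b p r + Ub b q r) - \<Phi> r (Ub b p r) - w r (Ub b p r) * Ub b q r \<le> \<delta> / (4 * A) * \<bar>Ub b q r\<bar>"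
    using rem[OF r Up[OF r], of "Ub b q r"] Uq[OF r] small by simp
   also have "\<dots> \<le> \<delta> / (4 * A) * (c * g * ew N a)" using Uq[OF r] \<delta> A by (intro mult_left_mono) auto
   also have "\<dots> = \<delta> / 4 * (c * g / (b - a))" using ea ab by (simp add: A_def field_simps)
   finally show ?thesis by simp
  qed
  have cpq: "continuous_on {a..b} (\<lambda>x. p x + q x)" by (intro continuous_intros p q)
  have "integral {a..b} (\<lambda>r. \<Phi> r (Ub b (\<lambda>x. p x + q x) r)) \<le>
    integral {a..b} (\<lambda>r. \<Phi> r (Ub b p r) + w r (Ub b p r) * Ub b q r + \<delta> / 4 * (c * g / (b - a)))"
   by (rule integral_le) (use pt Ub_add[OF p q] in \<open>auto intro!: ii \<Phi>U_cont\<close>)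
  also have "\<dots> = integral {a..b} (\<lambda>r. \<Phi> r (Ub b p r)) + integral {a..b} (\<lambda>r. w r (Ub b p r) * Ub b q r)
    + \<delta> / 4 * (c * g)"
   by (subst integral_add integral_add; (intro ii)?)+ (use ab in \<open>simp add: field_simps\<close>)
  finally have 1: "integral {a..b} (\<lambda>r. \<Phi> r (Ub b (\<lambda>x. p x + q x) r)) \<le> \<dots>" .
  have "integral {a..b} (\<lambda>s. p s * q s * om N s) + integral {a..b} (\<lambda>r. w r (Ub b p r) * Ub b q r)
    = integral {a..b} (\<lambda>s. Gd p s * q s * om N s)" by (rule Gd_inner[OF p q, symmetric])
  also have "\<dots> = integral {a..b} (\<lambda>s. - c * ((Gd p s)\<^sup>2 * om N s))"
   by (simp add: q_def power2_eq_square algebra_simps)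
  also have "\<dots> = - c * g\<^sup>2" unfolding integral_mult_right nG[symmetric] nsq_def ..
  finally have 2: "integral {a..b} (\<lambda>s. p s * q s * om N s) + integral {a..b} (\<lambda>r. w r (Ub b p r) * Ub b q r) = - c * g\<^sup>2" .
  have "J (\<lambda>x. p x + q x) \<le> J p + (- c * g\<^sup>2) + (c * g)\<^sup>2 / 2 + \<delta> / 4 * (c * g)"
   unfolding J_def nsq_add[OF a p q] nq add_divide_distrib using 1 2 by simp
  also have "(c * g)\<^sup>2 / 2 \<le> c * g * (\<delta> / 4)"
  proof -
   have "c * g * (c * g) \<le> c * g * (\<delta> / 2)" using cs cg0 by (intro mult_left_mono) (auto simp: s_def)
   hence "(c * g)\<^sup>2 / 2 \<le> c * g * (\<delta> / 2) / 2" unfolding power2_eq_square by (rule divide_right_mono) simp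
   thus ?thesis by simp
  qed
  finally show ?thesis by (simp add: q_def algebra_simps power2_eq_square)
 qed
 ultimately show ?thesis by blast
qed

text \<open>Constant extension beyond a and b embeds the continuous functions on [a, b] into the
  normed space of bounded continuous functions on the line, where the abstract lemma is
  applied.\<close>

lemma bcontfun_clamp:
 fixes q :: "real \<Rightarrow> real"
 assumes "continuous_on {a..b} q"
 shows "(\<lambda>s. q (max a (min b s))) \<in> bcontfun"
proof -
 have "bounded (q ` {a..b})"
  by (rule compact_imp_bounded[OF compact_continuous_image[OF assms compact_Icc]])
 then obtain B where B: "\<And>x. x \<in> {a..b} \<Longrightarrow> norm (q x) \<le> B"
  unfolding bounded_iff ball_simps by metis
 show ?thesis
 proof (rule bcontfun_normI)
  show "continuous_on UNIV (\<lambda>s. q (max a (min b s)))"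
   by (rule continuous_on_compose2[OF assms]) (use ab in \<open>auto intro!: continuous_intros\<close>)
  show "norm (q (max a (min b s))) \<le> B" for s using ab by (intro B) auto
 qed
qed

lemma eval_cont: "continuous_on S (\<lambda>(u, s). apply_bcontfun u s)"
 for S :: "((real \<Rightarrow>\<^sub>C real) \<times> real) set"
proof -
 have "((\<lambda>(u, s). apply_bcontfun u s) \<longlongrightarrow> apply_bcontfun u0 s0) (at (u0, s0) within S)" for u0 s0
 proof -
  let ?F = "at (u0, s0) within S"
  have "isCont (apply_bcontfun u0) s0" using continuous_on_apply_bcontfun continuous_on_eq_continuous_at by blast
  moreover have "(snd \<longlongrightarrow> s0) ?F" by (intro tendsto_eq_intros refl) auto
  ultimately have 1: "((\<lambda>x. apply_bcontfun u0 (snd x)) \<longlongrightarrow> apply_bcontfun u0 s0) ?F"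
   by (rule isCont_tendsto_compose)
  have "(fst \<longlongrightarrow> u0) ?F" by (intro tendsto_eq_intros refl) auto
  hence "((\<lambda>x. dist (fst x) u0) \<longlongrightarrow> 0) ?F" by (rule tendsto_dist_iff[THEN iffD1])
  hence "((\<lambda>x. apply_bcontfun (fst x) (snd x) - apply_bcontfun u0 (snd x)) \<longlongrightarrow> 0) ?F"
   by (rule Lim_null_comparison[rotated])
    (auto intro!: always_eventually simp: dist_real_def[symmetric] dist_bounded)
  from tendsto_add[OF this 1] show ?thesis by (simp add: case_prod_beta')
 qed
 thus ?thesis by (auto simp: continuous_on_def)
qed

text \<open>Two structures coexist: continuity refers to the sup norm, while steps and gradients are
  measured by the weighted L^2 seminorm, which is continuous for the sup norm. The function \<Psi>
  adds a lower-order term to the energy that defines the separating level set.\<close>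

lemma mountain_pass:
 fixes \<Psi> :: "real \<Rightarrow> real \<Rightarrow> real"
 defines "Q \<equiv> \<lambda>p. nsq N a b p + integral {a..b} (\<lambda>r. \<Psi> r (Ub b p r))"
 assumes \<Psi>: "continuous_on ({a..b} \<times> UNIV) (\<lambda>(r, y). \<Psi> r y)" and \<Psi>0: "\<And>r. r \<in> {a..b} \<Longrightarrow> \<Psi> r 0 = 0"
  and e: "continuous_on {a..b} e" and \<delta>: "0 < \<delta>" and c: "0 < c" and rho: "0 < rho"
  and sphere: "\<And>p. continuous_on {a..b} p \<Longrightarrow> Q p = rho \<Longrightarrow> c \<le> J p"
  and Je: "J e \<le> 0" and Qe: "rho < Q e"
  and path: "\<And>t. 0 \<le> t \<Longrightarrow> t \<le> 1 \<Longrightarrow> J (\<lambda>x. t * e x) \<le> d"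
 shows "\<exists>p. continuous_on {a..b} p \<and> c / 2 \<le> J p \<and> J p \<le> d \<and> sqrt (nsq N a b (Gd p)) \<le> \<delta>"
proof -
 define BC where "BC q = Bcontfun (\<lambda>s. q (max a (min b s)))" for q :: "real \<Rightarrow> real"
 have BC: "apply_bcontfun (BC q) s = q (max a (min b s))" if "continuous_on {a..b} q" for q s
  unfolding BC_def using bcontfun_clamp[OF that] by (simp add: Bcontfun_inverse)
 have BCe: "apply_bcontfun (BC q) s = q s" if "continuous_on {a..b} q" "s \<in> {a..b}" for q s
  using BC[OF that(1)] that(2) by simp
 have cu: "continuous_on {a..b} (apply_bcontfun u)" for u :: "real \<Rightarrow>\<^sub>C real" by simp
 have J_cong: "J p = J q" if "\<And>s. s \<in> {a..b} \<Longrightarrow> p s = q s" for p q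
 proof -
  have "integral {a..b} (\<lambda>r. \<Phi> r (Ub b p r)) = integral {a..b} (\<lambda>r. \<Phi> r (Ub b q r))"
   by (rule integral_cong) (simp only: Ub_cong[OF that])
  thus ?thesis by (simp only: J_def nsq_cong[OF that])
 qed
 have Q_cong: "Q p = Q q" if "\<And>s. s \<in> {a..b} \<Longrightarrow> p s = q s" for p q
 proof -
  have "integral {a..b} (\<lambda>r. \<Psi> r (Ub b p r)) = integral {a..b} (\<lambda>r. \<Psi> r (Ub b q r))"
   by (rule integral_cong) (simp only: Ub_cong[OF that])
  thus ?thesis by (simp only: Q_def nsq_cong[OF that])
 qed
 have Ub_joint: "continuous_on (UNIV \<times> {a..b}) (\<lambda>(u, r). Ub b (apply_bcontfun u) r)"
  unfolding Ub_def by (rule continuous_on_integral_upper) (rule eval_cont)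
 have comp_joint: "continuous_on (UNIV \<times> {a..b}) (\<lambda>(u, r). F r (Ub b (apply_bcontfun u) r))"
  if "continuous_on ({a..b} \<times> UNIV) (\<lambda>(r, y). F r y)" for F :: "real \<Rightarrow> real \<Rightarrow> real"
 proof -
  have "continuous_on (UNIV \<times> {a..b}) (\<lambda>x. (snd x, Ub b (apply_bcontfun (fst x)) (snd x)))"
   using Ub_joint by (intro continuous_on_Pair continuous_on_snd continuous_on_id) (simp add: case_prod_beta)
  from continuous_on_compose2[OF that this] show ?thesis by (simp add: case_prod_beta image_subset_iff)
 qed
 have int_cont: "continuous_on UNIV (\<lambda>u. integral {a..b} (F u))"
  if "continuous_on (UNIV \<times> {a..b}) (\<lambda>(u, r). F u r)" for F :: "(real \<Rightarrow>\<^sub>C real) \<Rightarrow> real \<Rightarrow> real"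
  using integral_continuous_on_param[of UNIV a b F] that by simp
 have nsq_cont: "continuous_on UNIV (\<lambda>u. nsq N a b (apply_bcontfun u))"
  unfolding nsq_def
  by (rule int_cont) (use eval_cont in \<open>auto simp: case_prod_beta intro!: continuous_intros\<close>)
 have Gd_joint: "continuous_on (UNIV \<times> {a..b}) (\<lambda>(u, s). Gd (apply_bcontfun u) s)"
 proof -
  have "continuous_on (UNIV \<times> {a..b}) (\<lambda>(u, s). Ws (apply_bcontfun u) s)"
   unfolding Ws_def by (rule continuous_on_integral_lower) (rule comp_joint[OF w_cont])
  thus ?thesis unfolding Gd_def case_prod_beta
   by (intro continuous_intros) (use eval_cont om_ne in \<open>auto simp: case_prod_beta\<close>)
 qed
 have contG: "continuous_on UNIV (\<lambda>u. BC (Gd (apply_bcontfun u)))"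
  unfolding continuous_on_iff
 proof (intro ballI allI impI)
  fix u0 :: "real \<Rightarrow>\<^sub>C real" and eps :: real assume eps: "0 < eps"
  \<comment> \<open>Joint continuity and compactness of [a, b] give closeness that is uniform over
    the interval, as the sup norm asks.\<close>
  from continuous_on_prod_compactE[OF Gd_joint compact_Icc UNIV_I, of "eps / 2" u0] eps
  obtain X0 where X0: "u0 \<in> X0" "open X0"
   "\<forall>x\<in>X0 \<inter> UNIV. \<forall>t\<in>{a..b}. dist (Gd (apply_bcontfun x) t) (Gd (apply_bcontfun u0) t) \<le> eps / 2" by auto
  then obtain d where d: "d > 0" "\<And>x. dist x u0 < d \<Longrightarrow> x \<in> X0" by (metis open_dist)
  have "dist (BC (Gd (apply_bcontfun x))) (BC (Gd (apply_bcontfun u0))) < eps" if "dist x u0 < d" for x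
  proof -
   have "dist (BC (Gd (apply_bcontfun x))) (BC (Gd (apply_bcontfun u0))) \<le> eps / 2"
    by (rule dist_bound) (use X0(3) d(2)[OF that] BC[OF Gd_cont[OF cu]] ab in auto)
   thus ?thesis using eps by simp
  qed
  thus "\<exists>d>0. \<forall>x'\<in>UNIV. dist x' u0 < d \<longrightarrow> dist (BC (Gd (apply_bcontfun x'))) (BC (Gd (apply_bcontfun u0))) < eps"
   using d(1) by blast
 qed
 have nG: "nsq N a b (apply_bcontfun (BC (Gd (apply_bcontfun u)))) = nsq N a b (Gd (apply_bcontfun u))" for u
  by (rule nsq_cong) (simp add: BCe Gd_cont)
 have "\<exists>u. c / 2 \<le> J (apply_bcontfun u) \<and> J (apply_bcontfun u) \<le> d \<and>
   sqrt (nsq N a b (apply_bcontfun (BC (Gd (apply_bcontfun u))))) \<le> \<delta>"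
 proof (rule mountain_pass_approx[where Q = "\<lambda>u. Q (apply_bcontfun u)" and r = rho and e = "BC e"
    and w = "\<lambda>u. sqrt (nsq N a b (apply_bcontfun u))"])
  show "continuous_on UNIV (\<lambda>u. J (apply_bcontfun u))"
   unfolding J_def by (intro continuous_intros nsq_cont int_cont comp_joint \<Phi>_cont) simp
  show "continuous_on UNIV (\<lambda>u. Q (apply_bcontfun u))"
   unfolding Q_def by (intro continuous_intros nsq_cont int_cont comp_joint \<Psi>)
  show "continuous_on UNIV (\<lambda>u. sqrt (nsq N a b (apply_bcontfun u)))"
   by (intro continuous_intros nsq_cont)
  show "sqrt (nsq N a b (apply_bcontfun (u - v))) \<le> sqrt (nsq N a b (apply_bcontfun u)) + sqrt (nsq N a b (apply_bcontfun v))" for u v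
   using nsq_triangle[OF a cu[of u] continuous_on_minus[OF cu[of v]], of N] nsq_scale[of N a b "-1" "apply_bcontfun v"]
   by (simp add: minus_bcontfun.rep_eq fun_diff_def)
  show "sqrt (nsq N a b (apply_bcontfun (k *\<^sub>R u))) = \<bar>k\<bar> * sqrt (nsq N a b (apply_bcontfun u))" for k u
   using nsq_scale[of N a b k "apply_bcontfun u"] by (simp add: scaleR_bcontfun.rep_eq real_sqrt_mult)
  have U0: "Ub b (\<lambda>x. 0) r = 0" for r by (simp add: Ub_def)
  have "integral {a..b} (\<lambda>r. \<Phi> r 0) = integral {a..b} (\<lambda>r. 0)" by (rule integral_cong) (simp add: \<Phi>_0)
  thus "J (apply_bcontfun 0) \<le> 0" by (simp add: J_def zero_bcontfun.rep_eq U0 nsq_def)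
  have "integral {a..b} (\<lambda>r. \<Psi> r 0) = integral {a..b} (\<lambda>r. 0)" by (rule integral_cong) (simp add: \<Psi>0)
  thus "Q (apply_bcontfun 0) < rho" using rho by (simp add: Q_def zero_bcontfun.rep_eq U0 nsq_def)
  show "J (apply_bcontfun (BC e)) \<le> 0" using Je J_cong[of "apply_bcontfun (BC e)" e] BCe[OF e] by simp
  show "rho < Q (apply_bcontfun (BC e))" using Qe Q_cong[of "apply_bcontfun (BC e)" e] BCe[OF e] by simp
  show "c \<le> J (apply_bcontfun u)" if "Q (apply_bcontfun u) = rho" for u by (rule sphere[OF cu that])
  show "J (apply_bcontfun (t *\<^sub>R BC e)) \<le> d" if "0 \<le> t" "t \<le> 1" for t
   using path[OF that] J_cong[of "apply_bcontfun (t *\<^sub>R BC e)" "\<lambda>x. t * e x"] BCe[OF e]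
   by (simp add: scaleR_bcontfun.rep_eq)
  fix R :: real
  from J_descent[OF \<delta>, of R] obtain s where s: "s > 0" and S: "\<And>p c. continuous_on {a..b} p \<Longrightarrow> sqrt (nsq N a b p) \<le> R \<Longrightarrow> 0 \<le> c \<Longrightarrow>
    c * sqrt (nsq N a b (Gd p)) \<le> s \<Longrightarrow>
    J (\<lambda>x. p x - c * Gd p x) \<le> J p - c * sqrt (nsq N a b (Gd p)) * (sqrt (nsq N a b (Gd p)) - \<delta> / 2)" by blast
  have "J (apply_bcontfun (u - k *\<^sub>R BC (Gd (apply_bcontfun u)))) = J (\<lambda>x. apply_bcontfun u x - k * Gd (apply_bcontfun u) x)" for u k
   by (rule J_cong) (simp add: minus_bcontfun.rep_eq scaleR_bcontfun.rep_eq BCe Gd_cont)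
  thus "\<exists>s>0. \<forall>u k. sqrt (nsq N a b (apply_bcontfun u)) \<le> R \<longrightarrow> 0 \<le> k \<longrightarrow>
     k * sqrt (nsq N a b (apply_bcontfun (BC (Gd (apply_bcontfun u))))) \<le> s \<longrightarrow>
     J (apply_bcontfun (u - k *\<^sub>R BC (Gd (apply_bcontfun u)))) \<le> J (apply_bcontfun u) -
      k * sqrt (nsq N a b (apply_bcontfun (BC (Gd (apply_bcontfun u))))) *
      (sqrt (nsq N a b (apply_bcontfun (BC (Gd (apply_bcontfun u))))) - \<delta> / 2)"
   unfolding nG using s S[OF cu] by (intro exI[of _ s]) simp
 qed (use contG c \<delta> nsq_nonneg[OF a] in auto)
 then obtain u where "c / 2 \<le> J (apply_bcontfun u)" "J (apply_bcontfun u) \<le> d" "sqrt (nsq N a b (Gd (apply_bcontfun u))) \<le> \<delta>"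
  unfolding nG by blast
 thus ?thesis using cu by blast
qed

end

section \<open>The nonlinearity after the change of variable, and the weights\<close>

definition mfun :: "(real \<Rightarrow> real) \<Rightarrow> real \<Rightarrow> real" where
 "mfun g y = g (fODE y) / sqrt (1 + 2 * (fODE y)\<^sup>2)"

definition Mfun :: "(real \<Rightarrow> real) \<Rightarrow> real \<Rightarrow> real" where
 "Mfun g y = prim g (fODE y)"

text \<open>The definition changes its branch at 0. On a window that contains both 0 and t, either
  branch is an integral from the left end c, up to one common constant.\<close>

lemma prim_deriv:
 assumes g: "continuous_on UNIV g"
 shows "(prim g has_real_derivative g t) (at t)"
proof -
 define c where "c = - \<bar>t\<bar> - 1"
 define d where "d = \<bar>t\<bar> + 1"
 have ig: "g integrable_on {x..y}" for x y
  using g by (intro integrable_continuous_real) (auto intro: continuous_on_subset)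
 have eq: "prim g s = integral {c..s} g - integral {c..0} g" if "s \<in> {c<..<d}" for s
 proof (cases "0 \<le> s")
  case True
  have "integral {c..0} g + integral {0..s} g = integral {c..s} g"
   by (rule Henstock_Kurzweil_Integration.integral_combine) (use True ig in \<open>auto simp: c_def\<close>)
  thus ?thesis using True by (simp add: prim_def)
 next
  case False
  have "integral {c..s} g + integral {s..0} g = integral {c..0} g"
   by (rule Henstock_Kurzweil_Integration.integral_combine) (use False that ig in auto)
  thus ?thesis using False by (simp add: prim_def)
 qed
 have "((\<lambda>s. integral {c..s} g) has_real_derivative g t) (at t within {c..d})"
  by (rule integral_has_real_derivative) (use g in \<open>auto intro: continuous_on_subset simp: c_def d_def\<close>)
 hence "((\<lambda>s. integral {c..s} g) has_real_derivative g t) (at t within {c<..<d})"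
  by (rule has_field_derivative_subset) auto
 hence "((\<lambda>s. integral {c..s} g) has_real_derivative g t) (at t)"
  by (subst (asm) at_within_open) (auto simp: c_def d_def)
 hence "((\<lambda>s. integral {c..s} g - integral {c..0} g) has_real_derivative g t - 0) (at t)"
  by (intro DERIV_diff DERIV_const)
 thus ?thesis
  by (rule has_field_derivative_transform_within_open[where S = "{c<..<d}", OF DERIV_cong])
   (auto simp: eq c_def d_def)
qed

lemma Mfun_deriv:
 assumes g: "continuous_on UNIV g"
 shows "(Mfun g has_real_derivative mfun g y) (at y)"
proof -
 have "((\<lambda>y. prim g (fODE y)) has_real_derivative g (fODE y) * (1 / sqrt (1 + 2 * (fODE y)\<^sup>2))) (at y)"
  by (rule DERIV_chain2[OF prim_deriv[OF g] fODE_deriv])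
 moreover have "(\<lambda>y. prim g (fODE y)) = Mfun g" by (rule ext) (simp only: Mfun_def)
 ultimately show ?thesis by (simp only: mfun_def times_divide_eq_right mult_1_right)
qed

lemma isCont_mfun:
 assumes g: "continuous_on UNIV g" shows "isCont (mfun g) y"
proof -
 have "isCont (\<lambda>y. g (fODE y)) y"
  by (rule isCont_o2[OF isCont_fODE]) (use g continuous_on_eq_continuous_at[OF open_UNIV] in blast)
 moreover have "isCont (\<lambda>y. sqrt (1 + 2 * (fODE y)\<^sup>2)) y"
  by (intro continuous_intros isCont_fODE)
 ultimately show ?thesis unfolding mfun_def[abs_def]
  by (rule isCont_divide) (rule sqrt_1_plus_pos)
qed

lemma Mfun_0: "Mfun g 0 = 0"
 by (simp add: Mfun_def prim_def)

text \<open>The exponents are those of u: \<gamma>1 and \<gamma>2 stand for q1/2 and q2/2, hence the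
  powers 2 \<gamma> - 1 in the bounds on g.\<close>

locale nonlin =
 fixes g :: "real \<Rightarrow> real" and \<gamma>1 \<gamma>2 Cg \<theta> t0 :: real
 assumes g_cont: "continuous_on UNIV g"
  and \<theta>: "2 < \<theta>" and AR: "\<And>t. 0 \<le> 2 * \<theta> * prim g t" "\<And>t. 2 * \<theta> * prim g t \<le> g t * t"
  and t0: "0 < t0" "0 < prim g t0"
  and \<gamma>1: "2 < \<gamma>1" and \<gamma>2: "2 < \<gamma>2" and Cg: "0 < Cg"
  and growth: "\<And>t. \<bar>g t\<bar> \<le> Cg * \<bar>t\<bar> powr (2 * \<gamma>1 - 1)" "\<And>t. \<bar>g t\<bar> \<le> Cg * \<bar>t\<bar> powr (2 * \<gamma>2 - 1)"
begin

definition Cm :: real where "Cm = Cg * 2 powr (\<gamma>1 + \<gamma>2)"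

lemma Cm: "0 < Cm" using Cg by (simp add: Cm_def)

text \<open>Write f^(2 \<gamma> - 1) as (f^2)^(\<gamma> - 1) times f. The first factor is at most
  (2|y|)^(\<gamma> - 1), and the second is absorbed by f' because |f f'| \<le> 1. The exponent in
  \<open>Cm\<close> is large enough for both values of \<gamma>.\<close>

lemma mfun_bound_aux:
 assumes \<gamma>: "1 < \<gamma>" "\<gamma> \<le> \<gamma>1 + \<gamma>2" and gr: "\<bar>g (fODE y)\<bar> \<le> Cg * \<bar>fODE y\<bar> powr (2 * \<gamma> - 1)"
 shows "\<bar>mfun g y\<bar> \<le> Cm * \<bar>y\<bar> powr (\<gamma> - 1)"
proof -
 define f where "f = \<bar>fODE y\<bar>"
 define s where "s = sqrt (1 + 2 * (fODE y)\<^sup>2)"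
 have s: "s > 0" using sqrt_1_plus_ge_1[of "fODE y"] unfolding s_def by linarith
 have fs: "f / s \<le> 1" using kfun_le_1[of y] s by (simp add: kfun_def f_def s_def)
 have f0: "f \<ge> 0" by (simp add: f_def)
 have "f powr (2 * \<gamma> - 1) = f powr (2 * \<gamma> - 2) * f"
  using f0 powr_add[of f "2 * \<gamma> - 2" 1] by simp
 also have "f powr (2 * \<gamma> - 2) = (f\<^sup>2) powr (\<gamma> - 1)"
 proof (cases "f = 0")
  case False
  hence "f\<^sup>2 = f powr 2" using f0 by simp
  hence "(f\<^sup>2) powr (\<gamma> - 1) = f powr (2 * (\<gamma> - 1))" by (simp only: powr_powr)
  thus ?thesis by (simp add: algebra_simps)
 qed simp
 finally have e: "f powr (2 * \<gamma> - 1) = (f\<^sup>2) powr (\<gamma> - 1) * f" .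
 have "(f\<^sup>2) powr (\<gamma> - 1) \<le> (2 * \<bar>y\<bar>) powr (\<gamma> - 1)"
  using \<gamma> fODE_sq_le_2abs[of y] by (intro powr_mono2) (auto simp: f_def)
 also have "\<dots> = 2 powr (\<gamma> - 1) * \<bar>y\<bar> powr (\<gamma> - 1)" by (simp add: powr_mult)
 also have "\<dots> \<le> 2 powr (\<gamma>1 + \<gamma>2) * \<bar>y\<bar> powr (\<gamma> - 1)"
  using \<gamma> by (intro mult_right_mono powr_mono) auto
 finally have f2: "(f\<^sup>2) powr (\<gamma> - 1) \<le> 2 powr (\<gamma>1 + \<gamma>2) * \<bar>y\<bar> powr (\<gamma> - 1)" .
 have "\<bar>mfun g y\<bar> = \<bar>g (fODE y)\<bar> / s" using s by (simp add: mfun_def s_def abs_divide)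
 also have "\<dots> \<le> (Cg * ((f\<^sup>2) powr (\<gamma> - 1) * f)) / s"
  using gr[folded f_def, unfolded e] s by (intro divide_right_mono) auto
 also have "\<dots> = Cg * (f\<^sup>2) powr (\<gamma> - 1) * (f / s)" by simp
 also have "\<dots> \<le> Cg * (f\<^sup>2) powr (\<gamma> - 1) * 1" using fs Cg by (intro mult_left_mono) auto
 also have "\<dots> \<le> Cg * (2 powr (\<gamma>1 + \<gamma>2) * \<bar>y\<bar> powr (\<gamma> - 1))" using f2 Cg by simp
 finally show ?thesis by (simp add: Cm_def)
qed

lemma mfun_bound: "\<bar>mfun g y\<bar> \<le> Cm * \<bar>y\<bar> powr (\<gamma>1 - 1)" "\<bar>mfun g y\<bar> \<le> Cm * \<bar>y\<bar> powr (\<gamma>2 - 1)"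
 using \<gamma>1 \<gamma>2 by (auto intro!: mfun_bound_aux growth)

text \<open>Point of evaluation and factor share one majorant x, because in the remainder of I the
  nonlinearity is taken at a mean value point and multiplied by an increment.\<close>

lemma mfun_mult_bound:
 assumes "\<bar>y\<bar> \<le> x" "\<bar>z\<bar> \<le> x"
 shows "\<bar>mfun g y * z\<bar> \<le> Cm * x powr \<gamma>1" "\<bar>mfun g y * z\<bar> \<le> Cm * x powr \<gamma>2"
proof -
 have *: "\<bar>mfun g y * z\<bar> \<le> Cm * x powr \<gamma>" if "\<bar>mfun g y\<bar> \<le> Cm * \<bar>y\<bar> powr (\<gamma> - 1)" "2 < \<gamma>" for \<gamma>
 proof -
  have x: "x \<ge> 0" using assms(1) by linarith
  have "\<bar>y\<bar> powr (\<gamma> - 1) \<le> x powr (\<gamma> - 1)" using assms that by (intro powr_mono2) auto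
  hence "\<bar>mfun g y\<bar> \<le> Cm * x powr (\<gamma> - 1)" using Cm by (intro order_trans[OF that(1)] mult_left_mono) auto
  hence "\<bar>mfun g y\<bar> * \<bar>z\<bar> \<le> Cm * x powr (\<gamma> - 1) * x" using assms Cm by (intro mult_mono) auto
  also have "\<dots> = Cm * x powr \<gamma>" using x powr_add[of x "\<gamma> - 1" 1] by simp
  finally show ?thesis by (simp add: abs_mult)
 qed
 show "\<bar>mfun g y * z\<bar> \<le> Cm * x powr \<gamma>1" "\<bar>mfun g y * z\<bar> \<le> Cm * x powr \<gamma>2"
  by (rule *[OF mfun_bound(1) \<gamma>1], rule *[OF mfun_bound(2) \<gamma>2])
qed

lemma Mfun_nonneg: "0 \<le> Mfun g y"
 using AR(1)[of "fODE y"] \<theta> by (simp add: Mfun_def zero_le_mult_iff)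

text \<open>From f f' y \<ge> f^2 / 2 one gets f' y / f \<ge> 1/2. Multiplication by g(f) f \<ge> 0
  turns the constant 2 \<theta> for g into \<theta>, which is still above the quadratic growth of
  the energy.\<close>

lemma mfun_AR: "\<theta> * Mfun g y \<le> mfun g y * y"
proof (cases "y = 0")
 case False
 define f where "f = fODE y"
 define s where "s = sqrt (1 + 2 * f\<^sup>2)"
 have f: "f \<noteq> 0" using False by (metis f_def fprimitive_0 fprimitive_fODE)
 have s: "s > 0" using sqrt_1_plus_ge_1[of f] unfolding s_def by linarith
 have "f\<^sup>2 / 2 \<le> f / s * y" using kfun_mult_bounds(1)[of y] by (simp add: kfun_def f_def s_def)
 hence "(f\<^sup>2 / 2) / f\<^sup>2 \<le> (f / s * y) / f\<^sup>2" by (intro divide_right_mono) auto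
 hence h: "1 / 2 \<le> y / (s * f)" using f s by (simp add: power2_eq_square field_simps)
 have "0 \<le> g f * f" using AR[of f] by linarith
 hence "g f * f * (1 / 2) \<le> g f * f * (y / (s * f))" using h by (intro mult_left_mono)
 also have "\<dots> = mfun g y * y" using f s by (simp add: mfun_def f_def s_def)
 finally show ?thesis using AR(2)[of f] by (simp add: Mfun_def f_def)
qed (simp add: Mfun_0)

lemma Mfun_le_m: "Mfun g y \<le> mfun g y * y"
proof -
 have "1 * Mfun g y \<le> \<theta> * Mfun g y" using \<theta> Mfun_nonneg by (intro mult_right_mono) auto
 thus ?thesis using mfun_AR[of y] by linarith
qed

lemma Mfun_bound: "Mfun g y \<le> Cm * \<bar>y\<bar> powr \<gamma>1" "Mfun g y \<le> Cm * \<bar>y\<bar> powr \<gamma>2"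
 using mfun_mult_bound[of y "\<bar>y\<bar>" y] Mfun_le_m[of y] by auto

text \<open>\<open>G(t) / t^(2 \<theta>)\<close> is nondecreasing.\<close>
lemma prim_growth: assumes "t0 \<le> t" shows "prim g t0 / t0 powr (2 * \<theta>) * t powr (2 * \<theta>) \<le> prim g t"
proof -
 have "prim g t0 * t0 powr (- 2 * \<theta>) \<le> prim g t * t powr (- 2 * \<theta>)"
 proof (rule DERIV_nonneg_imp_nondecreasing[OF assms])
  fix x assume x: "t0 \<le> x" "x \<le> t"
  have xp: "x > 0" using x t0 by linarith
  have "((\<lambda>x. prim g x * x powr (- 2 * \<theta>)) has_real_derivative
    g x * x powr (- 2 * \<theta>) + (- 2 * \<theta> * x powr (- 2 * \<theta> - 1)) * prim g x) (at x)"
   by (intro DERIV_mult prim_deriv g_cont has_real_derivative_powr xp)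
  moreover have "x powr (- 2 * \<theta>) = x powr (- 2 * \<theta> - 1) * x"
   using xp powr_add[of x "- 2 * \<theta> - 1" 1] by simp
  hence "g x * x powr (- 2 * \<theta>) + (- 2 * \<theta> * x powr (- 2 * \<theta> - 1)) * prim g x =
    x powr (- 2 * \<theta> - 1) * (g x * x - 2 * \<theta> * prim g x)" by (simp add: algebra_simps)
  moreover have "0 \<le> x powr (- 2 * \<theta> - 1) * (g x * x - 2 * \<theta> * prim g x)"
   using AR(2)[of x] by (intro mult_nonneg_nonneg) auto
  ultimately show "\<exists>y. ((\<lambda>x. prim g x * x powr (- 2 * \<theta>)) has_real_derivative y) (at x) \<and> 0 \<le> y" by (metis (no_types, lifting))
 qed
 hence "prim g t0 / t0 powr (2 * \<theta>) \<le> prim g t / t powr (2 * \<theta>)" by (simp add: powr_minus_divide)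
 moreover have "t powr (2 * \<theta>) > 0" using assms t0 by simp
 ultimately show ?thesis by (simp add: field_simps)
qed

text \<open>Combine G(t) \<ge> c t^(2 \<theta>) for t \<ge> t0 with f(y)^2 \<ge> y/3 for y \<ge> 1.
  The threshold 3 t0^2 puts f(y) above t0.\<close>

lemma Mfun_growth: "\<exists>c>0. \<exists>y1>0. \<forall>y\<ge>y1. c * y powr \<theta> \<le> Mfun g y"
proof -
 define c0 where "c0 = prim g t0 / t0 powr (2 * \<theta>)"
 have c0: "c0 > 0" using t0 by (simp add: c0_def)
 define y1 where "y1 = max 1 (3 * t0\<^sup>2)"
 have "c0 * (1 / 3) powr \<theta> * y powr \<theta> \<le> Mfun g y" if y: "y \<ge> y1" for y
 proof -
  have y1: "y \<ge> 1" "y \<ge> 3 * t0\<^sup>2" using y by (auto simp: y1_def)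
  have f2: "y / 3 \<le> (fODE y)\<^sup>2" by (rule fODE_sq_ge_third[OF y1(1)])
  have f0: "fODE y \<ge> 0" using y1 fODE_nonneg by simp
  have "t0\<^sup>2 \<le> (fODE y)\<^sup>2" using f2 y1 by linarith
  hence tf: "t0 \<le> fODE y" using f0 by (rule power2_le_imp_le)
  hence fp: "fODE y > 0" using t0 by linarith
  have "(1 / 3) powr \<theta> * y powr \<theta> = (y / 3) powr \<theta>" using y1 by (simp add: powr_mult[symmetric])
  also have "\<dots> \<le> ((fODE y)\<^sup>2) powr \<theta>" using f2 y1 \<theta> by (intro powr_mono2) auto
  also have "(fODE y)\<^sup>2 = fODE y powr 2" using fp by simp
  also have "(fODE y powr 2) powr \<theta> = fODE y powr (2 * \<theta>)" by (rule powr_powr)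
  finally have "c0 * ((1 / 3) powr \<theta> * y powr \<theta>) \<le> c0 * fODE y powr (2 * \<theta>)" using c0 by simp
  also have "\<dots> \<le> Mfun g y" using prim_growth[OF tf] by (simp add: c0_def Mfun_def)
  finally show ?thesis by (simp add: mult.assoc)
 qed
 moreover have "c0 * (1 / 3) powr \<theta> > 0" "y1 > 0" using c0 by (auto simp: y1_def)
 ultimately show ?thesis by blast
qed

end

text \<open>The only form in which the growth of K relative to V enters the estimates. For x below S
  times the decay rate, the K-density is dominated near 0 by an integrable power. At infinity it is
  dominated by an integrable power plus r^(-eta) times the density of the V-weighted L^2 norm of
  x/S. The gain eta > 0 yields smallness at both ends.\<close>

locale weights =
 fixes N :: nat and V K :: "real \<Rightarrow> real" and \<gamma>1 \<gamma>2 eta CK CV :: real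
 assumes N: "3 \<le> N"
  and V_cont: "continuous_on {0<..} V" and V_nonneg: "\<And>r. 0 < r \<Longrightarrow> 0 \<le> V r"
  and K_cont: "continuous_on {0<..} K" and K_pos: "\<And>r. 0 < r \<Longrightarrow> 0 < K r"
  and V_bound: "\<And>r. 0 < r \<Longrightarrow> r \<le> 1 \<Longrightarrow> V r \<le> CV / r\<^sup>2" and CV: "0 < CV"
  and eta: "0 < eta" and CK: "0 < CK"
  and K0: "\<And>r S x. 0 < r \<Longrightarrow> r \<le> 1 \<Longrightarrow> 0 < S \<Longrightarrow> 0 \<le> x \<Longrightarrow> x \<le> S * ew N r \<Longrightarrow>
    K r * x powr \<gamma>1 * om N r \<le> CK * S powr \<gamma>1 * r powr (eta - 1)"
  and Kinf: "\<And>r S x. 1 \<le> r \<Longrightarrow> 0 < S \<Longrightarrow> 0 \<le> x \<Longrightarrow> x \<le> S * ew N r \<Longrightarrow>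
    K r * x powr \<gamma>2 * om N r \<le> CK * S powr \<gamma>2 * (V r * (x / S)\<^sup>2 * om N r * r powr (- eta) + r powr (- eta - 1))"

locale radial_problem = nonlin g \<gamma>1 \<gamma>2 Cg \<theta> t0 + weights N V K \<gamma>1 \<gamma>2 eta CK CV
 for g \<gamma>1 \<gamma>2 Cg \<theta> t0 N V K eta CK CV

section \<open>Bounds for the K-term near the origin and at infinity\<close>

context weights
begin

lemma V_cont_on [continuous_intros]: "0 < a \<Longrightarrow> continuous_on {a..b} V"
 by (rule continuous_on_subset[OF V_cont]) auto
lemma K_cont_on [continuous_intros]: "0 < a \<Longrightarrow> continuous_on {a..b} K"
 by (rule continuous_on_subset[OF K_cont]) auto

lemma has_integral_powr_0:
 assumes "0 < a" "a \<le> r"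
 shows "((\<lambda>s. s powr (eta - 1)) has_integral (r powr eta - a powr eta) / eta) {a..r}"
proof -
 have "((\<lambda>s. s powr (eta - 1)) has_integral (r powr eta / eta - a powr eta / eta)) {a..r}"
 proof (rule fundamental_theorem_of_calculus[OF assms(2)])
  fix x assume "x \<in> {a..r}"
  hence "x > 0" using assms by simp
  hence "((\<lambda>s. s powr eta / eta) has_real_derivative eta * x powr (eta - 1) / eta) (at x)"
   by (intro DERIV_cdivide has_real_derivative_powr)
  thus "((\<lambda>s. s powr eta / eta) has_vector_derivative x powr (eta - 1)) (at x within {a..r})"
   using eta by (simp add: vector_derivative_simps)
 qed
 thus ?thesis by (simp add: diff_divide_distrib)
qed

lemma has_integral_powr_inf:
 assumes "0 < R" "R \<le> b"
 shows "((\<lambda>s. s powr (- eta - 1)) has_integral (R powr (-eta) - b powr (-eta)) / eta) {R..b}"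
proof -
 have "((\<lambda>s. s powr (- eta - 1)) has_integral (- (b powr (-eta)) / eta - - (R powr (-eta)) / eta)) {R..b}"
 proof (rule fundamental_theorem_of_calculus[OF assms(2)])
  fix x assume "x \<in> {R..b}"
  hence "x > 0" using assms by simp
  hence "((\<lambda>s. - (s powr (-eta)) / eta) has_real_derivative - (-eta * x powr (-eta - 1)) / eta) (at x)"
   by (intro DERIV_cdivide DERIV_minus has_real_derivative_powr)
  thus "((\<lambda>s. - (s powr (-eta)) / eta) has_vector_derivative x powr (-eta - 1)) (at x within {R..b})"
   using eta by (simp add: vector_derivative_simps)
 qed
 thus ?thesis by (simp add: diff_divide_distrib)
qed

text \<open>The bound tends to 0 with r and does not see a, so the K-term cannot concentrate at the
  origin along the approximating problems.\<close>

lemma K_integral_near_0: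
 assumes "0 < a" "a \<le> r" "r \<le> 1" "0 < S" and H: "continuous_on {a..r} H"
  and Y: "\<And>s. s \<in> {a..r} \<Longrightarrow> 0 \<le> Y s \<and> Y s \<le> S * ew N s \<and> \<bar>H s\<bar> \<le> C * Y s powr \<gamma>1" and C: "0 \<le> C"
 shows "\<bar>integral {a..r} (\<lambda>s. om N s * (K s * H s))\<bar> \<le> C * CK * S powr \<gamma>1 * r powr eta / eta"
proof -
 have "norm (integral {a..r} (\<lambda>s. om N s * (K s * H s))) \<le> integral {a..r} (\<lambda>s. C * CK * S powr \<gamma>1 * s powr (eta - 1))"
 proof (rule integral_norm_bound_integral)
  show "(\<lambda>s. om N s * (K s * H s)) integrable_on {a..r}"
   by (intro integrable_continuous_real continuous_intros H assms(1))
  show "(\<lambda>s. C * CK * S powr \<gamma>1 * s powr (eta - 1)) integrable_on {a..r}"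
   using has_integral_powr_0[OF assms(1,2)] by (intro integrable_on_mult_right) (auto simp: integrable_on_def)
  fix s assume s: "s \<in> {a..r}"
  hence s0: "0 < s" "s \<le> 1" using assms by auto
  have "norm (om N s * (K s * H s)) = om N s * K s * \<bar>H s\<bar>"
   using om_pos[OF s0(1), of N] K_pos[OF s0(1)] by (simp add: abs_mult)
  also have "\<dots> \<le> om N s * K s * (C * Y s powr \<gamma>1)"
   using Y[OF s] om_pos[OF s0(1), of N] K_pos[OF s0(1)] by (intro mult_left_mono) auto
  also have "\<dots> = C * (K s * Y s powr \<gamma>1 * om N s)" by (simp add: mult_ac)
  also have "\<dots> \<le> C * (CK * S powr \<gamma>1 * s powr (eta - 1))"
   using Y[OF s] assms s0 C by (intro mult_left_mono K0) auto
  finally show "norm (om N s * (K s * H s)) \<le> C * CK * S powr \<gamma>1 * s powr (eta - 1)" by (simp add: mult_ac)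
 qed
 also have "\<dots> = C * CK * S powr \<gamma>1 * ((r powr eta - a powr eta) / eta)"
  using integral_unique[OF has_integral_powr_0[OF assms(1,2)]] by simp
 also have "\<dots> \<le> C * CK * S powr \<gamma>1 * (r powr eta / eta)"
  using eta C CK by (intro mult_left_mono divide_right_mono) auto
 finally show ?thesis by simp
qed

text \<open>The counterpart at infinity. Here a bound D for the V-weighted L^2 integral of Y/S is
  part of the input, and R^(-eta) supplies the smallness uniformly in b.\<close>

lemma K_integral_tail:
 assumes R: "1 \<le> R" "R \<le> b" and S: "0 < S" and H: "continuous_on {R..b} H" and Yc: "continuous_on {R..b} Y"
  and Y: "\<And>s. s \<in> {R..b} \<Longrightarrow> 0 \<le> Y s \<and> Y s \<le> S * ew N s \<and> \<bar>H s\<bar> \<le> C * Y s powr \<gamma>2" and C: "0 \<le> C"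
  and D: "integral {R..b} (\<lambda>s. om N s * (V s * (Y s / S)\<^sup>2)) \<le> D"
 shows "\<bar>integral {R..b} (\<lambda>s. om N s * (K s * H s))\<bar> \<le> C * CK * S powr \<gamma>2 * R powr (-eta) * (D + 1 / eta)"
proof -
 have R0: "0 < R" using R by simp
 note ii = integrable_continuous_real continuous_intros H Yc R0
 have i1: "(\<lambda>s. om N s * (V s * (Y s / S)\<^sup>2)) integrable_on {R..b}" using S by (intro ii) auto
 have i2: "(\<lambda>s. s powr (- eta - 1)) integrable_on {R..b}"
  using has_integral_powr_inf[OF R0 R(2)] by (auto simp: integrable_on_def)
 have "norm (integral {R..b} (\<lambda>s. om N s * (K s * H s))) \<le>
  integral {R..b} (\<lambda>s. C * CK * S powr \<gamma>2 * (R powr (-eta) * (om N s * (V s * (Y s / S)\<^sup>2)) + s powr (- eta - 1)))"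
 proof (rule integral_norm_bound_integral)
  show "(\<lambda>s. om N s * (K s * H s)) integrable_on {R..b}" by (intro ii)
  show "(\<lambda>s. C * CK * S powr \<gamma>2 * (R powr (-eta) * (om N s * (V s * (Y s / S)\<^sup>2)) + s powr (- eta - 1))) integrable_on {R..b}"
   by (intro integrable_on_mult_right integrable_add i1 i2)
  fix s assume s: "s \<in> {R..b}"
  hence s0: "0 < s" "1 \<le> s" using R by auto
  have "norm (om N s * (K s * H s)) = om N s * K s * \<bar>H s\<bar>"
   using om_pos[OF s0(1), of N] K_pos[OF s0(1)] by (simp add: abs_mult)
  also have "\<dots> \<le> om N s * K s * (C * Y s powr \<gamma>2)"
   using Y[OF s] om_pos[OF s0(1), of N] K_pos[OF s0(1)] by (intro mult_left_mono) auto
  also have "\<dots> = C * (K s * Y s powr \<gamma>2 * om N s)" by (simp add: mult_ac)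
  also have "\<dots> \<le> C * (CK * S powr \<gamma>2 * (V s * (Y s / S)\<^sup>2 * om N s * s powr (- eta) + s powr (- eta - 1)))"
   using Y[OF s] S s0 C by (intro mult_left_mono Kinf) auto
  also have "\<dots> \<le> C * (CK * S powr \<gamma>2 * (V s * (Y s / S)\<^sup>2 * om N s * R powr (- eta) + s powr (- eta - 1)))"
   using s R0 eta C CK V_nonneg[OF s0(1)] om_pos[OF s0(1), of N]
   by (intro mult_left_mono add_right_mono powr_mono2') auto
  finally show "norm (om N s * (K s * H s)) \<le> C * CK * S powr \<gamma>2 * (R powr (-eta) * (om N s * (V s * (Y s / S)\<^sup>2)) + s powr (- eta - 1))"
   by (simp add: mult_ac)
 qed
 also have "\<dots> = C * CK * S powr \<gamma>2 * (R powr (-eta) * integral {R..b} (\<lambda>s. om N s * (V s * (Y s / S)\<^sup>2)) + (R powr (-eta) - b powr (-eta)) / eta)"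
  using integral_add[OF integrable_on_mult_right[OF i1, of "R powr (-eta)"] i2]
   integral_unique[OF has_integral_powr_inf[OF R0 R(2)]] by simp
 also have "\<dots> \<le> C * CK * S powr \<gamma>2 * (R powr (-eta) * D + R powr (-eta) / eta)"
  using eta C CK D by (intro mult_left_mono add_mono divide_right_mono) auto
 finally show ?thesis by (simp add: algebra_simps)
qed

end

section \<open>Mountain pass geometry, uniform in the interval\<close>

context radial_problem
begin

definition wf :: "real \<Rightarrow> real \<Rightarrow> real" where "wf r y = om N r * (V r * kfun y - K r * mfun g y)"
definition Ph :: "real \<Rightarrow> real \<Rightarrow> real" where "Ph r y = om N r * (V r * ((fODE y)\<^sup>2 / 2) - K r * Mfun g y)"
definition Psi :: "real \<Rightarrow> real \<Rightarrow> real" where "Psi r y = om N r * (V r * (fODE y)\<^sup>2)"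

lemma cont_fODE: "continuous_on S fODE" using isCont_fODE by (simp add: continuous_at_imp_continuous_on)
lemma cont_kfun: "continuous_on S kfun" using isCont_kfun by (simp add: continuous_at_imp_continuous_on)
lemma cont_mfun: "continuous_on S (mfun g)" using isCont_mfun[OF g_cont] by (simp add: continuous_at_imp_continuous_on)
lemma cont_Mfun: "continuous_on S (Mfun g)"
 using DERIV_isCont[OF Mfun_deriv[OF g_cont]] by (simp add: continuous_at_imp_continuous_on)

lemmas cont_nonlin = continuous_on_compose2[OF cont_fODE[of UNIV] _ subset_UNIV]
 continuous_on_compose2[OF cont_kfun[of UNIV] _ subset_UNIV]
 continuous_on_compose2[OF cont_mfun[of UNIV] _ subset_UNIV]
 continuous_on_compose2[OF cont_Mfun[of UNIV] _ subset_UNIV]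

lemma cont_V_fst: "0 < a \<Longrightarrow> continuous_on ({a..b} \<times> UNIV) (\<lambda>x. V (fst x))"
 by (rule continuous_on_compose2[OF V_cont]) (auto intro!: continuous_intros)
lemma cont_K_fst: "0 < a \<Longrightarrow> continuous_on ({a..b} \<times> UNIV) (\<lambda>x. K (fst x))"
 by (rule continuous_on_compose2[OF K_cont]) (auto intro!: continuous_intros)

lemma cont_Psi: "0 < a \<Longrightarrow> continuous_on ({a..b} \<times> UNIV) (\<lambda>(r, y). Psi r y)"
 unfolding Psi_def case_prod_beta'
 by (intro continuous_intros cont_nonlin cont_V_fst)

lemma one_dim_problem: "0 < a \<Longrightarrow> a < b \<Longrightarrow> one_dim N a b wf Ph"
proof
 assume a: "0 < a" "a < b"
 show "continuous_on ({a..b} \<times> UNIV) (\<lambda>(r, y). wf r y)"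
  unfolding wf_def case_prod_beta'
  by (intro continuous_intros cont_nonlin cont_V_fst cont_K_fst a)
 show "continuous_on ({a..b} \<times> UNIV) (\<lambda>(r, y). Ph r y)"
  unfolding Ph_def case_prod_beta'
  by (intro continuous_intros cont_nonlin cont_V_fst cont_K_fst a) auto
 show "(Ph r has_real_derivative wf r y) (at y)" for r y
 proof -
  have "((\<lambda>y. om N r * (V r * ((fODE y)\<^sup>2 / 2) - K r * Mfun g y)) has_real_derivative
    om N r * (V r * (2 * kfun y / 2) - K r * mfun g y)) (at y)"
   by (intro DERIV_cmult DERIV_diff DERIV_cdivide fODE_sq_deriv Mfun_deriv g_cont)
  thus ?thesis by (simp add: Ph_def[abs_def] wf_def)
 qed
 show "Ph r 0 = 0" for r by (simp add: Ph_def Mfun_0)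
qed (use N in auto)

definition JJ where "JJ a b p = one_dim.J N a b Ph p"
definition GG where "GG a b p = one_dim.Gd N a b wf p"
text \<open>The quantity whose level set plays the role of the small sphere. It is not homogeneous,
  but it dominates the Dirichlet energy and hence gives the pointwise decay of U.\<close>

definition QQ where "QQ a b p = nsq N a b p + integral {a..b} (\<lambda>r. Psi r (Ub b p r))"

lemma JJ_eq: "0 < a \<Longrightarrow> a < b \<Longrightarrow> JJ a b p = nsq N a b p / 2 + integral {a..b} (\<lambda>r. Ph r (Ub b p r))"
 unfolding JJ_def by (rule one_dim.J_def[OF one_dim_problem])

lemma Psi_nonneg: "0 < r \<Longrightarrow> 0 \<le> Psi r y"
 using om_pos[of r N] V_nonneg[of r] by (simp add: Psi_def)

lemma Psi_U_cont: "0 < a \<Longrightarrow> continuous_on {a..b} p \<Longrightarrow> continuous_on {a..b} (\<lambda>r. Psi r (Ub b p r))"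
 unfolding Psi_def by (intro continuous_intros cont_nonlin Ub_cont)

lemma Psi_integral_nonneg: "0 < a \<Longrightarrow> continuous_on {a..b} p \<Longrightarrow> 0 \<le> integral {a..b} (\<lambda>r. Psi r (Ub b p r))"
 by (intro integral_nonneg integrable_continuous_real Psi_U_cont) (auto intro: Psi_nonneg)

lemma nsq_le_QQ: "0 < a \<Longrightarrow> continuous_on {a..b} p \<Longrightarrow> nsq N a b p \<le> QQ a b p"
 using Psi_integral_nonneg by (simp add: QQ_def)

lemma U_le_QQ:
 assumes "0 < a" "continuous_on {a..b} p" "QQ a b p \<le> S\<^sup>2" "0 \<le> S" "r \<in> {a..b}"
 shows "\<bar>Ub b p r\<bar> \<le> S * ew N r"
proof -
 have "sqrt (nsq N a b p) \<le> S"
  using nsq_le_QQ[OF assms(1,2)] assms(3,4) by (intro real_le_lsqrt) auto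
 hence "sqrt (nsq N a b p) * ew N r \<le> S * ew N r"
  using ew_pos[of r N] assms by (intro mult_right_mono) auto
 thus ?thesis using Ub_le_nsq[OF N assms(1,5,2)] by linarith
qed

lemma ew_le_1: "1 \<le> r \<Longrightarrow> ew N r \<le> 1"
 using ew_antimono[of 1 r N] N by (simp add: ew_def)

text \<open>For r \<ge> 1 the decay bound gives |U| \<le> S, where U^2 \<le> (1 + 2 S^2) f(U)^2. The
  division by S^2 cancels against the bound S^2 for \<open>QQ\<close>.\<close>

lemma V_U_tail:
 assumes a: "0 < a" "a \<le> 1" "1 \<le> R" "R \<le> b" and p: "continuous_on {a..b} p" and Q: "QQ a b p \<le> S\<^sup>2" and S: "0 < S"
 shows "integral {R..b} (\<lambda>s. om N s * (V s * (\<bar>Ub b p s\<bar> / S)\<^sup>2)) \<le> 1 + 2 * S\<^sup>2"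
proof -
 have sub: "{R..b} \<subseteq> {a..b}" using a by auto
 have c: "continuous_on {R..b} (Ub b p)" by (rule continuous_on_subset[OF Ub_cont[OF p] sub])
 have R0: "0 < R" using a by simp
 have "integral {R..b} (\<lambda>s. om N s * (V s * (\<bar>Ub b p s\<bar> / S)\<^sup>2)) \<le> integral {R..b} (\<lambda>s. (1 + 2 * S\<^sup>2) / S\<^sup>2 * Psi s (Ub b p s))"
 proof (rule integral_le)
  show "(\<lambda>s. om N s * (V s * (\<bar>Ub b p s\<bar> / S)\<^sup>2)) integrable_on {R..b}"
   using S by (intro integrable_continuous_real continuous_intros c R0) auto
  show "(\<lambda>s. (1 + 2 * S\<^sup>2) / S\<^sup>2 * Psi s (Ub b p s)) integrable_on {R..b}"
   by (intro integrable_continuous_real continuous_on_mult_left continuous_on_subset[OF Psi_U_cont[OF a(1) p] sub])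
  fix s assume s: "s \<in> {R..b}"
  hence s0: "0 < s" "1 \<le> s" using a by auto
  have "\<bar>Ub b p s\<bar> \<le> S * ew N s" by (rule U_le_QQ[OF a(1) p Q]) (use S s sub in auto)
  also have "\<dots> \<le> S * 1" using S ew_le_1[OF s0(2)] by (intro mult_left_mono) auto
  finally have "(Ub b p s)\<^sup>2 \<le> (1 + 2 * S\<^sup>2) * (fODE (Ub b p s))\<^sup>2" by (intro sq_le_fODE_sq) simp
  hence "om N s * (V s * (Ub b p s)\<^sup>2) / S\<^sup>2 \<le> om N s * (V s * ((1 + 2 * S\<^sup>2) * (fODE (Ub b p s))\<^sup>2)) / S\<^sup>2"
   using om_pos[OF s0(1), of N] V_nonneg[OF s0(1)] by (intro divide_right_mono mult_left_mono) auto
  thus "om N s * (V s * (\<bar>Ub b p s\<bar> / S)\<^sup>2) \<le> (1 + 2 * S\<^sup>2) / S\<^sup>2 * Psi s (Ub b p s)"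
   by (simp add: Psi_def power_divide mult_ac)
 qed
 also have "\<dots> = (1 + 2 * S\<^sup>2) / S\<^sup>2 * integral {R..b} (\<lambda>s. Psi s (Ub b p s))" by simp
 also have "\<dots> \<le> (1 + 2 * S\<^sup>2) / S\<^sup>2 * S\<^sup>2"
 proof (intro mult_left_mono)
  have "integral {R..b} (\<lambda>s. Psi s (Ub b p s)) \<le> integral {a..b} (\<lambda>s. Psi s (Ub b p s))"
   by (intro integral_subset_le integrable_continuous_real sub Psi_U_cont a p continuous_on_subset[OF Psi_U_cont[OF a(1) p]])
    (use a in \<open>auto intro!: Psi_nonneg\<close>)
  also have "\<dots> \<le> S\<^sup>2" using Q nsq_nonneg[OF a(1), of N b p] by (simp add: QQ_def)
  finally show "integral {R..b} (\<lambda>s. Psi s (Ub b p s)) \<le> S\<^sup>2" .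
 qed auto
 also have "\<dots> = 1 + 2 * S\<^sup>2" using S by simp
 finally show ?thesis .
qed

lemma K_near_0:
 assumes a: "0 < a" "a \<le> r" "r \<le> 1" "r \<le> b" and p: "continuous_on {a..b} p" and Q: "QQ a b p \<le> S\<^sup>2" and S: "0 < S"
  and H: "\<And>y. \<bar>H y\<bar> \<le> Cm * \<bar>y\<bar> powr \<gamma>1" "continuous_on UNIV H"
 shows "\<bar>integral {a..r} (\<lambda>s. om N s * (K s * H (Ub b p s)))\<bar> \<le> Cm * CK * S powr \<gamma>1 * r powr eta / eta"
proof (rule K_integral_near_0[where Y = "\<lambda>s. \<bar>Ub b p s\<bar>"])
 show "continuous_on {a..r} (\<lambda>s. H (Ub b p s))"
  by (intro continuous_on_compose2[OF H(2)] continuous_on_subset[OF Ub_cont[OF p]]) (use a in auto)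
 show "0 \<le> \<bar>Ub b p s\<bar> \<and> \<bar>Ub b p s\<bar> \<le> S * ew N s \<and> \<bar>H (Ub b p s)\<bar> \<le> Cm * \<bar>Ub b p s\<bar> powr \<gamma>1" if "s \<in> {a..r}" for s
  using U_le_QQ[OF a(1) p Q, of s] S that a H(1) by auto
qed (use a S Cm in auto)

lemma K_tail:
 assumes a: "0 < a" "a \<le> 1" "1 \<le> R" "R \<le> b" and p: "continuous_on {a..b} p" and Q: "QQ a b p \<le> S\<^sup>2" and S: "0 < S"
  and H: "\<And>y. \<bar>H y\<bar> \<le> Cm * \<bar>y\<bar> powr \<gamma>2" "continuous_on UNIV H"
 shows "\<bar>integral {R..b} (\<lambda>s. om N s * (K s * H (Ub b p s)))\<bar> \<le> Cm * CK * S powr \<gamma>2 * R powr (-eta) * (1 + 2 * S\<^sup>2 + 1 / eta)"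
proof (rule K_integral_tail[where Y = "\<lambda>s. \<bar>Ub b p s\<bar>"])
 have c: "continuous_on {R..b} (Ub b p)" by (rule continuous_on_subset[OF Ub_cont[OF p]]) (use a in auto)
 show "continuous_on {R..b} (\<lambda>s. H (Ub b p s))"
  by (rule continuous_on_compose2[OF H(2) c]) auto
 show "continuous_on {R..b} (\<lambda>s. \<bar>Ub b p s\<bar>)" by (intro continuous_intros c)
 show "0 \<le> \<bar>Ub b p s\<bar> \<and> \<bar>Ub b p s\<bar> \<le> S * ew N s \<and> \<bar>H (Ub b p s)\<bar> \<le> Cm * \<bar>Ub b p s\<bar> powr \<gamma>2" if "s \<in> {R..b}" for s
  using U_le_QQ[OF a(1) p Q, of s] S that a H(1) by auto
 show "integral {R..b} (\<lambda>s. om N s * (V s * (\<bar>Ub b p s\<bar> / S)\<^sup>2)) \<le> 1 + 2 * S\<^sup>2"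
  by (rule V_U_tail[OF a p Q S])
qed (use a S Cm in auto)

lemma Ph_integral:
 assumes "0 < a" "continuous_on {a..b} p"
 shows "integral {a..b} (\<lambda>r. Ph r (Ub b p r)) =
  integral {a..b} (\<lambda>r. Psi r (Ub b p r)) / 2 - integral {a..b} (\<lambda>r. om N r * (K r * Mfun g (Ub b p r)))"
proof -
 have "(\<lambda>r. Ph r (Ub b p r)) = (\<lambda>r. Psi r (Ub b p r) / 2 - om N r * (K r * Mfun g (Ub b p r)))"
  by (simp add: Ph_def Psi_def algebra_simps)
 moreover have "integral {a..b} \<dots> = integral {a..b} (\<lambda>r. Psi r (Ub b p r) / 2) - integral {a..b} (\<lambda>r. om N r * (K r * Mfun g (Ub b p r)))"
  using assms by (intro integral_diff integrable_continuous_real continuous_intros cont_nonlin Ub_cont Psi_U_cont) auto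
 ultimately show ?thesis by simp
qed

text \<open>On the level set J equals rho^2 / 2 minus the K-integral. Split at r = 1, the latter is
  at most C rho^\<gamma>1 + C rho^\<gamma>2, and both exponents exceed 2, so a small rho makes each
  part at most rho^2 / 8. The 3 in C comes from 1 + 2 rho^2 with rho \<le> 1.\<close>

lemma sphere:
 "\<exists>rho>0. \<forall>a b p. 0 < a \<longrightarrow> a < 1 \<longrightarrow> 1 < b \<longrightarrow> continuous_on {a..b} p \<longrightarrow> QQ a b p = rho\<^sup>2 \<longrightarrow> rho\<^sup>2 / 4 \<le> JJ a b p"
proof -
 define C where "C = Cm * CK * (3 + 1 / eta)"
 have C: "C > 0" unfolding C_def using Cm CK eta by (intro mult_pos_pos add_pos_pos) auto
 define \<gamma> where "\<gamma> = min \<gamma>1 \<gamma>2 - 2"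
 have \<gamma>: "\<gamma> > 0" using \<gamma>1 \<gamma>2 by (simp add: \<gamma>_def)
 define rho where "rho = min 1 ((1 / (8 * C)) powr (1 / \<gamma>))"
 have rho: "0 < rho" "rho \<le> 1" using C by (auto simp: rho_def)
 have "rho powr \<gamma> \<le> ((1 / (8 * C)) powr (1 / \<gamma>)) powr \<gamma>" using rho \<gamma> by (intro powr_mono2) (auto simp: rho_def)
 also have "\<dots> = 1 / (8 * C)" using \<gamma> C by (simp add: powr_powr)
 finally have rho\<gamma>: "C * rho powr \<gamma> \<le> 1 / 8" using C by (simp add: field_simps)
 have pw: "C * rho powr \<gamma>' \<le> rho\<^sup>2 / 8" if "\<gamma> + 2 \<le> \<gamma>'" for \<gamma>'
 proof -
  have "rho powr \<gamma>' \<le> rho powr (\<gamma> + 2)" using that rho by (intro powr_mono') auto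
  also have "\<dots> = rho powr \<gamma> * rho\<^sup>2" using rho by (simp add: powr_add)
  finally have "C * rho powr \<gamma>' \<le> (C * rho powr \<gamma>) * rho\<^sup>2" using C by (simp add: mult.assoc)
  also have "\<dots> \<le> 1 / 8 * rho\<^sup>2" using rho\<gamma> by (intro mult_right_mono) auto
  finally show ?thesis by simp
 qed
 have "rho\<^sup>2 / 4 \<le> JJ a b p"
  if ab: "0 < a" "a < 1" "1 < b" and p: "continuous_on {a..b} p" and Q: "QQ a b p = rho\<^sup>2" for a b p
 proof -
  have M: "\<bar>Mfun g y\<bar> \<le> Cm * \<bar>y\<bar> powr \<gamma>1" "\<bar>Mfun g y\<bar> \<le> Cm * \<bar>y\<bar> powr \<gamma>2" for y
   using Mfun_bound[of y] Mfun_nonneg[of y] by auto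
  have "\<bar>integral {a..1} (\<lambda>s. om N s * (K s * Mfun g (Ub b p s)))\<bar> \<le> Cm * CK * rho powr \<gamma>1 * 1 powr eta / eta"
   by (rule K_near_0[OF _ _ _ _ p]) (use ab Q rho M cont_Mfun in auto)
  also have "\<dots> \<le> C * rho powr \<gamma>1" using Cm CK eta by (simp add: C_def field_simps)
  also have "\<dots> \<le> rho\<^sup>2 / 8" by (rule pw) (simp add: \<gamma>_def)
  finally have 1: "integral {a..1} (\<lambda>s. om N s * (K s * Mfun g (Ub b p s))) \<le> rho\<^sup>2 / 8" by linarith
  have "\<bar>integral {1..b} (\<lambda>s. om N s * (K s * Mfun g (Ub b p s)))\<bar> \<le> Cm * CK * rho powr \<gamma>2 * 1 powr (-eta) * (1 + 2 * rho\<^sup>2 + 1 / eta)"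
   by (rule K_tail[OF _ _ _ _ p]) (use ab Q rho M cont_Mfun in auto)
  also have "\<dots> \<le> Cm * CK * rho powr \<gamma>2 * 1 powr (-eta) * (3 + 1 / eta)"
   using rho Cm CK power_le_one[of rho 2] by (intro mult_left_mono) auto
  also have "\<dots> = C * rho powr \<gamma>2" by (simp add: C_def)
  also have "\<dots> \<le> rho\<^sup>2 / 8" by (rule pw) (simp add: \<gamma>_def)
  finally have 2: "integral {1..b} (\<lambda>s. om N s * (K s * Mfun g (Ub b p s))) \<le> rho\<^sup>2 / 8" by linarith
  have "integral {a..1} (\<lambda>s. om N s * (K s * Mfun g (Ub b p s))) + integral {1..b} (\<lambda>s. om N s * (K s * Mfun g (Ub b p s)))
    = integral {a..b} (\<lambda>s. om N s * (K s * Mfun g (Ub b p s)))"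
   by (rule Henstock_Kurzweil_Integration.integral_combine)
    (use ab in \<open>auto intro!: integrable_continuous_real continuous_intros cont_nonlin Ub_cont p\<close>)
  thus ?thesis using 1 2 Q ab unfolding JJ_eq[OF ab(1) less_trans[OF ab(2,3)]] Ph_integral[OF ab(1) p] QQ_def by linarith
 qed
 thus ?thesis using rho by blast
qed

end

text \<open>The profile p of the path. Its support [1, 2] makes \<open>Ub b bump\<close> constant
  for r \<le> 1 and 0 for r \<ge> 2, so the same function serves all intervals with a \<le> 1 and b
  \<ge> 2.\<close>

definition bump :: "real \<Rightarrow> real" where "bump s = max 0 ((s - 1) * (2 - s))"

lemma bump_cont: "continuous_on S bump"
 unfolding bump_def[abs_def] by (intro continuous_intros)
lemma bump_nonneg: "0 \<le> bump s" by (simp add: bump_def)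
lemma bump_0: "s \<le> 1 \<or> 2 \<le> s \<Longrightarrow> bump s = 0"
 by (auto simp: bump_def max_def mult_le_0_iff zero_le_mult_iff)
lemma bump_pos: "bump (3/2) > 0" by (simp add: bump_def)

lemma bump_integral_outside: "2 \<le> r \<Longrightarrow> integral {r..b} bump = 0"
proof -
 assume "2 \<le> r"
 hence "integral {r..b} bump = integral {r..b} (\<lambda>_. 0)" by (intro integral_cong) (auto simp: bump_0)
 thus ?thesis by simp
qed

lemma bump_int: "bump integrable_on {a..b}" by (intro integrable_continuous_real bump_cont)

lemma Ub_bump:
 assumes "2 \<le> b"
 shows "r \<le> 1 \<Longrightarrow> Ub b bump r = integral {1..2} bump" and "2 \<le> r \<Longrightarrow> Ub b bump r = 0"
  and "0 \<le> Ub b bump r" and "Ub b bump r \<le> integral {1..2} bump"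
proof -
 have pos: "0 \<le> integral {1..2} bump" by (intro integral_nonneg bump_int bump_nonneg)
 show z: "2 \<le> r \<Longrightarrow> Ub b bump r = 0" for r by (simp add: Ub_def bump_integral_outside)
 show le1: "Ub b bump r = integral {1..2} bump" if r: "r \<le> 1" for r
 proof -
  have "integral {r..1} bump + integral {1..b} bump = integral {r..b} bump"
   by (rule Henstock_Kurzweil_Integration.integral_combine) (use assms r bump_int in auto)
  moreover have "integral {1..2} bump + integral {2..b} bump = integral {1..b} bump"
   by (rule Henstock_Kurzweil_Integration.integral_combine) (use assms bump_int in auto)
  moreover have "integral {r..1} bump = integral {r..1} (\<lambda>_. 0)" by (intro integral_cong) (auto simp: bump_0)
  ultimately show ?thesis by (simp add: Ub_def bump_integral_outside)
 qed
 show "0 \<le> Ub b bump r" unfolding Ub_def by (intro integral_nonneg bump_int bump_nonneg)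
 show "Ub b bump r \<le> integral {1..2} bump"
 proof (cases "r \<le> 1")
  case False
  have "Ub b bump r \<le> Ub b bump 1" unfolding Ub_def
   by (intro integral_subset_le bump_int) (use False bump_nonneg in auto)
  thus ?thesis using le1[of 1] by simp
 qed (simp add: le1)
qed

lemma bump_integral_pos: "0 < integral {1..2} bump"
proof -
 have "integral {1..2} bump \<noteq> 0"
  using integral_eq_0_iff[OF bump_cont, of 1 2] bump_nonneg bump_pos by force
 moreover have "0 \<le> integral {1..2} bump" by (intro integral_nonneg bump_int bump_nonneg)
 ultimately show ?thesis by simp
qed

lemma (in weights) nsq_bump:
 assumes "0 < a" "a \<le> 1" "2 \<le> b"
 shows "nsq N a b bump = nsq N 1 2 bump"
proof -
 have i: "(\<lambda>s. (bump s)\<^sup>2 * om N s) integrable_on {x..y}" for x y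
  by (intro integrable_continuous_real continuous_intros bump_cont)
 have "integral {a..1} (\<lambda>s. (bump s)\<^sup>2 * om N s) + integral {1..b} (\<lambda>s. (bump s)\<^sup>2 * om N s) = integral {a..b} (\<lambda>s. (bump s)\<^sup>2 * om N s)"
  by (rule Henstock_Kurzweil_Integration.integral_combine) (use assms i in auto)
 moreover have "integral {1..2} (\<lambda>s. (bump s)\<^sup>2 * om N s) + integral {2..b} (\<lambda>s. (bump s)\<^sup>2 * om N s) = integral {1..b} (\<lambda>s. (bump s)\<^sup>2 * om N s)"
  by (rule Henstock_Kurzweil_Integration.integral_combine) (use assms i in auto)
 moreover have "integral {a..1} (\<lambda>s. (bump s)\<^sup>2 * om N s) = integral {a..1} (\<lambda>_. 0)" by (intro integral_cong) (auto simp: bump_0)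
 moreover have "integral {2..b} (\<lambda>s. (bump s)\<^sup>2 * om N s) = integral {2..b} (\<lambda>_. 0)" by (intro integral_cong) (auto simp: bump_0)
 ultimately show ?thesis by (simp add: nsq_def)
qed

lemma (in weights) nsq_bump_pos: "0 < nsq N 1 2 bump"
proof -
 have "nsq N 1 2 bump \<noteq> 0"
  unfolding nsq_def
 proof (subst integral_eq_0_iff)
  show "continuous_on {1..2} (\<lambda>s. (bump s)\<^sup>2 * om N s)" by (intro continuous_intros bump_cont)
  show "\<not> (\<forall>x\<in>{1..2}. (bump x)\<^sup>2 * om N x = 0)"
   using bump_pos om_pos[of "3/2" N] by (auto intro!: bexI[of _ "3/2"])
 qed (use om_pos[of _ N] in \<open>auto intro!: mult_nonneg_nonneg less_imp_le[of 0 "om N _"]\<close>)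
 thus ?thesis using nsq_nonneg[of 1 N 2 bump] by simp
qed

text \<open>The bound V \<le> CV / r^2 turns r^(N-1) V into at most CV r^(N-3), which is bounded on
  (0, 1] as N \<ge> 3. The plateau of the path near 0 then costs a V-energy independent of
  a.\<close>

lemma (in weights) V_integral_near_0:
 assumes "0 < a" "a \<le> 1"
 shows "integral {a..1} (\<lambda>r. om N r * V r) \<le> CV"
proof -
 have "integral {a..1} (\<lambda>r. om N r * V r) \<le> integral {a..1} (\<lambda>r. CV)"
 proof (rule integral_le)
  show "(\<lambda>r. om N r * V r) integrable_on {a..1}" by (intro integrable_continuous_real continuous_intros assms)
  fix r assume "r \<in> {a..1}"
  hence r: "0 < r" "r \<le> 1" using assms by auto
  have omr: "om N r = r ^ (N - 3) * r\<^sup>2" using N unfolding om_def power_add[symmetric] by (intro arg_cong[of _ _ "power r"]) simp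
  have "om N r * V r \<le> om N r * (CV / r\<^sup>2)" using V_bound[OF r] om_pos[OF r(1), of N] by (intro mult_left_mono) auto
  also have "\<dots> = CV * r ^ (N - 3)" using r by (simp add: omr)
  also have "\<dots> \<le> CV * 1" using r CV by (intro mult_left_mono power_le_one) auto
  finally show "om N r * V r \<le> CV" by simp
 qed auto
 also have "\<dots> = (1 - a) * CV" using assms by simp
 also have "\<dots> \<le> 1 * CV" using assms CV by (intro mult_right_mono) auto
 finally show ?thesis by simp
qed

context radial_problem
begin

text \<open>J at l times the profile is at most l^2 (A0 + A2) / 2 - B M(l kappa). The K-part is kept
  only on [1/2, 1], which lies in every admissible interval and where U is the constant l kappa. As
  M grows at least like the power \<theta> > 2, a large l makes J negative; dropping the K-part
  bounds J along the path.\<close>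

lemma endpoint:
 "\<exists>l d. 0 < l \<and> (\<forall>a b. 0 < a \<longrightarrow> a \<le> 1/2 \<longrightarrow> 2 \<le> b \<longrightarrow>
   JJ a b (\<lambda>s. l * bump s) \<le> 0 \<and> rho\<^sup>2 < QQ a b (\<lambda>s. l * bump s) \<and>
   (\<forall>t. 0 \<le> t \<longrightarrow> t \<le> 1 \<longrightarrow> JJ a b (\<lambda>s. t * (l * bump s)) \<le> d))"
proof -
 define kappa where "kappa = integral {1..2} bump"
 have kappa: "kappa > 0" unfolding kappa_def by (rule bump_integral_pos)
 define A0 where "A0 = nsq N 1 2 bump"
 have A0: "A0 > 0" unfolding A0_def by (rule nsq_bump_pos)
 define A2 where "A2 = kappa\<^sup>2 * (CV + integral {1..2} (\<lambda>r. om N r * V r))"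
 have A2: "0 \<le> A2"
 proof -
  have "0 \<le> integral {1..2} (\<lambda>r. om N r * V r)"
   by (intro integral_nonneg integrable_continuous_real continuous_intros) (use V_nonneg om_pos[of _ N] in \<open>auto intro!: mult_nonneg_nonneg less_imp_le[of 0 "om N _"]\<close>)
  thus ?thesis using CV by (simp add: A2_def)
 qed
 define B where "B = integral {1/2..1} (\<lambda>r. om N r * K r)"
 have omK: "0 < om N r * K r" if "0 < r" for r using that om_pos K_pos by simp
 have B: "0 < B"
 proof -
  have c: "continuous_on {1/2..1} (\<lambda>r. om N r * K r)" by (intro continuous_intros) auto
  have "B \<noteq> 0" unfolding B_def
  proof (subst integral_eq_0_iff[OF c])
   show "\<not> (\<forall>x\<in>{1/2..1}. om N x * K x = 0)"
    using omK[of 1] by (auto intro!: bexI[of _ "1::real"] simp del: mult_eq_0_iff)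
  qed (use omK in \<open>auto intro!: less_imp_le\<close>)
  moreover have "0 \<le> B" unfolding B_def
   by (intro integral_nonneg integrable_continuous_real c) (use omK in \<open>auto intro!: less_imp_le\<close>)
  ultimately show ?thesis by simp
 qed
 obtain cM y1 where cM: "0 < cM" "0 < y1" and gr: "\<And>y. y1 \<le> y \<Longrightarrow> cM * y powr \<theta> \<le> Mfun g y"
  using Mfun_growth by blast
 have V_part: "integral {a..b} (\<lambda>r. om N r * (V r * (Ub b bump r)\<^sup>2)) \<le> A2"
  if a: "0 < a" "a \<le> 1/2" "2 \<le> b" for a b
 proof -
  have c: "(\<lambda>r. om N r * (V r * (Ub b bump r)\<^sup>2)) integrable_on {x..b}" if "0 < x" for x
   by (intro integrable_continuous_real continuous_intros Ub_cont bump_cont that)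
  have c2: "(\<lambda>r. om N r * V r) integrable_on {x..y}" if "0 < x" for x y
   by (intro integrable_continuous_real continuous_intros that)
  have c1: "(\<lambda>r. om N r * (V r * (Ub b bump r)\<^sup>2)) integrable_on {x..y}" if "0 < x" "y \<le> b" for x y
   by (rule integrable_on_subinterval[OF c[OF that(1)]]) (use that in auto)
  have bd: "om N r * (V r * (Ub b bump r)\<^sup>2) \<le> kappa\<^sup>2 * (om N r * V r)" if "0 < r" for r
  proof -
   have "(Ub b bump r)\<^sup>2 \<le> kappa\<^sup>2" using Ub_bump(3,4)[OF a(3)] by (intro power_mono) (auto simp: kappa_def)
   hence "om N r * V r * (Ub b bump r)\<^sup>2 \<le> om N r * V r * kappa\<^sup>2"
    using that om_pos[of r N] V_nonneg[of r] by (intro mult_left_mono) auto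
   thus ?thesis by (simp add: mult_ac)
  qed
  have "integral {a..1} (\<lambda>r. om N r * (V r * (Ub b bump r)\<^sup>2)) \<le> integral {a..1} (\<lambda>r. kappa\<^sup>2 * (om N r * V r))"
   by (intro integral_le c1 integrable_on_mult_right c2 bd) (use a in auto)
  also have "\<dots> \<le> kappa\<^sup>2 * CV" using V_integral_near_0[of a] a by (simp add: mult_left_mono)
  finally have 1: "integral {a..1} (\<lambda>r. om N r * (V r * (Ub b bump r)\<^sup>2)) \<le> kappa\<^sup>2 * CV" .
  have "integral {1..2} (\<lambda>r. om N r * (V r * (Ub b bump r)\<^sup>2)) \<le> integral {1..2} (\<lambda>r. kappa\<^sup>2 * (om N r * V r))"
   by (intro integral_le c1 integrable_on_mult_right c2 bd) (use a in auto)
  hence 2: "integral {1..2} (\<lambda>r. om N r * (V r * (Ub b bump r)\<^sup>2)) \<le> kappa\<^sup>2 * integral {1..2} (\<lambda>r. om N r * V r)" by simp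
  have "integral {2..b} (\<lambda>r. om N r * (V r * (Ub b bump r)\<^sup>2)) = integral {2..b} (\<lambda>_. 0)"
   by (intro integral_cong) (use a Ub_bump(2)[OF a(3)] in auto)
  hence 3: "integral {2..b} (\<lambda>r. om N r * (V r * (Ub b bump r)\<^sup>2)) = 0" by simp
  have "integral {a..1} (\<lambda>r. om N r * (V r * (Ub b bump r)\<^sup>2)) + integral {1..b} (\<lambda>r. om N r * (V r * (Ub b bump r)\<^sup>2)) = integral {a..b} (\<lambda>r. om N r * (V r * (Ub b bump r)\<^sup>2))"
   by (rule Henstock_Kurzweil_Integration.integral_combine) (use a c in auto)
  moreover have "integral {1..2} (\<lambda>r. om N r * (V r * (Ub b bump r)\<^sup>2)) + integral {2..b} (\<lambda>r. om N r * (V r * (Ub b bump r)\<^sup>2)) = integral {1..b} (\<lambda>r. om N r * (V r * (Ub b bump r)\<^sup>2))"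
   by (rule Henstock_Kurzweil_Integration.integral_combine) (use a c in auto)
  ultimately show ?thesis using 1 2 3 by (simp add: A2_def distrib_left)
 qed
 have up: "JJ a b (\<lambda>s. l * bump s) \<le> l\<^sup>2 * (A0 + A2) / 2 - integral {a..b} (\<lambda>r. om N r * (K r * Mfun g (l * Ub b bump r)))"
  if a: "0 < a" "a \<le> 1/2" "2 \<le> b" for a b l
 proof -
  have ab: "a < b" using a by simp
  have p: "continuous_on {a..b} (\<lambda>s. l * bump s)" by (intro continuous_intros bump_cont)
  have "integral {a..b} (\<lambda>r. Psi r (Ub b (\<lambda>s. l * bump s) r)) \<le> integral {a..b} (\<lambda>r. l\<^sup>2 * (om N r * (V r * (Ub b bump r)\<^sup>2)))"
  proof (rule integral_le)
   show "(\<lambda>r. Psi r (Ub b (\<lambda>s. l * bump s) r)) integrable_on {a..b}"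
    by (intro integrable_continuous_real Psi_U_cont a p)
   show "(\<lambda>r. l\<^sup>2 * (om N r * (V r * (Ub b bump r)\<^sup>2))) integrable_on {a..b}"
    by (intro integrable_continuous_real continuous_intros Ub_cont bump_cont a)
   fix r assume "r \<in> {a..b}"
   hence r: "0 < r" using a by simp
   have "Psi r (l * Ub b bump r) \<le> om N r * (V r * (l * Ub b bump r)\<^sup>2)"
    unfolding Psi_def using om_pos[OF r, of N] V_nonneg[OF r] fODE_sq_le[of "l * Ub b bump r"] by (intro mult_left_mono) auto
   thus "Psi r (Ub b (\<lambda>s. l * bump s) r) \<le> l\<^sup>2 * (om N r * (V r * (Ub b bump r)\<^sup>2))"
    unfolding Ub_scale by (simp add: power_mult_distrib mult_ac)
  qed
  also have "\<dots> \<le> l\<^sup>2 * A2" using V_part[OF a] by (simp add: mult_left_mono)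
  finally have 1: "integral {a..b} (\<lambda>r. Psi r (Ub b (\<lambda>s. l * bump s) r)) \<le> l\<^sup>2 * A2" .
  have "nsq N a b (\<lambda>s. l * bump s) = l\<^sup>2 * A0" unfolding nsq_scale A0_def using nsq_bump[of a b] a by simp
  thus ?thesis using 1[unfolded Ub_scale] Ph_integral[OF a(1) p, unfolded Ub_scale]
   unfolding JJ_eq[OF a(1) ab] Ub_scale by (simp add: distrib_left)
 qed
 have Kn: "0 \<le> integral {x..y} (\<lambda>r. om N r * (K r * Mfun g (l * Ub b bump r)))" and
  Ki: "(\<lambda>r. om N r * (K r * Mfun g (l * Ub b bump r))) integrable_on {x..y}" if "0 < x" "y \<le> b" for x y l b
 proof -
  have "(\<lambda>r. om N r * (K r * Mfun g (l * Ub b bump r))) integrable_on {x..b}"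
   by (intro integrable_continuous_real continuous_intros cont_nonlin Ub_cont bump_cont that)
  thus i: "(\<lambda>r. om N r * (K r * Mfun g (l * Ub b bump r))) integrable_on {x..y}"
   by (rule integrable_on_subinterval) (use that in auto)
  show "0 \<le> integral {x..y} (\<lambda>r. om N r * (K r * Mfun g (l * Ub b bump r)))"
   by (intro integral_nonneg i) (use that om_pos[of _ N] K_pos Mfun_nonneg in \<open>auto intro!: mult_nonneg_nonneg less_imp_le[of 0 "om N _"] less_imp_le[of 0 "K _"]\<close>)
 qed
 have dn: "B * Mfun g (l * kappa) \<le> integral {a..b} (\<lambda>r. om N r * (K r * Mfun g (l * Ub b bump r)))"
  if a: "0 < a" "a \<le> 1/2" "2 \<le> b" for a b l
 proof -
  have "B * Mfun g (l * kappa) = integral {1/2..1} (\<lambda>r. om N r * K r * Mfun g (l * kappa))" by (simp add: B_def)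
  also have "\<dots> = integral {1/2..1} (\<lambda>r. om N r * (K r * Mfun g (l * Ub b bump r)))"
   by (rule integral_cong) (use Ub_bump(1)[OF a(3)] in \<open>auto simp: kappa_def\<close>)
  also have "\<dots> \<le> integral {a..b} (\<lambda>r. om N r * (K r * Mfun g (l * Ub b bump r)))"
   by (intro integral_subset_le Ki) (use a om_pos[of _ N] K_pos Mfun_nonneg in \<open>auto intro!: mult_nonneg_nonneg less_imp_le[of 0 "om N _"] less_imp_le[of 0 "K _"]\<close>)
  finally show ?thesis .
 qed
 \<comment> \<open>The condition P \<le> l^(\<theta> - 2) rearranges l^2 (A0 + A2) / 2 \<le> B cM (l
   kappa)^\<theta>. The other lower bounds on l put l kappa beyond the threshold y1 and l^2 A0
   beyond rho^2.\<close>
 define P where "P = (A0 + A2) / (2 * B * cM * kappa powr \<theta>)"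
 define L where "L = (\<bar>P\<bar> + 1) powr (1 / (\<theta> - 2))"
 define l where "l = max L (max 1 (max (y1 / kappa) ((\<bar>rho\<bar> + 1) / sqrt A0)))"
 have "P \<le> L powr (\<theta> - 2)" using \<theta> by (simp add: L_def powr_powr)
 also have "\<dots> \<le> l powr (\<theta> - 2)" using \<theta> by (intro powr_mono2) (auto simp: l_def L_def)
 finally have l: "P \<le> l powr (\<theta> - 2)" "1 \<le> l" "y1 / kappa \<le> l" "(\<bar>rho\<bar> + 1) / sqrt A0 \<le> l"
  unfolding l_def le_max_iff_disj by auto
 have ly: "y1 \<le> l * kappa" using l(3) kappa by (simp add: field_simps)
 have "l\<^sup>2 * (A0 + A2) / 2 = l\<^sup>2 * (B * cM * kappa powr \<theta>) * P" using B cM kappa by (simp add: P_def field_simps)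
 also have "\<dots> \<le> l\<^sup>2 * (B * cM * kappa powr \<theta>) * l powr (\<theta> - 2)" using l(1) B cM by (intro mult_left_mono) auto
 also have "\<dots> = B * (cM * (l powr 2 * l powr (\<theta> - 2) * kappa powr \<theta>))" using l(2) by simp
 also have "l powr 2 * l powr (\<theta> - 2) * kappa powr \<theta> = (l * kappa) powr \<theta>"
  using l(2) kappa by (simp only: powr_add[symmetric]) (simp add: powr_mult)
 also have "B * (cM * (l * kappa) powr \<theta>) \<le> B * Mfun g (l * kappa)" using gr[OF ly] B by (intro mult_left_mono) auto
 finally have key: "l\<^sup>2 * (A0 + A2) / 2 \<le> B * Mfun g (l * kappa)" .
 show ?thesis
 proof (rule exI[of _ l], rule exI[of _ "l\<^sup>2 * (A0 + A2) / 2"], intro conjI allI impI)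
  show "0 < l" using l by simp
  fix a b :: real assume a: "0 < a" "a \<le> 1/2" "2 \<le> b"
  show "JJ a b (\<lambda>s. l * bump s) \<le> 0" using up[OF a, of l] dn[OF a, of l] key by linarith
  have "(\<bar>rho\<bar> + 1)\<^sup>2 \<le> (l * sqrt A0)\<^sup>2" using l(4) A0 by (intro power_mono) (auto simp: field_simps)
  hence "(\<bar>rho\<bar> + 1)\<^sup>2 \<le> l\<^sup>2 * A0" using A0 by (simp add: power_mult_distrib)
  moreover have "rho\<^sup>2 < (\<bar>rho\<bar> + 1)\<^sup>2" using power_strict_mono[of "\<bar>rho\<bar>" "\<bar>rho\<bar> + 1" 2] by simp
  moreover have "l\<^sup>2 * A0 = nsq N a b (\<lambda>s. l * bump s)" unfolding nsq_scale A0_def using nsq_bump[of a b] a by simp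
  moreover have "nsq N a b (\<lambda>s. l * bump s) \<le> QQ a b (\<lambda>s. l * bump s)"
   by (intro nsq_le_QQ a continuous_intros bump_cont)
  ultimately show "rho\<^sup>2 < QQ a b (\<lambda>s. l * bump s)" by linarith
  fix t :: real assume t: "0 \<le> t" "t \<le> 1"
  have "JJ a b (\<lambda>s. (t * l) * bump s) \<le> (t * l)\<^sup>2 * (A0 + A2) / 2"
   using up[OF a, of "t * l"] Kn[of a b b "t * l"] a by linarith
  also have "\<dots> \<le> l\<^sup>2 * (A0 + A2) / 2"
   using t A0 A2 power_le_one[of t 2] mult_right_mono[of "t\<^sup>2" 1 "l\<^sup>2"] by (intro divide_right_mono mult_right_mono) (auto simp: power_mult_distrib)
  finally show "JJ a b (\<lambda>s. t * (l * bump s)) \<le> l\<^sup>2 * (A0 + A2) / 2" by (simp add: mult.assoc)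
 qed
qed

lemma Palais_Smale:
 "\<exists>c d. 0 < c \<and> (\<forall>a b \<delta>. 0 < a \<longrightarrow> a \<le> 1/2 \<longrightarrow> 2 \<le> b \<longrightarrow> 0 < \<delta> \<longrightarrow>
   (\<exists>p. continuous_on {a..b} p \<and> c \<le> JJ a b p \<and> JJ a b p \<le> d \<and> sqrt (nsq N a b (GG a b p)) \<le> \<delta>))"
proof -
 obtain rho where rho: "rho > 0" and sph: "\<And>a b p. 0 < a \<Longrightarrow> a < 1 \<Longrightarrow> 1 < b \<Longrightarrow> continuous_on {a..b} p \<Longrightarrow> QQ a b p = rho\<^sup>2 \<Longrightarrow> rho\<^sup>2 / 4 \<le> JJ a b p"
  using sphere by blast
 obtain l d where l: "\<And>a b. 0 < a \<Longrightarrow> a \<le> 1/2 \<Longrightarrow> 2 \<le> b \<Longrightarrow> JJ a b (\<lambda>s. l * bump s) \<le> 0"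
   "\<And>a b. 0 < a \<Longrightarrow> a \<le> 1/2 \<Longrightarrow> 2 \<le> b \<Longrightarrow> rho\<^sup>2 < QQ a b (\<lambda>s. l * bump s)"
   "\<And>a b t. 0 < a \<Longrightarrow> a \<le> 1/2 \<Longrightarrow> 2 \<le> b \<Longrightarrow> 0 \<le> t \<Longrightarrow> t \<le> 1 \<Longrightarrow> JJ a b (\<lambda>s. t * (l * bump s)) \<le> d"
  using endpoint[of rho] by blast
 have "\<exists>p. continuous_on {a..b} p \<and> (rho\<^sup>2 / 4) / 2 \<le> JJ a b p \<and> JJ a b p \<le> d \<and> sqrt (nsq N a b (GG a b p)) \<le> \<delta>"
  if h: "0 < a" "a \<le> 1/2" "2 \<le> b" "0 < \<delta>" for a b \<delta>
 proof -
  have ab1: "a < b" "a < 1" "1 < b" using h by auto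
  interpret one_dim N a b wf Ph by (rule one_dim_problem[OF h(1) ab1(1)])
  show ?thesis unfolding JJ_def GG_def
  proof (rule mountain_pass[where \<Psi> = Psi and e = "\<lambda>s. l * bump s" and rho = "rho\<^sup>2"])
   show "Psi r 0 = 0" for r by (simp add: Psi_def)
   show "rho\<^sup>2 / 4 \<le> J p" if "continuous_on {a..b} p" "nsq N a b p + integral {a..b} (\<lambda>r. Psi r (Ub b p r)) = rho\<^sup>2" for p
    using sph[OF h(1) ab1(2,3) that(1)] that(2) by (simp add: QQ_def JJ_def)
  qed (use h rho l[OF h(1-3)] in \<open>auto simp: JJ_def QQ_def intro!: cont_Psi continuous_intros bump_cont\<close>)
 qed
 moreover have "0 < (rho\<^sup>2 / 4) / 2" using rho by simp
 ultimately show ?thesis by blast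
qed

lemma wf_U_cont: "0 < a \<Longrightarrow> continuous_on {a..b} p \<Longrightarrow> continuous_on {a..b} (\<lambda>r. wf r (Ub b p r))"
 unfolding wf_def by (intro continuous_intros cont_nonlin Ub_cont)

lemma GG_inner_self:
 assumes "0 < a" "a < b" and p: "continuous_on {a..b} p"
 shows "integral {a..b} (\<lambda>s. GG a b p s * p s * om N s) = nsq N a b p + integral {a..b} (\<lambda>r. wf r (Ub b p r) * Ub b p r)"
 unfolding GG_def one_dim.Gd_inner[OF one_dim_problem[OF assms(1,2)] p p] by (simp add: nsq_def power2_eq_square)

lemma GG_cont: "0 < a \<Longrightarrow> a < b \<Longrightarrow> continuous_on {a..b} p \<Longrightarrow> continuous_on {a..b} (GG a b p)"
 unfolding GG_def by (rule one_dim.Gd_cont[OF one_dim_problem])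

text \<open>Subtract 1/\<theta> times the pairing of the gradient with p from J: by f f' y \<le> f^2
  and \<theta> M \<le> m y the result is at least (1/2 - 1/\<theta>) \<open>QQ\<close>. The pairing
  is at most the root of \<open>QQ\<close>, which Young's inequality absorbs.\<close>

lemma Palais_Smale_bounded:
 assumes a: "0 < a" "a < b" and p: "continuous_on {a..b} p" and J: "JJ a b p \<le> d"
  and \<delta>: "sqrt (nsq N a b (GG a b p)) \<le> 1"
 shows "QQ a b p \<le> 2 / (1/2 - 1/\<theta>) * (d + 1 / (2 * (1/2 - 1/\<theta>)))"
proof -
 define kappa where "kappa = 1/2 - 1/\<theta>"
 have kappa: "kappa > 0" using \<theta> by (simp add: kappa_def field_simps)
 define Q where "Q = QQ a b p"
 have nQ: "nsq N a b p \<le> Q" unfolding Q_def by (rule nsq_le_QQ[OF a(1) p])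
 have Q0: "0 \<le> Q" using nQ nsq_nonneg[OF a(1), of N b p] by linarith
 define X where "X = integral {a..b} (\<lambda>s. GG a b p s * p s * om N s)"
 have "\<bar>X\<bar> \<le> sqrt (nsq N a b (GG a b p)) * sqrt (nsq N a b p)"
  unfolding X_def by (rule inner_le_nsq[OF a(1) GG_cont[OF a p] p])
 also have "\<dots> \<le> 1 * sqrt Q" using \<delta> nQ nsq_nonneg[OF a(1)] by (intro mult_mono real_sqrt_le_mono) auto
 finally have X: "\<bar>X\<bar> \<le> sqrt Q" by simp
 have "kappa * integral {a..b} (\<lambda>r. Psi r (Ub b p r)) = integral {a..b} (\<lambda>r. kappa * Psi r (Ub b p r))" by simp
 also have "\<dots> \<le> integral {a..b} (\<lambda>r. Ph r (Ub b p r) - 1/\<theta> * (wf r (Ub b p r) * Ub b p r))"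
 proof (rule integral_le)
  have "continuous_on {a..b} (\<lambda>r. Ph r (Ub b p r))"
   unfolding Ph_def by (intro continuous_intros cont_nonlin Ub_cont a p) auto
  thus "(\<lambda>r. Ph r (Ub b p r) - 1/\<theta> * (wf r (Ub b p r) * Ub b p r)) integrable_on {a..b}"
   by (intro integrable_continuous_real continuous_intros wf_U_cont Ub_cont a p)
  show "(\<lambda>r. kappa * Psi r (Ub b p r)) integrable_on {a..b}"
   by (intro integrable_continuous_real continuous_on_mult_left Psi_U_cont a p)
  fix r assume "r \<in> {a..b}"
  hence r: "0 < r" using a by simp
  let ?y = "Ub b p r"
  have "1/\<theta> * (kfun ?y * ?y) \<le> 1/\<theta> * (fODE ?y)\<^sup>2" using kfun_mult_bounds(2)[of ?y] \<theta> by (intro mult_left_mono) auto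
  hence 1: "V r * (kappa * (fODE ?y)\<^sup>2) \<le> V r * ((fODE ?y)\<^sup>2 / 2 - 1/\<theta> * (kfun ?y * ?y))"
   using V_nonneg[OF r] by (intro mult_left_mono) (simp_all add: kappa_def left_diff_distrib)
  have "Mfun g ?y \<le> 1/\<theta> * (mfun g ?y * ?y)" using mfun_AR[of ?y] \<theta> by (simp add: field_simps)
  hence 2: "0 \<le> K r * (1/\<theta> * (mfun g ?y * ?y) - Mfun g ?y)" using K_pos[OF r] by simp
  have "om N r * (V r * (kappa * (fODE ?y)\<^sup>2)) \<le> om N r * (V r * ((fODE ?y)\<^sup>2 / 2 - 1/\<theta> * (kfun ?y * ?y)) + K r * (1/\<theta> * (mfun g ?y * ?y) - Mfun g ?y))"
   using 1 2 om_pos[OF r, of N] by (intro mult_left_mono) auto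
  thus "kappa * Psi r ?y \<le> Ph r ?y - 1/\<theta> * (wf r ?y * ?y)"
   by (simp add: Psi_def Ph_def wf_def algebra_simps)
 qed
 also have "\<dots> = integral {a..b} (\<lambda>r. Ph r (Ub b p r)) - 1/\<theta> * integral {a..b} (\<lambda>r. wf r (Ub b p r) * Ub b p r)"
 proof -
  have "continuous_on {a..b} (\<lambda>r. Ph r (Ub b p r))"
   unfolding Ph_def by (intro continuous_intros cont_nonlin Ub_cont a p) auto
  thus ?thesis
   using \<theta> by (subst integral_diff) (auto intro!: integrable_continuous_real continuous_intros wf_U_cont Ub_cont a p)
 qed
 also have "\<dots> = JJ a b p - nsq N a b p / 2 - 1/\<theta> * (X - nsq N a b p)"
  unfolding JJ_eq[OF a] X_def GG_inner_self[OF a p] by simp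
 finally have "kappa * Q \<le> d - 1/\<theta> * X" using J by (simp add: Q_def QQ_def kappa_def algebra_simps)
 also have "- (1/\<theta> * X) \<le> 1 * sqrt Q"
 proof -
  have "\<bar>1/\<theta> * X\<bar> \<le> 1 * sqrt Q" unfolding abs_mult using X \<theta> by (intro mult_mono) auto
  thus ?thesis by linarith
 qed
 hence "d - 1/\<theta> * X \<le> d + sqrt Q" by simp
 also have "sqrt Q \<le> kappa * Q / 2 + 1 / (2 * kappa)"
 proof -
  have "0 \<le> (kappa * sqrt Q - 1)\<^sup>2" by simp
  hence "2 * kappa * sqrt Q \<le> kappa\<^sup>2 * Q + 1" using Q0 by (simp add: power2_diff power_mult_distrib)
  thus ?thesis using kappa by (simp add: field_simps power2_eq_square)
 qed
 finally have "kappa * Q / 2 \<le> d + 1 / (2 * kappa)" by simp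
 hence "Q \<le> 2 / kappa * (d + 1 / (2 * kappa))" using kappa by (simp add: field_simps)
 thus ?thesis by (simp add: Q_def kappa_def)
qed

text \<open>From f^2 / 2 \<le> f f' U and M \<ge> 0, J is at most the pairing of the gradient with p
  plus the K-term. A positive level therefore forces a K-term bounded away from 0, the source of
  nontriviality.\<close>

lemma JJ_le_K:
 assumes a: "0 < a" "a < b" and p: "continuous_on {a..b} p" and \<delta>: "sqrt (nsq N a b (GG a b p)) \<le> \<delta>" and S: "QQ a b p \<le> S\<^sup>2" "0 < S"
 shows "JJ a b p \<le> \<delta> * S + integral {a..b} (\<lambda>r. om N r * (K r * (mfun g (Ub b p r) * Ub b p r)))"
proof -
 define X where "X = integral {a..b} (\<lambda>s. GG a b p s * p s * om N s)"
 have nS: "sqrt (nsq N a b p) \<le> S" using nsq_le_QQ[OF a(1) p] S by (intro real_le_lsqrt) auto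
 have "\<bar>X\<bar> \<le> sqrt (nsq N a b (GG a b p)) * sqrt (nsq N a b p)"
  unfolding X_def by (rule inner_le_nsq[OF a(1) GG_cont[OF a p] p])
 also have "\<dots> \<le> \<delta> * S" using \<delta> nS nsq_nonneg[OF a(1)] order_trans[OF _ \<delta>] by (intro mult_mono) auto
 finally have X: "\<bar>X\<bar> \<le> \<delta> * S" .
 have c: "continuous_on {a..b} (\<lambda>r. Ph r (Ub b p r))" "continuous_on {a..b} (\<lambda>r. wf r (Ub b p r) * Ub b p r)"
   "continuous_on {a..b} (\<lambda>r. om N r * (K r * (mfun g (Ub b p r) * Ub b p r)))"
  unfolding Ph_def wf_def by (intro continuous_intros cont_nonlin Ub_cont a p; simp)+
 have "integral {a..b} (\<lambda>r. Ph r (Ub b p r)) \<le> integral {a..b} (\<lambda>r. wf r (Ub b p r) * Ub b p r + om N r * (K r * (mfun g (Ub b p r) * Ub b p r)))"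
 proof (rule integral_le)
  fix r assume "r \<in> {a..b}"
  hence r: "0 < r" using a by simp
  let ?y = "Ub b p r"
  have "V r * ((fODE ?y)\<^sup>2 / 2) \<le> V r * (kfun ?y * ?y)" using kfun_mult_bounds(1)[of ?y] V_nonneg[OF r] by (intro mult_left_mono) auto
  moreover have "0 \<le> K r * Mfun g ?y" using K_pos[OF r] Mfun_nonneg by simp
  ultimately have "om N r * (V r * ((fODE ?y)\<^sup>2 / 2) - K r * Mfun g ?y) \<le> om N r * (V r * (kfun ?y * ?y))"
   using om_pos[OF r, of N] by (intro mult_left_mono) auto
  thus "Ph r ?y \<le> wf r ?y * ?y + om N r * (K r * (mfun g ?y * ?y))" by (simp add: Ph_def wf_def algebra_simps)
 qed (intro integrable_continuous_real c continuous_on_add)+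
 also have "\<dots> = (X - nsq N a b p) + integral {a..b} (\<lambda>r. om N r * (K r * (mfun g (Ub b p r) * Ub b p r)))"
  unfolding X_def GG_inner_self[OF a p] by (subst integral_add) (auto intro!: integrable_continuous_real c)
 finally show ?thesis using X nsq_nonneg[OF a(1), of N b p] unfolding JJ_eq[OF a] by linarith
qed

end

section \<open>Local compactness and the limit along growing intervals\<close>

lemma uniform_limit_comp2:
 fixes F :: "real \<Rightarrow> real \<Rightarrow> real"
 assumes F: "continuous_on ({lo..hi} \<times> UNIV) (\<lambda>(r, y). F r y)"
  and u: "uniform_limit {lo..hi} f g sequentially" and g: "continuous_on {lo..hi} g"
 shows "uniform_limit {lo..hi} (\<lambda>n r. F r (f n r)) (\<lambda>r. F r (g r)) sequentially"
proof (rule uniform_limitI)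
 fix e :: real assume e: "0 < e"
 have "bounded (g ` {lo..hi})"
  by (rule compact_imp_bounded[OF compact_continuous_image[OF g compact_Icc]])
 then obtain B where B: "\<And>r. r \<in> {lo..hi} \<Longrightarrow> \<bar>g r\<bar> \<le> B"
  unfolding bounded_iff ball_simps real_norm_def by metis
 have "uniformly_continuous_on ({lo..hi} \<times> {-B-1..B+1}) (\<lambda>(r, y). F r y)"
  by (intro compact_uniformly_continuous compact_Times continuous_on_subset[OF F]) auto
 then obtain d where d: "d > 0" and D: "\<And>x x'. x \<in> {lo..hi} \<times> {-B-1..B+1} \<Longrightarrow>
   x' \<in> {lo..hi} \<times> {-B-1..B+1} \<Longrightarrow> dist x' x < d \<Longrightarrow> dist (case_prod F x') (case_prod F x) < e"
  unfolding uniformly_continuous_on_def using e by metis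
 from uniform_limitD[OF u, of "min 1 d"] d
 have "\<forall>\<^sub>F n in sequentially. \<forall>r\<in>{lo..hi}. dist (f n r) (g r) < min 1 d" by simp
 thus "\<forall>\<^sub>F n in sequentially. \<forall>r\<in>{lo..hi}. dist (F r (f n r)) (F r (g r)) < e"
 proof eventually_elim
  case (elim n)
  show ?case
  proof
   fix r assume r: "r \<in> {lo..hi}"
   have "dist (f n r) (g r) < min 1 d" using elim r by blast
   hence 1: "dist (r, f n r) (r, g r) < d" and 2: "\<bar>f n r - g r\<bar> < 1" by (auto simp: dist_Pair_Pair dist_real_def)
   have "\<bar>g r\<bar> \<le> B" by (rule B[OF r])
   hence "(r, f n r) \<in> {lo..hi} \<times> {-B-1..B+1}" "(r, g r) \<in> {lo..hi} \<times> {-B-1..B+1}" using 2 r by auto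
   from D[OF this(2,1) 1] show "dist (F r (f n r)) (F r (g r)) < e" by simp
  qed
 qed
qed

lemma uniform_limit_integral_tendsto:
 fixes f :: "nat \<Rightarrow> real \<Rightarrow> real"
 assumes u: "uniform_limit {lo..hi} f g sequentially" and c: "\<forall>\<^sub>F n in sequentially. continuous_on {lo..hi} (f n)"
 shows "(\<lambda>n. integral {lo..hi} (f n)) \<longlonglongrightarrow> integral {lo..hi} g"
proof -
 obtain n0 where n0: "\<And>n. n \<ge> n0 \<Longrightarrow> continuous_on {lo..hi} (f n)" using c by (auto simp: eventually_sequentially)
 have u': "uniform_limit {lo..hi} (\<lambda>n. f (n + n0)) g sequentially"
 proof (rule uniform_limitI)
  fix e :: real assume "0 < e"
  from sequentially_offset[OF uniform_limitD[OF u this], of n0]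
  show "\<forall>\<^sub>F n in sequentially. \<forall>x\<in>{lo..hi}. dist (f (n + n0) x) (g x) < e" .
 qed
 obtain I J where I: "\<And>n. (f (n + n0) has_integral I n) {lo..hi}" and J: "(g has_integral J) {lo..hi}" and l: "I \<longlonglongrightarrow> J"
  using uniform_limit_integral[OF u' n0 sequentially_bot] by (metis le_add2)
 have "(\<lambda>n. integral {lo..hi} (f (n + n0))) \<longlonglongrightarrow> integral {lo..hi} g"
  using l integral_unique[OF I] integral_unique[OF J] by simp
 thus ?thesis by (rule LIMSEQ_offset)
qed

text \<open>A finite net and three estimates of size e/4. Equicontinuity is asked only from n0 on,
  since a compact set lies inside the n-th interval only for large n.\<close>

lemma equicontinuous_uniform_limit:
 fixes f :: "nat \<Rightarrow> real \<Rightarrow> real"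
 assumes S: "compact S" and eq: "\<And>e. 0 < e \<Longrightarrow> \<exists>d>0. \<forall>n\<ge>n0. \<forall>x\<in>S. \<forall>y\<in>S. \<bar>x - y\<bar> < d \<longrightarrow> \<bar>f n x - f n y\<bar> \<le> e"
  and p: "\<And>x. x \<in> S \<Longrightarrow> (\<lambda>n. f n x) \<longlonglongrightarrow> g x"
 shows "uniform_limit S f g sequentially"
proof (rule uniform_limitI)
 fix e :: real assume e: "0 < e"
 obtain d where d: "d > 0" and D: "\<And>n x y. n \<ge> n0 \<Longrightarrow> x \<in> S \<Longrightarrow> y \<in> S \<Longrightarrow> \<bar>x - y\<bar> < d \<Longrightarrow> \<bar>f n x - f n y\<bar> \<le> e / 4"
  using eq[of "e / 4"] e by auto
 have Dg: "\<bar>g x - g y\<bar> \<le> e / 4" if "x \<in> S" "y \<in> S" "\<bar>x - y\<bar> < d" for x y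
  by (rule LIMSEQ_le_const2[OF tendsto_rabs[OF tendsto_diff[OF p p]]]) (use that D in auto)
 obtain k where k: "finite k" "k \<subseteq> S" "S \<subseteq> (\<Union>x\<in>k. ball x d)"
  using compact_eq_totally_bounded[of S] S d by (metis seq_compact_imp_totally_bounded compact_imp_seq_compact)
 have "\<forall>\<^sub>F n in sequentially. \<forall>x\<in>k. dist (f n x) (g x) < e / 4"
 proof (intro eventually_ball_finite ballI)
  show "\<forall>\<^sub>F n in sequentially. dist (f n x) (g x) < e / 4" if "x \<in> k" for x
   by (rule tendstoD[OF p]) (use k(2) that e in auto)
 qed (rule k(1))
 moreover have "\<forall>\<^sub>F n in sequentially. n \<ge> n0" by (rule eventually_ge_at_top)
 ultimately show "\<forall>\<^sub>F n in sequentially. \<forall>x\<in>S. dist (f n x) (g x) < e"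
 proof eventually_elim
  case (elim n)
  show ?case
  proof
   fix x assume x: "x \<in> S"
   then obtain y where y: "y \<in> k" "dist y x < d" using k(3) by auto
   hence yS: "y \<in> S" "\<bar>x - y\<bar> < d" using k(2) by (auto simp: dist_real_def)
   have "\<bar>f n x - f n y\<bar> \<le> e / 4" "\<bar>g x - g y\<bar> \<le> e / 4" using D[OF elim(2) x yS] Dg[OF x yS] by auto
   moreover have "\<bar>f n y - g y\<bar> < e / 4" using elim(1) y(1) by (auto simp: dist_real_def)
   ultimately show "dist (f n x) (g x) < e" using e unfolding dist_real_def by linarith
  qed
 qed
qed

text \<open>Cauchy-Schwarz on [r, s], where the weight is at least its value at lo: Hoelder
  continuity of exponent 1/2 with a constant that ignores the interval [a, b].\<close>

lemma U_holder:
 assumes a: "0 < a" and rs: "a \<le> lo" "lo \<le> r" "r \<le> s" "s \<le> b" and p: "continuous_on {a..b} p" and S: "nsq N a b p \<le> S\<^sup>2" "0 \<le> S"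
 shows "\<bar>Ub b p r - Ub b p s\<bar> \<le> S * sqrt ((s - r) / om N lo)"
proof -
 have lo: "0 < lo" using a rs by simp
 have pc: "continuous_on {r..s} p" by (rule continuous_on_subset[OF p]) (use rs in auto)
 have om: "om N x > 0" "om N lo \<le> om N x" if "x \<in> {r..s}" for x
  using that rs lo om_pos[of x N] by (auto simp: om_def intro: power_mono)
 have "integral {r..s} p + integral {s..b} p = integral {r..b} p"
  by (rule Henstock_Kurzweil_Integration.integral_combine)
   (use rs a in \<open>auto intro!: integrable_continuous_real continuous_on_subset[OF p]\<close>)
 hence eq: "Ub b p r - Ub b p s = integral {r..s} p" by (simp add: Ub_def)
 have c1: "continuous_on {r..s} (\<lambda>x. p x * sqrt (om N x))" by (intro continuous_intros pc)
 have c2: "continuous_on {r..s} (\<lambda>x. 1 / sqrt (om N x))"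
  by (intro continuous_intros) (use om(1) in \<open>auto simp: less_imp_neq[OF om(1), symmetric]\<close>)
 have "(integral {r..s} (\<lambda>x. (p x * sqrt (om N x)) * (1 / sqrt (om N x))))\<^sup>2 \<le>
   integral {r..s} (\<lambda>x. (p x * sqrt (om N x))\<^sup>2) * integral {r..s} (\<lambda>x. (1 / sqrt (om N x))\<^sup>2)"
  by (rule Cauchy_Schwarz_integral[OF c1 c2])
 moreover have "integral {r..s} (\<lambda>x. (p x * sqrt (om N x)) * (1 / sqrt (om N x))) = integral {r..s} p"
 proof (rule integral_cong)
  fix x assume "x \<in> {r..s}"
  thus "(p x * sqrt (om N x)) * (1 / sqrt (om N x)) = p x" using om(1)[of x] by simp
 qed
 moreover have "integral {r..s} (\<lambda>x. (p x * sqrt (om N x))\<^sup>2) \<le> S\<^sup>2"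
 proof -
  have "integral {r..s} (\<lambda>x. (p x * sqrt (om N x))\<^sup>2) = integral {r..s} (\<lambda>x. (p x)\<^sup>2 * om N x)"
   by (rule integral_cong) (use om(1) in \<open>auto simp: power_mult_distrib less_imp_le\<close>)
  also have "\<dots> \<le> nsq N a b p" unfolding nsq_def
   by (intro integral_subset_le integrable_continuous_real continuous_intros pc p)
    (use rs a in \<open>auto intro!: mult_nonneg_nonneg less_imp_le[OF om_pos]\<close>)
  finally show ?thesis using S by simp
 qed
 moreover have "integral {r..s} (\<lambda>x. (1 / sqrt (om N x))\<^sup>2) \<le> (s - r) / om N lo"
 proof -
  have "integral {r..s} (\<lambda>x. (1 / sqrt (om N x))\<^sup>2) \<le> integral {r..s} (\<lambda>x. 1 / om N lo)"
  proof (rule integral_le)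
   fix x assume x: "x \<in> {r..s}"
   have "(1 / sqrt (om N x))\<^sup>2 = 1 / om N x" using om(1)[OF x] by (simp add: power_divide)
   also have "\<dots> \<le> 1 / om N lo" using om[OF x] om_pos[OF lo, of N] by (intro divide_left_mono) auto
   finally show "(1 / sqrt (om N x))\<^sup>2 \<le> 1 / om N lo" .
  qed (intro integrable_continuous_real continuous_intros c2)+
  thus ?thesis using rs by simp
 qed
 moreover have "0 \<le> integral {r..s} (\<lambda>x. (1 / sqrt (om N x))\<^sup>2)"
  by (intro integral_nonneg integrable_continuous_real continuous_intros c2) simp
 ultimately have "(integral {r..s} p)\<^sup>2 \<le> S\<^sup>2 * ((s - r) / om N lo)"
  using mult_mono[of "integral {r..s} (\<lambda>x. (p x * sqrt (om N x))\<^sup>2)" "S\<^sup>2" "integral {r..s} (\<lambda>x. (1 / sqrt (om N x))\<^sup>2)" "(s - r) / om N lo"]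
  by simp
 from real_sqrt_le_mono[OF this] show ?thesis
  using S(2) unfolding real_sqrt_mult eq real_sqrt_abs by simp
qed

context radial_problem
begin

text \<open>The equation as a first-order system for U and the flux W = r^(N-1) U'. One constant S
  serves for the decay, the Dirichlet energy (whose density is W^2 / r^(N-1)) and the
  V-energy.\<close>

definition is_radial_solution :: "(real \<Rightarrow> real) \<Rightarrow> (real \<Rightarrow> real) \<Rightarrow> real \<Rightarrow> bool" where
 "is_radial_solution U W S \<longleftrightarrow> 0 < S \<and>
   (\<forall>r>0. (U has_real_derivative W r / om N r) (at r)) \<and>
   (\<forall>r>0. (W has_real_derivative wf r (U r)) (at r)) \<and>
   (\<forall>r>0. \<bar>U r\<bar> \<le> S * ew N r) \<and>
   (\<forall>a>0. \<forall>b. integral {a..b} (\<lambda>r. (W r)\<^sup>2 / om N r) \<le> S\<^sup>2) \<and>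
   (\<forall>a>0. \<forall>b. integral {a..b} (\<lambda>r. Psi r (U r)) \<le> S\<^sup>2)"

lemma K_middle:
 assumes a: "0 < a" "a \<le> rho" "rho \<le> 1" "1 \<le> R" "R \<le> b" and p: "continuous_on {a..b} p" and Q: "QQ a b p \<le> S\<^sup>2" and S: "0 < S"
 shows "integral {a..b} (\<lambda>r. om N r * (K r * (mfun g (Ub b p r) * Ub b p r))) \<le>
   integral {rho..R} (\<lambda>r. om N r * (K r * (mfun g (Ub b p r) * Ub b p r))) +
   Cm * CK * S powr \<gamma>1 * rho powr eta / eta + Cm * CK * S powr \<gamma>2 * R powr (-eta) * (1 + 2 * S\<^sup>2 + 1 / eta)"
proof -
 let ?H = "\<lambda>y. mfun g y * y"
 have H: "\<bar>?H y\<bar> \<le> Cm * \<bar>y\<bar> powr \<gamma>1" "\<bar>?H y\<bar> \<le> Cm * \<bar>y\<bar> powr \<gamma>2" for y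
  by (rule mfun_mult_bound; simp)+
 have Hc: "continuous_on UNIV ?H" by (intro continuous_intros cont_mfun)
 have 1: "\<bar>integral {a..rho} (\<lambda>s. om N s * (K s * ?H (Ub b p s)))\<bar> \<le> Cm * CK * S powr \<gamma>1 * rho powr eta / eta"
  by (rule K_near_0[OF _ _ _ _ p Q S]) (use a H Hc in auto)
 have 2: "\<bar>integral {R..b} (\<lambda>s. om N s * (K s * ?H (Ub b p s)))\<bar> \<le> Cm * CK * S powr \<gamma>2 * R powr (-eta) * (1 + 2 * S\<^sup>2 + 1 / eta)"
  by (rule K_tail[OF _ _ _ _ p Q S]) (use a H Hc in auto)
 have i: "(\<lambda>s. om N s * (K s * ?H (Ub b p s))) integrable_on {a..b}"
  by (intro integrable_continuous_real continuous_intros cont_nonlin Ub_cont p a)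
 have i2: "(\<lambda>s. om N s * (K s * ?H (Ub b p s))) integrable_on {rho..b}"
  by (rule integrable_on_subinterval[OF i]) (use a in auto)
 have "integral {a..rho} (\<lambda>s. om N s * (K s * ?H (Ub b p s))) + integral {rho..b} (\<lambda>s. om N s * (K s * ?H (Ub b p s))) = integral {a..b} (\<lambda>s. om N s * (K s * ?H (Ub b p s)))"
  by (rule Henstock_Kurzweil_Integration.integral_combine) (use a i in auto)
 moreover have "integral {rho..R} (\<lambda>s. om N s * (K s * ?H (Ub b p s))) + integral {R..b} (\<lambda>s. om N s * (K s * ?H (Ub b p s))) = integral {rho..b} (\<lambda>s. om N s * (K s * ?H (Ub b p s)))"
  by (rule Henstock_Kurzweil_Integration.integral_combine) (use a i2 in auto)
 ultimately show ?thesis using 1 2 by linarith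
qed

text \<open>The intervals are [1/(n+2), n+2] and the gradients at most 1/(n+1). A subsequence
  converges at rational radii, and Hoelder continuity makes the convergence locally uniform. Of the
  derivatives only an L^2 bound is known, so the flux is obtained as the limit of the integrals
  \<open>Wn\<close> of the right-hand side.\<close>

lemma radial_solution_exists: "\<exists>U W S. is_radial_solution U W S \<and> (\<exists>r>0. U r \<noteq> 0)"
proof -
 obtain c d where c: "0 < c" and PS: "\<And>a b \<delta>. 0 < a \<Longrightarrow> a \<le> 1/2 \<Longrightarrow> 2 \<le> b \<Longrightarrow> 0 < \<delta> \<Longrightarrow>
   \<exists>p. continuous_on {a..b} p \<and> c \<le> JJ a b p \<and> JJ a b p \<le> d \<and> sqrt (nsq N a b (GG a b p)) \<le> \<delta>"
  using Palais_Smale by blast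
 define S where "S = sqrt (max 1 (2 / (1/2 - 1/\<theta>) * (d + 1 / (2 * (1/2 - 1/\<theta>)))))"
 have S1: "1 \<le> S" by (simp add: S_def)
 hence S: "0 < S" by simp
 define a0 b0 \<delta>0 where "a0 n = 1 / (real n + 2)" and "b0 n = real n + 2" and "\<delta>0 n = 1 / (real n + 1)" for n
 have "\<forall>n. \<exists>p. continuous_on {a0 n..b0 n} p \<and> c \<le> JJ (a0 n) (b0 n) p \<and> JJ (a0 n) (b0 n) p \<le> d \<and> sqrt (nsq N (a0 n) (b0 n) (GG (a0 n) (b0 n) p)) \<le> \<delta>0 n"
  by (intro allI PS) (auto simp: a0_def b0_def \<delta>0_def field_simps)
 then obtain p0 where p0: "\<And>n. continuous_on {a0 n..b0 n} (p0 n)" "\<And>n. c \<le> JJ (a0 n) (b0 n) (p0 n)"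
  "\<And>n. JJ (a0 n) (b0 n) (p0 n) \<le> d" "\<And>n. sqrt (nsq N (a0 n) (b0 n) (GG (a0 n) (b0 n) (p0 n))) \<le> \<delta>0 n" by metis
 have ab0: "0 < a0 n" "a0 n < b0 n" "a0 n \<le> 1/2" "2 \<le> b0 n" "\<delta>0 n \<le> 1" for n
  by (auto simp: a0_def b0_def \<delta>0_def field_simps intro: less_le_trans[of _ 1])
 have Q0: "QQ (a0 n) (b0 n) (p0 n) \<le> S\<^sup>2" for n
 proof -
  have "S\<^sup>2 = max 1 (2 / (1/2 - 1/\<theta>) * (d + 1 / (2 * (1/2 - 1/\<theta>))))" unfolding S_def by (rule real_sqrt_pow2) simp
  thus ?thesis
   using Palais_Smale_bounded[OF ab0(1,2) p0(1,3) order_trans[OF p0(4) ab0(5)], of n] by (simp only: le_max_iff_disj) blast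
 qed
 have U0: "\<bar>Ub (b0 n) (p0 n) r\<bar> \<le> S * ew N r" if "r \<in> {a0 n..b0 n}" for n r
  using U_le_QQ[OF ab0(1) p0(1) Q0 _ that] S by simp
 \<comment> \<open>Division by the decay rate gives the single bound S at all radii. The value 0
   outside the n-th interval disappears in the limit, because every radius is eventually
   inside.\<close>
 define f where "f n q = (if q \<in> {a0 n..b0 n} then Ub (b0 n) (p0 n) q / ew N q else 0)" for n and q :: real
 obtain k where k: "strict_mono k" and kc: "\<And>q. q \<in> {q \<in> \<rat>. 0 < q} \<Longrightarrow> \<exists>l. (\<lambda>n. f (k n) q) \<longlonglongrightarrow> l"
 proof (rule function_convergent_subsequence[of "{q \<in> \<rat>. 0 < q}" f S])
  show "countable {q \<in> \<rat>. 0 < (q::real)}" by (rule countable_subset[OF _ countable_rat]) auto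
  show "norm (f n x) \<le> S" if "x \<in> {q \<in> \<rat>. 0 < q}" for n x
  proof (cases "x \<in> {a0 n..b0 n}")
   case True
   have "0 < ew N x" using that ew_pos by auto
   thus ?thesis using U0[OF True] True by (simp add: f_def abs_divide divide_le_eq)
  next
   case False
   hence "f n x = 0" unfolding f_def by (rule if_not_P)
   thus ?thesis using S by simp
  qed
 qed blast
 define a where "a n = a0 (k n)" for n
 define b where "b n = b0 (k n)" for n
 define \<delta> where "\<delta> n = \<delta>0 (k n)" for n
 define p where "p n = p0 (k n)" for n
 define u where "u n = Ub (b n) (p n)" for n
 define en where "en n = GG (a n) (b n) (p n)" for n
 define Wn where "Wn n s = integral {a n..s} (\<lambda>r. wf r (u n r))" for n s
 have ab: "0 < a n" "a n < b n" "a n \<le> 1/2" "2 \<le> b n" for n unfolding a_def b_def by (rule ab0)+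
 have pc: "continuous_on {a n..b n} (p n)" and Jc: "c \<le> JJ (a n) (b n) (p n)"
  and en_small: "sqrt (nsq N (a n) (b n) (en n)) \<le> \<delta> n" and Q: "QQ (a n) (b n) (p n) \<le> S\<^sup>2" for n
  by (simp_all add: a_def b_def p_def en_def \<delta>_def p0 Q0)
 have uS: "\<bar>u n r\<bar> \<le> S * ew N r" if "r \<in> {a n..b n}" for n r
  using U0[of r "k n"] that by (simp add: a_def b_def p_def u_def)
 have nS: "nsq N (a n) (b n) (p n) \<le> S\<^sup>2" for n using order_trans[OF nsq_le_QQ[OF ab(1) pc] Q] .
 have enc: "continuous_on {a n..b n} (en n)" for n unfolding en_def by (rule GG_cont[OF ab(1,2) pc])
 have uc: "continuous_on {a n..b n} (u n)" for n unfolding u_def by (rule Ub_cont[OF pc])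
 have wuc: "continuous_on {a n..b n} (\<lambda>r. wf r (u n r))" for n unfolding u_def by (rule wf_U_cont[OF ab(1) pc])
 \<comment> \<open>The gradient en measures the failure of r^(N-1) U' = Wn: since U' = -p, it equals
   (Wn - r^(N-1) U') / r^(N-1), and it tends to 0 in the weighted L^2 norm.\<close>
 have en_eq: "en n s = p n s + Wn n s / om N s" for n s
  unfolding en_def GG_def one_dim.Gd_def[OF one_dim_problem[OF ab(1,2)]] one_dim.Ws_def[OF one_dim_problem[OF ab(1,2)]] Wn_def u_def ..
 have kn: "n \<le> k n" for n by (rule seq_suble[OF k])
 have \<delta>0: "\<delta> \<longlonglongrightarrow> 0"
 proof -
  have "\<delta>0 = (\<lambda>n. inverse (real (Suc n)))" by (rule ext) (simp add: \<delta>0_def inverse_eq_divide add.commute)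
  hence "\<delta>0 \<longlonglongrightarrow> 0" using LIMSEQ_inverse_real_of_nat by simp
  thus ?thesis unfolding \<delta>_def[abs_def] using LIMSEQ_subseq_LIMSEQ[OF _ k] by (simp add: o_def)
 qed
 have evab: "\<exists>n0. \<forall>n\<ge>n0. a n \<le> lo \<and> hi \<le> b n" if lo: "0 < lo" for lo hi
 proof -
  obtain n0 where n0: "real n0 > max (1 / lo) hi" using reals_Archimedean2 by blast
  have "a n \<le> lo \<and> hi \<le> b n" if "n \<ge> n0" for n
  proof -
   have kn0: "real (k n) \<ge> real n0" using kn[of n] that by linarith
   hence "1 / lo \<le> real (k n) + 2" "hi \<le> real (k n) + 2" using n0 by auto
   thus ?thesis using lo by (simp add: a_def b_def a0_def b0_def field_simps)
  qed
  thus ?thesis by blast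
 qed
 have sub: "continuous_on {lo..hi} h" if "continuous_on {a n..b n} h" "a n \<le> lo" "hi \<le> b n" for h :: "real \<Rightarrow> real" and n lo hi
  by (rule continuous_on_subset[OF that(1)]) (use that in auto)
 have equi: "\<exists>d>0. \<forall>n\<ge>n0. \<forall>x\<in>{lo..hi}. \<forall>y\<in>{lo..hi}. \<bar>x - y\<bar> < d \<longrightarrow> \<bar>u n x - u n y\<bar> \<le> e"
  if lo: "0 < lo" and n0: "\<And>n. n \<ge> n0 \<Longrightarrow> a n \<le> lo \<and> hi \<le> b n" and e: "0 < e" for lo hi e n0
 proof (intro exI conjI allI ballI impI)
  show "0 < (e / S)\<^sup>2 * om N lo" using e S om_pos[OF lo] by simp
  fix n x y assume n: "n0 \<le> n" and xy: "x \<in> {lo..hi}" "y \<in> {lo..hi}" "\<bar>x - y\<bar> < (e / S)\<^sup>2 * om N lo"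
  have main: "\<bar>u n r - u n s\<bar> \<le> e" if h: "lo \<le> r" "r \<le> s" "s \<le> hi" "s - r < (e / S)\<^sup>2 * om N lo" for r s
  proof -
   have "\<bar>u n r - u n s\<bar> \<le> S * sqrt ((s - r) / om N lo)"
    unfolding u_def by (rule U_holder[OF ab(1) _ h(1,2) _ pc nS]) (use n0[OF n] h S in auto)
   also have "\<dots> \<le> S * sqrt ((e / S)\<^sup>2)"
    using h(4) om_pos[OF lo, of N] S by (intro mult_left_mono real_sqrt_le_mono) (auto simp: divide_le_eq)
   also have "\<dots> = e" using e S by simp
   finally show ?thesis .
  qed
  show "\<bar>u n x - u n y\<bar> \<le> e"
  proof (cases "x \<le> y")
   case True thus ?thesis using main[of x y] xy by auto
  next
   case False thus ?thesis using main[of y x] xy by (auto simp: abs_minus_commute)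
  qed
 qed
 have conv: "\<exists>l. (\<lambda>n. u n r) \<longlonglongrightarrow> l" if r: "0 < r" for r
 proof -
  have "Cauchy (\<lambda>n. u n r)"
  proof (rule metric_CauchyI)
   fix e :: real assume e: "0 < e"
   obtain n0 where n0: "\<And>n. n \<ge> n0 \<Longrightarrow> a n \<le> r / 2 \<and> r + 1 \<le> b n" using evab[of "r / 2" "r + 1"] r by auto
   obtain d where d: "d > 0" and D: "\<And>n x y. n \<ge> n0 \<Longrightarrow> x \<in> {r/2..r+1} \<Longrightarrow> y \<in> {r/2..r+1} \<Longrightarrow> \<bar>x - y\<bar> < d \<Longrightarrow> \<bar>u n x - u n y\<bar> \<le> e / 4"
    using equi[of "r / 2" n0 "r + 1" "e / 4"] n0 r e by auto
   obtain q where q: "q \<in> \<rat>" "r < q" "q < r + min 1 d" using Rats_dense_in_real[of r "r + min 1 d"] d by auto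
   have q0: "0 < q" "q \<in> {r/2..r+1}" "r \<in> {r/2..r+1}" "\<bar>r - q\<bar> < d" using q r by auto
   obtain l where "(\<lambda>n. f (k n) q) \<longlonglongrightarrow> l" using kc[of q] q q0 by auto
   hence "(\<lambda>n. f (k n) q * ew N q) \<longlonglongrightarrow> l * ew N q" by (intro tendsto_intros)
   moreover have "\<forall>\<^sub>F n in sequentially. f (k n) q * ew N q = u n q"
    using eventually_ge_at_top[of n0]
   proof eventually_elim
    case (elim n)
    hence "q \<in> {a n..b n}" using n0[OF elim] q0(2) by auto
    thus ?case using ew_pos[OF q0(1), of N] by (simp add: f_def u_def a_def b_def p_def)
   qed
   ultimately have "(\<lambda>n. u n q) \<longlonglongrightarrow> l * ew N q" by (rule Lim_transform_eventually)
   hence "Cauchy (\<lambda>n. u n q)" by (intro LIMSEQ_imp_Cauchy)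
   then obtain M where M: "\<And>m n. m \<ge> M \<Longrightarrow> n \<ge> M \<Longrightarrow> dist (u m q) (u n q) < e / 4"
    using e unfolding Cauchy_def by (metis zero_less_divide_iff zero_less_numeral)
   show "\<exists>M. \<forall>m\<ge>M. \<forall>n\<ge>M. dist (u m r) (u n r) < e"
   proof (intro exI allI impI)
    fix m n assume mn: "max M n0 \<le> m" "max M n0 \<le> n"
    have "\<bar>u m r - u m q\<bar> \<le> e / 4" "\<bar>u n r - u n q\<bar> \<le> e / 4" using D q0 mn by auto
    moreover have "\<bar>u m q - u n q\<bar> < e / 4" using M[of m n] mn by (simp add: dist_real_def)
    ultimately show "dist (u m r) (u n r) < e" using e unfolding dist_real_def by linarith
   qed
  qed
  thus ?thesis by (simp add: convergent_eq_Cauchy)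
 qed
 define U where "U r = lim (\<lambda>n. u n r)" for r
 have uU: "(\<lambda>n. u n r) \<longlonglongrightarrow> U r" if "0 < r" for r
  using conv[OF that] unfolding U_def by (metis convergent_def convergent_LIMSEQ_iff)
 have unif: "uniform_limit {lo..hi} u U sequentially" if lo: "0 < lo" for lo hi
 proof -
  obtain n0 where n0: "\<And>n. n \<ge> n0 \<Longrightarrow> a n \<le> lo \<and> hi \<le> b n" using evab[OF lo, of hi] by auto
  show ?thesis by (rule equicontinuous_uniform_limit[OF compact_Icc equi[OF lo n0] uU]) (use lo in auto)
 qed
 have evc: "\<forall>\<^sub>F n in sequentially. a n \<le> lo \<and> hi \<le> b n" if "0 < lo" for lo hi
  using evab[OF that, of hi] by (simp add: eventually_sequentially)
 have Uc: "continuous_on {lo..hi} U" if lo: "0 < lo" for lo hi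
  by (rule uniform_limit_theorem[OF eventually_mono[OF evc[OF lo, of hi]] unif[OF lo]]) (auto intro: sub uc)
 have comp: "(\<lambda>n. integral {lo..hi} (\<lambda>r. F r (u n r))) \<longlonglongrightarrow> integral {lo..hi} (\<lambda>r. F r (U r))"
  if lo: "0 < lo" and F: "continuous_on ({lo..hi} \<times> UNIV) (\<lambda>(r, y). F r y)" for lo hi and F :: "real \<Rightarrow> real \<Rightarrow> real"
 proof (rule uniform_limit_integral_tendsto[OF uniform_limit_comp2[OF F unif[OF lo] Uc[OF lo]]])
  show "\<forall>\<^sub>F n in sequentially. continuous_on {lo..hi} (\<lambda>r. F r (u n r))"
   using evc[OF lo, of hi]
  proof eventually_elim
   case (elim n)
   have "continuous_on {lo..hi} (u n)" using sub uc elim by blast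
   from continuous_on_compose2[OF F continuous_on_Pair[OF continuous_on_id this]] show ?case by auto
  qed
 qed
 have wfc: "continuous_on ({lo..hi} \<times> UNIV) (\<lambda>(r, y). wf r y)" if lo: "0 < lo" for lo hi
  unfolding wf_def case_prod_beta' by (intro continuous_intros cont_nonlin cont_V_fst cont_K_fst lo)
 have Wn_split: "Wn n s = Wn n lo + integral {lo..s} (\<lambda>r. wf r (u n r))" if "a n \<le> lo" "lo \<le> s" "s \<le> b n" for n lo s
  unfolding Wn_def
  by (rule Henstock_Kurzweil_Integration.integral_combine[symmetric]) (use that in \<open>auto intro!: integrable_continuous_real sub[OF wuc]\<close>)
 have Wnc: "continuous_on {lo..hi} (Wn n)" if "a n \<le> lo" "hi \<le> b n" for n lo hi
 proof -
  have "continuous_on {a n..b n} (Wn n)"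
   unfolding Wn_def[abs_def] by (rule DERIV_continuous_on) (rule integral_has_real_derivative[OF wuc])
  thus ?thesis by (rule sub) (use that in auto)
 qed
 have Wint: "uniform_limit {lo..hi} (\<lambda>n s. integral {lo..s} (\<lambda>r. wf r (u n r))) (\<lambda>s. integral {lo..s} (\<lambda>r. wf r (U r))) sequentially"
  if lo: "0 < lo" and hi: "lo < hi" for lo hi
 proof (rule uniform_limitI)
  fix e :: real assume e: "0 < e"
  have wUc: "continuous_on {lo..hi} (\<lambda>r. wf r (U r))"
   using continuous_on_compose2[OF wfc[OF lo] continuous_on_Pair[OF continuous_on_id Uc[OF lo]]] by auto
  have pos: "0 < e / (2 * (hi - lo))" using e hi by simp
  from uniform_limitD[OF uniform_limit_comp2[OF wfc[OF lo, of hi] unif[OF lo, of hi] Uc[OF lo, of hi]] pos] evc[OF lo, of hi]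
  show "\<forall>\<^sub>F n in sequentially. \<forall>s\<in>{lo..hi}. dist (integral {lo..s} (\<lambda>r. wf r (u n r))) (integral {lo..s} (\<lambda>r. wf r (U r))) < e"
  proof eventually_elim
   case (elim n)
   show ?case
   proof
    fix s assume s: "s \<in> {lo..hi}"
    have i1: "(\<lambda>r. wf r (u n r)) integrable_on {lo..s}" by (rule integrable_continuous_real, rule sub[OF wuc]) (use elim(2) s in auto)
    have i2: "(\<lambda>r. wf r (U r)) integrable_on {lo..s}" by (rule integrable_continuous_real, rule continuous_on_subset[OF wUc]) (use s in auto)
    have "norm (integral {lo..s} (\<lambda>r. wf r (u n r) - wf r (U r))) \<le> integral {lo..s} (\<lambda>r. e / (2 * (hi - lo)))"
     by (rule integral_norm_bound_integral) (use elim(1) s in \<open>auto intro!: integrable_diff i1 i2 simp: dist_real_def less_imp_le\<close>)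
    also have "\<dots> = (s - lo) * (e / (2 * (hi - lo)))" using s by simp
    also have "\<dots> \<le> (hi - lo) * (e / (2 * (hi - lo)))" using s pos by (intro mult_right_mono) auto
    also have "\<dots> = e / 2" using hi by (simp add: field_simps)
    also have "\<dots> < e" using e by simp
    finally show "dist (integral {lo..s} (\<lambda>r. wf r (u n r))) (integral {lo..s} (\<lambda>r. wf r (U r))) < e"
     by (simp add: dist_real_def integral_diff[OF i1 i2])
   qed
  qed
 qed
 have en0: "(\<lambda>n. integral {lo..hi} (en n)) \<longlonglongrightarrow> 0" if lo: "0 < lo" and hi: "lo \<le> hi" for lo hi
 proof (rule Lim_null_comparison)
  show "(\<lambda>n. \<delta> n * ew N lo) \<longlonglongrightarrow> 0" using tendsto_mult_right[OF \<delta>0, of "ew N lo"] by simp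
  show "\<forall>\<^sub>F n in sequentially. norm (integral {lo..hi} (en n)) \<le> \<delta> n * ew N lo"
   using evc[OF lo, of hi]
  proof eventually_elim
   case (elim n)
   have "\<bar>integral {lo..hi} (en n)\<bar> \<le> sqrt (nsq N lo hi (en n)) * ew N lo"
    by (rule integral_le_nsq[OF N lo hi sub[OF enc]]) (use elim in auto)
   also have "nsq N lo hi (en n) \<le> nsq N (a n) (b n) (en n)"
    unfolding nsq_def
    by (intro integral_subset_le integrable_continuous_real continuous_intros enc sub[OF enc])
     (use elim ab(1)[of n] in \<open>auto intro!: mult_nonneg_nonneg less_imp_le[OF om_pos]\<close>)
   hence "sqrt (nsq N lo hi (en n)) * ew N lo \<le> \<delta> n * ew N lo"
    using en_small[of n] ew_pos[OF lo, of N] by (intro mult_right_mono) (auto intro: order_trans[OF real_sqrt_le_mono])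
   finally show ?case by simp
  qed
 qed
 have ud: "u n r - u n s = integral {r..s} (en n) - integral {r..s} (\<lambda>x. Wn n x / om N x)"
  if h: "a n \<le> r" "r \<le> s" "s \<le> b n" for n r s
 proof -
  have r0: "0 < r" using h ab(1)[of n] by linarith
  have "integral {r..s} (p n) + integral {s..b n} (p n) = integral {r..b n} (p n)"
   by (rule Henstock_Kurzweil_Integration.integral_combine) (use h in \<open>auto intro!: integrable_continuous_real sub[OF pc]\<close>)
  hence "u n r - u n s = integral {r..s} (p n)" by (simp add: u_def Ub_def)
  also have "p n = (\<lambda>x. en n x - Wn n x / om N x)" using en_eq by auto
  also have "integral {r..s} \<dots> = integral {r..s} (en n) - integral {r..s} (\<lambda>x. Wn n x / om N x)"
   by (rule integral_diff; intro integrable_continuous_real sub[OF enc] continuous_intros Wnc)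
    (use h r0 om_pos[of _ N] in \<open>auto simp: less_imp_neq[symmetric]\<close>)
  finally show ?thesis .
 qed
 \<comment> \<open>On [lo, hi], Wn is its value at lo plus an integral that converges uniformly.
   Integrating Wn / r^(N-1) links the increment of u with that value times kappa, so
   \<open>Wn n lo\<close> is a convergent expression divided by kappa > 0.\<close>
 have Wconv: "convergent (\<lambda>n. Wn n lo)" if lo: "0 < lo" for lo
 proof -
  define hi where "hi = lo + 1"
  have hi: "lo < hi" by (simp add: hi_def)
  have omp: "0 < om N x" if "x \<in> {lo..hi}" for x using that lo om_pos[of x N] by auto
  have oc: "continuous_on {lo..hi} (\<lambda>x. 1 / om N x)" by (intro continuous_intros) (use omp in \<open>auto simp: less_imp_neq[symmetric]\<close>)
  define kappa where "kappa = integral {lo..hi} (\<lambda>x. 1 / om N x)"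
  have kappa: "kappa > 0"
  proof -
   have "kappa \<noteq> 0" unfolding kappa_def
   proof (subst integral_eq_0_iff[OF oc hi])
    show "\<not> (\<forall>x\<in>{lo..hi}. 1 / om N x = 0)" using omp[of lo] hi by (auto intro!: bexI[of _ lo])
   qed (use omp in \<open>auto simp: less_imp_le\<close>)
   moreover have "0 \<le> kappa" unfolding kappa_def by (intro integral_nonneg integrable_continuous_real oc) (use omp in \<open>auto simp: less_imp_le\<close>)
   ultimately show ?thesis by simp
  qed
  define I where "I n x = integral {lo..x} (\<lambda>r. wf r (u n r))" for n x
  have Fc: "continuous_on ({lo..hi} \<times> UNIV) (\<lambda>(r, y). y / om N r)"
   unfolding case_prod_beta' by (intro continuous_intros) (use omp in \<open>auto simp: less_imp_neq[symmetric]\<close>)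
  have Uw: "continuous_on {lo..hi} (\<lambda>s. integral {lo..s} (\<lambda>r. wf r (U r)))"
   by (rule DERIV_continuous_on, rule integral_has_real_derivative)
    (use continuous_on_compose2[OF wfc[OF lo] continuous_on_Pair[OF continuous_on_id Uc[OF lo]]] in auto)
  have Ic: "continuous_on {lo..hi} (I n)" if "a n \<le> lo \<and> hi \<le> b n" for n
   unfolding I_def[abs_def]
   by (rule DERIV_continuous_on, rule integral_has_real_derivative, rule sub[OF wuc]) (use that in auto)
  have Icc: "continuous_on {lo..hi} (\<lambda>x. I n x / om N x)" if "a n \<le> lo \<and> hi \<le> b n" for n
   by (intro continuous_intros Ic that) (use omp in \<open>auto simp: less_imp_neq[symmetric]\<close>)
  have T: "(\<lambda>n. integral {lo..hi} (\<lambda>x. I n x / om N x)) \<longlonglongrightarrow> integral {lo..hi} (\<lambda>x. integral {lo..x} (\<lambda>r. wf r (U r)) / om N x)"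
   unfolding I_def
   by (rule uniform_limit_integral_tendsto[OF uniform_limit_comp2[OF Fc Wint[OF lo hi] Uw]])
    (rule eventually_mono[OF evc[OF lo, of hi]], rule Icc[unfolded I_def])
  have "(\<lambda>n. (u n hi - u n lo + integral {lo..hi} (en n) - integral {lo..hi} (\<lambda>x. I n x / om N x)) / kappa) \<longlonglongrightarrow>
    (U hi - U lo + 0 - integral {lo..hi} (\<lambda>x. integral {lo..x} (\<lambda>r. wf r (U r)) / om N x)) / kappa"
  proof (rule tendsto_divide[OF tendsto_diff[OF tendsto_add[OF tendsto_diff[OF uU uU] en0] T] tendsto_const])
   show "0 < hi" "0 < lo" "0 < lo" "lo \<le> hi" "kappa \<noteq> 0" using lo hi kappa by linarith+
  qed
  moreover have "\<forall>\<^sub>F n in sequentially. (u n hi - u n lo + integral {lo..hi} (en n) - integral {lo..hi} (\<lambda>x. I n x / om N x)) / kappa = Wn n lo"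
   using evc[OF lo, of hi]
  proof eventually_elim
   case (elim n)
   have "integral {lo..hi} (\<lambda>x. Wn n x / om N x) = integral {lo..hi} (\<lambda>x. Wn n lo * (1 / om N x) + I n x / om N x)"
   proof (rule integral_cong)
    fix x assume "x \<in> {lo..hi}"
    hence "Wn n x = Wn n lo + I n x" unfolding I_def using elim by (intro Wn_split) auto
    thus "Wn n x / om N x = Wn n lo * (1 / om N x) + I n x / om N x" by (simp only: add_divide_distrib) simp
   qed
   also have "\<dots> = Wn n lo * kappa + integral {lo..hi} (\<lambda>x. I n x / om N x)"
    unfolding kappa_def integral_mult_right[symmetric]
    by (rule integral_add; intro integrable_continuous_real continuous_on_mult_left oc Icc elim)
   finally have "u n lo - u n hi = integral {lo..hi} (en n) - (Wn n lo * kappa + integral {lo..hi} (\<lambda>x. I n x / om N x))"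
    using ud[of n lo hi] elim hi by simp
   hence "u n hi - u n lo + integral {lo..hi} (en n) - integral {lo..hi} (\<lambda>x. I n x / om N x) = Wn n lo * kappa" by linarith
   thus ?case using kappa by simp
  qed
  ultimately show ?thesis unfolding convergent_def by (blast intro: Lim_transform_eventually)
 qed
 define W where "W s = lim (\<lambda>n. Wn n s)" for s
 have WW: "(\<lambda>n. Wn n s) \<longlonglongrightarrow> W s" if "0 < s" for s
  using Wconv[OF that] unfolding W_def by (simp add: convergent_LIMSEQ_iff)
 have wUc: "continuous_on {lo..hi} (\<lambda>r. wf r (U r))" if lo: "0 < lo" for lo hi
  using continuous_on_compose2[OF wfc[OF lo] continuous_on_Pair[OF continuous_on_id Uc[OF lo]]] by auto
 have W_split: "W s = W lo + integral {lo..s} (\<lambda>r. wf r (U r))" if h: "0 < lo" "lo \<le> s" for lo s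
 proof (rule LIMSEQ_unique[OF WW])
  have "(\<lambda>n. Wn n lo + integral {lo..s} (\<lambda>r. wf r (u n r))) \<longlonglongrightarrow> W lo + integral {lo..s} (\<lambda>r. wf r (U r))"
   by (intro tendsto_add WW comp wfc h)
  thus "(\<lambda>n. Wn n s) \<longlonglongrightarrow> W lo + integral {lo..s} (\<lambda>r. wf r (U r))"
   by (rule Lim_transform_eventually) (rule eventually_mono[OF evc[OF h(1), of s]], rule Wn_split[symmetric], use h in auto)
 qed (use h in simp)
 have Wd: "(W has_real_derivative wf r (U r)) (at r)" if r: "0 < r" for r
 proof -
  have "((\<lambda>s. integral {r/2..s} (\<lambda>r. wf r (U r))) has_real_derivative wf r (U r)) (at r within {r/2..r+1})"
   by (rule integral_has_real_derivative[OF wUc]) (use r in auto)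
  hence "((\<lambda>s. integral {r/2..s} (\<lambda>r. wf r (U r))) has_real_derivative wf r (U r)) (at r within {r/2<..<r+1})"
   by (rule has_field_derivative_subset) auto
  hence "((\<lambda>s. W (r/2) + integral {r/2..s} (\<lambda>r. wf r (U r))) has_real_derivative 0 + wf r (U r)) (at r)"
   using r by (intro DERIV_add DERIV_const) (simp add: at_within_open[of r "{r/2<..<r+1}"])
  thus ?thesis
   by (rule has_field_derivative_transform_within_open[where S = "{r/2<..<r+1}", OF DERIV_cong])
    (use r in \<open>auto intro!: W_split[symmetric]\<close>)
 qed
 have Wc: "continuous_on {lo..hi} W" if "0 < lo" for lo hi
  using that by (intro continuous_at_imp_continuous_on ballI DERIV_isCont[OF Wd]) auto
 have Wunif: "uniform_limit {lo..hi} Wn W sequentially" if lo: "0 < lo" and hi: "lo < hi" for lo hi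
 proof (rule uniform_limitI)
  fix e :: real assume e: "0 < e"
  from uniform_limitD[OF Wint[OF lo hi], of "e/2"] tendstoD[OF WW[OF lo], of "e/2"] evc[OF lo, of hi] e
  have "\<forall>\<^sub>F n in sequentially. (\<forall>s\<in>{lo..hi}. dist (integral {lo..s} (\<lambda>r. wf r (u n r))) (integral {lo..s} (\<lambda>r. wf r (U r))) < e/2)
   \<and> dist (Wn n lo) (W lo) < e/2 \<and> (a n \<le> lo \<and> hi \<le> b n)" by (auto intro: eventually_conj)
  thus "\<forall>\<^sub>F n in sequentially. \<forall>s\<in>{lo..hi}. dist (Wn n s) (W s) < e"
  proof eventually_elim
   case (elim n)
   show ?case
   proof
    fix s assume s: "s \<in> {lo..hi}"
    have "dist (integral {lo..s} (\<lambda>r. wf r (u n r))) (integral {lo..s} (\<lambda>r. wf r (U r))) < e/2" using elim s by blast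
    moreover have "Wn n s = Wn n lo + integral {lo..s} (\<lambda>r. wf r (u n r))" using elim s by (intro Wn_split) auto
    moreover have "W s = W lo + integral {lo..s} (\<lambda>r. wf r (U r))" using s by (intro W_split lo) auto
    moreover have "dist (Wn n lo) (W lo) < e/2" using elim by blast
    ultimately show "dist (Wn n s) (W s) < e" unfolding dist_real_def by linarith
   qed
  qed
 qed
 have omp: "0 < om N x" if "0 < lo" "x \<in> {lo..hi}" for x lo hi using that om_pos[of x N] by auto
 have U_split: "U s = U r + integral {r..s} (\<lambda>x. W x / om N x)" if h: "0 < r" "r < s" for r s
 proof -
  have Fc: "continuous_on ({r..s} \<times> UNIV) (\<lambda>(r, y). y / om N r)"
   unfolding case_prod_beta' by (intro continuous_intros) (use omp[OF h(1)] in \<open>auto simp: less_imp_neq[symmetric]\<close>)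
  have "(\<lambda>n. integral {r..s} (\<lambda>x. Wn n x / om N x)) \<longlonglongrightarrow> integral {r..s} (\<lambda>x. W x / om N x)"
  proof (rule uniform_limit_integral_tendsto[OF uniform_limit_comp2[OF Fc Wunif[OF h] Wc[OF h(1)]]])
   show "\<forall>\<^sub>F n in sequentially. continuous_on {r..s} (\<lambda>x. Wn n x / om N x)"
    by (rule eventually_mono[OF evc[OF h(1), of s]])
     (intro continuous_intros Wnc; use omp[OF h(1)] in \<open>auto simp: less_imp_neq[symmetric]\<close>)
  qed
  hence "(\<lambda>n. integral {r..s} (en n) - integral {r..s} (\<lambda>x. Wn n x / om N x)) \<longlonglongrightarrow> 0 - integral {r..s} (\<lambda>x. W x / om N x)"
   using h by (intro tendsto_diff en0) auto
  moreover have "(\<lambda>n. u n r - u n s) \<longlonglongrightarrow> U r - U s" using h by (intro tendsto_diff uU) auto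
  hence "(\<lambda>n. integral {r..s} (en n) - integral {r..s} (\<lambda>x. Wn n x / om N x)) \<longlonglongrightarrow> U r - U s"
   by (rule Lim_transform_eventually) (rule eventually_mono[OF evc[OF h(1), of s]], rule ud, use h in auto)
  ultimately have "0 - integral {r..s} (\<lambda>x. W x / om N x) = U r - U s" by (rule LIMSEQ_unique)
  thus ?thesis by simp
 qed
 have Woc: "continuous_on {lo..hi} (\<lambda>x. W x / om N x)" if "0 < lo" for lo hi
  by (intro continuous_intros Wc that) (use omp[OF that] in \<open>auto simp: less_imp_neq[symmetric]\<close>)
 have Ud: "(U has_real_derivative W r / om N r) (at r)" if r: "0 < r" for r
 proof -
  have "((\<lambda>s. integral {r/2..s} (\<lambda>x. W x / om N x)) has_real_derivative W r / om N r) (at r within {r/2..r+1})"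
   by (rule integral_has_real_derivative[OF Woc]) (use r in auto)
  hence "((\<lambda>s. integral {r/2..s} (\<lambda>x. W x / om N x)) has_real_derivative W r / om N r) (at r within {r/2<..<r+1})"
   by (rule has_field_derivative_subset) auto
  hence "((\<lambda>s. U (r/2) + integral {r/2..s} (\<lambda>x. W x / om N x)) has_real_derivative 0 + W r / om N r) (at r)"
   using r by (intro DERIV_add DERIV_const) (simp add: at_within_open[of r "{r/2<..<r+1}"])
  thus ?thesis
   by (rule has_field_derivative_transform_within_open[where S = "{r/2<..<r+1}", OF DERIV_cong])
    (use r in \<open>auto intro!: U_split[symmetric]\<close>)
 qed
 have US: "\<bar>U r\<bar> \<le> S * ew N r" if r: "0 < r" for r
 proof -
  obtain n0 where n0: "\<And>n. n \<ge> n0 \<Longrightarrow> a n \<le> r \<and> r \<le> b n" using evab[OF r, of r] by auto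
  show ?thesis by (rule LIMSEQ_le_const2[OF tendsto_rabs[OF uU[OF r]]]) (use uS n0 in auto)
 qed
 \<comment> \<open>Wn / r^(N-1) is en - p, and the weighted norms of en and p are at most 1 and S;
   hence the constant 1 + S of the final statement.\<close>
 have energy: "integral {lo..hi} (\<lambda>r. (W r)\<^sup>2 / om N r) \<le> (1 + S)\<^sup>2" if lo: "0 < lo" for lo hi
 proof (cases "lo < hi")
  case True
  have Fc: "continuous_on ({lo..hi} \<times> UNIV) (\<lambda>(r, y). y\<^sup>2 / om N r)"
   unfolding case_prod_beta' by (intro continuous_intros) (use omp[OF lo] in \<open>auto simp: less_imp_neq[symmetric]\<close>)
  have "(\<lambda>n. integral {lo..hi} (\<lambda>x. (Wn n x)\<^sup>2 / om N x)) \<longlonglongrightarrow> integral {lo..hi} (\<lambda>x. (W x)\<^sup>2 / om N x)"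
  proof (rule uniform_limit_integral_tendsto[OF uniform_limit_comp2[OF Fc Wunif[OF lo True] Wc[OF lo]]])
   show "\<forall>\<^sub>F n in sequentially. continuous_on {lo..hi} (\<lambda>x. (Wn n x)\<^sup>2 / om N x)"
    by (rule eventually_mono[OF evc[OF lo, of hi]])
     (intro continuous_intros Wnc; use omp[OF lo] in \<open>auto simp: less_imp_neq[symmetric]\<close>)
  qed
  moreover have "\<exists>M. \<forall>n\<ge>M. integral {lo..hi} (\<lambda>x. (Wn n x)\<^sup>2 / om N x) \<le> (1 + S)\<^sup>2"
  proof -
   obtain n0 where n0: "\<And>n. n \<ge> n0 \<Longrightarrow> a n \<le> lo \<and> hi \<le> b n" using evab[OF lo, of hi] by auto
   have "integral {lo..hi} (\<lambda>x. (Wn n x)\<^sup>2 / om N x) \<le> (1 + S)\<^sup>2" if n: "n \<ge> n0" for n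
   proof -
    have "integral {lo..hi} (\<lambda>x. (Wn n x)\<^sup>2 / om N x) = nsq N lo hi (\<lambda>x. en n x + - p n x)"
     unfolding nsq_def
    proof (rule integral_cong)
     fix x assume "x \<in> {lo..hi}"
     hence "om N x > 0" using omp[OF lo] by simp
     thus "(Wn n x)\<^sup>2 / om N x = (en n x + - p n x)\<^sup>2 * om N x" by (simp add: en_eq power2_eq_square)
    qed
    also have "\<dots> \<le> nsq N (a n) (b n) (\<lambda>x. en n x + - p n x)"
     unfolding nsq_def
     by (intro integral_subset_le integrable_continuous_real continuous_intros enc pc sub[OF enc] sub[OF pc])
      (use n0[OF n] ab(1)[of n] in \<open>auto intro!: mult_nonneg_nonneg less_imp_le[OF om_pos]\<close>)
    finally have 1: "sqrt (integral {lo..hi} (\<lambda>x. (Wn n x)\<^sup>2 / om N x)) \<le> sqrt (nsq N (a n) (b n) (\<lambda>x. en n x + - p n x))" by simp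
    also have "\<dots> \<le> sqrt (nsq N (a n) (b n) (en n)) + sqrt (nsq N (a n) (b n) (\<lambda>x. - p n x))"
     by (rule nsq_triangle[OF ab(1) enc continuous_on_minus[OF pc]])
    also have "nsq N (a n) (b n) (\<lambda>x. - p n x) = nsq N (a n) (b n) (p n)" using nsq_scale[of N "a n" "b n" "-1" "p n"] by simp
    also have "sqrt (nsq N (a n) (b n) (en n)) + sqrt (nsq N (a n) (b n) (p n)) \<le> 1 + S"
     using en_small[of n] ab0(5)[of "k n"] real_sqrt_le_mono[OF nS[of n]] S by (simp add: \<delta>_def)
    finally have "sqrt (integral {lo..hi} (\<lambda>x. (Wn n x)\<^sup>2 / om N x)) \<le> 1 + S" .
    thus ?thesis using S by (simp add: sqrt_le_D)
   qed
   thus ?thesis by blast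
  qed
  ultimately show ?thesis by (rule LIMSEQ_le_const2)
 next
  case False
  thus ?thesis by (cases "lo = hi") auto
 qed
 have Penergy: "integral {lo..hi} (\<lambda>r. Psi r (U r)) \<le> S\<^sup>2" if lo: "0 < lo" for lo hi
 proof (rule LIMSEQ_le_const2[OF comp[OF lo cont_Psi[OF lo]]])
  obtain n0 where n0: "\<And>n. n \<ge> n0 \<Longrightarrow> a n \<le> lo \<and> hi \<le> b n" using evab[OF lo, of hi] by auto
  have "integral {lo..hi} (\<lambda>r. Psi r (u n r)) \<le> S\<^sup>2" if n: "n \<ge> n0" for n
  proof -
   have c: "continuous_on {a n..b n} (\<lambda>r. Psi r (u n r))" unfolding u_def by (rule Psi_U_cont[OF ab(1) pc])
   have "integral {lo..hi} (\<lambda>r. Psi r (u n r)) \<le> integral {a n..b n} (\<lambda>r. Psi r (u n r))"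
    by (intro integral_subset_le integrable_continuous_real c sub[OF c])
     (use n0[OF n] ab(1)[of n] in \<open>auto intro!: Psi_nonneg\<close>)
   also have "\<dots> \<le> S\<^sup>2" using Q[of n] nsq_nonneg[OF ab(1), of N n "b n" "p n"] by (simp add: QQ_def u_def)
   finally show ?thesis .
  qed
  thus "\<exists>M. \<forall>n\<ge>M. integral {lo..hi} (\<lambda>r. Psi r (u n r)) \<le> S\<^sup>2" by blast
 qed
 have "\<exists>r>0. U r \<noteq> 0"
 proof (rule ccontr)
  assume "\<not> ?thesis"
  hence Z: "U r = 0" if "0 < r" for r using that by blast
  define C where "C = Cm * CK * S powr \<gamma>1 / eta + Cm * CK * S powr \<gamma>2 * (1 + 2 * S\<^sup>2 + 1 / eta)"
  have C: "C > 0" unfolding C_def using Cm CK eta S by (intro add_pos_pos divide_pos_pos mult_pos_pos) auto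
  \<comment> \<open>If U = 0, the K-term on the middle interval vanishes in the limit and only the
    two ends remain. The choice R = 1/rho makes both of order rho^eta.\<close>
  have bound: "c \<le> C * rho powr eta" if rho: "0 < rho" "rho \<le> 1" for rho
  proof -
   let ?I = "\<lambda>n. integral {rho..1/rho} (\<lambda>r. om N r * (K r * (mfun g (u n r) * u n r)))"
   have R: "1 \<le> 1 / rho" using rho by simp
   have "?I \<longlonglongrightarrow> integral {rho..1/rho} (\<lambda>r. om N r * (K r * (mfun g (U r) * U r)))"
    by (rule comp[OF rho(1)]) (unfold case_prod_beta', intro continuous_intros cont_nonlin cont_K_fst rho)
   also have "integral {rho..1/rho} (\<lambda>r. om N r * (K r * (mfun g (U r) * U r))) = integral {rho..1/rho} (\<lambda>_. 0)"
    by (rule integral_cong) (use Z rho in auto)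
   finally have I0: "?I \<longlonglongrightarrow> 0" by simp
   have lim: "(\<lambda>n. \<delta> n * S + (?I n + C * rho powr eta)) \<longlonglongrightarrow> 0 * S + (0 + C * rho powr eta)"
    by (intro tendsto_add tendsto_mult tendsto_const \<delta>0 I0)
   obtain n0 where n0: "\<And>n. n \<ge> n0 \<Longrightarrow> a n \<le> rho \<and> 1 / rho \<le> b n" using evab[OF rho(1), of "1/rho"] by auto
   have "c \<le> \<delta> n * S + (?I n + C * rho powr eta)" if n: "n \<ge> n0" for n
   proof -
    have "c \<le> \<delta> n * S + integral {a n..b n} (\<lambda>r. om N r * (K r * (mfun g (Ub (b n) (p n) r) * Ub (b n) (p n) r)))"
     using JJ_le_K[OF ab(1,2) pc en_small[unfolded en_def] Q S] Jc[of n] by (rule order_trans[rotated])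
    also have "integral {a n..b n} (\<lambda>r. om N r * (K r * (mfun g (Ub (b n) (p n) r) * Ub (b n) (p n) r))) \<le>
      ?I n + Cm * CK * S powr \<gamma>1 * rho powr eta / eta + Cm * CK * S powr \<gamma>2 * (1/rho) powr (-eta) * (1 + 2 * S\<^sup>2 + 1 / eta)"
     unfolding u_def by (rule K_middle[OF ab(1) _ rho(2) R _ pc Q S]) (use n0[OF n] in auto)
    also have "(1/rho) powr (-eta) = rho powr eta" using rho by (simp add: powr_minus_divide powr_divide)
    finally show ?thesis by (simp add: C_def algebra_simps)
   qed
   hence "c \<le> 0 * S + (0 + C * rho powr eta)" by (intro LIMSEQ_le_const[OF lim]) blast
   thus ?thesis by simp
  qed
  define rho where "rho = min 1 ((c / (2 * C)) powr (1 / eta))"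
  have rho: "0 < rho" "rho \<le> 1" using c C by (auto simp: rho_def)
  have "rho powr eta \<le> ((c / (2 * C)) powr (1 / eta)) powr eta" using rho eta by (intro powr_mono2) (auto simp: rho_def)
  also have "\<dots> = c / (2 * C)" using eta C c by (simp add: powr_powr)
  finally have "C * rho powr eta \<le> c / 2" using C by (simp add: field_simps)
  thus False using bound[OF rho] c by linarith
 qed
 moreover have "is_radial_solution U W (1 + S)"
  unfolding is_radial_solution_def
 proof (intro conjI allI impI)
  show "0 < 1 + S" using S by simp
  show "\<bar>U r\<bar> \<le> (1 + S) * ew N r" if "0 < r" for r
   using US[OF that] ew_pos[OF that, of N] by (simp add: distrib_right)
  show "integral {lo..hi} (\<lambda>r. Psi r (U r)) \<le> (1 + S)\<^sup>2" if "0 < lo" for lo hi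
   using Penergy[OF that, of hi] power_mono[of S "1 + S" 2] S by linarith
 qed (use Ud Wd energy in auto)
 ultimately show ?thesis by blast
qed

end

section \<open>Vanishing boundary terms and the sign of the solution\<close>

context radial_problem
begin

lemma solution_W_cont:
 assumes "is_radial_solution U W S" "0 < a" shows "continuous_on {a..b} W"
proof (intro continuous_at_imp_continuous_on ballI)
 fix x assume "x \<in> {a..b}"
 hence "(W has_real_derivative wf x (U x)) (at x)" using assms by (simp add: is_radial_solution_def)
 thus "isCont W x" by (rule DERIV_isCont)
qed

lemma solution_U_cont:
 assumes "is_radial_solution U W S" "0 < a" shows "continuous_on {a..b} U"
proof (intro continuous_at_imp_continuous_on ballI)
 fix x assume "x \<in> {a..b}"
 hence "(U has_real_derivative W x / om N x) (at x)" using assms by (simp add: is_radial_solution_def)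
 thus "isCont U x" by (rule DERIV_isCont)
qed

text \<open>As the squared decay rate is r / r^(N-1), the assumption makes the energy density W^2 /
  r^(N-1) at least e^2 / r, whose integral is a logarithm.\<close>

lemma W_ew_log_bound:
 assumes sol: "is_radial_solution U W S" and ab: "0 < a" "a \<le> b" and e: "0 < e"
  and big: "\<And>r. a \<le> r \<Longrightarrow> r \<le> b \<Longrightarrow> e \<le> \<bar>W r\<bar> * ew N r"
 shows "e\<^sup>2 * (ln b - ln a) \<le> S\<^sup>2"
proof -
 have i: "((\<lambda>r. 1 / r) has_integral (ln b - ln a)) {a..b}"
  by (rule fundamental_theorem_of_calculus[OF ab(2)])
   (use ab in \<open>auto simp: has_real_derivative_iff_has_vector_derivative[symmetric] intro!: derivative_eq_intros\<close>)
 have "e\<^sup>2 * (ln b - ln a) = integral {a..b} (\<lambda>r. e\<^sup>2 * (1 / r))"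
  unfolding integral_mult_right using integral_unique[OF i] by simp
 also have "\<dots> \<le> integral {a..b} (\<lambda>r. (W r)\<^sup>2 / om N r)"
 proof (rule integral_le)
  show "(\<lambda>r. e\<^sup>2 * (1 / r)) integrable_on {a..b}" using i by (intro integrable_on_mult_right) (auto simp: integrable_on_def)
  show "(\<lambda>r. (W r)\<^sup>2 / om N r) integrable_on {a..b}"
   by (intro integrable_continuous_real continuous_intros solution_W_cont[OF sol ab(1)])
    (use ab om_pos[of _ N] in \<open>auto simp: less_imp_neq[symmetric]\<close>)
  fix r assume r: "r \<in> {a..b}"
  hence r0: "0 < r" using ab by simp
  have "e\<^sup>2 \<le> (\<bar>W r\<bar> * ew N r)\<^sup>2" using big[of r] r e by (intro power_mono) auto
  also have "\<dots> = (W r)\<^sup>2 * r powr (2 - real N)" using r0 by (simp add: power_mult_distrib ew_sq)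
  also have "r powr (2 - real N) = r / om N r"
  proof -
   have "r powr (2 - real N) = r powr (1 - (real N - 1))" by (simp add: algebra_simps)
   also have "\<dots> = r powr 1 / r powr (real N - 1)" by (rule powr_diff)
   finally show ?thesis using r0 N by (simp add: om_powr)
  qed
  finally show "e\<^sup>2 * (1 / r) \<le> (W r)\<^sup>2 / om N r" using r0 by (simp add: field_simps)
 qed
 also have "\<dots> \<le> S\<^sup>2" using sol ab unfolding is_radial_solution_def by blast
 finally show ?thesis .
qed

text \<open>A persistent lower bound e over a logarithmic length L with e^2 L > S^2 would exceed the
  energy. The product of |W| and the decay rate dominates the boundary term W h at radius r for
  every h of finite energy, up to a constant.\<close>

lemma boundary_radii:
 assumes sol: "is_radial_solution U W S" and e: "0 < e" and R: "0 < R"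
 shows "\<exists>r>R. \<bar>W r\<bar> * ew N r < e" and "\<exists>r. 0 < r \<and> r < R \<and> \<bar>W r\<bar> * ew N r < e"
proof -
 define L where "L = (S\<^sup>2 + 1) / e\<^sup>2"
 have L: "e\<^sup>2 * L > S\<^sup>2" "0 < L" using e by (auto simp: L_def add_nonneg_pos)
 show "\<exists>r>R. \<bar>W r\<bar> * ew N r < e"
 proof (rule ccontr)
  assume "\<not> ?thesis"
  hence "e \<le> \<bar>W r\<bar> * ew N r" if "R + 1 \<le> r" for r
   using that by (meson not_less less_add_one less_le_trans)
  from W_ew_log_bound[OF sol _ _ e this, of "R + 1" "(R + 1) * exp L"]
  have "e\<^sup>2 * (ln ((R + 1) * exp L) - ln (R + 1)) \<le> S\<^sup>2" using R L by auto
  thus False using R L by (simp add: ln_mult)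
 qed
 show "\<exists>r. 0 < r \<and> r < R \<and> \<bar>W r\<bar> * ew N r < e"
 proof (rule ccontr)
  assume "\<not> ?thesis"
  hence "e \<le> \<bar>W r\<bar> * ew N r" if "R / 2 * exp (- L) \<le> r" "r \<le> R / 2" for r
  proof -
   have "0 < r" using that(1) R less_le_trans[of 0 "R / 2 * exp (- L)" r] by simp
   moreover have "r < R" using that R by simp
   ultimately show ?thesis using \<open>\<not> (\<exists>r. 0 < r \<and> r < R \<and> \<bar>W r\<bar> * ew N r < e)\<close> by (meson not_less)
  qed
  from W_ew_log_bound[OF sol _ _ e this, of "R / 2 * exp (- L)" "R / 2"]
  have "e\<^sup>2 * (ln (R / 2) - ln (R / 2 * exp (- L))) \<le> S\<^sup>2" using R L by auto
  moreover have "ln (R / 2 * exp (- L)) = ln (R / 2) - L" using R by (subst ln_mult) auto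
  ultimately show False using L by simp
 qed
qed

text \<open>Where \<open>U < 0\<close> the flux \<open>W = r^(N-1) U'\<close> is nonincreasing, so that \<open>U\<close>, once negative with
 \<open>W \<le> 0\<close>, stays below a negative constant, although \<open>U\<close> vanishes at infinity.\<close>
lemma radial_solution_nonneg:
 assumes sol: "is_radial_solution U W S" and g0: "\<And>t. t \<le> 0 \<Longrightarrow> g t = 0" and r0: "0 < r0"
 shows "0 \<le> U r0"
proof (rule ccontr)
 assume "\<not> ?thesis"
 hence neg: "U r0 < 0" by simp
 have Ud: "(U has_real_derivative W r / om N r) (at r)" and Wd: "(W has_real_derivative wf r (U r)) (at r)"
  and US: "\<bar>U r\<bar> \<le> S * ew N r" if "0 < r" for r
  using sol that by (auto simp: is_radial_solution_def)
 have S: "0 < S" using sol by (simp add: is_radial_solution_def)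
 have wneg: "wf r y \<le> 0" if "0 < r" "y \<le> 0" for r y
 proof -
  have "fODE y \<le> 0" using fODE_mono[OF that(2)] by simp
  hence "mfun g y = 0" by (simp add: mfun_def g0)
  thus ?thesis using that V_nonneg kfun_nonpos om_pos[of r N] by (simp add: wf_def mult_nonneg_nonpos)
 qed
 have W_anti: "W t \<le> W s" if h: "0 < s" "s \<le> t" "\<And>r. s \<le> r \<Longrightarrow> r \<le> t \<Longrightarrow> U r \<le> 0" for s t
  by (rule DERIV_nonpos_imp_nonincreasing[OF h(2)]) (use Wd wneg h in \<open>meson less_le_trans\<close>)
 have U_anti: "U t \<le> U s" if h: "0 < s" "s \<le> t" "\<And>r. s \<le> r \<Longrightarrow> r \<le> t \<Longrightarrow> W r \<le> 0" for s t
 proof (rule DERIV_nonpos_imp_nonincreasing[OF h(2)])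
  fix x assume x: "s \<le> x" "x \<le> t"
  hence "0 < x" using h by simp
  thus "\<exists>y. (U has_real_derivative y) (at x) \<and> y \<le> 0"
   using Ud[of x] h(3)[OF x] om_pos[of x N] by (intro exI[of _ "W x / om N x"]) (auto simp: divide_le_0_iff)
 qed
 \<comment> \<open>A starting point with flux at most 0. If U < 0 on all of (0, r0], a positive flux
   at r0 would persist towards the origin, against \<open>boundary_radii\<close>; otherwise the mean
   value theorem after the last point with U \<ge> 0 provides it.\<close>
 have "\<exists>\<xi>. 0 < \<xi> \<and> \<xi> \<le> r0 \<and> W \<xi> \<le> 0 \<and> (\<forall>r\<in>{\<xi>..r0}. U r < 0)"
 proof (cases "\<exists>z. 0 < z \<and> z \<le> r0 \<and> 0 \<le> U z")
  case False
  hence Un: "U r < 0" if "0 < r" "r \<le> r0" for r using that by force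
  have "W r0 \<le> 0"
  proof (rule ccontr)
   assume W0: "\<not> W r0 \<le> 0"
   obtain r where r: "0 < r" "r < min 1 r0" "\<bar>W r\<bar> * ew N r < W r0"
    using boundary_radii(2)[OF sol, of "W r0" "min 1 r0"] W0 r0 by auto
   have "W r0 \<le> W r" by (rule W_anti) (use r Un in \<open>auto intro: less_imp_le\<close>)
   moreover have "1 \<le> ew N r" using ew_antimono[of r 1 N] r N by (simp add: ew_def)
   hence "\<bar>W r\<bar> * 1 \<le> \<bar>W r\<bar> * ew N r" by (intro mult_left_mono) auto
   ultimately show False using r(3) by linarith
  qed
  thus ?thesis using Un r0 by (intro exI[of _ r0]) auto
 next
  case True
  then obtain z0 where z0: "0 < z0" "z0 \<le> r0" "0 \<le> U z0" by blast
  define Z where "Z = {z0..r0} \<inter> U -` {0..}"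
  have "closed Z" unfolding Z_def
   by (rule continuous_closed_preimage[OF solution_U_cont[OF sol z0(1)]]) auto
  moreover have "z0 \<in> Z" using z0 by (simp add: Z_def)
  moreover have bdd: "bdd_above Z" by (rule bdd_aboveI[of _ r0]) (simp add: Z_def)
  ultimately have zZ: "Sup Z \<in> Z" by (intro closed_contains_Sup) auto
  define z where "z = Sup Z"
  have z: "z0 \<le> z" "z \<le> r0" "0 \<le> U z" using zZ by (auto simp: Z_def z_def)
  have zr: "z < r0" using z neg by (cases "z = r0") auto
  have Un: "U r < 0" if "z < r" "r \<le> r0" for r
  proof (rule ccontr)
   assume "\<not> U r < 0"
   hence "r \<in> Z" using that z by (simp add: Z_def)
   hence "r \<le> z" unfolding z_def using bdd by (rule cSup_upper)
   thus False using that by simp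
  qed
  obtain \<xi> where \<xi>: "z < \<xi>" "\<xi> < r0" "U r0 - U z = (r0 - z) * (W \<xi> / om N \<xi>)"
   using MVT2[OF zr, of U "\<lambda>r. W r / om N r"] Ud z z0 by auto
  have \<xi>0: "0 < \<xi>" using \<xi> z z0 by simp
  have "(r0 - z) * (W \<xi> / om N \<xi>) < 0" using \<xi>(3) z neg by simp
  hence "W \<xi> / om N \<xi> < 0" using zr unfolding mult_less_0_iff by linarith
  hence "W \<xi> < 0" using om_pos[OF \<xi>0, of N] by (simp add: divide_less_0_iff)
  thus ?thesis using \<xi> \<xi>0 Un by (intro exI[of _ \<xi>]) auto
 qed
 then obtain \<xi> where \<xi>: "0 < \<xi>" "\<xi> \<le> r0" "W \<xi> \<le> 0" "\<And>r. \<xi> \<le> r \<Longrightarrow> r \<le> r0 \<Longrightarrow> U r < 0" by auto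
 \<comment> \<open>Negativity is assumed only before t, and the bound at t comes from the limit from
   the left. Applied at the first t \<ge> r0 with U t \<ge> 0, it shows that there is none.\<close>
 have stay: "U t \<le> U r0" if t: "r0 \<le> t" and n: "\<And>r. r0 \<le> r \<Longrightarrow> r < t \<Longrightarrow> U r < 0" for t
 proof (cases "t = r0")
  case False
  have lt: "U s \<le> U r0" if s: "r0 \<le> s" "s < t" for s
  proof -
   have "W r \<le> 0" if "r0 \<le> r" "r \<le> s" for r
   proof -
    have "W r \<le> W \<xi>" by (rule W_anti) (use \<xi> that s n in \<open>force intro: less_imp_le\<close>)+
    thus ?thesis using \<xi> by simp
   qed
   thus ?thesis by (intro U_anti r0 s) auto
  qed
  show ?thesis
  proof (rule tendsto_upperbound)
   have "isCont U t" using Ud[of t] t r0 DERIV_isCont by auto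
   thus "(U \<longlongrightarrow> U t) (at_left t)" by (simp add: isCont_def filterlim_at_split)
   show "\<forall>\<^sub>F s in at_left t. U s \<le> U r0"
    using eventually_at_left_real[of r0 t] False t by (auto elim!: eventually_mono intro: lt)
  qed simp
 qed simp
 have all: "U t < 0" if t: "r0 \<le> t" for t
 proof (rule ccontr)
  assume nt: "\<not> U t < 0"
  define Y where "Y = {r0..t} \<inter> U -` {0..}"
  have "closed Y" unfolding Y_def
   by (rule continuous_closed_preimage[OF solution_U_cont[OF sol r0]]) auto
  moreover have tY: "t \<in> Y" using nt t by (simp add: Y_def)
  moreover have bdd: "bdd_below Y" by (rule bdd_belowI[of _ r0]) (simp add: Y_def)
  ultimately have yY: "Inf Y \<in> Y" by (intro closed_contains_Inf) auto
  have "U r < 0" if "r0 \<le> r" "r < Inf Y" for r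
  proof (rule ccontr)
   assume "\<not> U r < 0"
   moreover have "r \<le> t" using that cInf_lower[OF tY bdd] by simp
   ultimately have "r \<in> Y" using that by (simp add: Y_def)
   thus False using cInf_lower[OF _ bdd, of r] that by simp
  qed
  hence "U (Inf Y) \<le> U r0" using yY by (intro stay) (auto simp: Y_def)
  thus False using yY neg by (auto simp: Y_def)
 qed
 have "U t \<le> U r0" if "r0 \<le> t" for t by (rule stay[OF that]) (use all in auto)
 moreover have "\<exists>t\<ge>r0. S * ew N t < - U r0"
 proof -
  define q where "q = (real N - 2) / 2"
  have q: "q > 0" using N by (simp add: q_def)
  define t where "t = max r0 ((2 * S / - U r0) powr (1 / q))"
  have t: "0 < t" using r0 by (simp add: t_def)
  have "2 * S / - U r0 = ((2 * S / - U r0) powr (1 / q)) powr q"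
   using q S neg by (simp add: powr_powr divide_pos_neg)
  also have "\<dots> \<le> t powr q" using q by (intro powr_mono2) (auto simp: t_def)
  finally have "2 * S \<le> t powr q * - U r0" using neg by (simp add: field_simps)
  moreover have "ew N t * t powr q = 1" using t by (simp add: ew_def q_def powr_add[symmetric] diff_divide_distrib)
  ultimately have "2 * S * ew N t \<le> - U r0"
   using mult_right_mono[of "2 * S" "t powr q * - U r0" "ew N t"] ew_pos[OF t, of N] by (simp add: algebra_simps)
  moreover have "S * ew N t > 0" using S ew_pos[OF t, of N] by simp
  ultimately have "S * ew N t < - U r0" by linarith
  thus ?thesis by (intro exI[of _ t]) (simp add: t_def)
 qed
 ultimately show False using US r0 by (smt (verit) abs_le_iff)
qed

end

section \<open>Polar coordinates for radial integrands\<close>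

definition cN :: "'a::euclidean_space itself \<Rightarrow> real" where
 "cN _ = real DIM('a) * unit_ball_vol (real DIM('a))"

lemma cN_pos: "0 < cN TYPE('a::euclidean_space)"
 by (simp add: cN_def)

text \<open>Both measures give the half-lines \<open>{..a}\<close> the volume of a ball, and these
  sets form an intersection-stable generator. The constant \<open>cN\<close>, N times the volume of
  the unit ball, is the area of the unit sphere.\<close>

lemma distr_norm_lborel:
 "distr (lborel :: 'a::euclidean_space measure) borel norm =
   density lborel (\<lambda>r. ennreal (indicator {0..} r * (cN TYPE('a) * om DIM('a) r)))" (is "?M = ?D")
proof (rule measure_eqI_generator_eq[where E = "range (\<lambda>a::real. {..a})" and \<Omega> = UNIV and A = "\<lambda>n. {..real n}"])
 let ?N = "DIM('a)"
 have N: "0 < ?N" by simp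
 show "Int_stable (range (\<lambda>a::real. {..a}))"
 proof (rule Int_stableI)
  fix A B assume "A \<in> range (\<lambda>a::real. {..a})" "B \<in> range (\<lambda>a::real. {..a})"
  then obtain a b where "A = {..a}" "B = {..b}" by blast
  hence "A \<inter> B = {..min a b}" by auto
  thus "A \<inter> B \<in> range (\<lambda>a::real. {..a})" by blast
 qed
 show "sets ?M = sigma_sets UNIV (range (\<lambda>a::real. {..a}))" "sets ?D = sigma_sets UNIV (range (\<lambda>a::real. {..a}))"
  by (simp_all add: borel_eq_atMost)
 show "(\<Union>i. {..real i}) = UNIV" using real_arch_simple by auto
 have eM: "emeasure ?M {..a} = ennreal (if a < 0 then 0 else unit_ball_vol (real ?N) * a ^ ?N)" for a
 proof -
  have "emeasure ?M {..a} = emeasure lborel (cball (0::'a) a)"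
   by (subst emeasure_distr) (auto intro!: arg_cong[of _ _ "emeasure lborel"])
  thus ?thesis by (cases "a < 0") (auto simp: emeasure_cball)
 qed
 show "emeasure ?M {..real i} \<noteq> \<infinity>" for i by (simp add: eM)
 fix X assume "X \<in> range (\<lambda>a::real. {..a})"
 then obtain a where X: "X = {..a}" by blast
 have "emeasure ?D {..a} = (\<integral>\<^sup>+r. ennreal (cN TYPE('a) * om ?N r) * indicator {0..a} r \<partial>lborel)"
  by (subst emeasure_density) (auto intro!: nn_integral_cong simp: indicator_def om_def)
 also have "\<dots> = ennreal (if a < 0 then 0 else unit_ball_vol (real ?N) * a ^ ?N)"
 proof (cases "a < 0")
  case False
  have "(\<integral>\<^sup>+r. ennreal (cN TYPE('a) * om ?N r) * indicator {0..a} r \<partial>lborel) = ennreal (unit_ball_vol (real ?N) * a ^ ?N - unit_ball_vol (real ?N) * 0 ^ ?N)"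
  proof (rule nn_integral_FTC_Icc)
   show "(\<lambda>r. cN TYPE('a) * om ?N r) \<in> borel_measurable borel" unfolding om_def by measurable
   show "((\<lambda>r. unit_ball_vol (real ?N) * r ^ ?N) has_real_derivative cN TYPE('a) * om ?N x) (at x)" for x
    by (rule derivative_eq_intros refl | simp add: cN_def om_def)+
   show "0 \<le> cN TYPE('a) * om ?N x" if "x \<in> {0..a}" for x using that by (simp add: cN_def om_def)
  qed (use False in auto)
  thus ?thesis using False N by simp
 qed auto
 finally show "emeasure ?M X = emeasure ?D X" by (simp add: X eM)
qed auto

lemma polar_nn_integral:
 assumes F: "F \<in> borel_measurable borel"
 shows "(\<integral>\<^sup>+x. F (norm (x::'a::euclidean_space)) \<partial>lebesgue) =
  (\<integral>\<^sup>+r. ennreal (indicator {0..} r * (cN TYPE('a) * om DIM('a) r)) * F r \<partial>lborel)"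
proof -
 have "(\<integral>\<^sup>+x. F (norm (x::'a)) \<partial>lebesgue) = (\<integral>\<^sup>+x. F (norm (x::'a)) \<partial>lborel)"
  by (rule nn_integral_completion)
 also have "\<dots> = (\<integral>\<^sup>+r. F r \<partial>distr (lborel :: 'a measure) borel norm)"
  using F by (subst nn_integral_distr) auto
 also have "\<dots> = (\<integral>\<^sup>+r. ennreal (indicator {0..} r * (cN TYPE('a) * om DIM('a) r)) * F r \<partial>lborel)"
  unfolding distr_norm_lborel using F by (subst nn_integral_density) (auto simp: om_def)
 finally show ?thesis .
qed

lemma polar_AE:
 assumes P: "Measurable.pred borel P"
 shows "(AE x in (lebesgue :: 'a::euclidean_space measure). P (norm x)) \<longleftrightarrow> (AE r in lborel. 0 < r \<longrightarrow> P r)"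
proof -
 have "(AE x in (lebesgue :: 'a measure). P (norm x)) \<longleftrightarrow> (AE x in (lborel :: 'a measure). P (norm x))"
  by (rule AE_completion_iff)
 also have "\<dots> \<longleftrightarrow> (AE r in distr (lborel :: 'a measure) borel norm. P r)"
  using P by (subst AE_distr_iff) auto
 also have "\<dots> \<longleftrightarrow> (AE r in lborel. 0 < ennreal (indicator {0..} r * (cN TYPE('a) * om DIM('a) r)) \<longrightarrow> P r)"
  unfolding distr_norm_lborel by (subst AE_density) (auto simp: om_def)
 also have "\<dots> \<longleftrightarrow> (AE r in lborel. 0 < r \<longrightarrow> P r)"
 proof (rule iffI)
  assume "AE r in lborel. 0 < ennreal (indicator {0..} r * (cN TYPE('a) * om DIM('a) r)) \<longrightarrow> P r"
  thus "AE r in lborel. 0 < r \<longrightarrow> P r"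
   by eventually_elim (auto simp: om_pos cN_pos)
 next
  assume "AE r in lborel. 0 < r \<longrightarrow> P r"
  moreover have "AE r in lborel. r \<noteq> (0::real)" by (rule AE_lborel_singleton)
  ultimately show "AE r in lborel. 0 < ennreal (indicator {0..} r * (cN TYPE('a) * om DIM('a) r)) \<longrightarrow> P r"
   by eventually_elim (auto simp: indicator_def split: if_splits)
 qed
 finally show ?thesis .
qed

lemma polar_shell:
 fixes F :: "real \<Rightarrow> real"
 assumes a: "0 < a" and F: "continuous_on {a..b} F" and F0: "\<And>r. r \<in> {a..b} \<Longrightarrow> 0 \<le> F r"
 shows "(\<integral>\<^sup>+x. ennreal (F (norm x)) * indicator {x. a \<le> norm x \<and> norm x \<le> b} x \<partial>(lebesgue :: 'a::euclidean_space measure))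
  = ennreal (cN TYPE('a) * integral {a..b} (\<lambda>r. om DIM('a) r * F r))"
proof -
 let ?G = "\<lambda>r. F r * indicator {a..b} r"
 have Gm: "(\<lambda>r. ennreal (?G r)) \<in> borel_measurable borel"
  using borel_measurable_continuous_on_indicator[OF _ F] by (simp add: mult.commute)
 have "(\<integral>\<^sup>+x. ennreal (F (norm x)) * indicator {x. a \<le> norm x \<and> norm x \<le> b} x \<partial>(lebesgue :: 'a measure)) =
  (\<integral>\<^sup>+x. ennreal (?G (norm (x::'a))) \<partial>lebesgue)"
  by (intro nn_integral_cong) (auto simp: indicator_def)
 also have "\<dots> = (\<integral>\<^sup>+r. ennreal (indicator {0..} r * (cN TYPE('a) * om DIM('a) r)) * ennreal (?G r) \<partial>lborel)"
  by (rule polar_nn_integral[OF Gm])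
 also have "\<dots> = (\<integral>\<^sup>+r. ennreal (indicator {a..b} r * (cN TYPE('a) * (om DIM('a) r * F r))) \<partial>lborel)"
 proof (intro nn_integral_cong)
  fix r :: real
  show "ennreal (indicator {0..} r * (cN TYPE('a) * om DIM('a) r)) * ennreal (?G r) =
   ennreal (indicator {a..b} r * (cN TYPE('a) * (om DIM('a) r * F r)))"
  proof (cases "r \<in> {a..b}")
   case True
   thus ?thesis using a F0[OF True] by (simp add: ennreal_mult'[symmetric] mult_ac)
  qed simp
 qed
 also have "\<dots> = ennreal (integral {a..b} (\<lambda>r. cN TYPE('a) * (om DIM('a) r * F r)))"
 proof (rule nn_integral_has_integral_lebesgue)
  show "0 \<le> cN TYPE('a) * (om DIM('a) r * F r)" if "r \<in> {a..b}" for r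
   using that a F0[OF that] om_pos[of r "DIM('a)"] cN_pos[where 'a='a] by auto
  show "((\<lambda>r. cN TYPE('a) * (om DIM('a) r * F r)) has_integral integral {a..b} (\<lambda>r. cN TYPE('a) * (om DIM('a) r * F r))) {a..b}"
   by (intro integrable_integral integrable_continuous_real continuous_intros F)
 qed
 finally show ?thesis by simp
qed

text \<open>The signed counterpart of \<open>polar_shell\<close>, for Bochner integrals. The inner
  radius may be 0, because \<open>weak_null\<close> integrates by parts down to the origin.\<close>

lemma polar_shell_integral:
 fixes F :: "real \<Rightarrow> real"
 assumes a: "0 \<le> a" and F: "continuous_on {a..b} F"
 defines "X \<equiv> {x :: 'a::euclidean_space. a \<le> norm x \<and> norm x \<le> b}"
 shows "(\<integral>x. indicator X x * F (norm x) \<partial>lebesgue) = cN TYPE('a) * integral {a..b} (\<lambda>r. om DIM('a) r * F r)"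
  and "integrable lebesgue (\<lambda>x. indicator X x * F (norm x))"
proof -
 let ?N = "DIM('a)"
 let ?G = "\<lambda>r. indicator {a..b} r * F r"
 let ?d = "\<lambda>r. indicator {0..} r * (cN TYPE('a) * om ?N r)"
 have Gm: "?G \<in> borel_measurable borel"
  using borel_measurable_continuous_on_indicator[OF _ F] by simp
 have d0: "AE r in lborel. 0 \<le> ?d r" by (auto simp: om_def cN_def indicator_def)
 have dm: "?d \<in> borel_measurable borel" unfolding om_def by measurable
 have XG: "(\<lambda>x. indicator X x * F (norm x)) = (\<lambda>x. ?G (norm x))" by (auto simp: X_def indicator_def)
 have GX: "(\<lambda>x::'a. ?G (norm x)) \<in> borel_measurable lborel" using Gm by measurable
 have cont: "continuous_on {a..b} (\<lambda>r. om ?N r * F r)" by (intro continuous_intros F)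
 have dG: "(\<lambda>r. ?d r *\<^sub>R ?G r) = (\<lambda>r. cN TYPE('a) * (indicator {a..b} r *\<^sub>R (om ?N r * F r)))"
  using a by (auto simp: indicator_def)
 have si: "set_integrable lborel {a..b} (\<lambda>r. om ?N r * F r)"
  by (rule borel_integrable_atLeastAtMost') (rule cont)
 hence int: "integrable lborel (\<lambda>r. ?d r *\<^sub>R ?G r)"
  unfolding dG set_integrable_def by (rule integrable_mult_right)
 have "integrable (distr (lborel :: 'a measure) borel norm) ?G"
  unfolding distr_norm_lborel using int by (subst integrable_density) (use Gm dm d0 in auto)
 hence il: "integrable lborel (\<lambda>x::'a. ?G (norm x))"
  by (subst (asm) integrable_distr_eq) (use Gm in auto)
 thus "integrable lebesgue (\<lambda>x. indicator X x * F (norm x))"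
  unfolding XG by (subst integrable_completion) (use GX in auto)
 have "(\<integral>x. indicator X x * F (norm x) \<partial>lebesgue) = (\<integral>x. ?G (norm (x::'a)) \<partial>lborel)"
  unfolding XG by (rule integral_completion[OF GX])
 also have "\<dots> = integral\<^sup>L (distr (lborel :: 'a measure) borel norm) ?G"
  by (subst integral_distr) (use Gm in auto)
 also have "\<dots> = (\<integral>r. ?d r *\<^sub>R ?G r \<partial>lborel)"
  unfolding distr_norm_lborel by (subst integral_density) (use Gm dm d0 in auto)
 also have "\<dots> = cN TYPE('a) * (LINT r:{a..b}|lborel. om ?N r * F r)"
  unfolding dG set_lebesgue_integral_def by simp
 also have "(LINT r:{a..b}|lborel. om ?N r * F r) = integral {a..b} (\<lambda>r. om ?N r * F r)"
  by (rule set_borel_integral_eq_integral(2)[OF si])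
 finally show "(\<integral>x. indicator X x * F (norm x) \<partial>lebesgue) = cN TYPE('a) * integral {a..b} (\<lambda>r. om ?N r * F r)" .
qed

text \<open>Monotone convergence along the shells 1/(n+1) \<le> |x| \<le> n+1, which exhaust
  everything but the origin. Integrands singular at 0 are thus controlled by bounds away from
  it.\<close>

lemma nn_integral_le_of_shells:
 fixes f :: "'a::euclidean_space \<Rightarrow> ennreal"
 assumes f: "f \<in> borel_measurable lebesgue"
  and le: "\<And>a b. 0 < a \<Longrightarrow> a \<le> 1 \<Longrightarrow> 1 \<le> b \<Longrightarrow> (\<integral>\<^sup>+x. f x * indicator {x. a \<le> norm x \<and> norm x \<le> b} x \<partial>lebesgue) \<le> C"
 shows "(\<integral>\<^sup>+x. f x \<partial>lebesgue) \<le> C"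
proof -
 define X where "X n = {x::'a. 1 / (real n + 1) \<le> norm x \<and> norm x \<le> real n + 1}" for n
 have Xm: "X n \<in> sets lebesgue" for n
 proof -
  have "X n = cball 0 (real n + 1) - ball 0 (1 / (real n + 1))" by (auto simp: X_def)
  thus ?thesis by simp
 qed
 have inc: "incseq X"
 proof (rule incseq_SucI)
  fix n
  have "1 / (real (Suc n) + 1) \<le> 1 / (real n + 1)" by (intro divide_left_mono) auto
  thus "X n \<le> X (Suc n)" by (auto simp: X_def)
 qed
 have cov: "\<exists>n. x \<in> X n" if "x \<noteq> 0" for x
 proof -
  obtain n where n: "real n > max (1 / norm x) (norm x)" using reals_Archimedean2 by blast
  hence "1 / norm x \<le> real n + 1" "norm x \<le> real n + 1" by auto
  hence "x \<in> X n" using that by (simp add: X_def field_simps)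
  thus ?thesis ..
 qed
 have "(\<integral>\<^sup>+x. f x \<partial>lebesgue) = (\<integral>\<^sup>+x. (SUP n. f x * indicator (X n) x) \<partial>lebesgue)"
 proof (rule nn_integral_cong_AE)
  have "AE x in lebesgue. x \<noteq> (0::'a)" by (intro AE_completion AE_lborel_singleton)
  thus "AE x in lebesgue. f x = (SUP n. f x * indicator (X n) x)"
  proof eventually_elim
   case (elim x)
   obtain n where n: "x \<in> X n" using cov[OF elim] by blast
   show ?case
   proof (rule antisym)
    show "f x \<le> (SUP n. f x * indicator (X n) x)" using n by (intro SUP_upper2[of n]) auto
    show "(SUP n. f x * indicator (X n) x) \<le> f x" by (rule SUP_least) (simp add: indicator_def)
   qed
  qed
 qed
 also have "\<dots> = (SUP n. \<integral>\<^sup>+x. f x * indicator (X n) x \<partial>lebesgue)"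
 proof (rule nn_integral_monotone_convergence_SUP)
  show "incseq (\<lambda>n x. f x * indicator (X n) x)"
   using inc by (auto simp: incseq_def le_fun_def indicator_def intro!: mult_left_mono)
  show "(\<lambda>x. f x * indicator (X n) x) \<in> borel_measurable lebesgue" for n using f Xm by measurable
 qed
 also have "\<dots> \<le> C" unfolding X_def by (intro SUP_least le) (auto simp: field_simps)
 finally show ?thesis .
qed

section \<open>Radial test functions and their profiles\<close>

lemma smooth_funD:
 assumes "smooth_fun f"
 shows "f differentiable (at x)" and "b \<in> Basis \<Longrightarrow> smooth_fun (\<lambda>x. frechet_derivative f (at x) b)"
 using assms by (auto elim: smooth_fun.cases)

lemma smooth_fun_cont: "smooth_fun f \<Longrightarrow> isCont f x"
 using smooth_funD(1) differentiable_imp_continuous_within by blast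

text \<open>Coinduction with the set of all combinations having the fixed coefficients s and t; it
  is closed under partial derivatives.\<close>

lemma smooth_fun_lincomb:
 assumes "smooth_fun f" "smooth_fun h"
 shows "smooth_fun (\<lambda>x. s * f x + t * h x)"
proof -
 define X where "X k \<longleftrightarrow> (\<exists>f h. smooth_fun f \<and> smooth_fun h \<and> k = (\<lambda>x. s * f x + t * h x))" for k :: "'a \<Rightarrow> real"
 have "X (\<lambda>x. s * f x + t * h x)" using assms by (auto simp: X_def)
 thus ?thesis
 proof (rule smooth_fun.coinduct[where X = X and x = "\<lambda>x. s * f x + t * h x"])
  fix k assume "X k"
  then obtain f h where fh: "smooth_fun f" "smooth_fun h" and k: "k = (\<lambda>x. s * f x + t * h x)" by (auto simp: X_def)
  have d: "(k has_derivative (\<lambda>v. s * frechet_derivative f (at x) v + t * frechet_derivative h (at x) v)) (at x)" for x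
   unfolding k using fh smooth_funD(1)
   by (intro has_derivative_add has_derivative_mult_right frechet_derivative_works[THEN iffD1]) auto
  have fd: "frechet_derivative k (at x) = (\<lambda>v. s * frechet_derivative f (at x) v + t * frechet_derivative h (at x) v)" for x
   using frechet_derivative_at[OF d] by simp
  have "X (\<lambda>x. frechet_derivative k (at x) b)" if "b \<in> Basis" for b
   unfolding X_def fd using smooth_funD(2)[OF fh(1) that] smooth_funD(2)[OF fh(2) that] by blast
  moreover have "k differentiable (at x)" for x using d differentiableI by blast
  ultimately show "\<exists>f. k = f \<and> (\<forall>x. f differentiable at x) \<and>
    (\<forall>b\<in>Basis. X (\<lambda>x. frechet_derivative f (at x) b) \<or> smooth_fun (\<lambda>x. frechet_derivative f (at x) b))" by auto
 qed
qed

lemma frechet_lincomb: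
 assumes "smooth_fun f" "smooth_fun h"
 shows "frechet_derivative (\<lambda>x. s * f x + t * h x) (at x) =
   (\<lambda>v. s * frechet_derivative f (at x) v + t * frechet_derivative h (at x) v)"
proof -
 have "((\<lambda>x. s * f x + t * h x) has_derivative (\<lambda>v. s * frechet_derivative f (at x) v + t * frechet_derivative h (at x) v)) (at x)"
  using assms smooth_funD(1)
  by (intro has_derivative_add has_derivative_mult_right frechet_derivative_works[THEN iffD1]) auto
 thus ?thesis using frechet_derivative_at by metis
qed

lemma grad_lincomb:
 assumes "smooth_fun f" "smooth_fun h"
 shows "grad (\<lambda>x. s * f x + t * h x) x = s *\<^sub>R grad f x + t *\<^sub>R grad h x"
 unfolding grad_def frechet_lincomb[OF assms]
 by (simp add: scaleR_left_distrib sum.distrib scaleR_right.sum)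

lemma grad_cont: "smooth_fun f \<Longrightarrow> continuous_on UNIV (grad f)"
 unfolding grad_def[abs_def]
 by (intro continuous_on_sum continuous_on_scaleR continuous_on_const continuous_at_imp_continuous_on ballI)
  (auto intro!: smooth_fun_cont smooth_funD(2))

lemma radial_testD:
 assumes "radial_test f"
 shows "smooth_fun f" "bounded {x. f x \<noteq> 0}" "norm x = norm y \<Longrightarrow> f x = f y"
 using assms unfolding radial_test_def by blast+

lemma radial_test_lincomb:
 assumes "radial_test f" "radial_test h"
 shows "radial_test (\<lambda>x. s * f x + t * h x)"
proof -
 have "{x. s * f x + t * h x \<noteq> 0} \<subseteq> {x. f x \<noteq> 0} \<union> {x. h x \<noteq> 0}" by auto
 moreover have "bounded ({x. f x \<noteq> 0} \<union> {x. h x \<noteq> 0})"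
  using radial_testD(2)[OF assms(1)] radial_testD(2)[OF assms(2)] by (rule bounded_Un[THEN iffD2, OF conjI])
 ultimately have "bounded {x. s * f x + t * h x \<noteq> 0}" by (rule bounded_subset[rotated])
 moreover have "\<forall>x y. norm x = norm y \<longrightarrow> s * f x + t * h x = s * f y + t * h y"
  using radial_testD(3)[OF assms(1)] radial_testD(3)[OF assms(2)] by metis
 ultimately show ?thesis
  using smooth_fun_lincomb[OF radial_testD(1)[OF assms(1)] radial_testD(1)[OF assms(2)]]
  unfolding radial_test_def by blast
qed

definition e0 :: "'a::euclidean_space" where "e0 = (SOME i. i \<in> Basis)"

lemma e0_Basis: "(e0::'a::euclidean_space) \<in> Basis"
 unfolding e0_def by (rule SOME_Basis)

lemma norm_e0 [simp]: "norm (e0::'a::euclidean_space) = 1"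
 using e0_Basis norm_Basis by blast

text \<open>The restriction to the line through a fixed unit vector. Being defined for all real r,
  it is smooth across r = 0, and its derivative \<open>dprof\<close> is the profile of a partial
  derivative, so the construction can be iterated.\<close>

definition prof :: "('a::euclidean_space \<Rightarrow> real) \<Rightarrow> real \<Rightarrow> real" where
 "prof phi r = phi (r *\<^sub>R e0)"

definition dprof :: "('a::euclidean_space \<Rightarrow> real) \<Rightarrow> real \<Rightarrow> real" where
 "dprof phi r = frechet_derivative phi (at (r *\<^sub>R e0)) e0"

lemma prof_deriv:
 assumes "smooth_fun phi" shows "(prof phi has_real_derivative dprof phi r) (at r)"
proof -
 let ?D = "frechet_derivative phi (at (r *\<^sub>R e0))"
 have d: "(phi has_derivative ?D) (at (r *\<^sub>R e0))"
  using smooth_funD(1)[OF assms] frechet_derivative_works by blast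
 have "((\<lambda>r. phi (r *\<^sub>R e0)) has_derivative (\<lambda>v. ?D (v *\<^sub>R e0))) (at r)"
  by (rule has_derivative_compose[where g = phi and f = "\<lambda>r. r *\<^sub>R e0", OF _ d]) (auto intro!: derivative_eq_intros)
 moreover have "?D (v *\<^sub>R e0) = dprof phi r * v" for v
  using linear_scale[OF has_derivative_linear[OF d], of v e0] by (simp add: dprof_def mult.commute)
 ultimately show ?thesis
  unfolding prof_def[abs_def] has_field_derivative_def by (simp add: mult_commute_abs)
qed

lemma dprof_eq: "dprof phi = prof (\<lambda>x. frechet_derivative phi (at x) e0)"
 by (auto simp: dprof_def prof_def)

lemma dprof_deriv:
 assumes "smooth_fun phi"
 shows "(dprof phi has_real_derivative dprof (\<lambda>x. frechet_derivative phi (at x) e0) r) (at r)"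
 unfolding dprof_eq[of phi] by (rule prof_deriv[OF smooth_funD(2)[OF assms e0_Basis]])

lemma prof_cont: "smooth_fun phi \<Longrightarrow> continuous_on S (prof phi)"
 using prof_deriv DERIV_isCont by (intro continuous_at_imp_continuous_on) blast
lemma dprof_cont: "smooth_fun phi \<Longrightarrow> continuous_on S (dprof phi)"
 using dprof_deriv DERIV_isCont by (intro continuous_at_imp_continuous_on) blast
lemma ddprof_cont: "smooth_fun phi \<Longrightarrow> continuous_on S (dprof (\<lambda>x. frechet_derivative phi (at x) e0))"
 by (rule dprof_cont[OF smooth_funD(2)[OF _ e0_Basis]])

lemma radial_test_prof: "radial_test phi \<Longrightarrow> phi x = prof phi (norm x)"
 unfolding prof_def by (rule radial_testD(3)) simp_all

lemma radial_test_support: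
 assumes "radial_test phi"
 obtains B where "1 \<le> B" "\<And>r. B \<le> r \<Longrightarrow> prof phi r = 0" "\<And>r. B \<le> r \<Longrightarrow> dprof phi r = 0" "\<And>x. B \<le> norm x \<Longrightarrow> phi x = 0"
proof -
 obtain B0 where B0: "\<And>x. phi x \<noteq> 0 \<Longrightarrow> norm x \<le> B0"
  using radial_testD(2)[OF assms] unfolding bounded_iff by auto
 \<comment> \<open>The margin beyond B0 makes the profile vanish on a neighbourhood of every r \<ge>
   B, so the derivative vanishes there as well.\<close>
 define B where "B = \<bar>B0\<bar> + 2"
 have z: "phi x = 0" if "\<bar>B0\<bar> < norm x" for x using B0[of x] that by force
 have pz: "prof phi r = 0" if "\<bar>B0\<bar> < r" for r unfolding prof_def by (rule z) (use that in auto)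
 have "dprof phi r = 0" if r: "B \<le> r" for r
 proof -
  have "((\<lambda>_. 0::real) has_real_derivative 0) (at r)" by simp
  hence "(prof phi has_real_derivative 0) (at r)"
   by (rule has_field_derivative_transform_within_open[where S = "{\<bar>B0\<bar><..}"]) (use pz r in \<open>auto simp: B_def\<close>)
  moreover have "(prof phi has_real_derivative dprof phi r) (at r)"
   by (rule prof_deriv[OF radial_testD(1)[OF assms]])
  ultimately show ?thesis using DERIV_unique by blast
 qed
 moreover have "1 \<le> B" by (simp add: B_def)
 ultimately show thesis using pz z by (intro that[of B]) (auto simp: B_def)
qed

lemma radial_test_grad:
 fixes x :: "'a::euclidean_space"
 assumes "radial_test phi" and x: "x \<noteq> 0"
 shows "grad phi x = (dprof phi (norm x) / norm x) *\<^sub>R x"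
proof -
 have sm: "smooth_fun phi" by (rule radial_testD(1)[OF assms(1)])
 have "phi = (\<lambda>x. prof phi (norm x))" using radial_test_prof[OF assms(1)] by auto
 moreover have "((\<lambda>x. prof phi (norm x)) has_derivative (\<lambda>v. (x \<bullet> v) / norm x * dprof phi (norm x))) (at x)"
 proof -
  have n: "(norm has_derivative (\<lambda>v. (x \<bullet> v) / norm x)) (at x)"
   using has_derivative_norm[OF x] by (simp add: sgn_div_norm inner_commute divide_inverse mult.commute)
  from has_derivative_compose[OF n prof_deriv[OF sm, unfolded has_field_derivative_def]]
  show ?thesis by (simp add: mult.commute)
 qed
 ultimately have fd: "frechet_derivative phi (at x) = (\<lambda>v. (x \<bullet> v) / norm x * dprof phi (norm x))"
  using frechet_derivative_at by metis
 have "grad phi x = (\<Sum>b\<in>Basis. (dprof phi (norm x) / norm x) *\<^sub>R ((x \<bullet> b) *\<^sub>R b))"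
  unfolding grad_def fd by (simp add: mult_ac)
 also have "\<dots> = (dprof phi (norm x) / norm x) *\<^sub>R x"
  unfolding scaleR_right.sum[symmetric] by (simp add: euclidean_representation)
 finally show ?thesis .
qed

lemma radial_test_grad_norm:
 assumes "radial_test phi" "x \<noteq> 0"
 shows "norm (grad phi x) = \<bar>dprof phi (norm x)\<bar>"
 using assms by (simp add: radial_test_grad)

definition L2sq :: "('a::euclidean_space \<Rightarrow> 'a) \<Rightarrow> ennreal" where
 "L2sq G = (\<integral>\<^sup>+x. ennreal ((norm (G x))\<^sup>2) \<partial>lebesgue)"

lemma AE_nonzero: "AE x in lebesgue. x \<noteq> (0::'a::euclidean_space)"
 by (intro AE_completion AE_lborel_singleton)

lemma nsq_dprof_le:
 fixes phi :: "'a::euclidean_space \<Rightarrow> real"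
 assumes phi: "radial_test phi" and a: "0 < a"
 shows "ennreal (cN TYPE('a) * nsq DIM('a) a b (dprof phi)) \<le> L2sq (grad phi)"
proof -
 have sm: "smooth_fun phi" by (rule radial_testD(1)[OF phi])
 let ?X = "{x::'a. a \<le> norm x \<and> norm x \<le> b}"
 have "ennreal (cN TYPE('a) * integral {a..b} (\<lambda>r. om DIM('a) r * (dprof phi r)\<^sup>2)) =
   (\<integral>\<^sup>+x. ennreal ((dprof phi (norm x))\<^sup>2) * indicator ?X x \<partial>lebesgue)"
  by (rule polar_shell[symmetric, OF a]) (auto intro!: continuous_intros dprof_cont sm)
 also have "\<dots> \<le> L2sq (grad phi)"
  unfolding L2sq_def
 proof (rule nn_integral_mono_AE)
  show "AE x in lebesgue. ennreal ((dprof phi (norm x))\<^sup>2) * indicator ?X x \<le> ennreal ((norm (grad phi x))\<^sup>2)"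
   using AE_nonzero by eventually_elim (auto simp: indicator_def radial_test_grad_norm[OF phi])
 qed
 finally show ?thesis by (simp add: nsq_def mult.commute)
qed

lemma L2sq_grad_finite:
 fixes phi :: "'a::euclidean_space \<Rightarrow> real"
 assumes phi: "radial_test phi" shows "L2sq (grad phi) < \<infinity>"
proof -
 have sm: "smooth_fun phi" by (rule radial_testD(1)[OF phi])
 obtain B where B: "\<And>r. B \<le> r \<Longrightarrow> dprof phi r = 0" using radial_test_support[OF phi] by metis
 have "bounded (grad phi ` cball 0 B)"
  by (intro compact_imp_bounded compact_continuous_image continuous_on_subset[OF grad_cont[OF sm]]) auto
 then obtain M where M: "\<And>x. x \<in> cball 0 B \<Longrightarrow> norm (grad phi x) \<le> M"
  unfolding bounded_iff ball_simps by metis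
 have "L2sq (grad phi) \<le> (\<integral>\<^sup>+x. ennreal (M\<^sup>2) * indicator (cball (0::'a) B) x \<partial>lebesgue)"
  unfolding L2sq_def
 proof (rule nn_integral_mono_AE)
  show "AE x in lebesgue. ennreal ((norm (grad phi x))\<^sup>2) \<le> ennreal (M\<^sup>2) * indicator (cball (0::'a) B) x"
   using AE_nonzero
  proof eventually_elim
   case (elim x)
   show ?case
   proof (cases "x \<in> cball 0 B")
    case True
    thus ?thesis using M[OF True] by (auto intro!: ennreal_leI power_mono)
   next
    case False
    hence "norm (grad phi x) = 0" using radial_test_grad_norm[OF phi elim] B[of "norm x"] by simp
    thus ?thesis by simp
   qed
  qed
 qed
 also have "\<dots> = ennreal (M\<^sup>2) * emeasure lebesgue (cball (0::'a) B)"
  by (rule nn_integral_cmult_indicator) auto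
 also have "\<dots> < \<infinity>" using emeasure_bounded_finite[OF bounded_cball, of "0::'a" B] by (simp add: ennreal_mult_less_top)
 finally show ?thesis .
qed

text \<open>Integrate the derivative from r to a radius beyond the support and apply
  \<open>integral_le_nsq\<close>.\<close>

lemma radial_test_pointwise:
 fixes phi :: "'a::euclidean_space \<Rightarrow> real"
 assumes N: "3 \<le> DIM('a)" and phi: "radial_test phi" and r: "0 < r" and M: "L2sq (grad phi) \<le> ennreal (cN TYPE('a) * M\<^sup>2)" "0 \<le> M"
 shows "\<bar>prof phi r\<bar> \<le> M * ew DIM('a) r"
proof -
 have sm: "smooth_fun phi" by (rule radial_testD(1)[OF phi])
 obtain B where B: "1 \<le> B" "\<And>r. B \<le> r \<Longrightarrow> prof phi r = 0" using radial_test_support[OF phi] by metis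
 define b where "b = max r B"
 have "(dprof phi has_integral (prof phi b - prof phi r)) {r..b}"
  by (rule fundamental_theorem_of_calculus)
   (auto simp: b_def has_real_derivative_iff_has_vector_derivative[symmetric] intro!: has_field_derivative_at_within prof_deriv sm)
 hence "prof phi r = - integral {r..b} (dprof phi)" using B(2)[of b] by (simp add: integral_unique b_def)
 hence "\<bar>prof phi r\<bar> \<le> sqrt (nsq DIM('a) r b (dprof phi)) * ew DIM('a) r"
  using integral_le_nsq[OF N r _ dprof_cont[OF sm], of b] by (simp add: b_def)
 also have "\<dots> \<le> M * ew DIM('a) r"
 proof (rule mult_right_mono)
  have "ennreal (cN TYPE('a) * nsq DIM('a) r b (dprof phi)) \<le> ennreal (cN TYPE('a) * M\<^sup>2)"
   using nsq_dprof_le[OF phi r] M(1) by (rule order_trans)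
  hence "cN TYPE('a) * nsq DIM('a) r b (dprof phi) \<le> cN TYPE('a) * M\<^sup>2"
   using cN_pos[where 'a='a] by (simp add: ennreal_le_iff)
  hence "nsq DIM('a) r b (dprof phi) \<le> M\<^sup>2" using cN_pos[where 'a='a] by simp
  thus "sqrt (nsq DIM('a) r b (dprof phi)) \<le> M" using M(2) by (intro real_le_lsqrt) (auto intro: nsq_nonneg r)
 qed (use ew_pos[OF r, of "DIM('a)"] in simp)
 finally show ?thesis .
qed

text \<open>Hardy's inequality from the derivative of F^2 r^(N-2): the boundary term is 0 at b and
  has a favourable sign at a. With A the left side, the cross term is at most A/2 plus twice the
  energy; since N - 2 \<ge> 1, this leaves A/2 \<le> 2 \<open>nsq\<close> and the constant
  4.\<close>

lemma hardy_shell: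
 assumes N: "3 \<le> N" and ab: "0 < a" "a \<le> b" and F: "\<And>r. (F has_real_derivative F' r) (at r)"
  and F'c: "continuous_on {a..b} F'" and Fb: "F b = 0"
 shows "integral {a..b} (\<lambda>r. om N r * ((F r)\<^sup>2 / r\<^sup>2)) \<le> 4 * nsq N a b F'"
proof -
 have Fc: "continuous_on {a..b} F" using F by (intro continuous_at_imp_continuous_on ballI DERIV_isCont)
 have r0: "0 < r" if "r \<in> {a..b}" for r using that ab by auto
 note ii = integrable_continuous_real continuous_intros Fc F'c
 let ?A = "\<lambda>r. om N r * ((F r)\<^sup>2 / r\<^sup>2)" and ?B = "\<lambda>r. 2 * F r * F' r * r ^ (N - 2)"
 have iA: "?A integrable_on {a..b}" by (intro ii) (use ab in auto)
 have iB: "?B integrable_on {a..b}" by (intro ii)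
 have iC: "(\<lambda>r. (F' r)\<^sup>2 * om N r) integrable_on {a..b}" by (intro ii)
 have omr: "om N r / r\<^sup>2 = r ^ (N - 3)" "om N r = r ^ (N - 2) * r" if "0 < r" for r
 proof -
  have "om N r = r ^ (N - 3) * r\<^sup>2" using N unfolding om_def power_add[symmetric] by (intro arg_cong[of _ _ "power r"]) simp
  thus "om N r / r\<^sup>2 = r ^ (N - 3)" using that by simp
  show "om N r = r ^ (N - 2) * r" using N unfolding om_def power_Suc2[symmetric] by (intro arg_cong[of _ _ "power r"]) simp
 qed
 have "((\<lambda>r. ?B r + (real N - 2) * ?A r) has_integral ((F b)\<^sup>2 * b ^ (N - 2) - (F a)\<^sup>2 * a ^ (N - 2))) {a..b}"
 proof (rule fundamental_theorem_of_calculus[OF ab(2)])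
  fix r assume r: "r \<in> {a..b}"
  have "((\<lambda>r. (F r)\<^sup>2 * r ^ (N - 2)) has_real_derivative 2 * F r * F' r * r ^ (N - 2) + real (N - 2) * r ^ (N - 2 - 1) * (F r)\<^sup>2) (at r)"
   by (rule derivative_eq_intros F refl | simp)+
  also have "real (N - 2) * r ^ (N - 2 - 1) * (F r)\<^sup>2 = (real N - 2) * ?A r"
  proof -
   have "?A r = (om N r / r\<^sup>2) * (F r)\<^sup>2" by simp
   moreover have "N - 2 - 1 = N - 3" by simp
   ultimately show ?thesis using omr(1)[OF r0[OF r]] N by (simp only: of_nat_diff) simp
  qed
  finally show "((\<lambda>r. (F r)\<^sup>2 * r ^ (N - 2)) has_vector_derivative ?B r + (real N - 2) * ?A r) (at r within {a..b})"
   by (simp add: vector_derivative_simps)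
 qed
 from integral_unique[OF this]
 have "integral {a..b} ?B + (real N - 2) * integral {a..b} ?A = (F b)\<^sup>2 * b ^ (N - 2) - (F a)\<^sup>2 * a ^ (N - 2)"
  unfolding integral_add[OF iB integrable_on_mult_right[OF iA]] integral_mult_right .
 hence "integral {a..b} ?B + (real N - 2) * integral {a..b} ?A = - ((F a)\<^sup>2 * a ^ (N - 2))"
  unfolding Fb by simp
 moreover have "0 \<le> (F a)\<^sup>2 * a ^ (N - 2)" using ab by simp
 moreover have "- integral {a..b} ?B \<le> 1/2 * integral {a..b} ?A + 2 * nsq N a b F'"
 proof -
  have "- integral {a..b} ?B = integral {a..b} (\<lambda>r. - ?B r)" by (simp only: integral_neg)
  also have "\<dots> \<le> integral {a..b} (\<lambda>r. 1/2 * ?A r + 2 * ((F' r)\<^sup>2 * om N r))"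
  proof (rule integral_le)
   show "(\<lambda>r. - ?B r) integrable_on {a..b}" using iB by (rule integrable_neg)
   show "(\<lambda>r. 1/2 * ?A r + 2 * ((F' r)\<^sup>2 * om N r)) integrable_on {a..b}"
    by (intro integrable_add integrable_on_mult_right iA iC)
   fix r assume "r \<in> {a..b}"
   hence r: "0 < r" by (rule r0)
   have "0 \<le> om N r * (F r / r + 2 * F' r)\<^sup>2" using om_pos[OF r, of N] by simp
   also have "\<dots> = 2 * (1/2 * ?A r + 2 * ((F' r)\<^sup>2 * om N r) + 2 * F r * F' r * (om N r / r))"
    using r by (simp add: power2_eq_square field_simps)
   also have "om N r / r = r ^ (N - 2)" using omr(2)[OF r] r by simp
   finally show "- ?B r \<le> 1/2 * ?A r + 2 * ((F' r)\<^sup>2 * om N r)" by (simp add: algebra_simps)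
  qed
  also have "\<dots> = 1/2 * integral {a..b} ?A + 2 * nsq N a b F'"
   unfolding integral_add[OF integrable_on_mult_right[OF iA] integrable_on_mult_right[OF iC]] integral_mult_right nsq_def ..
  finally show ?thesis .
 qed
 moreover have A0: "0 \<le> integral {a..b} ?A"
  by (intro integral_nonneg iA mult_nonneg_nonneg less_imp_le[OF om_pos] r0) auto
 moreover have "1 * integral {a..b} ?A \<le> (real N - 2) * integral {a..b} ?A"
  using N A0 by (intro mult_right_mono) auto
 ultimately show ?thesis by linarith
qed

lemma radial_test_hardy:
 fixes phi :: "'a::euclidean_space \<Rightarrow> real"
 assumes N: "3 \<le> DIM('a)" and phi: "radial_test phi"
 shows "(\<integral>\<^sup>+x. ennreal ((phi x)\<^sup>2 / (norm x)\<^sup>2) \<partial>lebesgue) \<le> 4 * L2sq (grad phi)"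
proof (rule nn_integral_le_of_shells)
 have sm: "smooth_fun phi" by (rule radial_testD(1)[OF phi])
 have [measurable]: "phi \<in> borel_measurable borel"
  using smooth_fun_cont[OF sm] by (intro borel_measurable_continuous_onI continuous_at_imp_continuous_on) auto
 show "(\<lambda>x. ennreal ((phi x)\<^sup>2 / (norm x)\<^sup>2)) \<in> borel_measurable lebesgue"
  by (intro measurable_completion) measurable
 obtain B where B: "1 \<le> B" "\<And>r. B \<le> r \<Longrightarrow> prof phi r = 0" using radial_test_support[OF phi] by metis
 fix a b :: real assume a: "0 < a" "a \<le> 1" "1 \<le> b"
 define b' where "b' = max b B"
 have ab': "0 < a" "a \<le> b'" using a by (auto simp: b'_def)
 have "(\<integral>\<^sup>+x. ennreal ((phi x)\<^sup>2 / (norm x)\<^sup>2) * indicator {x. a \<le> norm x \<and> norm x \<le> b} x \<partial>lebesgue) \<le>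
   (\<integral>\<^sup>+x. ennreal ((prof phi (norm x))\<^sup>2 / (norm x)\<^sup>2) * indicator {x. a \<le> norm x \<and> norm x \<le> b'} x \<partial>(lebesgue :: 'a measure))"
  by (intro nn_integral_mono) (auto simp: indicator_def b'_def radial_test_prof[OF phi])
 also have "\<dots> = ennreal (cN TYPE('a) * integral {a..b'} (\<lambda>r. om DIM('a) r * ((prof phi r)\<^sup>2 / r\<^sup>2)))"
  by (rule polar_shell[OF a(1)]) (use a in \<open>auto intro!: continuous_intros prof_cont sm\<close>)
 also have "\<dots> \<le> ennreal (cN TYPE('a) * (4 * nsq DIM('a) a b' (dprof phi)))"
  using cN_pos[where 'a='a] B(2)[of b']
  by (intro ennreal_leI mult_left_mono hardy_shell[OF N ab' prof_deriv[OF sm] dprof_cont[OF sm]]) (auto simp: b'_def)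
 also have "\<dots> = 4 * ennreal (cN TYPE('a) * nsq DIM('a) a b' (dprof phi))"
  using ennreal_mult'[of 4 "cN TYPE('a) * nsq DIM('a) a b' (dprof phi)"] by (simp add: mult_ac)
 also have "\<dots> \<le> 4 * L2sq (grad phi)" by (intro mult_left_mono nsq_dprof_le[OF phi a(1)]) auto
 finally show "(\<integral>\<^sup>+x. ennreal ((phi x)\<^sup>2 / (norm x)\<^sup>2) * indicator {x. a \<le> norm x \<and> norm x \<le> b} x \<partial>lebesgue) \<le> 4 * L2sq (grad phi)" .
qed

section \<open>The completion D: bounds and uniqueness of the weak gradient\<close>

lemma norm_add_sq_le: "(norm (a + b))\<^sup>2 \<le> 2 * (norm a)\<^sup>2 + 2 * (norm (b::'a::real_normed_vector))\<^sup>2"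
proof -
 have "(norm (a + b))\<^sup>2 \<le> (norm a + norm b)\<^sup>2" by (intro power_mono norm_triangle_ineq) auto
 also have "\<dots> \<le> 2 * (norm a)\<^sup>2 + 2 * (norm b)\<^sup>2"
  using zero_le_power2[of "norm a - norm b"] by (simp add: power2_eq_square algebra_simps)
 finally show ?thesis .
qed

lemma L2sq_lincomb:
 assumes [measurable]: "G \<in> borel_measurable lebesgue" "H \<in> borel_measurable lebesgue"
 shows "L2sq (\<lambda>x. s *\<^sub>R G x + t *\<^sub>R H x) \<le> ennreal (2 * s\<^sup>2) * L2sq G + ennreal (2 * t\<^sup>2) * L2sq H"
proof -
 have "L2sq (\<lambda>x. s *\<^sub>R G x + t *\<^sub>R H x) \<le>
  (\<integral>\<^sup>+x. ennreal (2 * s\<^sup>2) * ennreal ((norm (G x))\<^sup>2) + ennreal (2 * t\<^sup>2) * ennreal ((norm (H x))\<^sup>2) \<partial>lebesgue)"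
  unfolding L2sq_def
 proof (rule nn_integral_mono)
  fix x :: 'a
  have "(norm (s *\<^sub>R G x + t *\<^sub>R H x))\<^sup>2 \<le> 2 * s\<^sup>2 * (norm (G x))\<^sup>2 + 2 * t\<^sup>2 * (norm (H x))\<^sup>2"
   using norm_add_sq_le[of "s *\<^sub>R G x" "t *\<^sub>R H x"] by (simp add: power_mult_distrib)
  thus "ennreal ((norm (s *\<^sub>R G x + t *\<^sub>R H x))\<^sup>2) \<le> ennreal (2 * s\<^sup>2) * ennreal ((norm (G x))\<^sup>2) + ennreal (2 * t\<^sup>2) * ennreal ((norm (H x))\<^sup>2)"
   by (simp add: ennreal_mult[symmetric] ennreal_plus[symmetric] ennreal_leI del: ennreal_plus)
 qed
 also have "\<dots> = ennreal (2 * s\<^sup>2) * L2sq G + ennreal (2 * t\<^sup>2) * L2sq H"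
  unfolding L2sq_def by (subst nn_integral_add) (auto simp: nn_integral_cmult)
 finally show ?thesis .
qed

lemma grad_measurable: "radial_test phi \<Longrightarrow> grad phi \<in> borel_measurable lebesgue"
 by (intro measurable_completion) (auto intro: borel_measurable_continuous_onI grad_cont radial_testD(1))

lemma in_DE:
 assumes "in_D u G"
 obtains phi where "u \<in> borel_measurable lebesgue" "G \<in> borel_measurable lebesgue" "\<And>k. radial_test (phi k)"
  "(\<lambda>k. L2sq (\<lambda>x. grad (phi k) x - G x)) \<longlonglongrightarrow> 0" "AE x in lebesgue. (\<lambda>k. phi k x) \<longlonglongrightarrow> u x"
 using assms unfolding in_D_def L2sq_def by blast

lemma in_DI:
 assumes "u \<in> borel_measurable lebesgue" "G \<in> borel_measurable lebesgue" "\<And>k. radial_test (phi k)"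
  "(\<lambda>k. L2sq (\<lambda>x. grad (phi k) x - G x)) \<longlonglongrightarrow> 0" "AE x in lebesgue. (\<lambda>k. phi k x) \<longlonglongrightarrow> u x"
 shows "in_D u G"
 using assms unfolding in_D_def L2sq_def by blast

lemma in_D_finite:
 assumes "in_D u G" shows "L2sq G < \<infinity>"
proof -
 from in_DE[OF assms] obtain phi where m: "G \<in> borel_measurable lebesgue" and t: "\<And>k. radial_test (phi k)"
  and l: "(\<lambda>k. L2sq (\<lambda>x. grad (phi k) x - G x)) \<longlonglongrightarrow> 0" by metis
 have "\<forall>\<^sub>F k in sequentially. L2sq (\<lambda>x. grad (phi k) x - G x) < 1" by (rule order_tendstoD(2)[OF l]) simp
 then obtain k where k: "L2sq (\<lambda>x. grad (phi k) x - G x) < 1" using eventually_happens' by force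
 have "L2sq G = L2sq (\<lambda>x. 1 *\<^sub>R grad (phi k) x + (-1) *\<^sub>R (grad (phi k) x - G x))" by simp
 also have "\<dots> \<le> ennreal (2 * 1\<^sup>2) * L2sq (grad (phi k)) + ennreal (2 * (-1)\<^sup>2) * L2sq (\<lambda>x. grad (phi k) x - G x)"
  by (intro L2sq_lincomb borel_measurable_diff grad_measurable t m)
 also have "\<dots> < \<infinity>"
  using L2sq_grad_finite[OF t, of k] k by (auto simp: ennreal_mult_less_top intro: less_trans[OF k])
 finally show ?thesis .
qed

text \<open>The gradient G and its distance to the approximating gradient are eventually both below
  C, and |a + b|^2 \<le> 2 |a|^2 + 2 |b|^2 gives 4 C. Bounds for test functions then pass to the
  limit with this loss.\<close>

lemma in_D_grad_bound:
 assumes t: "\<And>k. radial_test (phi k)" and m: "G \<in> borel_measurable lebesgue"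
  and l: "(\<lambda>k. L2sq (\<lambda>x. grad (phi k) x - G x)) \<longlonglongrightarrow> 0" and M: "L2sq G \<le> ennreal C" "0 < C"
 shows "\<forall>\<^sub>F k in sequentially. L2sq (grad (phi k)) \<le> ennreal (4 * C)"
proof -
 have "\<forall>\<^sub>F k in sequentially. L2sq (\<lambda>x. grad (phi k) x - G x) < ennreal C" by (rule order_tendstoD(2)[OF l]) (use M in simp)
 thus ?thesis
 proof eventually_elim
  case (elim k)
  have "L2sq (grad (phi k)) = L2sq (\<lambda>x. 1 *\<^sub>R G x + 1 *\<^sub>R (grad (phi k) x - G x))" by simp
  also have "\<dots> \<le> ennreal (2 * 1\<^sup>2) * L2sq G + ennreal (2 * 1\<^sup>2) * L2sq (\<lambda>x. grad (phi k) x - G x)"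
   by (intro L2sq_lincomb borel_measurable_diff grad_measurable t m)
  also have "\<dots> \<le> ennreal (2 * C) + ennreal (2 * C)"
  proof (rule add_mono)
   have two: "ennreal (2 * C) = ennreal (2 * 1\<^sup>2) * ennreal C" using M by (simp add: ennreal_mult)
   show "ennreal (2 * 1\<^sup>2) * L2sq G \<le> ennreal (2 * C)" unfolding two using M by (rule_tac mult_left_mono) auto
   show "ennreal (2 * 1\<^sup>2) * L2sq (\<lambda>x. grad (phi k) x - G x) \<le> ennreal (2 * C)"
    unfolding two using elim by (rule_tac mult_left_mono) auto
  qed
  also have "\<dots> = ennreal (4 * C)"
   using M by (simp add: ennreal_plus[symmetric] del: ennreal_plus)
  finally show ?case .
 qed
qed

lemma in_D_pointwise:
 fixes u :: "'a::euclidean_space \<Rightarrow> real"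
 assumes N: "3 \<le> DIM('a)" and u: "in_D u G" and M: "L2sq G \<le> ennreal (cN TYPE('a) * M\<^sup>2)" "0 < M"
 shows "AE x in lebesgue. \<bar>u x\<bar> \<le> 2 * M * ew DIM('a) (norm x)"
proof -
 obtain phi where "u \<in> borel_measurable lebesgue" and m: "G \<in> borel_measurable lebesgue" and t: "\<And>k. radial_test (phi k)"
  and l: "(\<lambda>k. L2sq (\<lambda>x. grad (phi k) x - G x)) \<longlonglongrightarrow> 0" and ae: "AE x in lebesgue. (\<lambda>k. phi k x) \<longlonglongrightarrow> u x" by (rule in_DE[OF u]) (rule that; assumption)
 have ev: "\<forall>\<^sub>F k in sequentially. L2sq (grad (phi k)) \<le> ennreal (4 * (cN TYPE('a) * M\<^sup>2))"
  by (rule in_D_grad_bound[OF t m l M(1)]) (use M(2) cN_pos[where 'a='a] in simp)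
 have ev2: "\<forall>\<^sub>F k in sequentially. \<bar>phi k x\<bar> \<le> 2 * M * ew DIM('a) (norm x)" if "x \<noteq> 0" for x
  using ev
 proof eventually_elim
  case (elim k)
  have "\<bar>prof (phi k) (norm x)\<bar> \<le> (2 * M) * ew DIM('a) (norm x)"
   by (rule radial_test_pointwise[OF N t]) (use that elim M(2) in \<open>auto simp: power_mult_distrib mult_ac\<close>)
  thus ?case using radial_test_prof[OF t, of k x] by simp
 qed
 show ?thesis using ae AE_nonzero
 proof eventually_elim
  case (elim x)
  show ?case by (rule tendsto_upperbound[OF tendsto_rabs[OF elim(1)] ev2[OF elim(2)]]) simp
 qed
qed

text \<open>Fatou's lemma along the test functions; 16 is the Hardy constant 4 times the loss 4 of
  \<open>in_D_grad_bound\<close>.\<close>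

lemma in_D_hardy:
 fixes u :: "'a::euclidean_space \<Rightarrow> real"
 assumes N: "3 \<le> DIM('a)" and u: "in_D u G" and M: "L2sq G \<le> ennreal C" "0 < C"
 shows "(\<integral>\<^sup>+x. ennreal ((u x)\<^sup>2 / (norm x)\<^sup>2) \<partial>lebesgue) \<le> ennreal (16 * C)"
proof -
 obtain phi where "u \<in> borel_measurable lebesgue" and m: "G \<in> borel_measurable lebesgue" and t: "\<And>k. radial_test (phi k)"
  and l: "(\<lambda>k. L2sq (\<lambda>x. grad (phi k) x - G x)) \<longlonglongrightarrow> 0" and ae: "AE x in lebesgue. (\<lambda>k. phi k x) \<longlonglongrightarrow> u x" by (rule in_DE[OF u]) (rule that; assumption)
 have ev: "\<forall>\<^sub>F k in sequentially. L2sq (grad (phi k)) \<le> ennreal (4 * C)"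
  by (rule in_D_grad_bound[OF t m l M])
 have pb: "phi k \<in> borel_measurable borel" for k
  using smooth_fun_cont[OF radial_testD(1)[OF t]] by (intro borel_measurable_continuous_onI continuous_at_imp_continuous_on) auto
 have "(\<integral>\<^sup>+x. ennreal ((u x)\<^sup>2 / (norm x)\<^sup>2) \<partial>lebesgue) = (\<integral>\<^sup>+x. liminf (\<lambda>k. ennreal ((phi k x)\<^sup>2 / (norm x)\<^sup>2)) \<partial>lebesgue)"
 proof (rule nn_integral_cong_AE)
  show "AE x in lebesgue. ennreal ((u x)\<^sup>2 / (norm x)\<^sup>2) = liminf (\<lambda>k. ennreal ((phi k x)\<^sup>2 / (norm x)\<^sup>2))"
   using ae AE_nonzero
  proof eventually_elim
   case (elim x)
   have "(\<lambda>k. ennreal ((phi k x)\<^sup>2 / (norm x)\<^sup>2)) \<longlonglongrightarrow> ennreal ((u x)\<^sup>2 / (norm x)\<^sup>2)"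
    by (intro tendsto_ennrealI tendsto_intros elim) (use elim in auto)
   from lim_imp_Liminf[OF _ this] show ?case by simp
  qed
 qed
 also have "\<dots> \<le> liminf (\<lambda>k. \<integral>\<^sup>+x. ennreal ((phi k x)\<^sup>2 / (norm x)\<^sup>2) \<partial>lebesgue)"
 proof (rule nn_integral_liminf)
  fix k
  have [measurable]: "phi k \<in> borel_measurable borel" by (rule pb)
  show "(\<lambda>x. ennreal ((phi k x)\<^sup>2 / (norm x)\<^sup>2)) \<in> borel_measurable lebesgue" by (intro measurable_completion) measurable
 qed
 also have "\<dots> \<le> liminf (\<lambda>k. ennreal (16 * C))"
 proof (rule Liminf_mono)
  show "\<forall>\<^sub>F k in sequentially. (\<integral>\<^sup>+x. ennreal ((phi k x)\<^sup>2 / (norm x)\<^sup>2) \<partial>lebesgue) \<le> ennreal (16 * C)"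
   using ev
  proof eventually_elim
   case (elim k)
   have "(\<integral>\<^sup>+x. ennreal ((phi k x)\<^sup>2 / (norm x)\<^sup>2) \<partial>lebesgue) \<le> 4 * L2sq (grad (phi k))" by (rule radial_test_hardy[OF N t])
   also have "\<dots> \<le> 4 * ennreal (4 * C)" using elim by (intro mult_left_mono) auto
   also have "\<dots> = ennreal (16 * C)" using M ennreal_mult[of 4 "4 * C"] by simp
   finally show ?case .
  qed
 qed
 also have "\<dots> = ennreal (16 * C)" by (simp add: Liminf_const)
 finally show ?thesis .
qed

lemma in_D_lincomb:
 assumes u: "in_D u G" and h: "in_D h H"
 shows "in_D (\<lambda>x. s * u x + t * h x) (\<lambda>x. s *\<^sub>R G x + t *\<^sub>R H x)"
proof -
 obtain phi where um: "u \<in> borel_measurable lebesgue" "G \<in> borel_measurable lebesgue" and ut: "\<And>k. radial_test (phi k)"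
  and ul: "(\<lambda>k. L2sq (\<lambda>x. grad (phi k) x - G x)) \<longlonglongrightarrow> 0" and ua: "AE x in lebesgue. (\<lambda>k. phi k x) \<longlonglongrightarrow> u x" by (rule in_DE[OF u]) (rule that; assumption)
 obtain \<psi> where hm: "h \<in> borel_measurable lebesgue" "H \<in> borel_measurable lebesgue" and ht: "\<And>k. radial_test (\<psi> k)"
  and hl: "(\<lambda>k. L2sq (\<lambda>x. grad (\<psi> k) x - H x)) \<longlonglongrightarrow> 0" and ha: "AE x in lebesgue. (\<lambda>k. \<psi> k x) \<longlonglongrightarrow> h x" by (rule in_DE[OF h]) (rule that; assumption)
 show ?thesis
 proof (rule in_DI[where phi = "\<lambda>k x. s * phi k x + t * \<psi> k x"])
  note [measurable] = um hm
  show "(\<lambda>x. s * u x + t * h x) \<in> borel_measurable lebesgue" "(\<lambda>x. s *\<^sub>R G x + t *\<^sub>R H x) \<in> borel_measurable lebesgue"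
   by measurable
  show "radial_test (\<lambda>x. s * phi k x + t * \<psi> k x)" for k by (rule radial_test_lincomb[OF ut ht])
  show "AE x in lebesgue. (\<lambda>k. s * phi k x + t * \<psi> k x) \<longlonglongrightarrow> s * u x + t * h x"
   using ua ha by eventually_elim (intro tendsto_intros)
  have "(\<lambda>k. ennreal (2 * s\<^sup>2) * L2sq (\<lambda>x. grad (phi k) x - G x) + ennreal (2 * t\<^sup>2) * L2sq (\<lambda>x. grad (\<psi> k) x - H x)) \<longlonglongrightarrow>
    ennreal (2 * s\<^sup>2) * 0 + ennreal (2 * t\<^sup>2) * 0"
   by (intro tendsto_add ennreal_tendsto_cmult ul hl) auto
  hence lim: "(\<lambda>k. ennreal (2 * s\<^sup>2) * L2sq (\<lambda>x. grad (phi k) x - G x) + ennreal (2 * t\<^sup>2) * L2sq (\<lambda>x. grad (\<psi> k) x - H x)) \<longlonglongrightarrow> 0" by simp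
  show "(\<lambda>k. L2sq (\<lambda>x. grad (\<lambda>x. s * phi k x + t * \<psi> k x) x - (s *\<^sub>R G x + t *\<^sub>R H x))) \<longlonglongrightarrow> 0"
  proof (rule tendsto_sandwich[OF always_eventually always_eventually tendsto_const lim])
   show "\<forall>k. L2sq (\<lambda>x. grad (\<lambda>x. s * phi k x + t * \<psi> k x) x - (s *\<^sub>R G x + t *\<^sub>R H x)) \<le>
     ennreal (2 * s\<^sup>2) * L2sq (\<lambda>x. grad (phi k) x - G x) + ennreal (2 * t\<^sup>2) * L2sq (\<lambda>x. grad (\<psi> k) x - H x)"
   proof
    fix k
    have "(\<lambda>x. grad (\<lambda>x. s * phi k x + t * \<psi> k x) x - (s *\<^sub>R G x + t *\<^sub>R H x)) =
      (\<lambda>x. s *\<^sub>R (grad (phi k) x - G x) + t *\<^sub>R (grad (\<psi> k) x - H x))"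
     unfolding grad_lincomb[OF radial_testD(1)[OF ut] radial_testD(1)[OF ht]] by (simp add: algebra_simps)
    thus "L2sq (\<lambda>x. grad (\<lambda>x. s * phi k x + t * \<psi> k x) x - (s *\<^sub>R G x + t *\<^sub>R H x)) \<le>
     ennreal (2 * s\<^sup>2) * L2sq (\<lambda>x. grad (phi k) x - G x) + ennreal (2 * t\<^sup>2) * L2sq (\<lambda>x. grad (\<psi> k) x - H x)"
     by (simp only:) (intro L2sq_lincomb borel_measurable_diff grad_measurable ut ht um hm)
   qed
  qed simp
 qed
qed

lemma L2_integrable:
 assumes [measurable]: "G \<in> borel_measurable lebesgue" and "L2sq G < \<infinity>"
 shows "integrable lebesgue (\<lambda>x. (norm (G x))\<^sup>2)" "ennreal (\<integral>x. (norm (G x))\<^sup>2 \<partial>lebesgue) = L2sq G"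
proof -
 show i: "integrable lebesgue (\<lambda>x. (norm (G x))\<^sup>2)"
  by (rule integrableI_bounded) (use assms(2) in \<open>auto simp: L2sq_def\<close>)
 show "ennreal (\<integral>x. (norm (G x))\<^sup>2 \<partial>lebesgue) = L2sq G"
  unfolding L2sq_def by (rule nn_integral_eq_integral[symmetric, OF i]) auto
qed

lemma inner_le_sq: "\<bar>a \<bullet> b\<bar> \<le> (norm (a::'a::real_inner))\<^sup>2 + (norm b)\<^sup>2"
proof -
 have "\<bar>a \<bullet> b\<bar> \<le> norm a * norm b" by (rule Cauchy_Schwarz_ineq2)
 also have "\<dots> \<le> (norm a)\<^sup>2 + (norm b)\<^sup>2"
  using zero_le_power2[of "norm a - norm b"] mult_nonneg_nonneg[OF norm_ge_zero[of a] norm_ge_zero[of b]]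
  unfolding power2_diff by linarith
 finally show ?thesis .
qed

lemma L2_inner_integrable:
 assumes [measurable]: "G \<in> borel_measurable lebesgue" "H \<in> borel_measurable lebesgue" and "L2sq G < \<infinity>" "L2sq H < \<infinity>"
 shows "integrable lebesgue (\<lambda>x. G x \<bullet> H x)"
proof (rule Bochner_Integration.integrable_bound)
 show "integrable lebesgue (\<lambda>x. (norm (G x))\<^sup>2 + (norm (H x))\<^sup>2)"
  by (intro Bochner_Integration.integrable_add L2_integrable assms)
 show "AE x in lebesgue. norm (G x \<bullet> H x) \<le> norm ((norm (G x))\<^sup>2 + (norm (H x))\<^sup>2)"
  by (intro AE_I2) (use inner_le_sq in \<open>auto intro: order_trans\<close>)
qed measurable

text \<open>Young's inequality with a free parameter t, chosen later to make the term with the fixed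
  function small before the other one is sent to 0.\<close>

lemma L2_inner_bound:
 assumes [measurable]: "G \<in> borel_measurable lebesgue" "H \<in> borel_measurable lebesgue" and "L2sq G < \<infinity>" "L2sq H < \<infinity>" and t: "0 < t"
 shows "(\<integral>x. \<bar>G x \<bullet> H x\<bar> \<partial>lebesgue) \<le> t * (\<integral>x. (norm (G x))\<^sup>2 \<partial>lebesgue) + (\<integral>x. (norm (H x))\<^sup>2 \<partial>lebesgue) / t"
proof -
 have pt: "\<bar>G x \<bullet> H x\<bar> \<le> t * (norm (G x))\<^sup>2 + (norm (H x))\<^sup>2 / t" for x
 proof -
  have "\<bar>(sqrt t *\<^sub>R G x) \<bullet> ((1 / sqrt t) *\<^sub>R H x)\<bar> \<le> (norm (sqrt t *\<^sub>R G x))\<^sup>2 + (norm ((1 / sqrt t) *\<^sub>R H x))\<^sup>2"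
   by (rule inner_le_sq)
  thus ?thesis using t by (simp add: power_mult_distrib power_divide)
 qed
 have i: "integrable lebesgue (\<lambda>x. t * (norm (G x))\<^sup>2)" "integrable lebesgue (\<lambda>x. (norm (H x))\<^sup>2 / t)"
  by (intro integrable_mult_right integrable_divide L2_integrable assms)+
 have "(\<integral>x. \<bar>G x \<bullet> H x\<bar> \<partial>lebesgue) \<le> (\<integral>x. t * (norm (G x))\<^sup>2 + (norm (H x))\<^sup>2 / t \<partial>lebesgue)"
  by (intro integral_mono integrable_abs L2_inner_integrable assms Bochner_Integration.integrable_add i pt)
 also have "\<dots> = t * (\<integral>x. (norm (G x))\<^sup>2 \<partial>lebesgue) + (\<integral>x. (norm (H x))\<^sup>2 \<partial>lebesgue) / t"
  by (subst Bochner_Integration.integral_add[OF i]) simp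
 finally show ?thesis .
qed

lemma L2_inner_tendsto:
 assumes [measurable]: "G \<in> borel_measurable lebesgue" "\<And>k. H k \<in> borel_measurable lebesgue" and G: "L2sq G < \<infinity>"
  and l: "(\<lambda>k. L2sq (H k)) \<longlonglongrightarrow> 0"
 shows "(\<lambda>k. \<integral>x. \<bar>G x \<bullet> H k x\<bar> \<partial>lebesgue) \<longlonglongrightarrow> 0"
proof (rule LIMSEQ_I)
 fix e :: real assume e: "0 < e"
 define A where "A = (\<integral>x. (norm (G x))\<^sup>2 \<partial>lebesgue)"
 have A: "0 \<le> A" by (simp add: A_def)
 \<comment> \<open>This t makes the G-term at most e/3; the summand 1 covers the case A = 0.\<close>
 define t where "t = e / (3 * (A + 1))"
 have t: "0 < t" using e A by (simp add: t_def)
 have tA: "t * A < e / 2"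
 proof -
  have "t * A \<le> t * (A + 1)" using t by simp
  also have "\<dots> = e / 3"
  proof -
   have "A + 1 \<noteq> 0" using A by linarith
   thus ?thesis by (simp add: t_def del: distrib_left_numeral)
  qed
  finally show ?thesis using e by simp
 qed
 have "\<forall>\<^sub>F k in sequentially. L2sq (H k) < ennreal (t * (e / 2))" by (rule order_tendstoD(2)[OF l]) (use t e in simp)
 then obtain k0 where k0: "\<And>k. k \<ge> k0 \<Longrightarrow> L2sq (H k) < ennreal (t * (e / 2))" by (auto simp: eventually_sequentially)
 have "norm ((\<integral>x. \<bar>G x \<bullet> H k x\<bar> \<partial>lebesgue) - 0) < e" if k: "k \<ge> k0" for k
 proof -
  have fin: "L2sq (H k) < \<infinity>" using k0[OF k] by (rule less_trans) simp
  have "ennreal (\<integral>x. (norm (H k x))\<^sup>2 \<partial>lebesgue) < ennreal (t * (e / 2))"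
   using L2_integrable(2)[OF assms(2) fin] k0[OF k] by simp
  hence "(\<integral>x. (norm (H k x))\<^sup>2 \<partial>lebesgue) < t * (e / 2)" by (rule ennreal_less_iff[THEN iffD1, rotated]) auto
  hence "(\<integral>x. (norm (H k x))\<^sup>2 \<partial>lebesgue) / t < e / 2" using t by (simp add: field_simps)
  moreover have "(\<integral>x. \<bar>G x \<bullet> H k x\<bar> \<partial>lebesgue) \<le> t * A + (\<integral>x. (norm (H k x))\<^sup>2 \<partial>lebesgue) / t"
   unfolding A_def by (rule L2_inner_bound) (use assms fin t in auto)
  moreover have "0 \<le> (\<integral>x. \<bar>G x \<bullet> H k x\<bar> \<partial>lebesgue)" by simp
  ultimately have "0 \<le> (\<integral>x. \<bar>G x \<bullet> H k x\<bar> \<partial>lebesgue)" "(\<integral>x. \<bar>G x \<bullet> H k x\<bar> \<partial>lebesgue) < e" using tA by linarith+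
  thus ?thesis by simp
 qed
 thus "\<exists>k0. \<forall>k\<ge>k0. norm ((\<integral>x. \<bar>G x \<bullet> H k x\<bar> \<partial>lebesgue) - 0) < e" by blast
qed

lemma radial_test_inner:
 fixes \<psi> eta :: "'a::euclidean_space \<Rightarrow> real"
 assumes "radial_test \<psi>" "radial_test eta" "x \<noteq> 0"
 shows "grad \<psi> x \<bullet> grad eta x = dprof \<psi> (norm x) * dprof eta (norm x)"
proof -
 have "grad \<psi> x \<bullet> grad eta x = (dprof \<psi> (norm x) / norm x) * (dprof eta (norm x) / norm x) * (x \<bullet> x)"
  by (simp add: radial_test_grad assms)
 also have "x \<bullet> x = norm x * norm x" by (simp add: power2_norm_eq_inner[symmetric] power2_eq_square)
 finally show ?thesis using assms(3) by simp
qed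

text \<open>Integration by parts moves the derivative to the fixed function \<open>\<psi>\<close>.\<close>
lemma weak_null:
 fixes \<psi> :: "'a::euclidean_space \<Rightarrow> real"
 assumes N: "3 \<le> DIM('a)" and \<psi>: "radial_test \<psi>" and eta: "\<And>k. radial_test (eta k)"
  and M: "\<forall>\<^sub>F k in sequentially. L2sq (grad (eta k)) \<le> ennreal (cN TYPE('a) * M\<^sup>2)" "0 \<le> M"
  and ae: "AE x in lebesgue. (\<lambda>k. eta k x) \<longlonglongrightarrow> 0"
 shows "(\<lambda>k. \<integral>x. grad \<psi> x \<bullet> grad (eta k) x \<partial>lebesgue) \<longlonglongrightarrow> 0"
proof -
 let ?N = "DIM('a)" and ?c = "cN TYPE('a)"
 have sm: "smooth_fun \<psi>" "smooth_fun (eta k)" for k by (rule radial_testD(1)[OF \<psi>], rule radial_testD(1)[OF eta])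
 obtain B where B: "1 \<le> B" "\<And>r. B \<le> r \<Longrightarrow> dprof \<psi> r = 0" using radial_test_support[OF \<psi>] by metis
 define dd where "dd = dprof (\<lambda>x. frechet_derivative \<psi> (at x) e0)"
 \<comment> \<open>The derivative of r^(N-1) \<psi>', that is, r^(N-1) times the Laplacian of
   \<psi>.\<close>
 define Z where "Z r = real (?N - 1) * r ^ (?N - 2) * dprof \<psi> r + dd r * om ?N r" for r
 have omd: "((\<lambda>r. om ?N r) has_real_derivative real (?N - 1) * r ^ (?N - 2)) (at r)" for r
 proof -
  have "(?N - 1) - Suc 0 = ?N - 2" by simp
  thus ?thesis unfolding om_def by (auto intro!: derivative_eq_intros)
 qed
 have Zc: "continuous_on S Z" for S
  unfolding Z_def dd_def by (intro continuous_intros dprof_cont ddprof_cont sm)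
 have parts: "(\<integral>x. grad \<psi> x \<bullet> grad (eta k) x \<partial>lebesgue) = - ?c * (LINT r:{0..B}|lborel. Z r * prof (eta k) r)" for k
 proof -
  have cF: "continuous_on {0..B} (\<lambda>r. dprof \<psi> r * dprof (eta k) r)" by (intro continuous_intros dprof_cont sm)
  have "(\<integral>x. grad \<psi> x \<bullet> grad (eta k) x \<partial>lebesgue) =
   (\<integral>x. indicator {x::'a. 0 \<le> norm x \<and> norm x \<le> B} x * (dprof \<psi> (norm x) * dprof (eta k) (norm x)) \<partial>lebesgue)"
  proof (rule integral_cong_AE)
   show "AE x in lebesgue. grad \<psi> x \<bullet> grad (eta k) x = indicator {x::'a. 0 \<le> norm x \<and> norm x \<le> B} x * (dprof \<psi> (norm x) * dprof (eta k) (norm x))"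
    using AE_nonzero by eventually_elim (auto simp: radial_test_inner[OF \<psi> eta] indicator_def B(2))
   show "(\<lambda>x. grad \<psi> x \<bullet> grad (eta k) x) \<in> borel_measurable lebesgue"
    by (intro borel_measurable_inner grad_measurable \<psi> eta)
   show "(\<lambda>x. indicator {x::'a. 0 \<le> norm x \<and> norm x \<le> B} x * (dprof \<psi> (norm x) * dprof (eta k) (norm x))) \<in> borel_measurable lebesgue"
    using polar_shell_integral(2)[OF order_refl cF] by (rule borel_measurable_integrable)
  qed
  also have "\<dots> = ?c * integral {0..B} (\<lambda>r. om ?N r * (dprof \<psi> r * dprof (eta k) r))"
   by (rule polar_shell_integral(1)[OF order_refl cF])
  also have "integral {0..B} (\<lambda>r. om ?N r * (dprof \<psi> r * dprof (eta k) r)) = - integral {0..B} (\<lambda>r. Z r * prof (eta k) r)"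
  proof -
   have "((\<lambda>r. Z r * prof (eta k) r + om ?N r * (dprof \<psi> r * dprof (eta k) r)) has_integral
     (om ?N B * dprof \<psi> B * prof (eta k) B - om ?N 0 * dprof \<psi> 0 * prof (eta k) 0)) {0..B}"
   proof (rule fundamental_theorem_of_calculus)
    fix r
    have "((\<lambda>r. om ?N r * dprof \<psi> r * prof (eta k) r) has_real_derivative
      (real (?N - 1) * r ^ (?N - 2) * dprof \<psi> r + dd r * om ?N r) * prof (eta k) r + dprof (eta k) r * (om ?N r * dprof \<psi> r)) (at r)"
     unfolding dd_def by (intro DERIV_mult omd dprof_deriv prof_deriv sm)
    thus "((\<lambda>r. om ?N r * dprof \<psi> r * prof (eta k) r) has_vector_derivative Z r * prof (eta k) r + om ?N r * (dprof \<psi> r * dprof (eta k) r)) (at r within {0..B})"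
    proof -
     have eq: "(real (?N - 1) * r ^ (?N - 2) * dprof \<psi> r + dd r * om ?N r) * prof (eta k) r + dprof (eta k) r * (om ?N r * dprof \<psi> r)
       = Z r * prof (eta k) r + om ?N r * (dprof \<psi> r * dprof (eta k) r)"
      unfolding Z_def by (simp only: mult_ac)
     assume "((\<lambda>r. om ?N r * dprof \<psi> r * prof (eta k) r) has_real_derivative
       (real (?N - 1) * r ^ (?N - 2) * dprof \<psi> r + dd r * om ?N r) * prof (eta k) r + dprof (eta k) r * (om ?N r * dprof \<psi> r)) (at r)"
     thus ?thesis unfolding eq has_real_derivative_iff_has_vector_derivative[symmetric]
      by (rule has_field_derivative_at_within)
    qed
   qed (use B in simp)
   moreover have "om ?N 0 = 0" "dprof \<psi> B = 0" using N B(2)[of B] by (auto simp: om_def)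
   ultimately have "integral {0..B} (\<lambda>r. Z r * prof (eta k) r + om ?N r * (dprof \<psi> r * dprof (eta k) r)) = 0"
    by (simp add: integral_unique)
   moreover have "integral {0..B} (\<lambda>r. Z r * prof (eta k) r + om ?N r * (dprof \<psi> r * dprof (eta k) r)) =
     integral {0..B} (\<lambda>r. Z r * prof (eta k) r) + integral {0..B} (\<lambda>r. om ?N r * (dprof \<psi> r * dprof (eta k) r))"
    by (intro integral_add integrable_continuous_real continuous_intros Zc prof_cont dprof_cont sm)
   ultimately show ?thesis by linarith
  qed
  also have "integral {0..B} (\<lambda>r. Z r * prof (eta k) r) = (LINT r:{0..B}|lborel. Z r * prof (eta k) r)"
   by (rule set_borel_integral_eq_integral(2)[symmetric], rule borel_integrable_atLeastAtMost')
    (intro continuous_intros Zc prof_cont sm)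
  finally show ?thesis by simp
 qed
 have "bounded (dprof \<psi> ` {0..B})" "bounded (dd ` {0..B})"
  unfolding dd_def by (intro compact_imp_bounded compact_continuous_image dprof_cont ddprof_cont sm compact_Icc)+
 then obtain D1 D2 where D: "\<And>r. r \<in> {0..B} \<Longrightarrow> \<bar>dprof \<psi> r\<bar> \<le> D1" "\<And>r. r \<in> {0..B} \<Longrightarrow> \<bar>dd r\<bar> \<le> D2"
  unfolding bounded_iff ball_simps real_norm_def by metis
 have D0: "0 \<le> D1" "0 \<le> D2" using D(1)[of 0] D(2)[of 0] B by auto
 define D where "D = real ?N * D1 + D2 * B"
 have D00: "0 \<le> D" using D0 B by (simp add: D_def)
 \<comment> \<open>The order r^(N-2) near 0 compensates the possible growth r^(-(N-2)/2) of the
   profiles and leaves a bounded product, the majorant for dominated convergence.\<close>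
 have Zb: "\<bar>Z r\<bar> \<le> D * r ^ (?N - 2)" if r: "r \<in> {0..B}" for r
 proof -
  have omr: "om ?N r = r ^ (?N - 2) * r" using N unfolding om_def power_Suc2[symmetric] by (intro arg_cong[of _ _ "power r"]) simp
  have r0: "0 \<le> r ^ (?N - 2)" "0 \<le> r" using r by auto
  have "\<bar>Z r\<bar> \<le> \<bar>real (?N - 1) * r ^ (?N - 2) * dprof \<psi> r\<bar> + \<bar>dd r * om ?N r\<bar>" unfolding Z_def by (rule abs_triangle_ineq)
  also have "\<bar>real (?N - 1) * r ^ (?N - 2) * dprof \<psi> r\<bar> \<le> real ?N * r ^ (?N - 2) * D1"
   unfolding abs_mult using D(1)[OF r] r0 by (intro mult_mono) auto
  also have "\<bar>dd r * om ?N r\<bar> \<le> D2 * (r ^ (?N - 2) * B)"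
   unfolding abs_mult omr using D(2)[OF r] r0 r B by (intro mult_mono) auto
  finally show ?thesis by (simp add: D_def algebra_simps)
 qed
 have aer: "AE r in lborel. 0 < r \<longrightarrow> (\<lambda>k. prof (eta k) r) \<longlonglongrightarrow> 0"
 proof (rule polar_AE[where 'a='a, THEN iffD1])
  have [measurable]: "prof (eta k) \<in> borel_measurable borel" for k by (intro borel_measurable_continuous_onI prof_cont sm)
  show "Measurable.pred borel (\<lambda>r. (\<lambda>k. prof (eta k) r) \<longlonglongrightarrow> 0)" by measurable
  show "AE x in lebesgue. (\<lambda>k. prof (eta k) (norm (x::'a))) \<longlonglongrightarrow> 0"
   using ae radial_test_prof[OF eta] by simp
 qed
 obtain k0 where k0: "\<And>k. k \<ge> k0 \<Longrightarrow> L2sq (grad (eta k)) \<le> ennreal (?c * M\<^sup>2)" using M(1) by (auto simp: eventually_sequentially)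
 define C where "C = D * (M * B powr (real ?N / 2))"
 have "(\<lambda>k. LINT r|lborel. indicator {0..B} r *\<^sub>R (Z r * prof (eta (k + k0)) r)) \<longlonglongrightarrow> (LINT r|(lborel::real measure). 0)"
 proof (rule integral_dominated_convergence[where w = "\<lambda>r. indicator {0..B} r *\<^sub>R C"])
  show "integrable lborel (\<lambda>r. indicator {0..B} r *\<^sub>R C)"
   using borel_integrable_atLeastAtMost'[of 0 B "\<lambda>_. C"] by (simp add: set_integrable_def)
  have [measurable]: "Z \<in> borel_measurable borel" "prof (eta k) \<in> borel_measurable borel" for k
   by (intro borel_measurable_continuous_onI Zc prof_cont sm)+
  show "(\<lambda>r. indicator {0..B} r *\<^sub>R (Z r * prof (eta (k + k0)) r)) \<in> borel_measurable lborel" for k by measurable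
  show "AE r in lborel. (\<lambda>k. indicator {0..B} r *\<^sub>R (Z r * prof (eta (k + k0)) r)) \<longlonglongrightarrow> 0"
   using aer AE_lborel_singleton[of "0::real"]
  proof eventually_elim
   case (elim r)
   show ?case
   proof (cases "r \<in> {0..B}")
    case True
    hence "(\<lambda>k. prof (eta k) r) \<longlonglongrightarrow> 0" using elim by auto
    hence "(\<lambda>k. prof (eta (k + k0)) r) \<longlonglongrightarrow> 0" by (rule LIMSEQ_ignore_initial_segment)
    thus ?thesis using tendsto_mult_right_zero[of _ _ "Z r"] True by simp
   qed simp
  qed
  show "AE r in lborel. norm (indicator {0..B} r *\<^sub>R (Z r * prof (eta (k + k0)) r)) \<le> indicator {0..B} r *\<^sub>R C" for k
   using AE_lborel_singleton[of "0::real"]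
  proof eventually_elim
   case (elim r)
   show ?case
   proof (cases "r \<in> {0..B}")
    case True
    hence r: "0 < r" "r \<le> B" using elim by auto
    have "\<bar>prof (eta (k + k0)) r\<bar> \<le> M * ew ?N r" by (rule radial_test_pointwise[OF N eta r(1) k0 M(2)]) simp
    hence "\<bar>Z r\<bar> * \<bar>prof (eta (k + k0)) r\<bar> \<le> (D * r ^ (?N - 2)) * (M * ew ?N r)"
     using Zb[OF True] by (intro mult_mono) auto
    also have "\<dots> = D * (M * (r powr (real ?N - 2) * ew ?N r))"
     using r N by (simp add: powr_realpow[symmetric] of_nat_diff)
    also have "r powr (real ?N - 2) * ew ?N r = r powr ((real ?N - 2) / 2)"
     unfolding ew_def powr_add[symmetric] by (simp add: field_simps)
    also have "D * (M * r powr ((real ?N - 2) / 2)) \<le> D * (M * B powr (real ?N / 2))"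
    proof (intro mult_left_mono)
     have "r powr ((real ?N - 2) / 2) \<le> B powr ((real ?N - 2) / 2)" using r N by (intro powr_mono2) auto
     also have "\<dots> \<le> B powr (real ?N / 2)" using B by (intro powr_mono) auto
     finally show "r powr ((real ?N - 2) / 2) \<le> B powr (real ?N / 2)" .
    qed (use D00 M in auto)
    finally show ?thesis using True by (simp add: C_def abs_mult)
   qed simp
  qed
 qed auto
 hence "(\<lambda>k. LINT r:{0..B}|lborel. Z r * prof (eta (k + k0)) r) \<longlonglongrightarrow> 0" by (simp add: set_lebesgue_integral_def)
 hence "(\<lambda>k. LINT r:{0..B}|lborel. Z r * prof (eta k) r) \<longlonglongrightarrow> 0" by (rule LIMSEQ_offset)
 from tendsto_mult_right_zero[OF this, of "- ?c"] show ?thesis unfolding parts .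
qed

text \<open>G is an L^2 limit of gradients of test functions that tend to 0 almost everywhere. By
  \<open>weak_null\<close> each of these gradients is asymptotically orthogonal to the later ones,
  hence orthogonal to G; in the limit G is orthogonal to itself. So the choice in
  \<open>wgrad\<close> is harmless.\<close>

lemma in_D_zero_unique:
 fixes G :: "'a::euclidean_space \<Rightarrow> 'a"
 assumes N: "3 \<le> DIM('a)" and z: "in_D (\<lambda>x. 0) G"
 shows "AE x in lebesgue. G x = 0"
proof -
 obtain eta where "(\<lambda>x::'a. 0::real) \<in> borel_measurable lebesgue" and m: "G \<in> borel_measurable lebesgue" and t: "\<And>k. radial_test (eta k)"
  and l: "(\<lambda>k. L2sq (\<lambda>x. grad (eta k) x - G x)) \<longlonglongrightarrow> 0" and ae: "AE x in lebesgue. (\<lambda>k. eta k x) \<longlonglongrightarrow> 0" by (rule in_DE[OF z]) (rule that; assumption)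
 note [measurable] = m grad_measurable[OF t]
 have fin: "L2sq G < \<infinity>" by (rule in_D_finite[OF z])
 define A where "A = (\<integral>x. (norm (G x))\<^sup>2 \<partial>lebesgue)"
 have A0: "0 \<le> A" by (simp add: A_def)
 have GA: "L2sq G = ennreal A" unfolding A_def by (rule L2_integrable(2)[symmetric, OF m fin])
 define M where "M = sqrt (4 * (A + 1) / cN TYPE('a))"
 have M: "0 \<le> M" "cN TYPE('a) * M\<^sup>2 = 4 * (A + 1)" using A0 cN_pos[where 'a='a] by (simp_all add: M_def)
 have ev: "\<forall>\<^sub>F k in sequentially. L2sq (grad (eta k)) \<le> ennreal (cN TYPE('a) * M\<^sup>2)"
  unfolding M(2) by (rule in_D_grad_bound[OF t m l]) (use A0 GA in auto)
 have orth: "(\<integral>x. grad (eta j) x \<bullet> G x \<partial>lebesgue) = 0" for j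
 proof -
  have finj: "L2sq (grad (eta j)) < \<infinity>" for j by (rule L2sq_grad_finite[OF t])
  have "(\<lambda>k. \<integral>x. \<bar>grad (eta j) x \<bullet> (grad (eta k) x - G x)\<bar> \<partial>lebesgue) \<longlonglongrightarrow> 0"
   by (rule L2_inner_tendsto[OF _ _ finj l]) measurable
  hence "(\<lambda>k. \<integral>x. grad (eta j) x \<bullet> (grad (eta k) x - G x) \<partial>lebesgue) \<longlonglongrightarrow> 0"
   by (rule Lim_null_comparison[rotated]) (auto intro!: always_eventually integral_norm_bound[THEN order_trans])
  moreover have "(\<integral>x. grad (eta j) x \<bullet> (grad (eta k) x - G x) \<partial>lebesgue) = (\<integral>x. grad (eta j) x \<bullet> grad (eta k) x \<partial>lebesgue) - (\<integral>x. grad (eta j) x \<bullet> G x \<partial>lebesgue)" for k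
   unfolding inner_diff_right by (intro Bochner_Integration.integral_diff L2_inner_integrable finj fin) measurable
  ultimately have "(\<lambda>k. (\<integral>x. grad (eta j) x \<bullet> grad (eta k) x \<partial>lebesgue) - (\<integral>x. grad (eta j) x \<bullet> G x \<partial>lebesgue)) \<longlonglongrightarrow> 0" by simp
  moreover have "(\<lambda>k. (\<integral>x. grad (eta j) x \<bullet> grad (eta k) x \<partial>lebesgue) - (\<integral>x. grad (eta j) x \<bullet> G x \<partial>lebesgue)) \<longlonglongrightarrow> 0 - (\<integral>x. grad (eta j) x \<bullet> G x \<partial>lebesgue)"
   by (intro tendsto_diff tendsto_const weak_null[OF N t t ev M(1) ae])
  ultimately show ?thesis using LIMSEQ_unique by fastforce
 qed
 have "(\<lambda>k. \<integral>x. \<bar>G x \<bullet> (grad (eta k) x - G x)\<bar> \<partial>lebesgue) \<longlonglongrightarrow> 0"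
  by (rule L2_inner_tendsto[OF _ _ fin l]) measurable
 moreover have "A \<le> (\<integral>x. \<bar>G x \<bullet> (grad (eta k) x - G x)\<bar> \<partial>lebesgue)" for k
 proof -
  have "(\<integral>x. G x \<bullet> (grad (eta k) x - G x) \<partial>lebesgue) = (\<integral>x. grad (eta k) x \<bullet> G x \<partial>lebesgue) - (\<integral>x. G x \<bullet> G x \<partial>lebesgue)"
   unfolding inner_diff_right inner_commute[of _ "grad _ _"]
   by (intro Bochner_Integration.integral_diff L2_inner_integrable L2sq_grad_finite t fin) measurable
  hence "(\<integral>x. G x \<bullet> (grad (eta k) x - G x) \<partial>lebesgue) = - A" unfolding orth by (simp add: A_def power2_norm_eq_inner)
  thus ?thesis using integral_abs_bound[of lebesgue "\<lambda>x. G x \<bullet> (grad (eta k) x - G x)"] by linarith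
 qed
 ultimately have "A \<le> 0" by (intro LIMSEQ_le_const[where a = A]) auto
 hence "L2sq G = 0" using GA A0 by simp
 hence "AE x in lebesgue. ennreal ((norm (G x))\<^sup>2) = 0" unfolding L2sq_def by (subst (asm) nn_integral_0_iff_AE) auto
 thus ?thesis by eventually_elim (auto simp: ennreal_eq_0_iff)
qed

lemma in_D_unique:
 fixes G :: "'a::euclidean_space \<Rightarrow> 'a"
 assumes N: "3 \<le> DIM('a)" and "in_D u G" "in_D u H"
 shows "AE x in lebesgue. G x = H x"
proof -
 have "in_D (\<lambda>x. 0) (\<lambda>x. 1 *\<^sub>R G x + (-1) *\<^sub>R H x)"
  using in_D_lincomb[OF assms(2,3), of 1 "-1"] by simp
 from in_D_zero_unique[OF N this] show ?thesis by eventually_elim simp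
qed

lemma in_D_wgrad: "u \<in> Dspace \<Longrightarrow> in_D u (wgrad u)"
 using someI_ex[of "in_D u"] by (auto simp: Dspace_def wgrad_def)

lemma Espace_in_D: "u \<in> Espace V \<Longrightarrow> in_D u (wgrad u)"
 by (simp add: Espace_def in_D_wgrad)

lemma wgrad_eq:
 fixes u :: "'a::euclidean_space \<Rightarrow> real"
 assumes N: "3 \<le> DIM('a)" and u: "in_D u G"
 shows "AE x in lebesgue. wgrad u x = G x"
proof -
 have "u \<in> Dspace" using u by (auto simp: Dspace_def)
 from in_D_unique[OF N in_D_wgrad[OF this] u] show ?thesis .
qed

section \<open>Approximation by smooth radial functions\<close>

definition ee :: "nat \<Rightarrow> real \<Rightarrow> real" where
 "ee k x = (if 0 < x then exp (- (1 / x)) / x ^ k else 0)"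

lemma ee_tendsto_0: "(ee k \<longlongrightarrow> 0) (at 0)"
proof -
 have "((\<lambda>x. (1 / x) ^ k / exp (1 / x)) \<longlongrightarrow> 0) (at_right (0::real))"
  by (rule filterlim_compose[OF tendsto_power_div_exp_0])
   (simp add: filterlim_inverse_at_top_right inverse_eq_divide[symmetric])
 hence "(ee k \<longlongrightarrow> 0) (at_right 0)"
 proof (rule Lim_transform_eventually)
  show "\<forall>\<^sub>F x in at_right 0. (1 / x) ^ k / exp (1 / x) = ee k x"
   unfolding eventually_at_right_field by (intro exI[of _ 1]) (auto simp: ee_def exp_minus power_divide divide_inverse power_inverse)
 qed
 moreover have "(ee k \<longlongrightarrow> 0) (at_left 0)"
 proof (rule Lim_transform_eventually[OF tendsto_const])
  show "\<forall>\<^sub>F x in at_left 0. 0 = ee k x"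
   unfolding eventually_at_left_field by (intro exI[of _ "-1"]) (auto simp: ee_def)
 qed
 ultimately show ?thesis by (simp add: filterlim_at_split)
qed

text \<open>The family exp(-1/x) / x^k, extended by 0, is closed under differentiation up to linear
  combinations. This gives smoothness without formulas for higher derivatives; at 0 the difference
  quotient is again a member of the family.\<close>

lemma ee_deriv: "(ee k has_real_derivative - real k * ee (k + 1) x + ee (k + 2) x) (at x)"
proof (cases x "0::real" rule: linorder_cases)
 case less
 have "((\<lambda>_. 0::real) has_real_derivative 0) (at x)" by simp
 hence "(ee k has_real_derivative 0) (at x)"
  by (rule has_field_derivative_transform_within_open[where S = "{..<0}"]) (use less in \<open>auto simp: ee_def\<close>)
 thus ?thesis using less by (simp add: ee_def)
next
 case equal
 have "((\<lambda>h. ee (k + 1) h) \<longlongrightarrow> 0) (at 0)" by (rule ee_tendsto_0)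
 hence "((\<lambda>h. (ee k (0 + h) - ee k 0) / h) \<longlongrightarrow> 0) (at 0)"
  by (rule Lim_transform_eventually)
   (auto intro!: eventually_at_filter[THEN iffD2] always_eventually simp: ee_def mult.commute)
 thus ?thesis using equal by (simp add: DERIV_def ee_def)
next
 case greater
 have "((\<lambda>x. exp (- (1 / x)) / x ^ k) has_real_derivative
   ((exp (- (1 / x)) * (1 / x\<^sup>2)) * x ^ k - exp (- (1 / x)) * (real k * x ^ (k - 1))) / (x ^ k * x ^ k)) (at x)"
 proof (rule DERIV_divide)
  have "((\<lambda>x. - (1 / x)) has_real_derivative 1 / x\<^sup>2) (at x)"
   using greater by (auto intro!: derivative_eq_intros simp: power2_eq_square)
  from DERIV_chain2[OF DERIV_exp this] show "((\<lambda>x. exp (- (1 / x))) has_real_derivative exp (- (1 / x)) * (1 / x\<^sup>2)) (at x)" .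
  show "((\<lambda>x. x ^ k) has_real_derivative real k * x ^ (k - 1)) (at x)" using DERIV_pow[of k x] by simp
 qed (use greater in simp)
 also have "((exp (- (1 / x)) * (1 / x\<^sup>2)) * x ^ k - exp (- (1 / x)) * (real k * x ^ (k - 1))) / (x ^ k * x ^ k) =
   - real k * ee (k + 1) x + ee (k + 2) x"
  using greater by (cases k) (simp_all add: ee_def field_simps power2_eq_square)
 finally show ?thesis
  by (rule has_field_derivative_transform_within_open[where S = "{0<..}"]) (use greater in \<open>auto simp: ee_def\<close>)
qed

lemma ee_cont: "continuous_on S (ee k)"
 by (intro continuous_at_imp_continuous_on ballI DERIV_isCont[OF ee_deriv])

lemma ee0: "0 \<le> ee 0 x" "ee 0 x \<le> 1" "0 < x \<Longrightarrow> 0 < ee 0 x" "x \<le> 0 \<Longrightarrow> ee 0 x = 0"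
 by (auto simp: ee_def)

text \<open>A class closed under partial derivatives, so that coinduction makes its members smooth.
  The flat functions are composed with the squared norm, which avoids the singularity of the norm at
  the origin.\<close>

inductive sgen :: "real \<Rightarrow> real \<Rightarrow> ('a::euclidean_space \<Rightarrow> real) \<Rightarrow> bool" for lo hi where
 sgen_const: "sgen lo hi (\<lambda>x. c)"
| sgen_coord: "sgen lo hi (\<lambda>x. x \<bullet> i)"
| sgen_left: "sgen lo hi (\<lambda>x. ee k (x \<bullet> x - lo))"
| sgen_right: "sgen lo hi (\<lambda>x. ee k (hi - x \<bullet> x))"
| sgen_add: "sgen lo hi f \<Longrightarrow> sgen lo hi h \<Longrightarrow> sgen lo hi (\<lambda>x. f x + h x)"
| sgen_mult: "sgen lo hi f \<Longrightarrow> sgen lo hi h \<Longrightarrow> sgen lo hi (\<lambda>x. f x * h x)"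

lemma ee_comp_deriv:
 assumes s: "(s has_derivative s') (at x)"
 shows "((\<lambda>x. ee k (s x)) has_derivative (\<lambda>v. (- real k * ee (k + 1) (s x) + ee (k + 2) (s x)) * s' v)) (at x)"
 using has_derivative_compose[OF s ee_deriv[unfolded has_field_derivative_def]] by simp

lemma sgen_deriv:
 assumes "sgen lo hi f"
 shows "\<exists>D. (\<forall>x. (f has_derivative D x) (at x)) \<and> (\<forall>v. sgen lo hi (\<lambda>x. D x v))"
 using assms
proof induction
 case (sgen_const c)
 show ?case by (intro exI[of _ "\<lambda>x v. 0"]) (auto intro: sgen.intros)
next
 case (sgen_coord i)
 show ?case
  by (intro exI[of _ "\<lambda>x v. v \<bullet> i"]) (auto intro!: sgen.intros derivative_eq_intros)
next
 case (sgen_left k)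
 have d: "((\<lambda>x. x \<bullet> x - lo) has_derivative (\<lambda>v. 2 * (x \<bullet> v))) (at x)" for x :: 'a
  by (auto intro!: derivative_eq_intros simp: inner_commute)
 have "sgen lo hi (\<lambda>x. (- real k * ee (k + 1) (x \<bullet> x - lo) + ee (k + 2) (x \<bullet> x - lo)) * (2 * (x \<bullet> v)))" for v :: 'a
  by (intro sgen.intros)
 thus ?case
  by (intro exI[of _ "\<lambda>x v. (- real k * ee (k + 1) (x \<bullet> x - lo) + ee (k + 2) (x \<bullet> x - lo)) * (2 * (x \<bullet> v))"] conjI allI ee_comp_deriv[OF d])
next
 case (sgen_right k)
 have d: "((\<lambda>x. hi - x \<bullet> x) has_derivative (\<lambda>v. (-2) * (x \<bullet> v))) (at x)" for x :: 'a
  by (auto intro!: derivative_eq_intros simp: inner_commute)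
 have "sgen lo hi (\<lambda>x. (- real k * ee (k + 1) (hi - x \<bullet> x) + ee (k + 2) (hi - x \<bullet> x)) * ((-2) * (x \<bullet> v)))" for v :: 'a
  by (intro sgen.intros)
 thus ?case
  by (intro exI[of _ "\<lambda>x v. (- real k * ee (k + 1) (hi - x \<bullet> x) + ee (k + 2) (hi - x \<bullet> x)) * ((-2) * (x \<bullet> v))"] conjI allI ee_comp_deriv[OF d])
next
 case (sgen_add f h)
 then obtain D E where D: "\<And>x. (f has_derivative D x) (at x)" "\<And>v. sgen lo hi (\<lambda>x. D x v)"
  and E: "\<And>x. (h has_derivative E x) (at x)" "\<And>v. sgen lo hi (\<lambda>x. E x v)" by auto
 show ?case
  by (intro exI[of _ "\<lambda>x v. D x v + E x v"] conjI allI has_derivative_add D(1) E(1) sgen.sgen_add D(2) E(2))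
next
 case (sgen_mult f h)
 then obtain D E where D: "\<And>x. (f has_derivative D x) (at x)" "\<And>v. sgen lo hi (\<lambda>x. D x v)"
  and E: "\<And>x. (h has_derivative E x) (at x)" "\<And>v. sgen lo hi (\<lambda>x. E x v)" by auto
 show ?case
  by (intro exI[of _ "\<lambda>x v. f x * E x v + D x v * h x"] conjI allI has_derivative_mult D(1) E(1) sgen.sgen_add sgen.sgen_mult D(2) E(2) sgen_mult.hyps)
qed

lemma sgen_smooth: assumes "sgen lo hi f" shows "smooth_fun f"
proof (rule smooth_fun.coinduct[where X = "sgen lo hi" and x = f])
 fix h :: "'a \<Rightarrow> real" assume "sgen lo hi h"
 then obtain D where D: "\<And>x. (h has_derivative D x) (at x)" "\<And>v. sgen lo hi (\<lambda>x. D x v)" using sgen_deriv by blast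
 have "frechet_derivative h (at x) = D x" for x using frechet_derivative_at[OF D(1)] by simp
 moreover have "h differentiable (at x)" for x using D(1) differentiableI by blast
 ultimately show "\<exists>f. h = f \<and> (\<forall>x. f differentiable at x) \<and>
   (\<forall>b\<in>Basis. sgen lo hi (\<lambda>x. frechet_derivative f (at x) b) \<or> smooth_fun (\<lambda>x. frechet_derivative f (at x) b))"
  using D(2) by auto
qed (rule assms)

lemma sgen_sum: "finite I \<Longrightarrow> (\<And>i. i \<in> I \<Longrightarrow> sgen lo hi (f i)) \<Longrightarrow> sgen lo hi (\<lambda>x. \<Sum>i\<in>I. f i x)"
 by (induction I rule: finite_induct) (auto intro: sgen.intros)

lemma sgen_sq: "sgen lo hi (\<lambda>x::'a::euclidean_space. x \<bullet> x)"
proof -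
 have "(\<lambda>x::'a. x \<bullet> x) = (\<lambda>x. \<Sum>i\<in>Basis. (x \<bullet> i) * (x \<bullet> i))" by (rule ext) (rule euclidean_inner)
 moreover have "sgen lo hi (\<lambda>x::'a. \<Sum>i\<in>Basis. (x \<bullet> i) * (x \<bullet> i))" by (intro sgen_sum sgen.intros finite_Basis)
 ultimately show ?thesis by simp
qed

lemma sgen_poly: "real_polynomial_function q \<Longrightarrow> sgen lo hi (\<lambda>x::'a::euclidean_space. q (x \<bullet> x))"
proof (induction q rule: real_polynomial_function.induct)
 case (linear f)
 have "f y = f 1 * y" for y using linear_scale[OF bounded_linear.linear[OF linear], of y 1] by (simp add: mult.commute)
 hence "(\<lambda>x::'a. f (x \<bullet> x)) = (\<lambda>x. f 1 * (x \<bullet> x))" by blast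
 thus ?case using sgen_mult[OF sgen_const sgen_sq] by simp
qed (auto intro: sgen.intros)

text \<open>The function is a tail integral evaluated at |x|^2, with integrand q times a flat
  cut-off between a^2 and b^2. One unfolding of \<open>smooth_fun\<close> suffices, because its
  partial derivatives lie in \<open>sgen\<close>.\<close>

lemma radial_test_from_polynomial:
 assumes ab: "0 < a" "a < b" and q: "real_polynomial_function q"
 shows "\<exists>phi::'a::euclidean_space \<Rightarrow> real. radial_test phi \<and>
   (\<forall>r. dprof phi r = - (2 * r * q (r\<^sup>2) * ee 0 (r\<^sup>2 - a\<^sup>2) * ee 0 (b\<^sup>2 - r\<^sup>2)))"
proof -
 define \<zeta> where "\<zeta> t = q t * (ee 0 (t - a\<^sup>2) * ee 0 (b\<^sup>2 - t))" for t
 have qc: "continuous_on S q" for S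
  using continuous_on_polymonial_function[of q S] q by (simp add: real_polynomial_function_eq)
 have \<zeta>c: "continuous_on S \<zeta>" for S
  unfolding \<zeta>_def by (intro continuous_intros qc continuous_on_compose2[OF ee_cont[of UNIV]]) auto
 have \<zeta>0: "\<zeta> t = 0" if "b\<^sup>2 \<le> t" for t using that by (simp add: \<zeta>_def ee0)
 define \<Xi> where "\<Xi> s = integral {s..b\<^sup>2} \<zeta>" for s
 have \<Xi>0: "\<Xi> s = 0" if "b\<^sup>2 \<le> s" for s using that by (cases "s = b\<^sup>2") (auto simp: \<Xi>_def)
 have \<Xi>M: "\<Xi> s = integral {s..M} \<zeta>" if "b\<^sup>2 \<le> M" "s \<le> M" for s M
 proof (cases "s \<le> b\<^sup>2")
  case True
  have "integral {s..b\<^sup>2} \<zeta> + integral {b\<^sup>2..M} \<zeta> = integral {s..M} \<zeta>"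
   by (rule Henstock_Kurzweil_Integration.integral_combine) (use True that in \<open>auto intro!: integrable_continuous_real \<zeta>c\<close>)
  moreover have "integral {b\<^sup>2..M} \<zeta> = integral {b\<^sup>2..M} (\<lambda>_. 0)" by (rule integral_cong) (auto simp: \<zeta>0)
  ultimately show ?thesis by (simp add: \<Xi>_def)
 next
  case False
  hence "integral {s..M} \<zeta> = integral {s..M} (\<lambda>_. 0)" by (intro integral_cong) (auto simp: \<zeta>0)
  thus ?thesis using False \<Xi>0[of s] by simp
 qed
 have \<Xi>d: "(\<Xi> has_real_derivative - \<zeta> s) (at s)" for s
 proof -
  define M where "M = max (b\<^sup>2) s + 1"
  have "((\<lambda>x. integral {x..M} \<zeta>) has_real_derivative - \<zeta> s) (at s within {s - 1..M})"
   by (rule integral_has_real_derivative'[OF \<zeta>c]) (auto simp: M_def)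
  hence "((\<lambda>x. integral {x..M} \<zeta>) has_real_derivative - \<zeta> s) (at s within {s - 1<..<M})"
   by (rule has_field_derivative_subset) auto
  hence "((\<lambda>x. integral {x..M} \<zeta>) has_real_derivative - \<zeta> s) (at s)"
   by (subst (asm) at_within_open) (auto simp: M_def)
  thus ?thesis
   by (rule has_field_derivative_transform_within_open[where S = "{s - 1<..<M}"]) (auto simp: M_def intro!: \<Xi>M[symmetric])
 qed
 define phi where "phi x = \<Xi> (x \<bullet> x)" for x :: 'a
 have phid: "(phi has_derivative (\<lambda>v. - \<zeta> (x \<bullet> x) * (2 * (x \<bullet> v)))) (at x)" for x
 proof -
  have "((\<lambda>x. x \<bullet> x) has_derivative (\<lambda>v. 2 * (x \<bullet> v))) (at x)"
   by (auto intro!: derivative_eq_intros simp: inner_commute)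
  from has_derivative_compose[OF this \<Xi>d[unfolded has_field_derivative_def]] show ?thesis
   by (simp add: phi_def[abs_def])
 qed
 have fd: "frechet_derivative phi (at x) = (\<lambda>v. - \<zeta> (x \<bullet> x) * (2 * (x \<bullet> v)))" for x
  using frechet_derivative_at[OF phid] by simp
 have sm: "smooth_fun phi"
 proof (rule smooth_fun.intros)
  show "\<forall>x. phi differentiable (at x)" using phid differentiableI by blast
  show "\<forall>i\<in>Basis. smooth_fun (\<lambda>x. frechet_derivative phi (at x) i)"
  proof
   fix i :: 'a
   have "sgen (a\<^sup>2) (b\<^sup>2) (\<lambda>x::'a. (-1) * (q (x \<bullet> x) * (ee 0 (x \<bullet> x - a\<^sup>2) * ee 0 (b\<^sup>2 - x \<bullet> x))) * (2 * (x \<bullet> i)))"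
    by (intro sgen.intros sgen_poly q)
   from sgen_smooth[OF this] show "smooth_fun (\<lambda>x. frechet_derivative phi (at x) i)"
    unfolding fd \<zeta>_def by simp
  qed
 qed
 have "radial_test phi"
  unfolding radial_test_def
 proof (intro conjI allI impI sm)
  have "{x. phi x \<noteq> 0} \<subseteq> cball 0 b"
  proof clarsimp
   fix x assume "phi x \<noteq> 0"
   hence "x \<bullet> x < b\<^sup>2" using \<Xi>0[of "x \<bullet> x"] by (force simp: phi_def)
   hence "(norm x)\<^sup>2 \<le> b\<^sup>2" by (simp add: power2_norm_eq_inner)
   thus "norm x \<le> b" using ab by (intro power2_le_imp_le[of "norm x" b]) auto
  qed
  thus "bounded {x. phi x \<noteq> 0}" by (rule bounded_subset[OF bounded_cball])
  show "phi x = phi y" if "norm x = norm y" for x y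
   using that unfolding phi_def power2_norm_eq_inner[symmetric] by simp
 qed
 moreover have "dprof phi r = - (2 * r * q (r\<^sup>2) * ee 0 (r\<^sup>2 - a\<^sup>2) * ee 0 (b\<^sup>2 - r\<^sup>2))" for r
 proof -
  have "(e0::'a) \<bullet> e0 = 1" by (simp add: power2_norm_eq_inner[symmetric])
  thus ?thesis unfolding dprof_def fd by (simp add: \<zeta>_def power2_eq_square)
 qed
 ultimately show ?thesis by blast
qed

text \<open>Weierstrass approximation of a quotient: derivatives of the form -q(r^2) B(r) with a
  fixed flat B and a polynomial q are available, so q has to approximate -P/B as a function of r^2.
  As |B| \<le> 2 b, the accuracy eps / (2 b) is enough.\<close>

lemma radial_test_approx:
 assumes ab: "0 < a" "a < a'" "a' \<le> b'" "b' < b" and P: "continuous_on {a..b} P"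
  and P0: "\<And>r. r \<in> {a..b} \<Longrightarrow> r \<notin> {a'..b'} \<Longrightarrow> P r = 0" and eps: "0 < eps"
 shows "\<exists>phi::'a::euclidean_space \<Rightarrow> real. radial_test phi \<and>
   (\<forall>r\<in>{a..b}. \<bar>dprof phi r - P r\<bar> \<le> eps) \<and> (\<forall>r\<ge>0. r \<notin> {a..b} \<longrightarrow> dprof phi r = 0)"
proof -
 define B where "B r = 2 * r * ee 0 (r\<^sup>2 - a\<^sup>2) * ee 0 (b\<^sup>2 - r\<^sup>2)" for r
 have Bc: "continuous_on S B" for S
  unfolding B_def by (intro continuous_intros continuous_on_compose2[OF ee_cont[of UNIV]]) auto
 have Bpos: "0 < B r" if "r \<in> {a'..b'}" for r
 proof -
  have "a\<^sup>2 < r\<^sup>2" "r\<^sup>2 < b\<^sup>2" using that ab by (auto intro!: power_strict_mono)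
  thus ?thesis using that ab by (simp add: B_def ee0)
 qed
 have Bb: "\<bar>B r\<bar> \<le> 2 * b" if "r \<in> {a..b}" for r
 proof -
  have "\<bar>B r\<bar> = 2 * r * (ee 0 (r\<^sup>2 - a\<^sup>2) * ee 0 (b\<^sup>2 - r\<^sup>2))" using that ab ee0(1) by (simp add: B_def abs_mult)
  also have "\<dots> \<le> 2 * b * (1 * 1)" using that ab by (intro mult_mono ee0) (auto intro!: ee0 mult_nonneg_nonneg)
  finally show ?thesis by simp
 qed
 obtain r0 where r0: "r0 \<in> {a'..b'}" "\<And>r. r \<in> {a'..b'} \<Longrightarrow> B r0 \<le> B r"
  using continuous_attains_inf[OF compact_Icc _ Bc, of a' b'] ab by auto
 define m where "m = B r0"
 have m: "m > 0" unfolding m_def by (rule Bpos[OF r0(1)])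
 \<comment> \<open>On [a', b'] the maximum is B itself, because m is the minimum of B there;
   elsewhere P vanishes and the maximum only keeps the denominator positive.\<close>
 define h where "h t = - P (sqrt t) / max m (B (sqrt t))" for t
 have hc: "continuous_on {a\<^sup>2..b\<^sup>2} h"
  unfolding h_def
 proof (intro continuous_intros continuous_on_compose2[OF P] continuous_on_compose2[OF Bc[of UNIV]] ballI)
  have "a \<le> sqrt t \<and> sqrt t \<le> b" if "a\<^sup>2 \<le> t" "t \<le> b\<^sup>2" for t
   using real_sqrt_le_mono[OF that(1)] real_sqrt_le_mono[OF that(2)] ab by simp
  thus "sqrt ` {a\<^sup>2..b\<^sup>2} \<subseteq> {a..b}" "sqrt ` {a\<^sup>2..b\<^sup>2} \<subseteq> UNIV" by auto
  show "max m (B (sqrt x)) \<noteq> 0" for x using m by auto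
 qed
 have "0 < eps / (2 * b)" using eps ab by simp
 from Stone_Weierstrass_real_polynomial_function[OF compact_Icc hc this]
 obtain q where q: "real_polynomial_function q" "\<And>t. t \<in> {a\<^sup>2..b\<^sup>2} \<Longrightarrow> \<bar>h t - q t\<bar> < eps / (2 * b)" by blast
 obtain phi :: "'a \<Rightarrow> real" where phi: "radial_test phi" "\<And>r. dprof phi r = - (2 * r * q (r\<^sup>2) * ee 0 (r\<^sup>2 - a\<^sup>2) * ee 0 (b\<^sup>2 - r\<^sup>2))"
  using radial_test_from_polynomial[of a b q] ab q(1) by auto
 have d: "dprof phi r = - q (r\<^sup>2) * B r" for r by (simp add: phi(2) B_def)
 have "\<bar>dprof phi r - P r\<bar> \<le> eps" if r: "r \<in> {a..b}" for r
 proof -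
  have r0': "0 \<le> r" using r ab by simp
  have "P r = - h (r\<^sup>2) * B r"
  proof (cases "r \<in> {a'..b'}")
   case True
   have "max m (B r) = B r" using r0(2)[OF True] by (simp add: m_def)
   thus ?thesis using Bpos[OF True] r0' by (simp add: h_def)
  next
   case False thus ?thesis using P0[OF r False] r0' by (simp add: h_def)
  qed
  hence "\<bar>dprof phi r - P r\<bar> = \<bar>h (r\<^sup>2) - q (r\<^sup>2)\<bar> * \<bar>B r\<bar>" unfolding d abs_mult[symmetric] by (simp add: algebra_simps)
  also have "\<dots> \<le> eps / (2 * b) * (2 * b)"
   using q(2)[of "r\<^sup>2"] Bb[OF r] r ab by (intro mult_mono) (auto intro!: power_mono less_imp_le)
  also have "\<dots> = eps" using ab by simp
  finally show ?thesis .
 qed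
 moreover have "dprof phi r = 0" if "0 \<le> r" "r \<notin> {a..b}" for r
 proof -
  have "r\<^sup>2 \<le> a\<^sup>2 \<or> b\<^sup>2 \<le> r\<^sup>2" using that ab by (cases "r \<le> a") (auto intro!: power_mono)
  thus ?thesis unfolding phi(2) using ee0(4)[of "r\<^sup>2 - a\<^sup>2"] ee0(4)[of "b\<^sup>2 - r\<^sup>2"] by auto
 qed
 ultimately show ?thesis using phi(1) by blast
qed

text \<open>Functions such as V and K carry an arbitrary value at r = 0; a single point does not
  affect Borel measurability.\<close>

lemma radial_measurable:
 fixes F :: "real \<Rightarrow> 'b::topological_space"
 assumes "continuous_on {0<..} F"
 shows "(\<lambda>x::'a::euclidean_space. F (norm x)) \<in> borel_measurable borel"
proof -
 have [measurable]: "(\<lambda>r. if r \<in> {0<..} then F r else F 0) \<in> borel_measurable borel"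
  by (rule borel_measurable_continuous_on_if) (use assms in auto)
 have "(\<lambda>x::'a. F (norm x)) = (\<lambda>x. (\<lambda>r. if r \<in> {0<..} then F r else F 0) (norm x))" by (auto simp: fun_eq_iff)
 thus ?thesis by (simp only:) measurable
qed

text \<open>The cut-off is applied to the derivative P and not to U, so no derivative of the cut-off
  arises. The values of the test functions then converge by integrating inwards from a large radius,
  where both functions are small.\<close>

lemma radial_in_D:
 fixes U P :: "real \<Rightarrow> real"
 assumes N: "3 \<le> DIM('a::euclidean_space)" and Ud: "\<And>r. 0 < r \<Longrightarrow> (U has_real_derivative P r) (at r)"
  and Pc: "continuous_on {0<..} P" and US: "\<And>r. 0 < r \<Longrightarrow> \<bar>U r\<bar> \<le> S * ew DIM('a) r"
  and E: "\<And>a b. 0 < a \<Longrightarrow> integral {a..b} (\<lambda>r. om DIM('a) r * (P r)\<^sup>2) \<le> E"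
 shows "in_D (\<lambda>x::'a. U (norm x)) (\<lambda>x. (P (norm x) / norm x) *\<^sub>R x)"
proof -
 let ?N = "DIM('a)" and ?c = "cN TYPE('a)"
 define G where "G x = (P (norm x) / norm x) *\<^sub>R x" for x :: 'a
 have Uc: "continuous_on {0<..} U" using Ud by (intro continuous_at_imp_continuous_on ballI DERIV_isCont) auto
 have Pc': "continuous_on {a..b} P" if "0 < a" for a b by (rule continuous_on_subset[OF Pc]) (use that in auto)
 note [measurable] = radial_measurable[OF Pc, where 'a='a] radial_measurable[OF Uc, where 'a='a]
 have Gm: "G \<in> borel_measurable lebesgue" unfolding G_def[abs_def] by (intro measurable_completion) measurable
 have nG: "norm (G x) = \<bar>P (norm x)\<bar>" if "x \<noteq> 0" for x using that by (simp add: G_def)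
 have fin: "(\<integral>\<^sup>+x. ennreal ((P (norm (x::'a)))\<^sup>2) \<partial>lebesgue) \<le> ennreal (?c * E)"
 proof (rule nn_integral_le_of_shells)
  show "(\<lambda>x::'a. ennreal ((P (norm x))\<^sup>2)) \<in> borel_measurable lebesgue" by (intro measurable_completion) measurable
  fix a b :: real assume a: "0 < a" "a \<le> 1" "1 \<le> b"
  have "(\<integral>\<^sup>+x. ennreal ((P (norm (x::'a)))\<^sup>2) * indicator {x. a \<le> norm x \<and> norm x \<le> b} x \<partial>lebesgue) = ennreal (?c * integral {a..b} (\<lambda>r. om ?N r * (P r)\<^sup>2))"
   by (rule polar_shell[OF a(1)]) (auto intro!: continuous_intros Pc' a)
  also have "\<dots> \<le> ennreal (?c * E)" using E[OF a(1), of b] cN_pos[where 'a='a] by (intro ennreal_leI mult_left_mono) auto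
  finally show "(\<integral>\<^sup>+x. ennreal ((P (norm (x::'a)))\<^sup>2) * indicator {x. a \<le> norm x \<and> norm x \<le> b} x \<partial>lebesgue) \<le> ennreal (?c * E)" .
 qed
 \<comment> \<open>Piecewise linear: 1 on [2/(j+1), j+1] when this interval is nonempty, and 0
   outside [1/(j+1), j+2].\<close>
 define ct where "ct j r = max 0 (min 1 (min (real (j + 1) * r - 1) (real (j + 1) + 1 - r)))" for j :: nat and r :: real
 define a1 b1 where "a1 j = 1 / (2 * real (j + 1))" and "b1 j = real (j + 1) + 2" for j :: nat
 \<comment> \<open>The squared error times the volume of the ball of radius b1 is of order b1^(-N)
   and tends to 0.\<close>
 define eps where "eps j = 1 / b1 j ^ ?N" for j
 have ex: "\<exists>phi::'a \<Rightarrow> real. radial_test phi \<and> (\<forall>r\<in>{a1 j..b1 j}. \<bar>dprof phi r - ct j r * P r\<bar> \<le> eps j) \<and> (\<forall>r\<ge>0. r \<notin> {a1 j..b1 j} \<longrightarrow> dprof phi r = 0)" for j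
 proof (rule radial_test_approx[where a' = "1 / real (j + 1)" and b' = "real (j + 1) + 1"])
  show "0 < a1 j" "a1 j < 1 / real (j + 1)" "real (j + 1) + 1 < b1 j" "0 < eps j" by (auto simp: a1_def b1_def eps_def field_simps)
  have "1 / real (j + 1) \<le> 1" by simp
  thus "1 / real (j + 1) \<le> real (j + 1) + 1" by linarith
  show "continuous_on {a1 j..b1 j} (\<lambda>r. ct j r * P r)"
   unfolding ct_def by (intro continuous_intros Pc') (auto simp: a1_def)
  show "ct j r * P r = 0" if "r \<in> {a1 j..b1 j}" "r \<notin> {1 / real (j + 1)..real (j + 1) + 1}" for r
  proof -
   have "real (j + 1) * r - 1 \<le> 0 \<or> real (j + 1) + 1 - r \<le> 0" using that(2) by (auto simp: field_simps)
   hence "ct j r = 0" unfolding ct_def by (auto simp: min_def max_def)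
   thus ?thesis by simp
  qed
 qed
 then obtain phi :: "nat \<Rightarrow> 'a \<Rightarrow> real" where t: "\<And>j. radial_test (phi j)"
  and ap: "\<And>j r. r \<in> {a1 j..b1 j} \<Longrightarrow> \<bar>dprof (phi j) r - ct j r * P r\<bar> \<le> eps j"
  and ap0: "\<And>j r. 0 \<le> r \<Longrightarrow> r \<notin> {a1 j..b1 j} \<Longrightarrow> dprof (phi j) r = 0" by metis
 have ct01: "0 \<le> ct j r" "ct j r \<le> 1" for j r by (auto simp: ct_def)
 have b1p: "1 \<le> b1 j" for j by (simp add: b1_def)
 have dist: "\<bar>dprof (phi j) r - P r\<bar> \<le> (if r \<le> b1 j then eps j else 0) + (1 - ct j r) * \<bar>P r\<bar>" if r: "0 \<le> r" for j r
 proof (cases "r \<in> {a1 j..b1 j}")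
  case True
  have "\<bar>dprof (phi j) r - P r\<bar> \<le> \<bar>dprof (phi j) r - ct j r * P r\<bar> + \<bar>(1 - ct j r) * P r\<bar>" by (simp add: algebra_simps)
  thus ?thesis using ap[OF True] True ct01[of j r] by (simp add: abs_mult)
 next
  case False
  have "real (j + 1) * r - 1 \<le> 0 \<or> real (j + 1) + 1 - r \<le> 0"
   using False r by (auto simp: a1_def b1_def field_simps)
  hence "ct j r = 0" unfolding ct_def by (auto simp: min_def max_def)
  thus ?thesis using ap0[OF r False] b1p[of j] by (simp add: eps_def)
 qed
 have lim: "(\<lambda>j. L2sq (\<lambda>x. grad (phi j) x - G x)) \<longlonglongrightarrow> 0"
 proof (rule tendsto_sandwich[OF always_eventually always_eventually tendsto_const])
  show "\<forall>j. L2sq (\<lambda>x. grad (phi j) x - G x) \<le>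
    ennreal (2 * unit_ball_vol ?N) * ennreal (1 / b1 j) + 2 * (\<integral>\<^sup>+x. ennreal (((1 - ct j (norm (x::'a))) * P (norm x))\<^sup>2) \<partial>lebesgue)"
  proof
   fix j
   have "L2sq (\<lambda>x. grad (phi j) x - G x) \<le>
    (\<integral>\<^sup>+x. ennreal (2 * (eps j)\<^sup>2) * indicator (cball (0::'a) (b1 j)) x + 2 * ennreal (((1 - ct j (norm x)) * P (norm x))\<^sup>2) \<partial>lebesgue)"
    unfolding L2sq_def
   proof (rule nn_integral_mono_AE)
    show "AE x in lebesgue. ennreal ((norm (grad (phi j) x - G x))\<^sup>2) \<le> ennreal (2 * (eps j)\<^sup>2) * indicator (cball (0::'a) (b1 j)) x + 2 * ennreal (((1 - ct j (norm x)) * P (norm x))\<^sup>2)"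
     using AE_nonzero
    proof eventually_elim
     case (elim x)
     have "grad (phi j) x - G x = ((dprof (phi j) (norm x) - P (norm x)) / norm x) *\<^sub>R x"
      by (simp add: radial_test_grad[OF t elim] G_def diff_divide_distrib scaleR_diff_left)
     hence "norm (grad (phi j) x - G x) = \<bar>dprof (phi j) (norm x) - P (norm x)\<bar>" using elim by simp
     also have "\<dots> \<le> (if norm x \<le> b1 j then eps j else 0) + (1 - ct j (norm x)) * \<bar>P (norm x)\<bar>" by (rule dist) simp
     finally have "(norm (grad (phi j) x - G x))\<^sup>2 \<le> ((if norm x \<le> b1 j then eps j else 0) + (1 - ct j (norm x)) * \<bar>P (norm x)\<bar>)\<^sup>2"
      by (intro power_mono) auto
     also have "\<dots> \<le> 2 * (if norm x \<le> b1 j then eps j else 0)\<^sup>2 + 2 * ((1 - ct j (norm x)) * P (norm x))\<^sup>2"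
      using norm_add_sq_le[of "if norm x \<le> b1 j then eps j else 0" "(1 - ct j (norm x)) * \<bar>P (norm x)\<bar>"]
      by (simp add: power_mult_distrib)
     finally have "ennreal ((norm (grad (phi j) x - G x))\<^sup>2) \<le> ennreal (2 * (if norm x \<le> b1 j then eps j else 0)\<^sup>2) + ennreal (2 * ((1 - ct j (norm x)) * P (norm x))\<^sup>2)"
      by (simp add: ennreal_plus[symmetric] ennreal_leI del: ennreal_plus)
     also have "ennreal (2 * ((1 - ct j (norm x)) * P (norm x))\<^sup>2) = 2 * ennreal (((1 - ct j (norm x)) * P (norm x))\<^sup>2)"
      using ennreal_mult[of 2 "((1 - ct j (norm x)) * P (norm x))\<^sup>2"] by simp
     also have "ennreal (2 * (if norm x \<le> b1 j then eps j else 0)\<^sup>2) = ennreal (2 * (eps j)\<^sup>2) * indicator (cball (0::'a) (b1 j)) x"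
      by (simp add: indicator_def)
     finally show ?case .
    qed
   qed
   also have "\<dots> = (\<integral>\<^sup>+x. ennreal (2 * (eps j)\<^sup>2) * indicator (cball (0::'a) (b1 j)) x \<partial>lebesgue) + 2 * (\<integral>\<^sup>+x. ennreal (((1 - ct j (norm (x::'a))) * P (norm x))\<^sup>2) \<partial>lebesgue)"
   proof (subst nn_integral_add)
    have m: "(\<lambda>x::'a. ennreal (((1 - ct j (norm x)) * P (norm x))\<^sup>2)) \<in> borel_measurable lebesgue"
     unfolding ct_def by (intro measurable_completion) measurable
    thus "(\<lambda>x::'a. 2 * ennreal (((1 - ct j (norm x)) * P (norm x))\<^sup>2)) \<in> borel_measurable lebesgue" by measurable
    show "(\<integral>\<^sup>+x. ennreal (2 * (eps j)\<^sup>2) * indicator (cball (0::'a) (b1 j)) x \<partial>lebesgue) + (\<integral>\<^sup>+x. 2 * ennreal (((1 - ct j (norm (x::'a))) * P (norm x))\<^sup>2) \<partial>lebesgue) =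
     (\<integral>\<^sup>+x. ennreal (2 * (eps j)\<^sup>2) * indicator (cball (0::'a) (b1 j)) x \<partial>lebesgue) + 2 * (\<integral>\<^sup>+x. ennreal (((1 - ct j (norm (x::'a))) * P (norm x))\<^sup>2) \<partial>lebesgue)"
     by (subst nn_integral_cmult[OF m]) simp
    have [measurable]: "cball (0::'a) (b1 j) \<in> sets borel" by simp
    show "(\<lambda>x. ennreal (2 * (eps j)\<^sup>2) * indicator (cball (0::'a) (b1 j)) x) \<in> borel_measurable lebesgue"
     by (intro measurable_completion) measurable
   qed
   also have "(\<integral>\<^sup>+x. ennreal (2 * (eps j)\<^sup>2) * indicator (cball (0::'a) (b1 j)) x \<partial>lebesgue) = ennreal (2 * (eps j)\<^sup>2) * ennreal (unit_ball_vol ?N * b1 j ^ ?N)"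
    using b1p[of j] by (subst nn_integral_cmult_indicator) (auto simp: emeasure_cball)
   also have "\<dots> = ennreal (2 * unit_ball_vol ?N * ((eps j)\<^sup>2 * b1 j ^ ?N))"
    using b1p[of j] by (subst ennreal_mult[symmetric]) (auto simp: mult_ac)
   also have "\<dots> \<le> ennreal (2 * unit_ball_vol ?N * (1 / b1 j))"
   proof (intro ennreal_leI mult_left_mono)
    have "(eps j)\<^sup>2 * b1 j ^ ?N = 1 / b1 j ^ ?N" using b1p[of j] by (simp add: eps_def power2_eq_square)
    also have "\<dots> \<le> 1 / b1 j" using b1p[of j] N power_increasing[of 1 ?N "b1 j"] by (intro divide_left_mono) auto
    finally show "(eps j)\<^sup>2 * b1 j ^ ?N \<le> 1 / b1 j" .
   qed simp
   also have "\<dots> = ennreal (2 * unit_ball_vol ?N) * ennreal (1 / b1 j)" using b1p[of j] by (intro ennreal_mult) auto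
   finally show "L2sq (\<lambda>x. grad (phi j) x - G x) \<le>
    ennreal (2 * unit_ball_vol ?N) * ennreal (1 / b1 j) + 2 * (\<integral>\<^sup>+x. ennreal (((1 - ct j (norm (x::'a))) * P (norm x))\<^sup>2) \<partial>lebesgue)" by simp
  qed
  have "(\<lambda>j. 1 / b1 j) \<longlonglongrightarrow> 0"
   by (rule tendsto_sandwich[OF _ _ tendsto_const LIMSEQ_inverse_real_of_nat])
    (auto intro!: always_eventually simp: b1_def field_simps)
  hence l1: "(\<lambda>j. ennreal (1 / b1 j)) \<longlonglongrightarrow> ennreal 0" by (rule tendsto_ennrealI)
  have l2: "(\<lambda>j. \<integral>\<^sup>+x. ennreal (((1 - ct j (norm (x::'a))) * P (norm x))\<^sup>2) \<partial>lebesgue) \<longlonglongrightarrow> (\<integral>\<^sup>+x. 0 \<partial>(lebesgue :: 'a measure))"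
  proof (rule nn_integral_dominated_convergence[where w = "\<lambda>x. ennreal ((P (norm (x::'a)))\<^sup>2)"])
   show "(\<lambda>x::'a. ennreal (((1 - ct j (norm x)) * P (norm x))\<^sup>2)) \<in> borel_measurable lebesgue" for j
    unfolding ct_def by (intro measurable_completion) measurable
   show "(\<lambda>x::'a. ennreal ((P (norm x))\<^sup>2)) \<in> borel_measurable lebesgue" by (intro measurable_completion) measurable
   show "(\<integral>\<^sup>+x. ennreal ((P (norm (x::'a)))\<^sup>2) \<partial>lebesgue) < \<infinity>" using fin by (rule order_le_less_trans) simp
   show "AE x in lebesgue. ennreal (((1 - ct j (norm (x::'a))) * P (norm x))\<^sup>2) \<le> ennreal ((P (norm x))\<^sup>2)" for j
   proof (intro AE_I2 ennreal_leI)
    fix x :: 'a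
    have "(1 - ct j (norm x))\<^sup>2 \<le> 1" using ct01[of j "norm x"] by (intro power_le_one) auto
    thus "((1 - ct j (norm x)) * P (norm x))\<^sup>2 \<le> (P (norm x))\<^sup>2"
     unfolding power_mult_distrib by (intro mult_left_le_one_le) auto
   qed
   show "AE x in lebesgue. (\<lambda>j. ennreal (((1 - ct j (norm (x::'a))) * P (norm x))\<^sup>2)) \<longlonglongrightarrow> 0"
    using AE_nonzero
   proof eventually_elim
    case (elim x)
    define r where "r = norm x"
    have r: "0 < r" using elim by (simp add: r_def)
    obtain j0 where j0: "real j0 > max (2 / r) r" using reals_Archimedean2 by blast
    have "ct j r = 1" if "j \<ge> j0" for j
    proof -
     have j: "2 / r \<le> real (j + 1)" "r \<le> real (j + 1)" using j0 that by auto
     hence "2 \<le> real (j + 1) * r" using r by (simp add: field_simps)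
     thus ?thesis using j unfolding ct_def by auto
    qed
    hence "\<forall>\<^sub>F j in sequentially. 0 = ennreal (((1 - ct j r) * P r)\<^sup>2)" by (auto simp: eventually_sequentially)
    from Lim_transform_eventually[OF tendsto_const this] show ?case by (simp add: r_def)
   qed
  qed auto
  have "(\<lambda>j. ennreal (2 * unit_ball_vol ?N) * ennreal (1 / b1 j) + 2 * (\<integral>\<^sup>+x. ennreal (((1 - ct j (norm (x::'a))) * P (norm x))\<^sup>2) \<partial>lebesgue)) \<longlonglongrightarrow>
   ennreal (2 * unit_ball_vol ?N) * ennreal 0 + 2 * (\<integral>\<^sup>+x. 0 \<partial>(lebesgue :: 'a measure))"
   by (intro tendsto_add ennreal_tendsto_cmult l1 l2) auto
  thus "(\<lambda>j. ennreal (2 * unit_ball_vol ?N) * ennreal (1 / b1 j) + 2 * (\<integral>\<^sup>+x. ennreal (((1 - ct j (norm (x::'a))) * P (norm x))\<^sup>2) \<partial>lebesgue)) \<longlonglongrightarrow> 0"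
   by simp
 qed simp
 have pw: "(\<lambda>j. prof (phi j) r) \<longlonglongrightarrow> U r" if r: "0 < r" for r
 proof (rule LIMSEQ_I)
  fix e :: real assume e: "0 < e"
  have er: "ew ?N r > 0" by (rule ew_pos[OF r])
  define d where "d = e / (3 * ew ?N r)"
  have d: "0 < d" using e er by (simp add: d_def)
  have "0 < ennreal (?c * d\<^sup>2)" using d cN_pos[where 'a='a] by simp
  from order_tendstoD(2)[OF lim this] obtain j0 where j0: "\<And>j. j \<ge> j0 \<Longrightarrow> L2sq (\<lambda>x. grad (phi j) x - G x) < ennreal (?c * d\<^sup>2)"
   by (auto simp: eventually_sequentially)
  have "norm (prof (phi j) r - U r) < e" if j: "j \<ge> j0" for j
  proof -
   have sm: "smooth_fun (phi j)" by (rule radial_testD(1)[OF t])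
   obtain B where B: "1 \<le> B" "\<And>r. B \<le> r \<Longrightarrow> prof (phi j) r = 0" using radial_test_support[OF t[of j]] by metis
   define q where "q = (real ?N - 2) / 2"
   have q: "q > 0" using N by (simp add: q_def)
   \<comment> \<open>Beyond the support of phi j, and so far out that the decay of U gives |U R|
     \<le> e/3.\<close>
   define R where "R = max (max r B) ((3 * (\<bar>S\<bar> + 1) / e) powr (1 / q))"
   have R: "r \<le> R" "B \<le> R" by (auto simp: R_def)
   have R0: "0 < R" using R r by simp
   have "3 * (\<bar>S\<bar> + 1) / e = ((3 * (\<bar>S\<bar> + 1) / e) powr (1 / q)) powr q" using q e by (simp add: powr_powr)
   also have "\<dots> \<le> R powr q" using q by (intro powr_mono2) (auto simp: R_def)
   finally have Rq: "3 * (\<bar>S\<bar> + 1) \<le> R powr q * e" using e by (simp add: field_simps)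
   have ewR: "ew ?N R * R powr q = 1" using R0 by (simp add: ew_def q_def powr_add[symmetric] diff_divide_distrib)
   have "3 * (\<bar>S\<bar> + 1) * ew ?N R \<le> (R powr q * e) * ew ?N R" using Rq ew_pos[OF R0, of ?N] by (intro mult_right_mono) auto
   also have "\<dots> = e" using ewR by (simp add: mult_ac)
   finally have tail: "(\<bar>S\<bar> + 1) * ew ?N R \<le> e / 3" unfolding mult.assoc[of 3] by linarith
   have UR: "\<bar>U R\<bar> \<le> e / 3"
   proof -
    have "\<bar>U R\<bar> \<le> S * ew ?N R" by (rule US[OF R0])
    also have "\<dots> \<le> (\<bar>S\<bar> + 1) * ew ?N R" using ew_pos[OF R0, of ?N] by (intro mult_right_mono) auto
    finally show ?thesis using tail by simp
   qed
   define D where "D = (\<lambda>s. dprof (phi j) s - P s)"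
   have Dc: "continuous_on {r..R} D" unfolding D_def by (intro continuous_intros dprof_cont sm Pc' r)
   have "(D has_integral ((prof (phi j) R - U R) - (prof (phi j) r - U r))) {r..R}"
    unfolding D_def
   proof (rule fundamental_theorem_of_calculus[OF R(1), where f = "\<lambda>s. prof (phi j) s - U s"])
    fix s assume "s \<in> {r..R}"
    hence "0 < s" using r by simp
    hence "((\<lambda>s. prof (phi j) s - U s) has_real_derivative dprof (phi j) s - P s) (at s)"
     by (intro DERIV_diff prof_deriv sm Ud)
    thus "((\<lambda>s. prof (phi j) s - U s) has_vector_derivative dprof (phi j) s - P s) (at s within {r..R})"
     unfolding has_real_derivative_iff_has_vector_derivative[symmetric] by (rule has_field_derivative_at_within)
   qed
   hence "prof (phi j) r - U r = - U R - integral {r..R} D" using B(2)[OF R(2)] by (simp add: integral_unique)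
   hence "\<bar>prof (phi j) r - U r\<bar> \<le> e / 3 + \<bar>integral {r..R} D\<bar>" using UR by linarith
   also have "\<bar>integral {r..R} D\<bar> \<le> sqrt (nsq ?N r R D) * ew ?N r" by (rule integral_le_nsq[OF N r R(1) Dc])
   also have "sqrt (nsq ?N r R D) * ew ?N r \<le> d * ew ?N r"
   proof (rule mult_right_mono)
    have "ennreal (?c * integral {r..R} (\<lambda>s. om ?N s * (D s)\<^sup>2)) = (\<integral>\<^sup>+x. ennreal ((D (norm x))\<^sup>2) * indicator {x::'a. r \<le> norm x \<and> norm x \<le> R} x \<partial>lebesgue)"
     by (rule polar_shell[symmetric, OF r]) (auto intro!: continuous_intros Dc)
    also have "\<dots> \<le> L2sq (\<lambda>x. grad (phi j) x - G x)"
     unfolding L2sq_def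
    proof (rule nn_integral_mono_AE)
     show "AE x in lebesgue. ennreal ((D (norm x))\<^sup>2) * indicator {x::'a. r \<le> norm x \<and> norm x \<le> R} x \<le> ennreal ((norm (grad (phi j) x - G x))\<^sup>2)"
      using AE_nonzero
     proof eventually_elim
      case (elim x)
      have "grad (phi j) x - G x = (D (norm x) / norm x) *\<^sub>R x"
       by (simp add: radial_test_grad[OF t elim] G_def D_def diff_divide_distrib scaleR_diff_left)
      hence "norm (grad (phi j) x - G x) = \<bar>D (norm x)\<bar>" using elim by simp
      thus ?case by (simp add: indicator_def)
     qed
    qed
    also have "\<dots> < ennreal (?c * d\<^sup>2)" by (rule j0[OF j])
    finally have "?c * integral {r..R} (\<lambda>s. om ?N s * (D s)\<^sup>2) < ?c * d\<^sup>2"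
     using cN_pos[where 'a='a] by (subst (asm) ennreal_less_iff) (auto intro!: mult_nonneg_nonneg integral_nonneg integrable_continuous_real continuous_intros Dc less_imp_le[OF om_pos] simp: r less_le_trans[OF r])
    hence "nsq ?N r R D < d\<^sup>2" using cN_pos[where 'a='a] by (simp add: nsq_def mult.commute)
    thus "sqrt (nsq ?N r R D) \<le> d" using d by (intro real_le_lsqrt) auto
   qed (use er in simp)
   also have "d * ew ?N r = e / 3" using er by (simp add: d_def)
   finally show ?thesis using e by simp
  qed
  thus "\<exists>j0. \<forall>j\<ge>j0. norm (prof (phi j) r - U r) < e" by blast
 qed
 show ?thesis
  unfolding G_def[symmetric]
 proof (rule in_DI[OF _ _ t lim])
  show "(\<lambda>x::'a. U (norm x)) \<in> borel_measurable lebesgue" by (intro measurable_completion) measurable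
  show "AE x in lebesgue. (\<lambda>k. phi k x) \<longlonglongrightarrow> U (norm x)"
   using AE_nonzero by eventually_elim (auto simp: radial_test_prof[OF t] intro: pw)
 qed (rule Gm)
qed

lemma integrable_of_nn_bound:
 fixes f :: "'a \<Rightarrow> real"
 assumes "f \<in> borel_measurable M" "(\<integral>\<^sup>+x. ennreal \<bar>f x\<bar> \<partial>M) \<le> ennreal C"
 shows "integrable M f"
 using assms by (intro integrableI_bounded) (auto intro: le_less_trans)

lemma integral_le_of_nn_bound:
 fixes f :: "'a \<Rightarrow> real"
 assumes "(\<integral>\<^sup>+x. ennreal \<bar>f x\<bar> \<partial>M) \<le> ennreal C" "0 \<le> C"
 shows "\<bar>integral\<^sup>L M f\<bar> \<le> C"
proof (cases "integrable M f")
 case True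
 have "\<bar>integral\<^sup>L M f\<bar> \<le> (\<integral>x. \<bar>f x\<bar> \<partial>M)" by (rule integral_abs_bound)
 also have "ennreal (\<integral>x. \<bar>f x\<bar> \<partial>M) = (\<integral>\<^sup>+x. ennreal \<bar>f x\<bar> \<partial>M)"
  by (rule nn_integral_eq_integral[symmetric]) (use True in auto)
 hence "(\<integral>x. \<bar>f x\<bar> \<partial>M) \<le> C" using assms by (metis ennreal_le_iff)
 finally show ?thesis .
\<comment> \<open>A function that is not integrable has integral 0 by convention, so the bound holds
  as well.\<close>
qed (use assms in \<open>simp add: not_integrable_integral_eq\<close>)

section \<open>Weighted integrals and norm estimates on E\<close>

context weights
begin

abbreviation Vsq :: "('a::euclidean_space \<Rightarrow> real) \<Rightarrow> ennreal" where
 "Vsq h \<equiv> \<integral>\<^sup>+x. ennreal (V (norm x) * (h x)\<^sup>2) \<partial>lebesgue"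

lemma V_meas: "(\<lambda>x::'a::euclidean_space. V (norm x)) \<in> borel_measurable lebesgue"
 by (intro measurable_completion) (use radial_measurable[OF V_cont, where 'a='a] in simp)

lemma K_meas: "(\<lambda>x::'a::euclidean_space. K (norm x)) \<in> borel_measurable lebesgue"
 by (intro measurable_completion) (use radial_measurable[OF K_cont, where 'a='a] in simp)

lemma nn_integral_power_near_0:
 assumes NN: "N = DIM('a::euclidean_space)" and rho: "0 < rho" "rho \<le> 1"
 shows "(\<integral>\<^sup>+x. ennreal (norm x powr (eta - 1) / om N (norm x)) * indicator {x::'a. norm x \<le> rho} x \<partial>lebesgue) \<le> ennreal (cN TYPE('a) * (rho powr eta / eta))"
proof (rule nn_integral_le_of_shells)
 have "(\<lambda>r. r powr (eta - 1) / om N r) \<in> borel_measurable borel" unfolding om_def by measurable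
 hence [measurable]: "(\<lambda>x::'a. norm x powr (eta - 1) / om N (norm x)) \<in> borel_measurable borel" by measurable
 show "(\<lambda>x::'a. ennreal (norm x powr (eta - 1) / om N (norm x)) * indicator {x. norm x \<le> rho} x) \<in> borel_measurable lebesgue"
  by (intro measurable_completion) measurable
 fix a b :: real assume a: "0 < a" "a \<le> 1" "1 \<le> b"
 have "(\<integral>\<^sup>+x. ennreal (norm x powr (eta - 1) / om N (norm x)) * indicator {x::'a. norm x \<le> rho} x * indicator {x. a \<le> norm x \<and> norm x \<le> b} x \<partial>lebesgue)
  \<le> (\<integral>\<^sup>+x. ennreal (norm x powr (eta - 1) / om N (norm x)) * indicator {x::'a. min a rho \<le> norm x \<and> norm x \<le> rho} x \<partial>lebesgue)"
  by (intro nn_integral_mono) (auto simp: indicator_def)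
 also have "\<dots> = ennreal (cN TYPE('a) * integral {min a rho..rho} (\<lambda>r. om DIM('a) r * (r powr (eta - 1) / om N r)))"
 proof (rule polar_shell)
  show "0 < min a rho" using a rho by simp
  show "continuous_on {min a rho..rho} (\<lambda>r. r powr (eta - 1) / om N r)"
   by (intro continuous_intros) (use a rho om_pos[of _ N] in \<open>auto simp: less_imp_neq[symmetric] min_def split: if_splits\<close>)
  show "0 \<le> r powr (eta - 1) / om N r" if "r \<in> {min a rho..rho}" for r
  proof -
   have "0 < r" using that a rho by (auto simp: min_def split: if_splits)
   thus ?thesis using om_pos[of r N] by simp
  qed
 qed
 also have "integral {min a rho..rho} (\<lambda>r. om DIM('a) r * (r powr (eta - 1) / om N r)) = integral {min a rho..rho} (\<lambda>r. r powr (eta - 1))"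
 proof (rule integral_cong)
  fix r assume "r \<in> {min a rho..rho}"
  hence "0 < r" using a rho by (auto simp: min_def split: if_splits)
  thus "om DIM('a) r * (r powr (eta - 1) / om N r) = r powr (eta - 1)" using om_pos[of r N] NN by simp
 qed
 also have "\<dots> = (rho powr eta - min a rho powr eta) / eta"
  by (rule integral_unique[OF has_integral_powr_0]) (use a rho in auto)
 also have "ennreal (cN TYPE('a) * ((rho powr eta - min a rho powr eta) / eta)) \<le> ennreal (cN TYPE('a) * (rho powr eta / eta))"
  using eta cN_pos[where 'a='a] by (intro ennreal_leI mult_left_mono divide_right_mono) auto
 finally show "(\<integral>\<^sup>+x. ennreal (norm x powr (eta - 1) / om N (norm x)) * indicator {x::'a. norm x \<le> rho} x * indicator {x. a \<le> norm x \<and> norm x \<le> b} x \<partial>lebesgue) \<le> ennreal (cN TYPE('a) * (rho powr eta / eta))" .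
qed

lemma nn_integral_power_tail:
 assumes NN: "N = DIM('a::euclidean_space)" and R: "1 \<le> R"
 shows "(\<integral>\<^sup>+x. ennreal (norm x powr (- eta - 1) / om N (norm x)) * indicator {x::'a. R < norm x} x \<partial>lebesgue) \<le> ennreal (cN TYPE('a) * (R powr (-eta) / eta))"
proof (rule nn_integral_le_of_shells)
 have "(\<lambda>r. r powr (- eta - 1) / om N r) \<in> borel_measurable borel" unfolding om_def by measurable
 hence [measurable]: "(\<lambda>x::'a. norm x powr (- eta - 1) / om N (norm x)) \<in> borel_measurable borel" by measurable
 show "(\<lambda>x::'a. ennreal (norm x powr (- eta - 1) / om N (norm x)) * indicator {x. R < norm x} x) \<in> borel_measurable lebesgue"
  by (intro measurable_completion) measurable
 fix a b :: real assume a: "0 < a" "a \<le> 1" "1 \<le> b"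
 define b' where "b' = max b R"
 have R0: "0 < R" using R by simp
 have "(\<integral>\<^sup>+x. ennreal (norm x powr (- eta - 1) / om N (norm x)) * indicator {x::'a. R < norm x} x * indicator {x. a \<le> norm x \<and> norm x \<le> b} x \<partial>lebesgue)
  \<le> (\<integral>\<^sup>+x. ennreal (norm x powr (- eta - 1) / om N (norm x)) * indicator {x::'a. R \<le> norm x \<and> norm x \<le> b'} x \<partial>lebesgue)"
  by (intro nn_integral_mono) (auto simp: indicator_def b'_def)
 also have "\<dots> = ennreal (cN TYPE('a) * integral {R..b'} (\<lambda>r. om DIM('a) r * (r powr (- eta - 1) / om N r)))"
 proof (rule polar_shell[OF R0])
  show "continuous_on {R..b'} (\<lambda>r. r powr (- eta - 1) / om N r)"
   by (intro continuous_intros) (use R0 om_pos[of _ N] in \<open>auto simp: less_imp_neq[symmetric]\<close>)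
  show "0 \<le> r powr (- eta - 1) / om N r" if "r \<in> {R..b'}" for r
   using that R0 om_pos[of r N] by simp
 qed
 also have "integral {R..b'} (\<lambda>r. om DIM('a) r * (r powr (- eta - 1) / om N r)) = integral {R..b'} (\<lambda>r. r powr (- eta - 1))"
 proof (rule integral_cong)
  fix r assume "r \<in> {R..b'}"
  hence "0 < r" using R0 by simp
  thus "om DIM('a) r * (r powr (- eta - 1) / om N r) = r powr (- eta - 1)" using om_pos[of r N] NN by simp
 qed
 also have "\<dots> = (R powr (-eta) - b' powr (-eta)) / eta"
  by (rule integral_unique[OF has_integral_powr_inf[OF R0]]) (simp add: b'_def)
 also have "ennreal (cN TYPE('a) * ((R powr (-eta) - b' powr (-eta)) / eta)) \<le> ennreal (cN TYPE('a) * (R powr (-eta) / eta))"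
  using eta cN_pos[where 'a='a] by (intro ennreal_leI mult_left_mono divide_right_mono) auto
 finally show "(\<integral>\<^sup>+x. ennreal (norm x powr (- eta - 1) / om N (norm x)) * indicator {x::'a. R < norm x} x * indicator {x. a \<le> norm x \<and> norm x \<le> b} x \<partial>lebesgue) \<le> ennreal (cN TYPE('a) * (R powr (-eta) / eta))" .
qed

text \<open>The common majorant of all K-densities. The exponent changes at |x| = 1, where the two
  bounds of \<open>weights\<close> meet.\<close>

definition Qf :: "('a::euclidean_space \<Rightarrow> real) \<Rightarrow> 'a \<Rightarrow> real" where
 "Qf Y x = K (norm x) * (if norm x \<le> 1 then Y x powr \<gamma>1 else Y x powr \<gamma>2)"

lemma Qf_meas:
 assumes [measurable]: "Y \<in> borel_measurable lebesgue"
 shows "Qf Y \<in> borel_measurable (lebesgue :: 'a::euclidean_space measure)"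
proof -
 note [measurable] = K_meas
 have [measurable]: "{x::'a. norm x \<le> 1} \<in> sets lebesgue"
 proof -
  have "{x::'a. norm x \<le> 1} = cball 0 1" by auto
  thus ?thesis by simp
 qed
 have "Qf Y = (\<lambda>x. K (norm x) * (indicator {x. norm x \<le> 1} x * Y x powr \<gamma>1 + (1 - indicator {x. norm x \<le> 1} x) * Y x powr \<gamma>2))"
  by (auto simp: Qf_def indicator_def)
 thus ?thesis by (simp only:) measurable
qed

text \<open>The K-mass outside the shell from rho to R is small by the factors rho^eta and R^(-eta).
  With rho = R = 1 the set is the whole space, which yields integrability in
  \<open>Qf_integrable\<close>.\<close>

lemma K_outer:
 fixes Y :: "'a::euclidean_space \<Rightarrow> real"
 assumes NN: "N = DIM('a)" and rho: "0 < rho" "rho \<le> 1" and R: "1 \<le> R" and S: "0 < S" and A: "0 \<le> A"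
  and Ym: "Y \<in> borel_measurable lebesgue" and Y0: "AE x in lebesgue. 0 \<le> Y x \<and> Y x \<le> S * ew N (norm x)"
  and YA: "Vsq Y \<le> ennreal A"
 shows "(\<integral>\<^sup>+x. ennreal (Qf Y x) * indicator {x. norm x \<le> rho \<or> R < norm x} x \<partial>lebesgue)
  \<le> ennreal (CK * (S powr \<gamma>1 * (cN TYPE('a) / eta) * rho powr eta + S powr \<gamma>2 * (A / S\<^sup>2 + cN TYPE('a) / eta) * R powr (-eta)))"
proof -
 note [measurable] = Ym V_meas
 let ?c = "cN TYPE('a)"
 let ?p0 = "\<lambda>x::'a. ennreal (norm x powr (eta - 1) / om N (norm x)) * indicator {x. norm x \<le> rho} x"
 let ?p1 = "\<lambda>x::'a. ennreal (norm x powr (- eta - 1) / om N (norm x)) * indicator {x. R < norm x} x"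
 let ?p2 = "\<lambda>x::'a. ennreal (V (norm x) * (Y x)\<^sup>2)"
 have "(\<lambda>r. r powr (eta - 1) / om N r) \<in> borel_measurable borel" unfolding om_def by measurable
 hence [measurable]: "(\<lambda>x::'a. norm x powr (eta - 1) / om N (norm x)) \<in> borel_measurable borel" by measurable
 have "(\<lambda>r. r powr (- eta - 1) / om N r) \<in> borel_measurable borel" unfolding om_def by measurable
 hence [measurable]: "(\<lambda>x::'a. norm x powr (- eta - 1) / om N (norm x)) \<in> borel_measurable borel" by measurable
 have m0: "?p0 \<in> borel_measurable lebesgue" by (intro measurable_completion) measurable
 have m1: "?p1 \<in> borel_measurable lebesgue" by (intro measurable_completion) measurable
 have m2: "?p2 \<in> borel_measurable lebesgue" by measurable
 let ?k0 = "CK * S powr \<gamma>1" and ?k1 = "CK * S powr \<gamma>2" and ?k2 = "CK * S powr \<gamma>2 * R powr (-eta) / S\<^sup>2"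
 have k: "0 \<le> ?k0" "0 \<le> ?k1" "0 \<le> ?k2" using CK by auto
 have "(\<integral>\<^sup>+x. ennreal (Qf Y x) * indicator {x. norm x \<le> rho \<or> R < norm x} x \<partial>lebesgue) \<le>
   (\<integral>\<^sup>+x. ennreal ?k0 * ?p0 x + (ennreal ?k1 * ?p1 x + ennreal ?k2 * ?p2 x) \<partial>lebesgue)"
 proof (rule nn_integral_mono_AE)
  show "AE x in lebesgue. ennreal (Qf Y x) * indicator {x. norm x \<le> rho \<or> R < norm x} x \<le> ennreal ?k0 * ?p0 x + (ennreal ?k1 * ?p1 x + ennreal ?k2 * ?p2 x)"
   using Y0 AE_nonzero
  proof eventually_elim
   case (elim x)
   define r where "r = norm x"
   have r: "0 < r" using elim by (simp add: r_def)
   have om: "0 < om N r" by (rule om_pos[OF r])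
   consider "r \<le> rho" | "R < r" | "rho < r" "r \<le> R" by linarith
   thus ?case
   proof cases
    case 1
    have "K r * Y x powr \<gamma>1 * om N r \<le> ?k0 * r powr (eta - 1)"
     by (rule K0) (use r 1 rho S elim in \<open>auto simp: r_def\<close>)
    hence "Qf Y x \<le> ?k0 * (r powr (eta - 1) / om N r)"
     using om 1 rho by (simp add: Qf_def r_def[symmetric] field_simps)
    hence "ennreal (Qf Y x) \<le> ennreal ?k0 * ennreal (r powr (eta - 1) / om N r)"
     using k by (subst ennreal_mult[symmetric]) (auto intro!: ennreal_leI simp: om less_imp_le)
    also have "\<dots> \<le> ennreal ?k0 * ?p0 x + (ennreal ?k1 * ?p1 x + ennreal ?k2 * ?p2 x)"
     using 1 by (simp add: r_def[symmetric])
    finally show ?thesis using 1 by (simp add: r_def[symmetric])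
   next
    case 2
    have "K r * Y x powr \<gamma>2 * om N r \<le> ?k1 * (V r * (Y x / S)\<^sup>2 * om N r * r powr (- eta) + r powr (- eta - 1))"
     by (rule Kinf) (use 2 R S elim in \<open>auto simp: r_def\<close>)
    also have "\<dots> \<le> ?k1 * (V r * (Y x / S)\<^sup>2 * om N r * R powr (- eta) + r powr (- eta - 1))"
     using k(2) 2 R eta V_nonneg[OF r] om by (intro mult_left_mono add_right_mono powr_mono2') auto
    also have "\<dots> = (?k2 * (V r * (Y x)\<^sup>2) + ?k1 * (r powr (- eta - 1) / om N r)) * om N r"
     using om S by (simp add: power_divide field_simps)
    finally have "K r * Y x powr \<gamma>2 \<le> ?k2 * (V r * (Y x)\<^sup>2) + ?k1 * (r powr (- eta - 1) / om N r)" using om by simp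
    hence "Qf Y x \<le> ?k1 * (r powr (- eta - 1) / om N r) + ?k2 * (V r * (Y x)\<^sup>2)"
     using 2 R by (simp add: Qf_def r_def[symmetric])
    hence "ennreal (Qf Y x) \<le> ennreal (?k1 * (r powr (- eta - 1) / om N r) + ?k2 * (V r * (Y x)\<^sup>2))" by (rule ennreal_leI)
    also have "\<dots> = ennreal (?k1 * (r powr (- eta - 1) / om N r)) + ennreal (?k2 * (V r * (Y x)\<^sup>2))"
     using k om V_nonneg[OF r] by (intro ennreal_plus) (auto intro!: mult_nonneg_nonneg divide_nonneg_nonneg)
    also have "ennreal (?k1 * (r powr (- eta - 1) / om N r)) = ennreal ?k1 * ?p1 x"
     using k om 2 by (subst ennreal_mult) (auto simp: r_def[symmetric] less_imp_le)
    also have "ennreal (?k2 * (V r * (Y x)\<^sup>2)) = ennreal ?k2 * ?p2 x"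
     using k V_nonneg[OF r] by (subst ennreal_mult) (auto simp: r_def[symmetric])
    finally have "ennreal (Qf Y x) \<le> ennreal ?k1 * ?p1 x + ennreal ?k2 * ?p2 x" .
    thus ?thesis using 2 by (simp add: r_def[symmetric] add_increasing)
   qed (simp add: r_def[symmetric])
  qed
 qed
 also have "\<dots> = ennreal ?k0 * (\<integral>\<^sup>+x. ?p0 x \<partial>lebesgue) + (ennreal ?k1 * (\<integral>\<^sup>+x. ?p1 x \<partial>lebesgue) + ennreal ?k2 * (\<integral>\<^sup>+x. ?p2 x \<partial>lebesgue))"
  using m0 m1 m2 by (simp add: nn_integral_add nn_integral_cmult)
 also have "\<dots> \<le> ennreal ?k0 * ennreal (?c * (rho powr eta / eta)) + (ennreal ?k1 * ennreal (?c * (R powr (-eta) / eta)) + ennreal ?k2 * ennreal A)"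
  by (intro add_mono mult_left_mono nn_integral_power_near_0 nn_integral_power_tail NN rho R YA) auto
 also have "\<dots> = ennreal (?k0 * (?c * (rho powr eta / eta)) + (?k1 * (?c * (R powr (-eta) / eta)) + ?k2 * A))"
  using k A eta cN_pos[where 'a='a] by (simp add: ennreal_mult[symmetric] ennreal_plus[symmetric] less_imp_le del: ennreal_plus)
 also have "?k0 * (?c * (rho powr eta / eta)) + (?k1 * (?c * (R powr (-eta) / eta)) + ?k2 * A) =
  CK * (S powr \<gamma>1 * (?c / eta) * rho powr eta + S powr \<gamma>2 * (A / S\<^sup>2 + ?c / eta) * R powr (-eta))"
  by (simp add: algebra_simps)
 finally show ?thesis .
qed

text \<open>On \<open>E\<close> the Orlicz-type norm controls the weighted \<open>L\<^sup>2\<close> norm: by Hardy's inequality near the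
 origin, where \<open>V \<le> CV / r\<^sup>2\<close>, and by boundedness of \<open>h / d\<close> away from it.\<close>
lemma Espace_bounds:
 fixes h :: "'a::euclidean_space \<Rightarrow> real"
 defines "Cp \<equiv> 2 / sqrt (cN TYPE('a))"
 assumes NN: "N = DIM('a)" and h: "h \<in> Espace V" and d: "Enorm V h < d"
 shows "L2sq (wgrad h) \<le> ennreal (d\<^sup>2)" and "AE x in lebesgue. \<bar>h x\<bar> \<le> Cp * d * ew N (norm x)"
  and "Vsq h \<le> ennreal ((16 * CV + 1 + 2 * Cp\<^sup>2) * d\<^sup>2)"
proof -
 note [measurable] = V_meas
 have N3: "3 \<le> DIM('a)" using N NN by simp
 have hD: "in_D h (wgrad h)" and hV: "Vint V h < \<infinity>" using h in_D_wgrad by (auto simp: Espace_def)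
 from in_DE[OF hD] have hm[measurable]: "h \<in> borel_measurable lebesgue" by blast
 have fm[measurable]: "fODE \<in> borel_measurable borel"
  by (intro borel_measurable_continuous_onI continuous_at_imp_continuous_on ballI isCont_fODE)
 have D: "Dnorm h < d" and O: "Onorm V h < d" and d0: "0 < d"
 proof -
  have "0 \<le> Dnorm h" "0 \<le> Onorm V h" by (simp_all add: Dnorm_def Onorm_def)
  thus "Dnorm h < d" "Onorm V h < d" "0 < d" using d by (auto simp: Enorm_def)
 qed
 have fin: "L2sq (wgrad h) < \<infinity>" by (rule in_D_finite[OF hD])
 show L: "L2sq (wgrad h) \<le> ennreal (d\<^sup>2)"
 proof -
  have "sqrt (enn2real (L2sq (wgrad h))) < d" using D by (simp add: Dnorm_def L2sq_def)
  hence "enn2real (L2sq (wgrad h)) \<le> d\<^sup>2" by (meson less_imp_le sqrt_le_D)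
  thus ?thesis using fin by (metis ennreal_enn2real ennreal_leI infinity_ennreal_def)
 qed
 have c: "0 < cN TYPE('a)" by (rule cN_pos)
 show pw: "AE x in lebesgue. \<bar>h x\<bar> \<le> Cp * d * ew N (norm x)"
 proof -
  have "AE x in lebesgue. \<bar>h x\<bar> \<le> 2 * (d / sqrt (cN TYPE('a))) * ew DIM('a) (norm x)"
   by (rule in_D_pointwise[OF N3 hD]) (use L c d0 in \<open>simp_all add: power_divide\<close>)
  thus ?thesis by (simp add: Cp_def NN)
 qed
 have Cp: "0 < Cp" using c by (simp add: Cp_def)
 have "(INF k\<in>{0<..}. ennreal (1 / k) * (1 + Vint V (\<lambda>x. k * h x))) < ennreal d"
 proof -
  let ?I = "INF k\<in>{0<..}. ennreal (1 / k) * (1 + Vint V (\<lambda>x. k * h x))"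
  have "?I \<le> ennreal (1 / 1) * (1 + Vint V (\<lambda>x. 1 * h x))" by (rule INF_lower) simp
  also have "\<dots> < \<infinity>" using hV by simp
  finally have "?I < \<infinity>" .
  hence "?I = ennreal (enn2real ?I)" by simp
  also have "\<dots> < ennreal d" using O d0 by (intro ennreal_lessI) (simp_all add: Onorm_def)
  finally show ?thesis .
 qed
 then obtain k where k: "0 < k" "ennreal (1 / k) * (1 + Vint V (\<lambda>x. k * h x)) < ennreal d"
  unfolding INF_less_iff by auto
 have "1 + Vint V (\<lambda>x. k * h x) = ennreal k * (ennreal (1 / k) * (1 + Vint V (\<lambda>x. k * h x)))"
  using k(1) by (simp add: mult.assoc[symmetric] ennreal_mult[symmetric])
 also have "\<dots> \<le> ennreal k * ennreal d" using k(2) by (intro mult_left_mono) auto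
 finally have kd: "1 + Vint V (\<lambda>x. k * h x) \<le> ennreal (k * d)" using k(1) d0 by (simp add: ennreal_mult)
 have "ennreal 1 \<le> 1 + Vint V (\<lambda>x. k * h x)" by simp
 also note kd
 \<comment> \<open>The summand 1 in the Orlicz-type norm forces k d \<ge> 1, so 1 / (k d) is an
   admissible factor in \<open>fODE_sq_scale\<close>.\<close>
 finally have kd1: "1 \<le> k * d" using ennreal_le_iff[of "k * d" 1] k(1) d0 by simp
 have Vk: "Vint V (\<lambda>x. k * h x) \<le> ennreal (k * d)" using kd by (rule order_trans[rotated]) simp
 \<comment> \<open>Since h/d = (1 / (k d)) (k h), convexity bounds h^2 by this constant times f(k
   h)^2. The integral of V f(k h)^2 is at most k d, and the product is (1 + 2 Cp^2) d^2.\<close>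
 let ?b = "d * (1 + 2 * Cp\<^sup>2) / k"
 have b0: "0 \<le> ?b" using d0 k(1) by simp
 have "Vsq h \<le>
  (\<integral>\<^sup>+x. ennreal CV * ennreal ((h x)\<^sup>2 / (norm x)\<^sup>2) + ennreal ?b * ennreal (V (norm x) * (fODE (k * h x))\<^sup>2) \<partial>lebesgue)"
 proof (rule nn_integral_mono_AE)
  show "AE x in lebesgue. ennreal (V (norm x) * (h x)\<^sup>2) \<le> ennreal CV * ennreal ((h x)\<^sup>2 / (norm x)\<^sup>2) + ennreal ?b * ennreal (V (norm x) * (fODE (k * h x))\<^sup>2)"
   using pw AE_nonzero
  proof eventually_elim
   case (elim x)
   define r where "r = norm x"
   have r: "0 < r" using elim by (simp add: r_def)
   have nn: "0 \<le> ?b * (V r * (fODE (k * h x))\<^sup>2)" "0 \<le> CV * ((h x)\<^sup>2 / r\<^sup>2)"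
    using V_nonneg[OF r] CV by (auto intro!: mult_nonneg_nonneg[OF b0] mult_nonneg_nonneg divide_nonneg_nonneg simp del: times_divide_eq_left times_divide_eq_right)
   have "V r * (h x)\<^sup>2 \<le> CV * ((h x)\<^sup>2 / r\<^sup>2) + ?b * (V r * (fODE (k * h x))\<^sup>2)"
   proof (cases "r \<le> 1")
    case True
    have "V r * (h x)\<^sup>2 \<le> CV / r\<^sup>2 * (h x)\<^sup>2" using V_bound[OF r True] by (intro mult_right_mono) auto
    thus ?thesis using nn(1) by simp
   next
    case False
    have "ew N r \<le> 1" using ew_antimono[of 1 r N] False N by (simp add: ew_def)
    hence "Cp * d * ew N r \<le> Cp * d * 1" using Cp d0 by (intro mult_left_mono) auto
    hence "\<bar>h x\<bar> \<le> Cp * d * 1" using elim(1) unfolding r_def by linarith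
    hence "\<bar>h x / d\<bar> \<le> Cp" using d0 by (simp add: abs_divide field_simps)
    hence "(h x / d)\<^sup>2 \<le> (1 + 2 * Cp\<^sup>2) * (fODE (h x / d))\<^sup>2" by (rule sq_le_fODE_sq)
    also have "fODE (h x / d) = fODE (1 / (k * d) * (k * h x))" using k(1) d0 by simp
    also have "(1 + 2 * Cp\<^sup>2) * (fODE (1 / (k * d) * (k * h x)))\<^sup>2 \<le> (1 + 2 * Cp\<^sup>2) * (1 / (k * d) * (fODE (k * h x))\<^sup>2)"
     using kd1 by (intro mult_left_mono fODE_sq_scale) auto
    finally have "d\<^sup>2 * (h x / d)\<^sup>2 \<le> d\<^sup>2 * ((1 + 2 * Cp\<^sup>2) * (1 / (k * d) * (fODE (k * h x))\<^sup>2))" by (intro mult_left_mono) auto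
    moreover have "d\<^sup>2 * (h x / d)\<^sup>2 = (h x)\<^sup>2" using d0 by (simp add: power_divide)
    moreover have "d\<^sup>2 * ((1 + 2 * Cp\<^sup>2) * (1 / (k * d) * (fODE (k * h x))\<^sup>2)) = ?b * (fODE (k * h x))\<^sup>2"
     using d0 k(1) by (simp add: power2_eq_square)
    ultimately have "(h x)\<^sup>2 \<le> ?b * (fODE (k * h x))\<^sup>2" by linarith
    hence "V r * (h x)\<^sup>2 \<le> V r * (?b * (fODE (k * h x))\<^sup>2)" using V_nonneg[OF r] by (intro mult_left_mono)
    also have "\<dots> = ?b * (V r * (fODE (k * h x))\<^sup>2)" by (simp add: mult_ac)
    finally show ?thesis using nn(2) by linarith
   qed
   moreover have "ennreal (CV * ((h x)\<^sup>2 / r\<^sup>2) + ?b * (V r * (fODE (k * h x))\<^sup>2)) =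
     ennreal (CV * ((h x)\<^sup>2 / r\<^sup>2)) + ennreal (?b * (V r * (fODE (k * h x))\<^sup>2))"
    using nn by (intro ennreal_plus)
   moreover have "ennreal (CV * ((h x)\<^sup>2 / r\<^sup>2)) = ennreal CV * ennreal ((h x)\<^sup>2 / r\<^sup>2)"
    by (rule ennreal_mult) (use CV in auto)
   moreover have "ennreal (?b * (V r * (fODE (k * h x))\<^sup>2)) = ennreal ?b * ennreal (V r * (fODE (k * h x))\<^sup>2)"
    by (rule ennreal_mult[OF b0]) (use V_nonneg[OF r] in simp)
   ultimately show ?case unfolding r_def by (metis ennreal_leI)
  qed
 qed
 also have "\<dots> = ennreal CV * (\<integral>\<^sup>+x. ennreal ((h x)\<^sup>2 / (norm x)\<^sup>2) \<partial>lebesgue) + ennreal ?b * Vint V (\<lambda>x. k * h x)"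
 proof -
  have nm: "norm \<in> borel_measurable (lebesgue :: 'a measure)" by (intro measurable_completion) measurable
  have m1: "(\<lambda>x. ennreal ((h x)\<^sup>2 / (norm x)\<^sup>2)) \<in> borel_measurable lebesgue" using nm by measurable
  have m2: "(\<lambda>x. ennreal (V (norm x) * (fODE (k * h x))\<^sup>2)) \<in> borel_measurable lebesgue" by measurable
  show ?thesis using m1 m2 by (simp add: nn_integral_add nn_integral_cmult Vint_def)
 qed
 also have "\<dots> \<le> ennreal CV * ennreal (16 * d\<^sup>2) + ennreal ?b * ennreal (k * d)"
  by (intro add_mono mult_left_mono Vk in_D_hardy[OF N3 hD L]) (use d0 in auto)
 also have "\<dots> = ennreal (CV * (16 * d\<^sup>2) + ?b * (k * d))"
  using CV b0 k(1) d0 by (simp add: ennreal_mult[symmetric] ennreal_plus[symmetric] less_imp_le del: ennreal_plus)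
 also have "CV * (16 * d\<^sup>2) + ?b * (k * d) = (16 * CV + 1 + 2 * Cp\<^sup>2) * d\<^sup>2"
 proof -
  have "?b * (k * d) = d * (1 + 2 * Cp\<^sup>2) * d" using k(1) by simp
  thus ?thesis by (simp only:) (simp add: power2_eq_square algebra_simps)
 qed
 finally show "Vsq h \<le> ennreal ((16 * CV + 1 + 2 * Cp\<^sup>2) * d\<^sup>2)" .
qed

end

context weights
begin

lemma Qf_nonneg: "x \<noteq> 0 \<Longrightarrow> 0 \<le> Qf Y x"
 using K_pos[of "norm x"] by (simp add: Qf_def)

lemma Qf_integrable:
 fixes Y :: "'a::euclidean_space \<Rightarrow> real"
 assumes NN: "N = DIM('a)" and S: "0 < S" and A: "0 \<le> A" and Ym: "Y \<in> borel_measurable lebesgue"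
  and Y0: "AE x in lebesgue. 0 \<le> Y x \<and> Y x \<le> S * ew N (norm x)"
  and YA: "Vsq Y \<le> ennreal A"
 shows "integrable lebesgue (Qf Y)"
proof -
 have r1: "0 < (1::real)" "(1::real) \<le> 1" by simp_all
 have "(\<integral>\<^sup>+x. ennreal \<bar>Qf Y x\<bar> \<partial>lebesgue) = (\<integral>\<^sup>+x. ennreal (Qf Y x) * indicator {x. norm x \<le> 1 \<or> 1 < norm x} x \<partial>lebesgue)"
  by (rule nn_integral_cong_AE) (use AE_nonzero in eventually_elim, auto simp: Qf_nonneg indicator_def)
 also note K_outer[OF NN r1 r1(2) S A Ym Y0 YA]
 finally show ?thesis by (intro integrable_of_nn_bound Qf_meas Ym)
qed

lemma K_integrable:
 fixes Y H :: "'a::euclidean_space \<Rightarrow> real"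
 assumes "N = DIM('a)" "0 < S" "0 \<le> A" "Y \<in> borel_measurable lebesgue"
  and "AE x in lebesgue. 0 \<le> Y x \<and> Y x \<le> S * ew N (norm x)"
  and "Vsq Y \<le> ennreal A"
  and Hm: "H \<in> borel_measurable lebesgue"
  and HY: "\<And>x. \<bar>H x\<bar> \<le> C * Y x powr \<gamma>1 \<and> \<bar>H x\<bar> \<le> C * Y x powr \<gamma>2"
 shows "integrable lebesgue (\<lambda>x. K (norm x) * H x)"
proof (rule Bochner_Integration.integrable_bound)
 show "integrable lebesgue (\<lambda>x. C * Qf Y x)" by (intro integrable_mult_right Qf_integrable[of S A] assms)
 show "(\<lambda>x. K (norm x) * H x) \<in> borel_measurable lebesgue" by (intro borel_measurable_times K_meas Hm)
 show "AE x in lebesgue. norm (K (norm x) * H x) \<le> norm (C * Qf Y x)"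
  using AE_nonzero
 proof eventually_elim
  case (elim x)
  hence K: "0 < K (norm x)" by (simp add: K_pos)
  have "K (norm x) * \<bar>H x\<bar> \<le> K (norm x) * (C * (if norm x \<le> 1 then Y x powr \<gamma>1 else Y x powr \<gamma>2))"
   using HY[of x] K by (intro mult_left_mono) auto
  also have "\<dots> = C * Qf Y x" by (simp add: Qf_def mult_ac)
  finally show ?case using K abs_ge_self[of "C * Qf Y x"] unfolding real_norm_def abs_mult[of "K (norm x)"] by simp
 qed
qed

lemma V_sq_add:
 fixes u h :: "'a::euclidean_space \<Rightarrow> real"
 assumes [measurable]: "u \<in> borel_measurable lebesgue" "h \<in> borel_measurable lebesgue"
  and A: "Vsq u \<le> ennreal A" "0 \<le> A"
  and B: "Vsq h \<le> ennreal B" "0 \<le> B"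
 shows "(\<integral>\<^sup>+x. ennreal (V (norm x) * (\<bar>u x\<bar> + \<bar>h x\<bar>)\<^sup>2) \<partial>lebesgue) \<le> ennreal (2 * A + 2 * B)"
proof -
 note [measurable] = V_meas
 have "(\<integral>\<^sup>+x. ennreal (V (norm x) * (\<bar>u x\<bar> + \<bar>h x\<bar>)\<^sup>2) \<partial>lebesgue) \<le>
  (\<integral>\<^sup>+x. 2 * ennreal (V (norm x) * (u x)\<^sup>2) + 2 * ennreal (V (norm x) * (h x)\<^sup>2) \<partial>lebesgue)"
 proof (rule nn_integral_mono_AE)
  show "AE x in lebesgue. ennreal (V (norm x) * (\<bar>u x\<bar> + \<bar>h x\<bar>)\<^sup>2) \<le> 2 * ennreal (V (norm x) * (u x)\<^sup>2) + 2 * ennreal (V (norm x) * (h x)\<^sup>2)"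
   using AE_nonzero
  proof eventually_elim
   case (elim x)
   hence V: "0 \<le> V (norm x)" by (simp add: V_nonneg)
   have "(\<bar>u x\<bar> + \<bar>h x\<bar>)\<^sup>2 \<le> 2 * (u x)\<^sup>2 + 2 * (h x)\<^sup>2"
    using sum_squares_bound[of "\<bar>u x\<bar>" "\<bar>h x\<bar>"] by (simp add: power2_sum)
   hence "V (norm x) * (\<bar>u x\<bar> + \<bar>h x\<bar>)\<^sup>2 \<le> V (norm x) * (2 * (u x)\<^sup>2 + 2 * (h x)\<^sup>2)" using V by (rule mult_left_mono)
   hence "ennreal (V (norm x) * (\<bar>u x\<bar> + \<bar>h x\<bar>)\<^sup>2) \<le> ennreal (2 * (V (norm x) * (u x)\<^sup>2) + 2 * (V (norm x) * (h x)\<^sup>2))"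
    by (intro ennreal_leI) (simp add: algebra_simps)
   also have "\<dots> = 2 * ennreal (V (norm x) * (u x)\<^sup>2) + 2 * ennreal (V (norm x) * (h x)\<^sup>2)"
    using V by (simp add: ennreal_plus ennreal_mult)
   finally show ?case .
  qed
 qed
 also have "\<dots> = 2 * Vsq u + 2 * Vsq h"
  by (simp add: nn_integral_add nn_integral_cmult)
 also have "\<dots> \<le> 2 * ennreal A + 2 * ennreal B" using A B by (intro add_mono mult_left_mono) auto
 also have "\<dots> = ennreal (2 * A + 2 * B)" using A B by (simp add: ennreal_plus ennreal_mult)
 finally show ?thesis .
qed

lemma V_integrable:
 fixes Y H :: "'a::euclidean_space \<Rightarrow> real"
 assumes [measurable]: "Y \<in> borel_measurable lebesgue" "H \<in> borel_measurable lebesgue"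
  and YA: "Vsq Y \<le> ennreal A"
  and HY: "\<And>x. \<bar>H x\<bar> \<le> C * (Y x)\<^sup>2"
 shows "integrable lebesgue (\<lambda>x. V (norm x) * H x)"
proof (rule Bochner_Integration.integrable_bound)
 note [measurable] = V_meas
 have "(\<integral>\<^sup>+x. ennreal \<bar>V (norm x) * (Y x)\<^sup>2\<bar> \<partial>lebesgue) = Vsq Y"
  by (rule nn_integral_cong_AE) (use AE_nonzero in eventually_elim, auto simp: V_nonneg)
 hence "integrable lebesgue (\<lambda>x. V (norm x) * (Y x)\<^sup>2)" using YA by (intro integrable_of_nn_bound[of _ _ A]) auto
 thus "integrable lebesgue (\<lambda>x. C * (V (norm x) * (Y x)\<^sup>2))" by (rule integrable_mult_right)
 show "(\<lambda>x. V (norm x) * H x) \<in> borel_measurable lebesgue" by measurable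
 show "AE x in lebesgue. norm (V (norm x) * H x) \<le> norm (C * (V (norm x) * (Y x)\<^sup>2))"
  using AE_nonzero
 proof eventually_elim
  case (elim x)
  hence V: "0 \<le> V (norm x)" by (simp add: V_nonneg)
  have "V (norm x) * \<bar>H x\<bar> \<le> V (norm x) * (C * (Y x)\<^sup>2)" using V HY by (rule mult_left_mono[rotated])
  hence "V (norm x) * \<bar>H x\<bar> \<le> C * (V (norm x) * (Y x)\<^sup>2)" by (simp add: mult_ac)
  thus ?case using V abs_ge_self[of "C * (V (norm x) * (Y x)\<^sup>2)"] unfolding real_norm_def abs_mult[of "V (norm x)"] by simp
 qed
qed

end

section \<open>The weak equation on all of E\<close>

locale radial_critical = radial_problem g \<gamma>1 \<gamma>2 Cg \<theta> t0 N V K eta CK CV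
 for g \<gamma>1 \<gamma>2 Cg \<theta> t0 N V K eta CK CV +
 fixes U W :: "real \<Rightarrow> real" and S :: real and u :: "'a::euclidean_space \<Rightarrow> real"
 assumes NN: "N = DIM('a)" and sol: "is_radial_solution U W S" and u: "u = (\<lambda>x. U (norm x))"
begin

lemma N3: "3 \<le> DIM('a)" using N NN by simp

lemma sol_facts:
 shows "0 < S" and "\<And>r. 0 < r \<Longrightarrow> (U has_real_derivative W r / om N r) (at r)"
  and "\<And>r. 0 < r \<Longrightarrow> (W has_real_derivative wf r (U r)) (at r)"
  and "\<And>r. 0 < r \<Longrightarrow> \<bar>U r\<bar> \<le> S * ew N r"
  and "\<And>a b. 0 < a \<Longrightarrow> integral {a..b} (\<lambda>r. (W r)\<^sup>2 / om N r) \<le> S\<^sup>2"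
  and "\<And>a b. 0 < a \<Longrightarrow> integral {a..b} (\<lambda>r. Psi r (U r)) \<le> S\<^sup>2"
 using sol unfolding is_radial_solution_def by blast+

text \<open>The gradient of U(|x|): the radial derivative W / r^(N-1) times the unit vector x /
  |x|.\<close>

definition Gu :: "'a \<Rightarrow> 'a" where "Gu x = ((W (norm x) / om N (norm x)) / norm x) *\<^sub>R x"

lemma U_cont: "continuous_on {0<..} U"
 using sol_facts(2) by (intro continuous_at_imp_continuous_on ballI DERIV_isCont) auto

lemma W_cont: "continuous_on {0<..} W"
 using sol_facts(3) by (intro continuous_at_imp_continuous_on ballI DERIV_isCont) auto

lemma u_in_D: "in_D u Gu"
 unfolding u Gu_def[abs_def]
proof (rule radial_in_D[OF N3, where S=S and E="S\<^sup>2"])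
 show "continuous_on {0<..} (\<lambda>r. W r / om N r)"
  by (intro continuous_intros W_cont) (use om_pos[of _ N] in \<open>auto simp: less_imp_neq[symmetric]\<close>)
 show "\<bar>U r\<bar> \<le> S * ew DIM('a) r" if "0 < r" for r using sol_facts(4)[OF that] by (simp add: NN)
 show "integral {a..b} (\<lambda>r. om DIM('a) r * (W r / om N r)\<^sup>2) \<le> S\<^sup>2" if "0 < a" for a b
 proof -
  have "integral {a..b} (\<lambda>r. om DIM('a) r * (W r / om N r)\<^sup>2) = integral {a..b} (\<lambda>r. (W r)\<^sup>2 / om N r)"
  proof (rule integral_cong)
   fix r assume "r \<in> {a..b}"
   hence "0 < om N r" using that by (intro om_pos) auto
   thus "om DIM('a) r * (W r / om N r)\<^sup>2 = (W r)\<^sup>2 / om N r" by (simp add: NN[symmetric] power_divide power2_eq_square)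
  qed
  thus ?thesis using sol_facts(5)[OF that] by simp
 qed
qed (rule sol_facts(2))

lemma u_meas [measurable]: "u \<in> borel_measurable lebesgue"
 and Gu_meas [measurable]: "Gu \<in> borel_measurable lebesgue"
 using in_DE[OF u_in_D] by blast+

lemma Gu_finite: "L2sq Gu < \<infinity>" by (rule in_D_finite[OF u_in_D])

lemma fODE_meas [measurable]: "fODE \<in> borel_measurable borel"
 by (intro borel_measurable_continuous_onI cont_fODE)
lemma kfun_meas [measurable]: "kfun \<in> borel_measurable borel"
 by (intro borel_measurable_continuous_onI cont_kfun)
lemma mfun_meas [measurable]: "mfun g \<in> borel_measurable borel"
 by (intro borel_measurable_continuous_onI cont_mfun)
lemma Mfun_meas [measurable]: "Mfun g \<in> borel_measurable borel"
 by (intro borel_measurable_continuous_onI cont_Mfun)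

lemma u_Espace: "u \<in> Espace V"
proof -
 have "Vint V u \<le> ennreal (cN TYPE('a) * S\<^sup>2)"
  unfolding Vint_def
 proof (rule nn_integral_le_of_shells)
  note [measurable] = V_meas
  show "(\<lambda>x. ennreal (V (norm x) * (fODE (u x))\<^sup>2)) \<in> borel_measurable lebesgue" by measurable
  fix a b :: real assume a: "0 < a"
  have "(\<integral>\<^sup>+x. ennreal (V (norm x) * (fODE (u x))\<^sup>2) * indicator {x. a \<le> norm x \<and> norm x \<le> b} x \<partial>lebesgue)
    = ennreal (cN TYPE('a) * integral {a..b} (\<lambda>r. om DIM('a) r * (V r * (fODE (U r))\<^sup>2)))"
   unfolding u
  proof (rule polar_shell[OF a])
   show "continuous_on {a..b} (\<lambda>r. V r * (fODE (U r))\<^sup>2)"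
    by (intro continuous_intros cont_nonlin V_cont_on[OF a] continuous_on_subset[OF U_cont]) (use a in auto)
   show "0 \<le> V r * (fODE (U r))\<^sup>2" if "r \<in> {a..b}" for r using that a by (intro mult_nonneg_nonneg V_nonneg) auto
  qed
  also have "\<dots> \<le> ennreal (cN TYPE('a) * S\<^sup>2)"
   using sol_facts(6)[OF a, of b, unfolded Psi_def, unfolded NN] cN_pos[where 'a='a] by (intro ennreal_leI mult_left_mono) simp_all
  finally show "(\<integral>\<^sup>+x. ennreal (V (norm x) * (fODE (u x))\<^sup>2) * indicator {x. a \<le> norm x \<and> norm x \<le> b} x \<partial>lebesgue) \<le> ennreal (cN TYPE('a) * S\<^sup>2)" .
 qed
 also have "\<dots> < \<infinity>" by simp
 finally show ?thesis using u_in_D by (auto simp: Espace_def Dspace_def)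
qed

lemma u_pointwise: "AE x in lebesgue. \<bar>u x\<bar> \<le> S * ew N (norm x)"
 using AE_nonzero by eventually_elim (auto simp: u intro: sol_facts(4))

lemma u_L2V: obtains A where "0 \<le> A" "Vsq u \<le> ennreal A"
proof (rule that)
 show "Vsq u \<le>
   ennreal ((16 * CV + 1 + 2 * (2 / sqrt (cN TYPE('a)))\<^sup>2) * (Enorm V u + 1)\<^sup>2)"
  by (rule Espace_bounds(3)[OF NN u_Espace]) simp
qed (use CV in auto)

definition Z :: "real \<Rightarrow> real" where "Z r = V r * kfun (U r) - K r * mfun g (U r)"

lemma Z_cont: "continuous_on {0<..} Z"
 unfolding Z_def[abs_def] by (intro continuous_intros cont_nonlin V_cont K_cont U_cont)

text \<open>In polar coordinates the integrand is the derivative of W times the profile of phi, so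
  the fundamental theorem of calculus replaces the divergence theorem.\<close>

lemma weak_on_shell:
 fixes phi :: "'a \<Rightarrow> real"
 assumes phi: "radial_test phi" and a: "0 < a" "a \<le> b"
 shows "(\<integral>x. indicator {x. a \<le> norm x \<and> norm x \<le> b} x * (Gu x \<bullet> grad phi x + Z (norm x) * phi x) \<partial>lebesgue)
  = cN TYPE('a) * (W b * prof phi b - W a * prof phi a)"
proof -
 have sm: "smooth_fun phi" by (rule radial_testD(1)[OF phi])
 let ?F = "\<lambda>r. W r / om N r * dprof phi r + Z r * prof phi r"
 have sub: "{a..b} \<subseteq> {0<..}" using a by auto
 have omn: "om N r \<noteq> 0" if "r \<in> {a..b}" for r using om_pos[of r N] that a by auto
 have c: "continuous_on {a..b} ?F"
  by (intro continuous_intros continuous_on_subset[OF W_cont sub] continuous_on_subset[OF Z_cont sub] dprof_cont[OF sm] prof_cont[OF sm] ballI omn)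
 have "(\<integral>x. indicator {x. a \<le> norm x \<and> norm x \<le> b} x * (Gu x \<bullet> grad phi x + Z (norm x) * phi x) \<partial>lebesgue)
  = (\<integral>x. indicator {x::'a. a \<le> norm x \<and> norm x \<le> b} x * ?F (norm x) \<partial>lebesgue)"
 proof (rule Bochner_Integration.integral_cong[OF refl])
  fix x :: 'a
  show "indicator {x. a \<le> norm x \<and> norm x \<le> b} x * (Gu x \<bullet> grad phi x + Z (norm x) * phi x) =
   indicator {x::'a. a \<le> norm x \<and> norm x \<le> b} x * ?F (norm x)"
  proof (cases "x = 0")
   case False
   have "Gu x \<bullet> grad phi x = W (norm x) / om N (norm x) * dprof phi (norm x)"
    using False by (simp add: Gu_def radial_test_grad[OF phi False] power2_norm_eq_inner[symmetric] power2_eq_square)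
   thus ?thesis using radial_test_prof[OF phi, of x] by simp
  qed (use a in \<open>simp add: indicator_def\<close>)
 qed
 also have "\<dots> = cN TYPE('a) * integral {a..b} (\<lambda>r. om DIM('a) r * ?F r)"
  by (rule polar_shell_integral(1)[OF less_imp_le[OF a(1)] c])
 also have "((\<lambda>r. om DIM('a) r * ?F r) has_integral (W b * prof phi b - W a * prof phi a)) {a..b}"
 proof (rule fundamental_theorem_of_calculus[OF a(2)])
  fix r assume r: "r \<in> {a..b}"
  hence r0: "0 < r" using a by simp
  have "((\<lambda>r. W r * prof phi r) has_real_derivative wf r (U r) * prof phi r + dprof phi r * W r) (at r)"
   by (rule DERIV_mult[OF sol_facts(3)[OF r0] prof_deriv[OF sm]])
  also have "wf r (U r) * prof phi r + dprof phi r * W r = om DIM('a) r * ?F r"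
   using omn[OF r] by (simp add: wf_def Z_def NN[symmetric] field_simps)
  finally show "((\<lambda>r. W r * prof phi r) has_vector_derivative om DIM('a) r * ?F r) (at r within {a..b})"
   by (simp add: vector_derivative_simps)
 qed
 hence "integral {a..b} (\<lambda>r. om DIM('a) r * ?F r) = W b * prof phi b - W a * prof phi a" by (rule integral_unique)
 finally show ?thesis .
qed

text \<open>On a shell the test functions are dominated by their uniform pointwise bound, so both
  volume integrals pass to the limit. The boundary terms are only estimated, because h has no values
  on a sphere; their bound is uniform along the sequence.\<close>

lemma weak_shell_bound:
 fixes h :: "'a \<Rightarrow> real"
 assumes h: "in_D h H" and int: "integrable lebesgue (\<lambda>x. Z (norm x) * h x)"
  and M: "L2sq H \<le> ennreal (cN TYPE('a) * M\<^sup>2)" "0 < M" and a: "0 < a" "a \<le> b"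
 shows "\<bar>\<integral>x. indicator {x. a \<le> norm x \<and> norm x \<le> b} x * (Gu x \<bullet> H x + Z (norm x) * h x) \<partial>lebesgue\<bar>
  \<le> cN TYPE('a) * (2 * M) * (\<bar>W b\<bar> * ew N b + \<bar>W a\<bar> * ew N a)"
proof -
 let ?X = "{x::'a. a \<le> norm x \<and> norm x \<le> b}"
 let ?c = "cN TYPE('a)"
 have c: "0 < ?c" by (rule cN_pos)
 have X[measurable]: "?X \<in> sets lebesgue"
 proof -
  have "?X = cball 0 b - ball 0 a" by auto
  thus ?thesis by simp
 qed
 obtain phi' where hm[measurable]: "h \<in> borel_measurable lebesgue" and Hm[measurable]: "H \<in> borel_measurable lebesgue"
  and t': "\<And>k. radial_test (phi' k)" and l': "(\<lambda>k. L2sq (\<lambda>x. grad (phi' k) x - H x)) \<longlonglongrightarrow> 0"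
  and ae': "AE x in lebesgue. (\<lambda>k. phi' k x) \<longlonglongrightarrow> h x" using in_DE[OF h] by blast
 have "0 < ?c * M\<^sup>2" using c M by simp
 from in_D_grad_bound[OF t' Hm l' M(1) this] obtain k0 where k0: "\<And>k. k0 \<le> k \<Longrightarrow> L2sq (grad (phi' k)) \<le> ennreal (4 * (?c * M\<^sup>2))"
  unfolding eventually_sequentially by blast
 \<comment> \<open>The energy bound holds only eventually; dropping the first k0 terms makes it, and
   with it the pointwise bound, uniform in k.\<close>
 define phi where "phi k = phi' (k + k0)" for k
 have t: "radial_test (phi k)" for k using t' by (simp add: phi_def)
 have l: "(\<lambda>k. L2sq (\<lambda>x. grad (phi k) x - H x)) \<longlonglongrightarrow> 0" unfolding phi_def by (rule LIMSEQ_ignore_initial_segment[OF l'])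
 have ae: "AE x in lebesgue. (\<lambda>k. phi k x) \<longlonglongrightarrow> h x"
  using ae' by eventually_elim (unfold phi_def, rule LIMSEQ_ignore_initial_segment)
 have L: "L2sq (grad (phi k)) \<le> ennreal (?c * (2 * M)\<^sup>2)" for k
  using k0[of "k + k0"] by (simp add: phi_def power_mult_distrib mult_ac)
 have M0: "0 \<le> 2 * M" using M by simp
 have pb: "\<bar>prof (phi k) r\<bar> \<le> 2 * M * ew N r" if "0 < r" for k r
  using radial_test_pointwise[OF N3 t that L M0] by (simp add: NN)
 note gm[measurable] = grad_measurable[OF t]
 have gfin: "L2sq (grad (phi k)) < \<infinity>" for k using L[of k] by (rule le_less_trans) simp
 have Hfin: "L2sq H < \<infinity>" by (rule in_D_finite[OF h])
 have phim[measurable]: "phi k \<in> borel_measurable lebesgue" for k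
  by (intro measurable_completion) (use smooth_fun_cont[OF radial_testD(1)[OF t]] in \<open>auto intro!: borel_measurable_continuous_onI continuous_at_imp_continuous_on\<close>)
 have Zm[measurable]: "(\<lambda>x::'a. Z (norm x)) \<in> borel_measurable lebesgue"
  by (intro measurable_completion) (use radial_measurable[OF Z_cont, where 'a='a] in simp)
 have iG: "integrable lebesgue (\<lambda>x. indicator ?X x * (Gu x \<bullet> G x))" if "G \<in> borel_measurable lebesgue" "L2sq G < \<infinity>" for G
  using integrable_mult_indicator[OF X L2_inner_integrable[OF Gu_meas that(1) Gu_finite that(2)]] by simp
 have lim1: "(\<lambda>k. \<integral>x. indicator ?X x * (Gu x \<bullet> grad (phi k) x) \<partial>lebesgue) \<longlonglongrightarrow> (\<integral>x. indicator ?X x * (Gu x \<bullet> H x) \<partial>lebesgue)"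
 proof (rule LIM_zero_cancel, rule Lim_null_comparison)
  have dm: "(\<lambda>x. grad (phi k) x - H x) \<in> borel_measurable lebesgue" for k by measurable
  show "(\<lambda>k. \<integral>x. \<bar>Gu x \<bullet> (grad (phi k) x - H x)\<bar> \<partial>lebesgue) \<longlonglongrightarrow> 0"
   by (rule L2_inner_tendsto[OF Gu_meas dm Gu_finite l])
  show "\<forall>\<^sub>F k in sequentially. norm ((\<integral>x. indicator ?X x * (Gu x \<bullet> grad (phi k) x) \<partial>lebesgue) - (\<integral>x. indicator ?X x * (Gu x \<bullet> H x) \<partial>lebesgue))
   \<le> (\<integral>x. \<bar>Gu x \<bullet> (grad (phi k) x - H x)\<bar> \<partial>lebesgue)"
  proof (rule always_eventually, rule allI)
   fix k
   have i: "integrable lebesgue (\<lambda>x. Gu x \<bullet> (grad (phi k) x - H x))"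
    using L2_inner_integrable[OF Gu_meas gm Gu_finite gfin, of k] L2_inner_integrable[OF Gu_meas Hm Gu_finite Hfin]
    by (simp add: inner_diff_right)
   have "(\<integral>x. indicator ?X x * (Gu x \<bullet> grad (phi k) x) \<partial>lebesgue) - (\<integral>x. indicator ?X x * (Gu x \<bullet> H x) \<partial>lebesgue) =
     (\<integral>x. indicator ?X x * (Gu x \<bullet> (grad (phi k) x - H x)) \<partial>lebesgue)"
    by (subst Bochner_Integration.integral_diff[symmetric]) (intro iG gm gfin Hm Hfin | simp add: inner_diff_right right_diff_distrib)+
   also have "norm \<dots> \<le> (\<integral>x. norm (indicator ?X x * (Gu x \<bullet> (grad (phi k) x - H x))) \<partial>lebesgue)" by (rule integral_norm_bound)
   also have "\<dots> \<le> (\<integral>x. \<bar>Gu x \<bullet> (grad (phi k) x - H x)\<bar> \<partial>lebesgue)"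
    using i integrable_mult_indicator[OF X i] by (intro integral_mono) (auto simp: indicator_def)
   finally show "norm ((\<integral>x. indicator ?X x * (Gu x \<bullet> grad (phi k) x) \<partial>lebesgue) - (\<integral>x. indicator ?X x * (Gu x \<bullet> H x) \<partial>lebesgue))
    \<le> (\<integral>x. \<bar>Gu x \<bullet> (grad (phi k) x - H x)\<bar> \<partial>lebesgue)" .
  qed
 qed
 let ?B = "\<lambda>r. \<bar>Z r\<bar> * (2 * M * r powr (- (real N - 2) / 2))"
 have Bc: "continuous_on {a..b} ?B"
  by (intro continuous_intros continuous_on_subset[OF Z_cont]) (use a in auto)
 have Bi: "integrable lebesgue (\<lambda>x::'a. indicator ?X x * ?B (norm x))" by (rule polar_shell_integral(2)[OF less_imp_le[OF a(1)] Bc])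
 have dom: "\<bar>indicator ?X x * (Z (norm x) * phi k x)\<bar> \<le> indicator ?X x * ?B (norm x)" for k x
 proof (cases "x \<in> ?X")
  case True
  hence "0 < norm x" using less_le_trans[OF a(1)] by blast
  from pb[OF this, of k] have "\<bar>phi k x\<bar> \<le> 2 * M * ew N (norm x)" using radial_test_prof[OF t, of k x] by simp
  thus ?thesis using True by (simp add: abs_mult mult_left_mono ew_def)
 qed simp
 have iZ: "integrable lebesgue (\<lambda>x. indicator ?X x * (Z (norm x) * phi k x))" for k
  by (rule Bochner_Integration.integrable_bound[OF Bi]) (use dom[of _ k] in \<open>auto intro!: order_trans[OF _ abs_ge_self]\<close>)
 have iZh: "integrable lebesgue (\<lambda>x. indicator ?X x * (Z (norm x) * h x))"
  using integrable_mult_indicator[OF X int] by simp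
 have lim2: "(\<lambda>k. \<integral>x. indicator ?X x * (Z (norm x) * phi k x) \<partial>lebesgue) \<longlonglongrightarrow> (\<integral>x. indicator ?X x * (Z (norm x) * h x) \<partial>lebesgue)"
 proof (rule integral_dominated_convergence[OF _ _ Bi])
  show "AE x in lebesgue. (\<lambda>k. indicator ?X x * (Z (norm x) * phi k x)) \<longlonglongrightarrow> indicator ?X x * (Z (norm x) * h x)"
   using ae by eventually_elim (intro tendsto_intros)
  show "AE x in lebesgue. norm (indicator ?X x * (Z (norm x) * phi k x)) \<le> indicator ?X x * ?B (norm x)" for k
   using dom[of _ k] by simp
 qed measurable
 have e: "(\<integral>x. indicator ?X x * (Gu x \<bullet> grad (phi k) x) \<partial>lebesgue) + (\<integral>x. indicator ?X x * (Z (norm x) * phi k x) \<partial>lebesgue)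
   = ?c * (W b * prof (phi k) b - W a * prof (phi k) a)" for k
  using weak_on_shell[OF t a, of k] Bochner_Integration.integral_add[OF iG[OF gm gfin, of k] iZ[of k]] by (simp add: distrib_left)
 have bd: "\<bar>?c * (W b * prof (phi k) b - W a * prof (phi k) a)\<bar> \<le> ?c * (2 * M) * (\<bar>W b\<bar> * ew N b + \<bar>W a\<bar> * ew N a)" for k
 proof -
  have "\<bar>W b * prof (phi k) b\<bar> \<le> \<bar>W b\<bar> * (2 * M * ew N b)" using pb[of b k] a by (simp add: abs_mult mult_left_mono)
  moreover have "\<bar>W a * prof (phi k) a\<bar> \<le> \<bar>W a\<bar> * (2 * M * ew N a)" using pb[of a k] a by (simp add: abs_mult mult_left_mono)
  ultimately have "\<bar>W b * prof (phi k) b - W a * prof (phi k) a\<bar> \<le> 2 * M * (\<bar>W b\<bar> * ew N b + \<bar>W a\<bar> * ew N a)"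
   unfolding distrib_left by (simp add: mult_ac)
  hence "?c * \<bar>W b * prof (phi k) b - W a * prof (phi k) a\<bar> \<le> ?c * (2 * M * (\<bar>W b\<bar> * ew N b + \<bar>W a\<bar> * ew N a))" using c by (intro mult_left_mono) auto
  thus ?thesis using c by (simp add: abs_mult mult_ac)
 qed
 have "\<bar>(\<integral>x. indicator ?X x * (Gu x \<bullet> H x) \<partial>lebesgue) + (\<integral>x. indicator ?X x * (Z (norm x) * h x) \<partial>lebesgue)\<bar>
   \<le> ?c * (2 * M) * (\<bar>W b\<bar> * ew N b + \<bar>W a\<bar> * ew N a)"
  by (rule LIMSEQ_le_const2[OF tendsto_rabs[OF tendsto_add[OF lim1 lim2]]]) (use bd e in auto)
 thus ?thesis using Bochner_Integration.integral_add[OF iG[OF Hm Hfin] iZh] by (simp add: distrib_left)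
qed

text \<open>The boundary terms vanish along suitable radii \<open>a \<rightarrow> 0\<close>, \<open>b \<rightarrow> \<infinity>\<close>.\<close>
lemma weak_equation:
 fixes h :: "'a \<Rightarrow> real"
 assumes h: "h \<in> Espace V"
 shows "integrable lebesgue (\<lambda>x. V (norm x) * (kfun (u x) * h x))"
  and "integrable lebesgue (\<lambda>x. K (norm x) * (mfun g (u x) * h x))"
  and "(\<integral>x. Gu x \<bullet> wgrad h x \<partial>lebesgue) + (\<integral>x. V (norm x) * (kfun (u x) * h x) \<partial>lebesgue)
    - (\<integral>x. K (norm x) * (mfun g (u x) * h x) \<partial>lebesgue) = 0"
proof -
 note hD = Espace_in_D[OF h]
 from in_DE[OF hD] have hm[measurable]: "h \<in> borel_measurable lebesgue" and Hm[measurable]: "wgrad h \<in> borel_measurable lebesgue" by blast+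
 define d where "d = Enorm V h + 1"
 have d: "Enorm V h < d" "0 < d" by (auto simp: d_def Enorm_def Dnorm_def Onorm_def intro: add_nonneg_pos)
 let ?c = "cN TYPE('a)"
 define Cp where "Cp = 2 / sqrt ?c"
 have c: "0 < ?c" by (rule cN_pos)
 have Cp: "0 < Cp" using c by (simp add: Cp_def)
 note eb = Espace_bounds[OF NN h d(1), folded Cp_def]
 obtain A where A: "0 \<le> A" "Vsq u \<le> ennreal A" by (rule u_L2V)
 let ?B = "(16 * CV + 1 + 2 * Cp\<^sup>2) * d\<^sup>2"
 have B: "0 \<le> ?B" using CV by (intro mult_nonneg_nonneg) auto
 \<comment> \<open>One majorant for both integrability claims: the V-term is at most Y^2 and the
   K-term at most \<open>Cm\<close> times either power of Y.\<close>
 define Y where "Y x = \<bar>u x\<bar> + \<bar>h x\<bar>" for x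
 have Ym[measurable]: "Y \<in> borel_measurable lebesgue" unfolding Y_def[abs_def] by measurable
 have YA: "Vsq Y \<le> ennreal (2 * A + 2 * ?B)"
  unfolding Y_def by (rule V_sq_add[OF u_meas hm A(2,1) eb(3) B])
 have Y0: "AE x in lebesgue. 0 \<le> Y x \<and> Y x \<le> (S + Cp * d) * ew N (norm x)"
  using u_pointwise eb(2) by eventually_elim (auto simp: Y_def distrib_right)
 have T0: "0 < S + Cp * d" using sol_facts(1) Cp d by (intro add_pos_pos mult_pos_pos) auto
 show iV: "integrable lebesgue (\<lambda>x. V (norm x) * (kfun (u x) * h x))"
 proof (rule V_integrable[OF Ym _ YA, where C=1])
  show "\<bar>kfun (u x) * h x\<bar> \<le> 1 * (Y x)\<^sup>2" for x
  proof -
   have "\<bar>kfun (u x)\<bar> * \<bar>h x\<bar> \<le> Y x * Y x" using kfun_abs_le[of "u x"] by (intro mult_mono) (auto simp: Y_def)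
   thus ?thesis by (simp add: abs_mult power2_eq_square)
  qed
 qed measurable
 show iK: "integrable lebesgue (\<lambda>x. K (norm x) * (mfun g (u x) * h x))"
  by (rule K_integrable[OF NN T0 _ Ym Y0 YA, where C=Cm])
   (use A B mfun_mult_bound in \<open>auto simp: Y_def\<close>)
 have hfin: "L2sq (wgrad h) < \<infinity>" by (rule in_D_finite[OF hD])
 have iG: "integrable lebesgue (\<lambda>x. Gu x \<bullet> wgrad h x)" by (rule L2_inner_integrable[OF Gu_meas Hm Gu_finite hfin])
 have Zeq: "Z (norm x) * h x = V (norm x) * (kfun (u x) * h x) - K (norm x) * (mfun g (u x) * h x)" for x
  by (simp add: Z_def u algebra_simps)
 have iZ: "integrable lebesgue (\<lambda>x. Z (norm x) * h x)" unfolding Zeq by (intro Bochner_Integration.integrable_diff iV iK)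
 define T where "T x = Gu x \<bullet> wgrad h x + Z (norm x) * h x" for x
 have iT: "integrable lebesgue T" unfolding T_def[abs_def] by (intro Bochner_Integration.integrable_add iG iZ)
 \<comment> \<open>This brings the bound d^2 into the normalised form \<open>cN\<close> M^2 of the
   radial estimates.\<close>
 define M where "M = d / sqrt ?c"
 have M: "L2sq (wgrad h) \<le> ennreal (?c * M\<^sup>2)" "0 < M" using eb(1) c d(2) by (simp_all add: M_def power_divide)
 have "\<exists>a b. 0 < a \<and> a < 1 / (real n + 1) \<and> real n + 1 < b \<and> \<bar>W a\<bar> * ew N a < 1 / (real n + 1) \<and> \<bar>W b\<bar> * ew N b < 1 / (real n + 1)" for n
 proof -
  have "0 < 1 / (real n + 1)" "0 < real n + 1" by simp_all
  from boundary_radii(1)[OF sol this] boundary_radii(2)[OF sol this(1) this(1)] show ?thesis by blast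
 qed
 then obtain a b where ab: "\<And>n. 0 < a n" "\<And>n. a n < 1 / (real n + 1)" "\<And>n. real n + 1 < b n"
  "\<And>n. \<bar>W (a n)\<bar> * ew N (a n) < 1 / (real n + 1)" "\<And>n. \<bar>W (b n)\<bar> * ew N (b n) < 1 / (real n + 1)" by metis
 have a1: "a n < 1" for n using ab(2)[of n] by (rule less_le_trans) simp
 have b1: "1 < b n" for n using ab(3)[of n] by linarith
 define X where "X n = {x::'a. a n \<le> norm x \<and> norm x \<le> b n}" for n
 have X: "X n \<in> sets lebesgue" for n
 proof -
  have "X n = cball 0 (b n) - ball 0 (a n)" by (auto simp: X_def)
  thus ?thesis by simp
 qed
 have lim: "(\<lambda>n. \<integral>x. indicator (X n) x * T x \<partial>lebesgue) \<longlonglongrightarrow> (\<integral>x. T x \<partial>lebesgue)"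
 proof (rule integral_dominated_convergence[where w="\<lambda>x. \<bar>T x\<bar>"])
  show "(\<lambda>x. indicator (X n) x * T x) \<in> borel_measurable lebesgue" for n
   by (intro borel_measurable_times borel_measurable_indicator X borel_measurable_integrable[OF iT])
  show "AE x in lebesgue. (\<lambda>n. indicator (X n) x * T x) \<longlonglongrightarrow> T x"
   using AE_nonzero
  proof eventually_elim
   case (elim x)
   have "0 < norm x" using elim by simp
   hence "\<forall>\<^sub>F n in sequentially. 1 / (real n + 1) < norm x" by real_asymp
   moreover have "\<forall>\<^sub>F n in sequentially. norm x < real n + 1" by real_asymp
   ultimately have "\<forall>\<^sub>F n in sequentially. indicator (X n) x * T x = T x"
   proof eventually_elim
    case (elim n)
    have "a n \<le> norm x \<and> norm x \<le> b n" using elim ab(2)[of n] ab(3)[of n] by linarith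
    thus ?case by (simp add: indicator_def X_def)
   qed
   thus ?case by (rule tendsto_eventually)
  qed
 qed (use iT in \<open>auto simp: indicator_def\<close>)
 have "(\<lambda>n. \<integral>x. indicator (X n) x * T x \<partial>lebesgue) \<longlonglongrightarrow> 0"
 proof (rule Lim_null_comparison)
  show "(\<lambda>n. ?c * (2 * M) * (2 / (real n + 1))) \<longlonglongrightarrow> 0" by real_asymp
  show "\<forall>\<^sub>F n in sequentially. norm (\<integral>x. indicator (X n) x * T x \<partial>lebesgue) \<le> ?c * (2 * M) * (2 / (real n + 1))"
  proof (rule always_eventually, rule allI)
   fix n
   have "a n \<le> b n" using a1[of n] b1[of n] by linarith
   from weak_shell_bound[OF hD iZ M ab(1)[of n] this]
   have "norm (\<integral>x. indicator (X n) x * T x \<partial>lebesgue) \<le> ?c * (2 * M) * (\<bar>W (b n)\<bar> * ew N (b n) + \<bar>W (a n)\<bar> * ew N (a n))"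
    by (simp add: T_def X_def)
   also have "\<dots> \<le> ?c * (2 * M) * (2 / (real n + 1))"
    using ab(4)[of n] ab(5)[of n] c M(2) by (intro mult_left_mono) auto
   finally show "norm (\<integral>x. indicator (X n) x * T x \<partial>lebesgue) \<le> ?c * (2 * M) * (2 / (real n + 1))" .
  qed
 qed
 with lim have "(\<integral>x. T x \<partial>lebesgue) = 0" by (rule LIMSEQ_unique)
 moreover have "(\<integral>x. T x \<partial>lebesgue) = (\<integral>x. Gu x \<bullet> wgrad h x \<partial>lebesgue) + ((\<integral>x. V (norm x) * (kfun (u x) * h x) \<partial>lebesgue) - (\<integral>x. K (norm x) * (mfun g (u x) * h x) \<partial>lebesgue))"
  unfolding T_def[abs_def] Zeq
  by (subst Bochner_Integration.integral_add[OF iG Bochner_Integration.integrable_diff[OF iV iK]])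
   (subst Bochner_Integration.integral_diff[OF iV iK], rule refl)
 ultimately show "(\<integral>x. Gu x \<bullet> wgrad h x \<partial>lebesgue) + (\<integral>x. V (norm x) * (kfun (u x) * h x) \<partial>lebesgue)
    - (\<integral>x. K (norm x) * (mfun g (u x) * h x) \<partial>lebesgue) = 0" by simp
qed

text \<open>Writing h as d (h/d) extracts a factor d, and d \<le> 1 keeps the mean value point below
  |y| + |h/d|, whose size is governed by the normalised increment. The difference form is kept
  because uniform continuity of \<open>mfun g\<close> is applied to it inside the shell.\<close>

lemma Mfun_remainder:
 assumes d: "0 < d" "d \<le> 1"
 obtains \<xi> where "\<bar>\<xi> - y\<bar> \<le> \<bar>h\<bar>" "Mfun g (y + h) - Mfun g y - mfun g y * h = (mfun g \<xi> - mfun g y) * h"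
  "\<bar>(mfun g \<xi> - mfun g y) * h\<bar> \<le> 2 * Cm * d * (\<bar>y\<bar> + \<bar>h / d\<bar>) powr \<gamma>1"
  "\<bar>(mfun g \<xi> - mfun g y) * h\<bar> \<le> 2 * Cm * d * (\<bar>y\<bar> + \<bar>h / d\<bar>) powr \<gamma>2"
proof -
 obtain \<xi> where \<xi>: "\<bar>\<xi> - y\<bar> \<le> \<bar>h\<bar>" "Mfun g (y + h) - Mfun g y = mfun g \<xi> * h"
 proof -
  consider "h = 0" | "0 < h" | "h < 0" by linarith
  thus ?thesis
  proof cases
   case 2
   have "\<exists>z. y < z \<and> z < y + h \<and> Mfun g (y + h) - Mfun g y = (y + h - y) * mfun g z"
    by (rule MVT2) (use 2 Mfun_deriv[OF g_cont] in auto)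
   thus ?thesis using 2 by (auto simp: mult.commute intro!: that)
  next
   case 3
   have "\<exists>z. y + h < z \<and> z < y \<and> Mfun g y - Mfun g (y + h) = (y - (y + h)) * mfun g z"
    by (rule MVT2) (use 3 Mfun_deriv[OF g_cont] in auto)
   then obtain z where z: "y + h < z" "z < y" "Mfun g y - Mfun g (y + h) = (y - (y + h)) * mfun g z" by blast
   show ?thesis by (rule that[of z]) (use z 3 in \<open>auto simp: algebra_simps\<close>)
  qed (auto intro: that[of y])
 qed
 define x where "x = \<bar>y\<bar> + \<bar>h / d\<bar>"
 have "\<bar>h\<bar> * 1 \<le> \<bar>h\<bar> * (1 / d)" using d by (intro mult_left_mono) auto
 hence hd: "\<bar>h\<bar> \<le> \<bar>h / d\<bar>" using d by (simp add: abs_divide)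
 have y1: "\<bar>y\<bar> \<le> x" "\<bar>\<xi>\<bar> \<le> x" "\<bar>h / d\<bar> \<le> x" using \<xi>(1) hd by (auto simp: x_def)
 have le: "\<bar>(mfun g \<xi> - mfun g y) * h\<bar> \<le> 2 * Cm * d * p" if "\<bar>mfun g \<xi> * (h / d)\<bar> \<le> Cm * p" "\<bar>mfun g y * (h / d)\<bar> \<le> Cm * p" for p
 proof -
  have "\<bar>(mfun g \<xi> - mfun g y) * h\<bar> = d * \<bar>mfun g \<xi> * (h / d) - mfun g y * (h / d)\<bar>"
   using d by (simp add: abs_mult abs_divide left_diff_distrib[symmetric] diff_divide_distrib[symmetric])
  also have "\<dots> \<le> d * (2 * Cm * p)" by (rule mult_left_mono) (use that d in linarith)+
  finally show ?thesis by (simp add: mult_ac)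
 qed
 show thesis
 proof (rule that[OF \<xi>(1)])
  show "Mfun g (y + h) - Mfun g y - mfun g y * h = (mfun g \<xi> - mfun g y) * h" using \<xi>(2) by (simp add: left_diff_distrib)
  show "\<bar>(mfun g \<xi> - mfun g y) * h\<bar> \<le> 2 * Cm * d * (\<bar>y\<bar> + \<bar>h / d\<bar>) powr \<gamma>1"
   "\<bar>(mfun g \<xi> - mfun g y) * h\<bar> \<le> 2 * Cm * d * (\<bar>y\<bar> + \<bar>h / d\<bar>) powr \<gamma>2"
   unfolding x_def[symmetric] by (intro le mfun_mult_bound y1)+
 qed
qed

end

section \<open>Expansion of I at u\<close>

context radial_critical
begin

abbreviation fRem :: "('a \<Rightarrow> real) \<Rightarrow> 'a \<Rightarrow> real" where
 "fRem h x \<equiv> (fODE (u x + h x))\<^sup>2 - (fODE (u x))\<^sup>2 - 2 * kfun (u x) * h x"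

abbreviation MRem :: "('a \<Rightarrow> real) \<Rightarrow> 'a \<Rightarrow> real" where
 "MRem h x \<equiv> Mfun g (u x + h x) - Mfun g (u x) - mfun g (u x) * h x"

text \<open>Stated for any v dominated by |u| + |h| so that it serves for u + h and for u
  itself.\<close>

lemma energy_integrable:
 fixes h v :: "'a \<Rightarrow> real"
 assumes h: "h \<in> Espace V" and vm[measurable]: "v \<in> borel_measurable lebesgue" and v: "\<And>x. \<bar>v x\<bar> \<le> \<bar>u x\<bar> + \<bar>h x\<bar>"
 shows "integrable lebesgue (\<lambda>x. V (norm x) * (fODE (v x))\<^sup>2)"
  and "integrable lebesgue (\<lambda>x. K (norm x) * Mfun g (v x))"
proof -
 note hD = Espace_in_D[OF h]
 from in_DE[OF hD] have hm[measurable]: "h \<in> borel_measurable lebesgue" by blast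
 define d where "d = Enorm V h + 1"
 have d: "Enorm V h < d" "0 < d" by (auto simp: d_def Enorm_def Dnorm_def Onorm_def intro: add_nonneg_pos)
 define Cp where "Cp = 2 / sqrt (cN TYPE('a))"
 have Cp: "0 < Cp" using cN_pos[where 'a='a] by (simp add: Cp_def)
 note eb = Espace_bounds[OF NN h d(1), folded Cp_def]
 obtain A where A: "0 \<le> A" "Vsq u \<le> ennreal A" by (rule u_L2V)
 let ?B = "(16 * CV + 1 + 2 * Cp\<^sup>2) * d\<^sup>2"
 have B: "0 \<le> ?B" using CV by (intro mult_nonneg_nonneg) auto
 define Y where "Y x = \<bar>u x\<bar> + \<bar>h x\<bar>" for x
 have Ym[measurable]: "Y \<in> borel_measurable lebesgue" unfolding Y_def[abs_def] by measurable
 have YA: "Vsq Y \<le> ennreal (2 * A + 2 * ?B)"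
  unfolding Y_def by (rule V_sq_add[OF u_meas hm A(2,1) eb(3) B])
 have Y0: "AE x in lebesgue. 0 \<le> Y x \<and> Y x \<le> (S + Cp * d) * ew N (norm x)"
  using u_pointwise eb(2) by eventually_elim (auto simp: Y_def distrib_right)
 have T0: "0 < S + Cp * d" using sol_facts(1) Cp d by (intro add_pos_pos mult_pos_pos) auto
 show "integrable lebesgue (\<lambda>x. V (norm x) * (fODE (v x))\<^sup>2)"
 proof (rule V_integrable[OF Ym _ YA, where C=1])
  show "\<bar>(fODE (v x))\<^sup>2\<bar> \<le> 1 * (Y x)\<^sup>2" for x
  proof -
   have "(v x)\<^sup>2 \<le> (Y x)\<^sup>2" using v[of x] by (intro abs_le_square_iff[THEN iffD1]) (simp add: Y_def)
   thus ?thesis using fODE_sq_le[of "v x"] by simp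
  qed
 qed measurable
 show "integrable lebesgue (\<lambda>x. K (norm x) * Mfun g (v x))"
 proof (rule K_integrable[OF NN T0 _ Ym Y0 YA, where C=Cm])
  show "0 \<le> 2 * A + 2 * ?B" using A B by linarith
  fix x
  have "Cm * \<bar>v x\<bar> powr \<gamma> \<le> Cm * Y x powr \<gamma>" if "2 < \<gamma>" for \<gamma>
   using v[of x] Cm that by (intro mult_left_mono powr_mono2) (auto simp: Y_def)
  from this[OF \<gamma>1] this[OF \<gamma>2] show "\<bar>Mfun g (v x)\<bar> \<le> Cm * Y x powr \<gamma>1 \<and> \<bar>Mfun g (v x)\<bar> \<le> Cm * Y x powr \<gamma>2"
   using Mfun_nonneg[of "v x"] Mfun_bound[of "v x"] by auto
 qed measurable
qed

text \<open>Uniqueness of the weak gradient replaces the chosen gradient by any G at hand, and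
  integrability turns extended integrals into Bochner integrals, whose differences can be
  expanded.\<close>

lemma Ifun_eq:
 fixes v :: "'a \<Rightarrow> real"
 assumes v: "in_D v G" and int: "integrable lebesgue (\<lambda>x. V (norm x) * (fODE (v x))\<^sup>2)"
 shows "Ifun V K g v = 1/2 * (\<integral>x. (norm (G x))\<^sup>2 \<partial>lebesgue) + 1/2 * (\<integral>x. V (norm x) * (fODE (v x))\<^sup>2 \<partial>lebesgue)
   - (\<integral>x. K (norm x) * Mfun g (v x) \<partial>lebesgue)"
proof -
 have Gm: "G \<in> borel_measurable lebesgue" using in_DE[OF v] by blast
 have "(\<integral>\<^sup>+x. ennreal ((norm (wgrad v x))\<^sup>2) \<partial>lebesgue) = L2sq G"
  unfolding L2sq_def by (rule nn_integral_cong_AE) (use wgrad_eq[OF N3 v] in eventually_elim, simp)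
 also have "\<dots> = ennreal (\<integral>x. (norm (G x))\<^sup>2 \<partial>lebesgue)" by (rule L2_integrable(2)[OF Gm in_D_finite[OF v], symmetric])
 finally have "enn2real (\<integral>\<^sup>+x. ennreal ((norm (wgrad v x))\<^sup>2) \<partial>lebesgue) = (\<integral>x. (norm (G x))\<^sup>2 \<partial>lebesgue)" by simp
 moreover have "AE x in lebesgue. 0 \<le> V (norm (x::'a)) * (fODE (v x))\<^sup>2"
  using AE_nonzero by eventually_elim (simp add: V_nonneg)
 hence "enn2real (Vint V v) = (\<integral>x. V (norm x) * (fODE (v x))\<^sup>2 \<partial>lebesgue)"
  unfolding Vint_def by (simp add: nn_integral_eq_integral[OF int] integral_nonneg_AE)
 ultimately show ?thesis by (simp add: Ifun_def Mfun_def)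
qed

text \<open>Outside a large shell the remainder is small by the decay of \<open>K\<close>, linearly in \<open>d\<close>; inside the
 shell all functions are bounded and \<open>mfun g\<close> is uniformly continuous.\<close>
lemma K_remainder:
 assumes eps: "0 < eps"
 shows "\<exists>\<delta>>0. \<delta> \<le> 1 \<and> (\<forall>h d. h \<in> Espace V \<longrightarrow> Enorm V h < d \<longrightarrow> d < \<delta> \<longrightarrow>
  \<bar>\<integral>x. K (norm x) * MRem h x \<partial>lebesgue\<bar> \<le> eps * d)"
proof -
 let ?c = "cN TYPE('a)"
 define Cp where "Cp = 2 / sqrt ?c"
 have c: "0 < ?c" by (rule cN_pos)
 have Cp: "0 < Cp" using c by (simp add: Cp_def)
 define T where "T = S + Cp"
 have T: "0 < T" using sol_facts(1) Cp by (simp add: T_def)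
 obtain A where A: "0 \<le> A" "Vsq u \<le> ennreal A" by (rule u_L2V)
 define A1 where "A1 = 16 * CV + 1 + 2 * Cp\<^sup>2"
 have A1: "0 \<le> A1" using CV by (simp add: A1_def)
 define A2 where "A2 = 2 * A + 2 * A1"
 have A2: "0 \<le> A2" using A A1 by (simp add: A2_def)
 define B0 where "B0 = CK * (T powr \<gamma>1 * (?c / eta) + T powr \<gamma>2 * (A2 / T\<^sup>2 + ?c / eta))"
 have B0: "0 \<le> B0" unfolding B0_def using CK c eta A2 by (intro mult_nonneg_nonneg add_nonneg_nonneg) auto
 \<comment> \<open>B0 collects the constants of \<open>K_outer\<close> for R = 1/rho, where both
   ends carry rho^eta. Keeping rho^eta below t makes the outer part at most eps/2 times d; the
   summand 1 avoids a zero denominator.\<close>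
 define t where "t = eps / (4 * (Cm * B0 + 1))"
 have CB: "0 \<le> Cm * B0" using Cm B0 by simp
 have t: "0 < t" "2 * Cm * B0 * t \<le> eps / 2"
 proof -
  show t0: "0 < t" using eps CB by (simp add: t_def)
  have "4 * (Cm * B0 + 1) * t = eps" using CB by (simp add: t_def)
  moreover have "2 * Cm * B0 * t = 2 * (Cm * B0 + 1) * t - 2 * t" by (simp add: algebra_simps)
  ultimately show "2 * Cm * B0 * t \<le> eps / 2" using t0 by linarith
 qed
 define rho where "rho = min 1 (t powr (1 / eta))"
 have rho: "0 < rho" "rho \<le> 1" using t by (auto simp: rho_def)
 have R: "1 \<le> 1 / rho" using rho by simp
 have rhot: "rho powr eta \<le> t"
 proof -
  have "rho powr eta \<le> (t powr (1 / eta)) powr eta" using rho eta by (intro powr_mono2) (auto simp: rho_def)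
  thus ?thesis using eta t by (simp add: powr_powr)
 qed
 define e where "e = ew N rho"
 have e: "0 < e" using ew_pos[OF rho(1)] by (simp add: e_def)
 have "bounded (K ` {rho..1/rho})" by (intro compact_imp_bounded compact_continuous_image K_cont_on rho compact_Icc)
 then obtain Kb where Kb: "0 < Kb" "\<And>r. rho \<le> r \<Longrightarrow> r \<le> 1/rho \<Longrightarrow> \<bar>K r\<bar> \<le> Kb" unfolding bounded_pos by auto
 define vol where "vol = measure lebesgue (cball (0::'a) (1/rho))"
 have vol: "emeasure lebesgue (cball (0::'a) (1/rho)) = ennreal vol" "0 \<le> vol"
  unfolding vol_def by (rule emeasure_eq_measure2[OF lmeasurable_cball], rule measure_nonneg)
 \<comment> \<open>The inner shell contributes at most kappa eps' d: the bound on K, the bound Cp d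
   e on |h|, the volume, and the modulus eps' of \<open>mfun g\<close>.\<close>
 define kappa where "kappa = Kb * Cp * e * vol"
 have kappa: "0 \<le> kappa" using Kb Cp e vol by (simp add: kappa_def)
 define eps' where "eps' = eps / (2 * (kappa + 1))"
 have eps': "0 < eps'" "kappa * eps' \<le> eps / 2"
 proof -
  show e0: "0 < eps'" using eps kappa by (simp add: eps'_def)
  have "2 * (kappa + 1) * eps' = eps" using kappa by (simp add: eps'_def)
  moreover have "kappa * eps' = (kappa + 1) * eps' - eps'" by (simp add: algebra_simps)
  ultimately show "kappa * eps' \<le> eps / 2" using e0 by linarith
 qed
 define L where "L = T * e"
 have "uniformly_continuous_on {-L..L} (mfun g)" by (intro compact_uniformly_continuous cont_mfun compact_Icc)
 then obtain \<delta>0 where \<delta>0: "0 < \<delta>0" "\<And>y z. y \<in> {-L..L} \<Longrightarrow> z \<in> {-L..L} \<Longrightarrow> \<bar>z - y\<bar> < \<delta>0 \<Longrightarrow> \<bar>mfun g z - mfun g y\<bar> < eps'"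
  unfolding uniformly_continuous_on_def dist_real_def using eps'(1) by metis
 define \<delta> where "\<delta> = min 1 (\<delta>0 / (Cp * e))"
 have \<delta>: "0 < \<delta>" "\<delta> \<le> 1" using \<delta>0 Cp e by (auto simp: \<delta>_def)
 have "\<bar>\<integral>x. K (norm x) * MRem h x \<partial>lebesgue\<bar> \<le> eps * d"
  if h: "h \<in> Espace V" and hd: "Enorm V h < d" and d\<delta>: "d < \<delta>" for h :: "'a \<Rightarrow> real" and d
 proof (rule integral_le_of_nn_bound)
  have d0: "0 < d" by (rule le_less_trans[OF _ hd]) (simp add: Enorm_def Dnorm_def Onorm_def)
  have d1: "d \<le> 1" using d\<delta> \<delta>(2) by simp
  note hD = Espace_in_D[OF h]
  from in_DE[OF hD] have hm[measurable]: "h \<in> borel_measurable lebesgue" by blast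
  note eb = Espace_bounds[OF NN h hd, folded Cp_def, folded A1_def]
  \<comment> \<open>The increment is divided by d, which makes all bounds on Y independent of h and
    d.\<close>
  define Y where "Y x = \<bar>u x\<bar> + \<bar>h x / d\<bar>" for x
  have Ym[measurable]: "Y \<in> borel_measurable lebesgue" unfolding Y_def[abs_def] by measurable
  have hV: "(\<integral>\<^sup>+x. ennreal (V (norm x) * (h x / d)\<^sup>2) \<partial>lebesgue) \<le> ennreal A1"
  proof -
   note [measurable] = V_meas
   have "(\<integral>\<^sup>+x. ennreal (V (norm x) * (h x / d)\<^sup>2) \<partial>lebesgue) = (\<integral>\<^sup>+x. ennreal (1 / d\<^sup>2) * ennreal (V (norm x) * (h x)\<^sup>2) \<partial>lebesgue)"
    by (rule nn_integral_cong_AE) (use AE_nonzero in eventually_elim, simp add: ennreal_mult[symmetric] V_nonneg power_divide)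
   also have "\<dots> = ennreal (1 / d\<^sup>2) * Vsq h" by (rule nn_integral_cmult) measurable
   also have "\<dots> \<le> ennreal (1 / d\<^sup>2) * ennreal (A1 * d\<^sup>2)" by (rule mult_left_mono[OF eb(3)]) simp
   also have "\<dots> = ennreal A1" using d0 A1 by (simp add: ennreal_mult[symmetric])
   finally show ?thesis .
  qed
  have hdm: "(\<lambda>x. h x / d) \<in> borel_measurable lebesgue" by measurable
  have YA: "Vsq Y \<le> ennreal A2"
   unfolding Y_def A2_def by (rule V_sq_add[OF u_meas hdm A(2,1) hV A1])
  have Y0: "AE x in lebesgue. 0 \<le> Y x \<and> Y x \<le> T * ew N (norm x)"
   using u_pointwise eb(2)
  proof eventually_elim
   case (elim x)
   have "\<bar>h x / d\<bar> \<le> Cp * ew N (norm x)" using elim(2) d0 by (simp add: abs_divide field_simps)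
   thus ?case using elim(1) by (auto simp: Y_def T_def distrib_right)
  qed
  let ?out = "{x::'a. norm x \<le> rho \<or> 1 / rho < norm x}"
  have outm: "?out \<in> sets lebesgue"
  proof -
   have "?out = cball 0 rho \<union> (- cball 0 (1 / rho))" by auto
   thus ?thesis by simp
  qed
  have Qm: "(\<lambda>x. ennreal (Qf Y x) * indicator ?out x) \<in> borel_measurable lebesgue"
   using Qf_meas[OF Ym] outm by measurable
  have out: "(\<integral>\<^sup>+x. ennreal (Qf Y x) * indicator ?out x \<partial>lebesgue) \<le> ennreal (B0 * t)"
  proof -
   have "(1 / rho) powr (- eta) = rho powr eta" using rho by (simp add: powr_divide powr_minus_divide)
   hence "CK * (T powr \<gamma>1 * (?c / eta) * rho powr eta + T powr \<gamma>2 * (A2 / T\<^sup>2 + ?c / eta) * (1 / rho) powr (- eta)) = B0 * rho powr eta"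
    by (simp only: B0_def) (simp add: distrib_left distrib_right mult_ac)
   also have "\<dots> \<le> B0 * t" using B0 rhot by (rule mult_left_mono[rotated])
   finally show ?thesis by (intro order_trans[OF K_outer[OF NN rho R T A2 Ym Y0 YA]] ennreal_leI)
  qed
  let ?k = "Kb * eps' * Cp * e * d"
  have k0: "0 \<le> ?k" using Kb eps' Cp e d0 by simp
  have cd: "0 \<le> 2 * Cm * d" using Cm d0 by simp
  have "(\<integral>\<^sup>+x. ennreal \<bar>K (norm x) * MRem h x\<bar> \<partial>lebesgue) \<le>
   (\<integral>\<^sup>+x. ennreal (2 * Cm * d) * (ennreal (Qf Y x) * indicator ?out x) + ennreal ?k * indicator (cball 0 (1/rho)) x \<partial>lebesgue)"
  proof (rule nn_integral_mono_AE)
   show "AE x in lebesgue. ennreal \<bar>K (norm x) * MRem h x\<bar> \<le>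
    ennreal (2 * Cm * d) * (ennreal (Qf Y x) * indicator ?out x) + ennreal ?k * indicator (cball 0 (1/rho)) x"
    using u_pointwise eb(2) AE_nonzero
   proof eventually_elim
    case (elim x)
    define r where "r = norm x"
    have r: "0 < r" using elim by (simp add: r_def)
    have K: "0 < K r" by (rule K_pos[OF r])
    obtain \<xi> where \<xi>: "\<bar>\<xi> - u x\<bar> \<le> \<bar>h x\<bar>" "Mfun g (u x + h x) - Mfun g (u x) - mfun g (u x) * h x = (mfun g \<xi> - mfun g (u x)) * h x"
     "\<bar>(mfun g \<xi> - mfun g (u x)) * h x\<bar> \<le> 2 * Cm * d * Y x powr \<gamma>1"
     "\<bar>(mfun g \<xi> - mfun g (u x)) * h x\<bar> \<le> 2 * Cm * d * Y x powr \<gamma>2"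
     unfolding Y_def by (rule Mfun_remainder[OF d0 d1])
    let ?R = "\<bar>(mfun g \<xi> - mfun g (u x)) * h x\<bar>"
    show ?case
    proof (cases "r \<le> rho \<or> 1 / rho < r")
     case True
     have "K r * ?R \<le> K r * (2 * Cm * d * (if norm x \<le> 1 then Y x powr \<gamma>1 else Y x powr \<gamma>2))"
      using \<xi> K by (intro mult_left_mono) auto
     also have "\<dots> = 2 * Cm * d * Qf Y x" by (simp add: Qf_def r_def mult_ac)
     finally have "ennreal (K r * ?R) \<le> ennreal (2 * Cm * d * Qf Y x)" by (rule ennreal_leI)
     also have "\<dots> = ennreal (2 * Cm * d) * ennreal (Qf Y x)" using elim by (intro ennreal_mult cd Qf_nonneg)
     finally show ?thesis using True K unfolding \<xi>(2) by (simp add: r_def abs_mult add_increasing2)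
    next
     case False
     hence r': "rho \<le> r" "r \<le> 1 / rho" by auto
     have ewr: "ew N r \<le> e" unfolding e_def using N by (intro ew_antimono rho r') simp
     have "S * ew N r \<le> S * e" using ewr sol_facts(1) by (intro mult_left_mono) auto
     hence uS: "\<bar>u x\<bar> \<le> S * e" using elim(1) by (simp add: r_def)
     have "Cp * d * ew N r \<le> Cp * d * e" using ewr Cp d0 by (intro mult_left_mono) auto
     hence hC: "\<bar>h x\<bar> \<le> Cp * d * e" using elim(2) by (simp add: r_def)
     have "d < \<delta>0 / (Cp * e)" using d\<delta> by (simp add: \<delta>_def)
     hence "Cp * d * e < \<delta>0" using Cp e by (simp add: field_simps)
     hence h1: "\<bar>\<xi> - u x\<bar> < \<delta>0" using \<xi>(1) hC by linarith
     have "Cp * d * e \<le> Cp * 1 * e" using Cp e d0 d1 by (intro mult_mono) auto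
     hence "\<bar>u x\<bar> + \<bar>h x\<bar> \<le> L" using uS hC by (simp add: L_def T_def distrib_right)
     hence "u x \<in> {-L..L}" "\<xi> \<in> {-L..L}" using \<xi>(1) by auto
     from \<delta>0(2)[OF this h1] have "?R \<le> eps' * (Cp * d * e)" unfolding abs_mult using hC by (intro mult_mono) auto
     hence "K r * ?R \<le> Kb * (eps' * (Cp * d * e))" using Kb(1) Kb(2)[OF r'] K by (intro mult_mono) auto
     also have "\<dots> = ?k" by (simp add: mult_ac)
     finally have "ennreal (K r * ?R) \<le> ennreal ?k" by (rule ennreal_leI)
     thus ?thesis using False K unfolding \<xi>(2) by (simp add: r_def abs_mult add_increasing)
    qed
   qed
  qed
  also have "\<dots> = ennreal (2 * Cm * d) * (\<integral>\<^sup>+x. ennreal (Qf Y x) * indicator ?out x \<partial>lebesgue) + ennreal ?k * emeasure lebesgue (cball (0::'a) (1/rho))"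
  proof -
   have cb: "cball (0::'a) (1/rho) \<in> sets lebesgue" by (rule fmeasurableD[OF lmeasurable_cball])
   have "(\<lambda>x. ennreal ?k * indicator (cball (0::'a) (1/rho)) x) \<in> borel_measurable lebesgue" using cb by measurable
   moreover have "(\<lambda>x. ennreal (2 * Cm * d) * (ennreal (Qf Y x) * indicator ?out x)) \<in> borel_measurable lebesgue" using Qm by measurable
   ultimately show ?thesis by (simp only: nn_integral_add nn_integral_cmult[OF Qm] nn_integral_cmult_indicator[OF cb])
  qed
  also have "\<dots> \<le> ennreal (2 * Cm * d) * ennreal (B0 * t) + ennreal ?k * ennreal vol"
   unfolding vol(1) by (intro add_mono mult_left_mono out) auto
  also have "\<dots> = ennreal (2 * Cm * d * (B0 * t) + ?k * vol)"
   using cd k0 B0 t(1) vol(2) by (simp add: ennreal_plus ennreal_mult)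
  also have "\<dots> \<le> ennreal (eps * d)"
  proof (rule ennreal_leI)
   have "2 * Cm * d * (B0 * t) + ?k * vol = (2 * Cm * B0 * t + kappa * eps') * d" by (simp add: kappa_def algebra_simps)
   also have "\<dots> \<le> eps * d" by (rule mult_right_mono) (use t(2) eps'(2) d0 in linarith)+
   finally show "2 * Cm * d * (B0 * t) + ?k * vol \<le> eps * d" .
  qed
  finally show "(\<integral>\<^sup>+x. ennreal \<bar>K (norm x) * MRem h x\<bar> \<partial>lebesgue) \<le> ennreal (eps * d)" .
  show "0 \<le> eps * d" using eps d0 by simp
 qed
 thus ?thesis using \<delta> by blast
qed

text \<open>The first-order terms of the three parts cancel by \<open>weak_equation\<close>; what
  remains is of second order, apart from the K-remainder.\<close>

lemma Ifun_expansion: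
 fixes h :: "'a \<Rightarrow> real"
 assumes h: "h \<in> Espace V"
 shows "Ifun V K g (\<lambda>x. u x + h x) - Ifun V K g u =
   1/2 * (\<integral>x. (norm (wgrad h x))\<^sup>2 \<partial>lebesgue)
   + 1/2 * (\<integral>x. V (norm x) * fRem h x \<partial>lebesgue)
   - (\<integral>x. K (norm x) * MRem h x \<partial>lebesgue)"
proof -
 note hD = Espace_in_D[OF h]
 from in_DE[OF hD] have hm[measurable]: "h \<in> borel_measurable lebesgue" and Hm[measurable]: "wgrad h \<in> borel_measurable lebesgue" by blast+
 have hfin: "L2sq (wgrad h) < \<infinity>" by (rule in_D_finite[OF hD])
 have uh: "in_D (\<lambda>x. u x + h x) (\<lambda>x. Gu x + wgrad h x)" using in_D_lincomb[OF u_in_D hD, of 1 1] by simp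
 have uhm: "(\<lambda>x. u x + h x) \<in> borel_measurable lebesgue" by measurable
 note e1 = energy_integrable[OF h uhm abs_triangle_ineq]
 have e2: "integrable lebesgue (\<lambda>x. V (norm x) * (fODE (u x))\<^sup>2)" "integrable lebesgue (\<lambda>x. K (norm x) * Mfun g (u x))"
  using energy_integrable[OF h u_meas] by auto
 note w = weak_equation[OF h]
 have i1: "integrable lebesgue (\<lambda>x. (norm (Gu x))\<^sup>2)" by (rule L2_integrable(1)[OF Gu_meas Gu_finite])
 have i2: "integrable lebesgue (\<lambda>x. (norm (wgrad h x))\<^sup>2)" by (rule L2_integrable(1)[OF Hm hfin])
 have i3: "integrable lebesgue (\<lambda>x. Gu x \<bullet> wgrad h x)" by (rule L2_inner_integrable[OF Gu_meas Hm Gu_finite hfin])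
 have "(\<integral>x. (norm (Gu x + wgrad h x))\<^sup>2 \<partial>lebesgue) = (\<integral>x. (norm (Gu x))\<^sup>2 + (2 * (Gu x \<bullet> wgrad h x) + (norm (wgrad h x))\<^sup>2) \<partial>lebesgue)"
  by (rule Bochner_Integration.integral_cong[OF refl]) (simp add: power2_norm_eq_inner inner_add_left inner_add_right inner_commute)
 also have "\<dots> = (\<integral>x. (norm (Gu x))\<^sup>2 \<partial>lebesgue) + (2 * (\<integral>x. Gu x \<bullet> wgrad h x \<partial>lebesgue) + (\<integral>x. (norm (wgrad h x))\<^sup>2 \<partial>lebesgue))"
  using i1 i2 i3 by simp
 finally have g: "(\<integral>x. (norm (Gu x + wgrad h x))\<^sup>2 \<partial>lebesgue) = (\<integral>x. (norm (Gu x))\<^sup>2 \<partial>lebesgue) + (2 * (\<integral>x. Gu x \<bullet> wgrad h x \<partial>lebesgue) + (\<integral>x. (norm (wgrad h x))\<^sup>2 \<partial>lebesgue))" .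
 have "(\<integral>x. V (norm x) * fRem h x \<partial>lebesgue)
  = (\<integral>x. V (norm x) * (fODE (u x + h x))\<^sup>2 - V (norm x) * (fODE (u x))\<^sup>2 - 2 * (V (norm x) * (kfun (u x) * h x)) \<partial>lebesgue)"
  by (rule Bochner_Integration.integral_cong[OF refl]) (simp add: algebra_simps)
 also have "\<dots> = (\<integral>x. V (norm x) * (fODE (u x + h x))\<^sup>2 \<partial>lebesgue) - (\<integral>x. V (norm x) * (fODE (u x))\<^sup>2 \<partial>lebesgue) - 2 * (\<integral>x. V (norm x) * (kfun (u x) * h x) \<partial>lebesgue)"
  using e1(1) e2(1) w(1) by simp
 finally have v: "(\<integral>x. V (norm x) * fRem h x \<partial>lebesgue) = (\<integral>x. V (norm x) * (fODE (u x + h x))\<^sup>2 \<partial>lebesgue) - (\<integral>x. V (norm x) * (fODE (u x))\<^sup>2 \<partial>lebesgue) - 2 * (\<integral>x. V (norm x) * (kfun (u x) * h x) \<partial>lebesgue)" .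
 have "(\<integral>x. K (norm x) * MRem h x \<partial>lebesgue)
  = (\<integral>x. K (norm x) * Mfun g (u x + h x) - K (norm x) * Mfun g (u x) - K (norm x) * (mfun g (u x) * h x) \<partial>lebesgue)"
  by (rule Bochner_Integration.integral_cong[OF refl]) (simp add: algebra_simps)
 also have "\<dots> = (\<integral>x. K (norm x) * Mfun g (u x + h x) \<partial>lebesgue) - (\<integral>x. K (norm x) * Mfun g (u x) \<partial>lebesgue) - (\<integral>x. K (norm x) * (mfun g (u x) * h x) \<partial>lebesgue)"
  using e1(2) e2(2) w(2) by simp
 finally have k: "(\<integral>x. K (norm x) * MRem h x \<partial>lebesgue) = (\<integral>x. K (norm x) * Mfun g (u x + h x) \<partial>lebesgue) - (\<integral>x. K (norm x) * Mfun g (u x) \<partial>lebesgue) - (\<integral>x. K (norm x) * (mfun g (u x) * h x) \<partial>lebesgue)" .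
 show ?thesis unfolding Ifun_eq[OF uh e1(1)] Ifun_eq[OF u_in_D e2(1)] g v k using w(3) by (simp add: algebra_simps)
qed

lemma u_critical: "critical_point V K g u"
 unfolding critical_point_def
proof (intro conjI u_Espace allI impI)
 fix eps :: real assume eps: "0 < eps"
 define A1 where "A1 = 16 * CV + 1 + 2 * (2 / sqrt (cN TYPE('a)))\<^sup>2"
 have A1: "0 \<le> A1" using CV by (simp add: A1_def)
 obtain \<delta>1 where \<delta>1: "0 < \<delta>1" "\<delta>1 \<le> 1" and R: "\<And>h d. h \<in> Espace V \<Longrightarrow> Enorm V h < d \<Longrightarrow> d < \<delta>1 \<Longrightarrow>
  \<bar>\<integral>x. K (norm x) * MRem h x \<partial>lebesgue\<bar> \<le> eps / 2 * d"
  using K_remainder[OF half_gt_zero[OF eps]] by blast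
 define \<delta> where "\<delta> = min \<delta>1 (eps / (1 + 2 * A1))"
 have \<delta>: "0 < \<delta>" using \<delta>1 eps A1 by (simp add: \<delta>_def)
 have "\<bar>Ifun V K g (\<lambda>x. u x + h x) - Ifun V K g u\<bar> \<le> eps * Enorm V h" if h: "h \<in> Espace V" and hd: "Enorm V h < \<delta>" for h :: "'a \<Rightarrow> real"
 proof -
  let ?\<Delta> = "\<bar>Ifun V K g (\<lambda>x. u x + h x) - Ifun V K g u\<bar>"
  \<comment> \<open>The estimates hold for d strictly above the norm of h, which may be 0; the
    argument by contradiction at the end lets d decrease to the norm.\<close>
  have le: "?\<Delta> \<le> eps * d" if d: "Enorm V h < d" "d < \<delta>" for d
  proof -
   have d0: "0 < d" by (rule le_less_trans[OF _ d(1)]) (simp add: Enorm_def Dnorm_def Onorm_def)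
   note eb = Espace_bounds[OF NN h d(1), folded A1_def]
   note hD = Espace_in_D[OF h]
   have Hm: "wgrad h \<in> borel_measurable lebesgue" and hm[measurable]: "h \<in> borel_measurable lebesgue" using in_DE[OF hD] by blast+
   have "ennreal (\<integral>x. (norm (wgrad h x))\<^sup>2 \<partial>lebesgue) \<le> ennreal (d\<^sup>2)"
    using L2_integrable(2)[OF Hm in_D_finite[OF hD]] eb(1) by simp
   hence 1: "(\<integral>x. (norm (wgrad h x))\<^sup>2 \<partial>lebesgue) \<le> d\<^sup>2" by (simp add: ennreal_le_iff)
   have 10: "0 \<le> (\<integral>x. (norm (wgrad h x))\<^sup>2 \<partial>lebesgue)" by (rule integral_nonneg_AE) simp
   have 2: "\<bar>\<integral>x. V (norm x) * fRem h x \<partial>lebesgue\<bar> \<le> 2 * A1 * d\<^sup>2"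
   proof (rule integral_le_of_nn_bound)
    note [measurable] = V_meas
    have "(\<integral>\<^sup>+x. ennreal \<bar>V (norm x) * fRem h x\<bar> \<partial>lebesgue)
     \<le> (\<integral>\<^sup>+x. 2 * ennreal (V (norm x) * (h x)\<^sup>2) \<partial>lebesgue)"
    proof (rule nn_integral_mono_AE)
     show "AE x in lebesgue. ennreal \<bar>V (norm x) * fRem h x\<bar> \<le> 2 * ennreal (V (norm x) * (h x)\<^sup>2)"
      using AE_nonzero
     proof eventually_elim
      case (elim x)
      hence V: "0 \<le> V (norm x)" by (simp add: V_nonneg)
      have "V (norm x) * fRem h x \<le> V (norm x) * (2 * (h x)\<^sup>2)"
       by (rule mult_left_mono[OF fODE_sq_remainder(2) V])
      moreover have "0 \<le> V (norm x) * fRem h x"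
       by (rule mult_nonneg_nonneg[OF V fODE_sq_remainder(1)])
      ultimately have "ennreal \<bar>V (norm x) * fRem h x\<bar> \<le> ennreal (2 * (V (norm x) * (h x)\<^sup>2))"
       by (intro ennreal_leI) linarith
      also have "\<dots> = 2 * ennreal (V (norm x) * (h x)\<^sup>2)" using V by (simp add: ennreal_mult)
      finally show ?case .
     qed
    qed
    also have "\<dots> = 2 * Vsq h" by (rule nn_integral_cmult) measurable
    also have "\<dots> \<le> 2 * ennreal (A1 * d\<^sup>2)" by (rule mult_left_mono[OF eb(3)]) simp
    also have "\<dots> = ennreal (2 * A1 * d\<^sup>2)" using A1 by (simp add: ennreal_mult mult.assoc)
    finally show "(\<integral>\<^sup>+x. ennreal \<bar>V (norm x) * fRem h x\<bar> \<partial>lebesgue) \<le> ennreal (2 * A1 * d\<^sup>2)" .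
    show "0 \<le> 2 * A1 * d\<^sup>2" using A1 by simp
   qed
   have 3: "\<bar>\<integral>x. K (norm x) * MRem h x \<partial>lebesgue\<bar> \<le> eps / 2 * d"
    by (rule R[OF h d(1)]) (use d(2) in \<open>simp add: \<delta>_def\<close>)
   \<comment> \<open>The quadratic terms contribute half of d^2 + 2 A1 d^2, hence at most eps d / 2;
     the K-remainder takes the other half.\<close>
   have "d \<le> eps / (1 + 2 * A1)" using d(2) by (simp add: \<delta>_def)
   hence "d * (1 + 2 * A1) \<le> eps" using A1 by (simp add: field_simps)
   hence "d * (1 + 2 * A1) * d \<le> eps * d" using d0 by (intro mult_right_mono) auto
   hence 4: "d\<^sup>2 + 2 * A1 * d\<^sup>2 \<le> eps * d" by (simp add: power2_eq_square algebra_simps)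
   show ?thesis unfolding Ifun_expansion[OF h] using 1 10 2 3 4 by linarith
  qed
  show ?thesis
  proof (rule ccontr)
   assume "\<not> ?\<Delta> \<le> eps * Enorm V h"
   hence "Enorm V h < ?\<Delta> / eps" using eps by (simp add: field_simps)
   hence "Enorm V h < min \<delta> (?\<Delta> / eps)" using hd by simp
   then obtain d where d: "Enorm V h < d" "d < min \<delta> (?\<Delta> / eps)" using dense by blast
   have "?\<Delta> \<le> eps * d" using d by (intro le) auto
   moreover have "eps * d < ?\<Delta>" using d eps by (simp add: field_simps)
   ultimately show False by linarith
  qed
 qed
 thus "\<exists>\<delta>>0. \<forall>h\<in>Espace V. Enorm V h < \<delta> \<longrightarrow> \<bar>Ifun V K g (\<lambda>x. u x + h x) - Ifun V K g u\<bar> \<le> eps * Enorm V h"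
  using \<delta> by blast
qed

text \<open>By continuity U has no zero near r0, and the corresponding nonempty open shell has
  positive measure.\<close>

lemma u_not_AE_zero:
 assumes "0 < r0" "U r0 \<noteq> 0" shows "\<not> (AE x in lebesgue. u x = 0)"
proof
 assume "AE x in lebesgue. u x = 0"
 moreover have "isCont U r0" by (rule DERIV_isCont[OF sol_facts(2)[OF assms(1)]])
 from continuous_at_avoid[OF this assms(2)] obtain e where e: "0 < e" "\<And>r. \<bar>r - r0\<bar> < e \<Longrightarrow> U r \<noteq> 0"
  by (auto simp: dist_real_def abs_minus_commute)
 have "{x::'a. \<bar>norm x - r0\<bar> < e} \<noteq> {}"
  using assms e by (intro ex_in_conv[THEN iffD1] exI[of _ "r0 *\<^sub>R e0"]) simp
 moreover have op: "open {x::'a. \<bar>norm x - r0\<bar> < e}" by (intro open_Collect_less continuous_intros)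
 ultimately show False
 proof -
  assume z: "AE x in lebesgue. u x = 0" and ne: "{x::'a. \<bar>norm x - r0\<bar> < e} \<noteq> {}"
  have "AE x in lebesgue. x \<notin> {x::'a. \<bar>norm x - r0\<bar> < e}" using z by eventually_elim (use e in \<open>auto simp: u\<close>)
  hence "{x::'a. \<bar>norm x - r0\<bar> < e} \<in> null_sets lebesgue" using op by (subst AE_iff_null_sets) auto
  hence "negligible {x::'a. \<bar>norm x - r0\<bar> < e}" by (simp add: negligible_iff_null_sets)
  thus False using open_not_negligible[OF op ne] by simp
 qed
qed

end

section \<open>From the growth hypotheses to the weights\<close>

lemma continuous_bounded_on_Icc:
 fixes F :: "real \<Rightarrow> real"
 assumes "continuous_on {0<..} F" "0 < a"
 obtains B where "0 < B" "\<And>r. a \<le> r \<Longrightarrow> r \<le> b \<Longrightarrow> F r \<le> B"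
proof -
 have "bounded (F ` {a..b})"
  by (intro compact_imp_bounded compact_continuous_image continuous_on_subset[OF assms(1)] compact_Icc) (use assms(2) in auto)
 then obtain B where "0 < B" "\<forall>y\<in>F ` {a..b}. norm y \<le> B" unfolding bounded_pos by blast
 thus thesis by (intro that[of B]) (auto intro: order_trans[OF abs_ge_self])
qed

lemma powr_interpolate:
 fixes a b s :: real
 assumes "0 \<le> a" "0 < b" "0 \<le> s" "s \<le> 1"
 shows "a powr s * b powr (1 - s) \<le> a + b"
proof -
 have "a powr s * b powr (1 - s) \<le> (a + b) powr s * (a + b) powr (1 - s)"
  using assms by (intro mult_mono powr_mono2) auto
 also have "\<dots> = a + b" using assms by (simp add: powr_add[symmetric])
 finally show ?thesis .
qed

text \<open>The factor \<open>max 1 CV\<close> majorises CV^\<beta> for all \<beta> in [0, 1], and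
  also the value 1 that \<open>vpow\<close> takes at \<beta> = 0.\<close>

lemma vpow_near_0:
 assumes v: "0 \<le> v" "v \<le> CV / r\<^sup>2" and r: "0 < r" and \<beta>: "0 \<le> \<beta>" "\<beta> \<le> 1" and CV: "0 < CV"
 shows "vpow v \<beta> \<le> max 1 CV * r powr (- 2 * \<beta>)"
proof (cases "\<beta> = 0")
 case False
 have "vpow v \<beta> \<le> (CV / r\<^sup>2) powr \<beta>" using v \<beta> False by (simp add: vpow_def powr_mono2)
 also have "\<dots> = CV powr \<beta> * r powr (- 2 * \<beta>)"
  using r CV by (simp add: powr_divide powr_minus_divide powr_powr flip: powr_numeral)
 also have "\<dots> \<le> max 1 CV * r powr (- 2 * \<beta>)"
 proof (rule mult_right_mono)
  have "CV powr \<beta> \<le> max 1 CV powr \<beta>" using CV \<beta> by (intro powr_mono2) auto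
  also have "\<dots> \<le> max 1 CV powr 1" using \<beta> by (intro powr_mono) auto
  finally show "CV powr \<beta> \<le> max 1 CV" by simp
 qed simp
 finally show ?thesis .
qed (use r in \<open>simp add: vpow_def\<close>)

text \<open>Interpolation between v y^2 and r^(-n). The second is chosen because, times the weight
  r^(n-1), it is 1/r, and any further factor r^(-eta) makes it integrable at infinity.\<close>

lemma vpow_at_infinity:
 assumes v: "0 \<le> v" and r: "0 < r" and y: "0 < y" and \<beta>: "0 \<le> \<beta>" "\<beta> \<le> 1"
 shows "vpow v \<beta> * y powr (2 * \<beta>) \<le> (v * y\<^sup>2 + r powr (- n)) * r powr (n * (1 - \<beta>))"
proof -
 have e: "(r powr (- n)) powr (1 - \<beta>) * r powr (n * (1 - \<beta>)) = 1"
  using r by (simp add: powr_powr powr_add[symmetric])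
 have "vpow v \<beta> * y powr (2 * \<beta>) * (r powr (- n)) powr (1 - \<beta>) \<le> v * y\<^sup>2 + r powr (- n)"
 proof (cases "\<beta> = 0")
  case False
  have "vpow v \<beta> * y powr (2 * \<beta>) = (v * y\<^sup>2) powr \<beta>"
   using False v y by (simp add: vpow_def powr_mult powr_powr flip: powr_numeral)
  thus ?thesis using powr_interpolate[of "v * y\<^sup>2" "r powr (- n)" \<beta>] v r \<beta> by simp
 qed (use v y r in \<open>simp add: vpow_def powr_powr\<close>)
 hence "vpow v \<beta> * y powr (2 * \<beta>) * (r powr (- n)) powr (1 - \<beta>) * r powr (n * (1 - \<beta>)) \<le> (v * y\<^sup>2 + r powr (- n)) * r powr (n * (1 - \<beta>))"
  by (rule mult_right_mono) simp
 thus ?thesis using e by (simp add: mult.assoc)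
qed

text \<open>Exponent counting. Near 0 the bound on V and the decay of x leave the power eta0 - 1,
  and eta0 > 0 because \<beta>0 (N+2) / 2 is at least 2 \<beta>0. At infinity the power 2 \<beta>inf
  of y goes into the interpolation and the rest into the decay rate, leaving r^(-etai). On the
  compact gaps between 1 and R1 or R2, continuity of K is enough.\<close>

lemma weights_from_growth:
 fixes V K :: "real \<Rightarrow> real"
 assumes N: "3 \<le> N" and V_cont: "continuous_on {0<..} V" and V_nonneg: "\<forall>r>0. V r \<ge> 0"
  and K_cont: "continuous_on {0<..} K" and K_pos: "\<forall>r>0. K r > 0"
  and V_bound: "\<exists>C>0. \<forall>r\<in>{0<..<1}. V r \<le> C / r\<^sup>2"
  and R1: "R1 > 0" and \<beta>0: "\<beta>0 \<in> {0..1}"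
  and K0: "\<exists>M. \<forall>r\<in>{0<..<R1}. K r \<le> M * (r powr \<alpha>0 * vpow (V r) \<beta>0)"
  and R2: "R2 > 0" and \<beta>inf: "\<beta>inf \<in> {0..1}"
  and Kinf: "\<exists>M. \<forall>r\<in>{R2<..}. K r \<le> M * (r powr \<alpha>inf * vpow (V r) \<beta>inf)"
  and \<gamma>: "2 < \<gamma>1" "2 < \<gamma>2"
  and e0: "(real N - 2) * \<gamma>1 / 2 < \<alpha>0 + real N - \<beta>0 * (real N + 2) / 2"
  and einf: "\<alpha>inf + real N - 2 * \<beta>inf < (real N - 2) * \<gamma>2 / 2"
 shows "\<exists>eta CK CV. weights N V K \<gamma>1 \<gamma>2 eta CK CV"
proof -
 define n where "n = real N"
 have n: "3 \<le> n" using N by (simp add: n_def)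
 obtain C where C: "0 < C" "\<And>r. 0 < r \<Longrightarrow> r < 1 \<Longrightarrow> V r \<le> C / r\<^sup>2" using V_bound by auto
 \<comment> \<open>The bound is given on the open interval (0, 1); the value of V at 1 adds the
   endpoint.\<close>
 define CV where "CV = max C (V 1)"
 have CV: "0 < CV" using C by (simp add: CV_def)
 have Vb: "V r \<le> CV / r\<^sup>2" if r: "0 < r" "r \<le> 1" for r
 proof (cases "r = 1")
  case False
  have "C / r\<^sup>2 \<le> CV / r\<^sup>2" by (rule divide_right_mono) (simp_all add: CV_def)
  thus ?thesis using C(2)[of r] r False by force
 qed (simp add: CV_def)
 obtain M0' where M0': "\<And>r. 0 < r \<Longrightarrow> r < R1 \<Longrightarrow> K r \<le> M0' * (r powr \<alpha>0 * vpow (V r) \<beta>0)"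
  using K0 by (meson greaterThanLessThan_iff)
 obtain Mi' where Mi': "\<And>r. R2 < r \<Longrightarrow> K r \<le> Mi' * (r powr \<alpha>inf * vpow (V r) \<beta>inf)"
  using Kinf by (meson greaterThan_iff)
 define M0 where "M0 = max 1 M0'"
 define Mi where "Mi = max 1 Mi'"
 have vp: "0 \<le> vpow v b" for v b by (simp add: vpow_def)
 have M: "K r \<le> M0 * (r powr \<alpha>0 * vpow (V r) \<beta>0)" if "0 < r" "r < R1" for r
  by (rule order_trans[OF M0'[OF that]]) (intro mult_right_mono mult_nonneg_nonneg vp, simp_all add: M0_def)
 have Mi: "K r \<le> Mi * (r powr \<alpha>inf * vpow (V r) \<beta>inf)" if "R2 < r" for r
  by (rule order_trans[OF Mi'[OF that]]) (intro mult_right_mono mult_nonneg_nonneg vp, simp_all add: Mi_def)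
 define eta0 where "eta0 = \<alpha>0 - 2 * \<beta>0 + n - (n - 2) * \<gamma>1 / 2"
 define etai where "etai = (n - 2) * \<gamma>2 / 2 - (\<alpha>inf + n - 2 * \<beta>inf)"
 define eta where "eta = min eta0 etai"
 have "0 < eta0"
 proof -
  have "0 \<le> \<beta>0 * (n - 2)" using \<beta>0 n by (intro mult_nonneg_nonneg) auto
  moreover have "\<beta>0 * (n - 2) = \<beta>0 * (n + 2) - 4 * \<beta>0" by (simp add: algebra_simps)
  ultimately show ?thesis using e0 unfolding eta0_def n_def by linarith
 qed
 moreover have "0 < etai" using einf by (simp add: etai_def n_def)
 ultimately have eta: "0 < eta" "eta \<le> eta0" "eta \<le> etai" by (auto simp: eta_def)
 \<comment> \<open>The exponent of r in r^(N-1) times the power \<gamma>1 of the decay rate.\<close>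
 let ?s = "(n - 1) - (n - 2) / 2 * \<gamma>1"
 have c1: "continuous_on {0<..} (\<lambda>r. K r * r powr (?s - (eta - 1)))" by (intro continuous_intros K_cont) auto
 obtain B1 where B1: "0 < B1" "\<And>r. R1 \<le> r \<Longrightarrow> r \<le> 1 \<Longrightarrow> K r * r powr (?s - (eta - 1)) \<le> B1"
  using continuous_bounded_on_Icc[OF c1 R1, where b=1] by blast
 have c2: "continuous_on {0<..} (\<lambda>r. K r * r powr (n - 1) * r powr (eta + 1))" by (intro continuous_intros K_cont) auto
 obtain B2 where B2: "0 < B2" "\<And>r. 1 \<le> r \<Longrightarrow> r \<le> R2 \<Longrightarrow> K r * r powr (n - 1) * r powr (eta + 1) \<le> B2"
  using continuous_bounded_on_Icc[OF c2 zero_less_one, where b=R2] by blast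
 define CK where "CK = M0 * max 1 CV + B1 + B2 + Mi"
 have CK: "0 < CK" "M0 * max 1 CV \<le> CK" "B1 \<le> CK" "B2 \<le> CK" "Mi \<le> CK"
 proof -
  have "0 < M0" "0 < Mi" by (auto simp: M0_def Mi_def)
  moreover from this have "0 < M0 * max 1 CV" by (intro mult_pos_pos) auto
  ultimately show "0 < CK" "M0 * max 1 CV \<le> CK" "B1 \<le> CK" "B2 \<le> CK" "Mi \<le> CK" using B1(1) B2(1) unfolding CK_def by linarith+
 qed
 have omn: "om N r = r powr (n - 1)" if "0 < r" for r using om_powr[OF that, of N] N by (simp add: n_def)
 have ewn: "ew N r powr \<gamma> = r powr (- ((n - 2) / 2 * \<gamma>))" for r \<gamma>
  unfolding ew_def powr_powr n_def by (rule arg_cong2[of _ _ _ _ "(powr)"]) (simp_all add: field_simps)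
 have near: "K r * r powr ?s \<le> CK * r powr (eta - 1)" if r: "0 < r" "r \<le> 1" for r
 proof (cases "r < R1")
  case True
  have "K r * r powr ?s \<le> M0 * (r powr \<alpha>0 * (max 1 CV * r powr (- 2 * \<beta>0))) * r powr ?s"
  proof (rule mult_right_mono[OF order_trans[OF M[OF r(1) True]]])
   have "vpow (V r) \<beta>0 \<le> max 1 CV * r powr (- 2 * \<beta>0)"
    by (rule vpow_near_0[OF _ Vb[OF r] r(1) _ _ CV]) (use V_nonneg r \<beta>0 in auto)
   thus "M0 * (r powr \<alpha>0 * vpow (V r) \<beta>0) \<le> M0 * (r powr \<alpha>0 * (max 1 CV * r powr (- 2 * \<beta>0)))"
    by (intro mult_left_mono) (auto simp: M0_def)
  qed simp
  also have "\<dots> = M0 * max 1 CV * (r powr \<alpha>0 * r powr (- 2 * \<beta>0) * r powr ?s)" by (simp only: mult_ac)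
  also have "r powr \<alpha>0 * r powr (- 2 * \<beta>0) * r powr ?s = r powr (eta0 - 1)"
   unfolding powr_add[symmetric] by (rule arg_cong2[of _ _ _ _ "(powr)"]) (simp_all add: eta0_def)
  also have "M0 * max 1 CV * r powr (eta0 - 1) \<le> CK * r powr (eta - 1)"
   using CK r eta by (intro mult_mono powr_mono') auto
  finally show ?thesis .
 next
  case False
  have "r powr ?s = r powr (?s - (eta - 1)) * r powr (eta - 1)"
   unfolding powr_add[symmetric] by (rule arg_cong2[of _ _ _ _ "(powr)"]) simp_all
  hence "K r * r powr ?s = K r * r powr (?s - (eta - 1)) * r powr (eta - 1)" by (simp only: mult.assoc)
  also have "\<dots> \<le> CK * r powr (eta - 1)" using B1(2)[of r] CK(3) r False by (intro mult_right_mono) auto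
  finally show ?thesis .
 qed
 have far: "K r * y powr \<gamma>2 * om N r \<le> CK * (V r * y\<^sup>2 * om N r * r powr (- eta) + r powr (- eta - 1))"
  if r: "1 \<le> r" and y: "0 < y" "y \<le> ew N r" for r y
 proof -
  have r0: "0 < r" using r by simp
  have V0: "0 \<le> V r" and K0': "0 < K r" using V_nonneg K_pos r0 by auto
  have om0: "0 < om N r" by (rule om_pos[OF r0])
  show ?thesis
  proof (cases "R2 < r")
   case True
   have yA: "y powr (\<gamma>2 - 2 * \<beta>inf) \<le> r powr (- ((n - 2) / 2 * (\<gamma>2 - 2 * \<beta>inf)))"
    unfolding ewn[symmetric] using y \<gamma> \<beta>inf by (intro powr_mono2) auto
   have yB: "vpow (V r) \<beta>inf * y powr (2 * \<beta>inf) \<le> (V r * y\<^sup>2 + r powr (- n)) * r powr (n * (1 - \<beta>inf))"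
    using \<beta>inf by (intro vpow_at_infinity V0 r0 y) auto
   have "vpow (V r) \<beta>inf * y powr (2 * \<beta>inf) * y powr (\<gamma>2 - 2 * \<beta>inf)
     \<le> (V r * y\<^sup>2 + r powr (- n)) * r powr (n * (1 - \<beta>inf)) * r powr (- ((n - 2) / 2 * (\<gamma>2 - 2 * \<beta>inf)))"
    by (rule mult_mono[OF yB yA]) (use V0 in auto)
   hence "vpow (V r) \<beta>inf * y powr \<gamma>2 \<le> (V r * y\<^sup>2 + r powr (- n)) * r powr (n * (1 - \<beta>inf)) * r powr (- ((n - 2) / 2 * (\<gamma>2 - 2 * \<beta>inf)))"
    by (simp only: mult.assoc powr_add[symmetric]) simp
   hence "r powr \<alpha>inf * (vpow (V r) \<beta>inf * y powr \<gamma>2) \<le> r powr \<alpha>inf * ((V r * y\<^sup>2 + r powr (- n)) * r powr (n * (1 - \<beta>inf)) * r powr (- ((n - 2) / 2 * (\<gamma>2 - 2 * \<beta>inf))))"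
    by (rule mult_left_mono) simp
   also have "\<dots> = (V r * y\<^sup>2 + r powr (- n)) * (r powr \<alpha>inf * r powr (n * (1 - \<beta>inf)) * r powr (- ((n - 2) / 2 * (\<gamma>2 - 2 * \<beta>inf))))"
    by (simp only: mult_ac)
   also have "r powr \<alpha>inf * r powr (n * (1 - \<beta>inf)) * r powr (- ((n - 2) / 2 * (\<gamma>2 - 2 * \<beta>inf))) = r powr (- etai)"
    unfolding powr_add[symmetric] by (rule arg_cong2[of _ _ _ _ "(powr)"]) (simp_all add: etai_def field_simps)
   also have "(V r * y\<^sup>2 + r powr (- n)) * r powr (- etai) \<le> (V r * y\<^sup>2 + r powr (- n)) * r powr (- eta)"
    using V0 r eta by (intro mult_left_mono powr_mono) auto
   finally have *: "r powr \<alpha>inf * (vpow (V r) \<beta>inf * y powr \<gamma>2) \<le> (V r * y\<^sup>2 + r powr (- n)) * r powr (- eta)" .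
   have "K r * y powr \<gamma>2 * om N r \<le> Mi * (r powr \<alpha>inf * vpow (V r) \<beta>inf) * y powr \<gamma>2 * om N r"
    using Mi[OF True] om0 by (intro mult_right_mono) auto
   also have "\<dots> = Mi * (r powr \<alpha>inf * (vpow (V r) \<beta>inf * y powr \<gamma>2)) * om N r" by (simp only: mult_ac)
   also have "\<dots> \<le> CK * ((V r * y\<^sup>2 + r powr (- n)) * r powr (- eta)) * om N r"
    by (rule mult_right_mono[OF mult_mono[OF CK(5) *]]) (use CK(1) om0 vp in auto)
   also have "\<dots> = CK * (V r * y\<^sup>2 * om N r * r powr (- eta) + r powr (- n) * r powr (- eta) * om N r)"
    by (simp add: algebra_simps)
   also have "r powr (- n) * r powr (- eta) * om N r = r powr (- eta - 1)"
    unfolding omn[OF r0] powr_add[symmetric] by (rule arg_cong2[of _ _ _ _ "(powr)"]) simp_all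
   finally show ?thesis .
  next
   case False
   have "ew N r \<le> 1" using ew_antimono[of 1 r N] r N by (simp add: ew_def)
   hence "y powr \<gamma>2 \<le> 1 powr \<gamma>2" using y \<gamma> by (intro powr_mono2) auto
   hence "K r * y powr \<gamma>2 * om N r \<le> K r * 1 * om N r" using K0' om0 by (intro mult_right_mono mult_left_mono) auto
   also have "\<dots> = K r * r powr (n - 1) * r powr (eta + 1) * r powr (- eta - 1)"
   proof -
    have "r powr (eta + 1) * r powr (- eta - 1) = 1" using r0 unfolding powr_add[symmetric] by simp
    thus ?thesis by (simp add: omn[OF r0] mult.assoc)
   qed
   also have "\<dots> \<le> CK * r powr (- eta - 1)" using B2(2)[OF r] CK(4) False by (intro mult_right_mono) auto
   also have "\<dots> \<le> CK * (V r * y\<^sup>2 * om N r * r powr (- eta) + r powr (- eta - 1))"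
    using CK V0 om0 by (intro mult_left_mono) auto
   finally show ?thesis .
  qed
 qed
 have "weights N V K \<gamma>1 \<gamma>2 eta CK CV"
 proof
  show "K r * x powr \<gamma>1 * om N r \<le> CK * S powr \<gamma>1 * r powr (eta - 1)"
   if r: "0 < r" "r \<le> 1" and S: "0 < S" and x: "0 \<le> x" "x \<le> S * ew N r" for r S x
  proof -
   have K: "0 < K r" using K_pos r by simp
   have "x powr \<gamma>1 \<le> (S * ew N r) powr \<gamma>1" using x \<gamma> by (intro powr_mono2) auto
   also have "\<dots> = S powr \<gamma>1 * r powr (- ((n - 2) / 2 * \<gamma>1))" using S ew_pos[OF r(1), of N] by (simp add: powr_mult ewn)
   finally have "K r * x powr \<gamma>1 * om N r \<le> K r * (S powr \<gamma>1 * r powr (- ((n - 2) / 2 * \<gamma>1))) * om N r"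
    using K om_pos[OF r(1), of N] by (intro mult_right_mono mult_left_mono) auto
   also have "\<dots> = S powr \<gamma>1 * (K r * (r powr (- ((n - 2) / 2 * \<gamma>1)) * r powr (n - 1)))"
    by (simp only: omn[OF r(1)] mult_ac)
   also have "r powr (- ((n - 2) / 2 * \<gamma>1)) * r powr (n - 1) = r powr ?s"
    unfolding powr_add[symmetric] by (rule arg_cong2[of _ _ _ _ "(powr)"]) simp_all
   also have "S powr \<gamma>1 * (K r * r powr ?s) \<le> S powr \<gamma>1 * (CK * r powr (eta - 1))" by (intro mult_left_mono near r) simp
   finally show ?thesis by (simp only: mult_ac)
  qed
  show "K r * x powr \<gamma>2 * om N r \<le> CK * S powr \<gamma>2 * (V r * (x / S)\<^sup>2 * om N r * r powr (- eta) + r powr (- eta - 1))"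
   if r: "1 \<le> r" and S: "0 < S" and x: "0 \<le> x" "x \<le> S * ew N r" for r S x
  proof (cases "x = 0")
   case True
   thus ?thesis using CK by simp
  next
   case False
   \<comment> \<open>By homogeneity it is enough to treat x/S, which lies below the decay rate
     itself.\<close>
   have "K r * (x / S) powr \<gamma>2 * om N r \<le> CK * (V r * (x / S)\<^sup>2 * om N r * r powr (- eta) + r powr (- eta - 1))"
    by (rule far[OF r]) (use x S False in \<open>auto simp: field_simps\<close>)
   hence "S powr \<gamma>2 * (K r * (x / S) powr \<gamma>2 * om N r) \<le> S powr \<gamma>2 * (CK * (V r * (x / S)\<^sup>2 * om N r * r powr (- eta) + r powr (- eta - 1)))"
    by (rule mult_left_mono) simp
   moreover have "S powr \<gamma>2 * (x / S) powr \<gamma>2 = x powr \<gamma>2" using S x by (simp add: powr_mult[symmetric])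
   hence "S powr \<gamma>2 * (K r * (x / S) powr \<gamma>2 * om N r) = K r * x powr \<gamma>2 * om N r" by (metis mult.assoc mult.left_commute)
   ultimately show ?thesis by (simp only: mult.assoc mult.left_commute)
  qed
 qed (use N V_cont V_nonneg K_cont K_pos Vb CV eta CK in auto)
 thus ?thesis by blast
qed

section \<open>Truncation and conclusion\<close>

lemma prim_truncate:
 assumes g0: "g 0 = 0"
 shows "prim (\<lambda>t. g (max 0 t)) t = (if 0 \<le> t then prim g t else 0)"
proof (cases "0 \<le> t")
 case True
 have "integral {0..t} (\<lambda>t. g (max 0 t)) = integral {0..t} g" by (rule integral_cong) simp
 thus ?thesis using True by (simp add: prim_def)
next
 case False
 have "integral {t..0} (\<lambda>t. g (max 0 t)) = integral {t..0} (\<lambda>t. 0)" by (rule integral_cong) (simp add: g0)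
 thus ?thesis using False by (simp add: prim_def)
qed

theorem theorem4p1:
  fixes V K g :: "real \<Rightarrow> real"
    and R1 R2 \<beta>0 \<beta>inf \<alpha>0 \<alpha>inf q1 q2 :: real
  assumes dim: "DIM('a::euclidean_space) \<ge> 3"
    and V_cont: "continuous_on {0<..} V" and V_nonneg: "\<forall>r>0. V r \<ge> 0"
    and K_cont: "continuous_on {0<..} K" and K_pos: "\<forall>r>0. K r > 0"
    and V_bound: "\<exists>C>0. \<forall>r\<in>{0<..<1}. V r \<le> C / r\<^sup>2"
    and R1: "R1 > 0" and \<beta>0: "\<beta>0 \<in> {0..1}"
    and K0: "\<exists>M. \<forall>r\<in>{0<..<R1}. K r \<le> M * (r powr \<alpha>0 * vpow (V r) \<beta>0)"
    and R2: "R2 > 0" and \<beta>inf: "\<beta>inf \<in> {0..1}"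
    and Kinf: "\<exists>M. \<forall>r\<in>{R2<..}. K r \<le> M * (r powr \<alpha>inf * vpow (V r) \<beta>inf)"
    and q1: "4 < q1" "q1 < 2 * q0star (real DIM('a)) \<alpha>0 \<beta>0"
    and q2: "q2 > max 4 (2 * qinfstar (real DIM('a)) \<alpha>inf \<beta>inf)"
    and g_cont: "continuous_on UNIV g"
    and AR: "\<exists>\<theta>>2. \<forall>t. 0 \<le> 2 * \<theta> * prim g t \<and> 2 * \<theta> * prim g t \<le> g t * t"
    and G_pos: "\<exists>t0>0. prim g t0 > 0"
    and g_growth: "\<exists>C>0. \<forall>t. \<bar>g t\<bar> \<le> C * min (\<bar>t\<bar> powr (q1 - 1)) (\<bar>t\<bar> powr (q2 - 1))"
  shows "\<exists>u::'a \<Rightarrow> real. u \<in> Espace V \<and> critical_point V K g u \<and>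
           (AE x in lebesgue. u x \<ge> 0) \<and> \<not> (AE x in lebesgue. u x = 0)"
proof -
 define N where "N = DIM('a)"
 have N3: "3 \<le> N" using dim by (simp add: N_def)
 have n: "0 < real N - 2" using N3 by simp
 obtain \<theta> where \<theta>: "2 < \<theta>" "\<And>t. 0 \<le> 2 * \<theta> * prim g t" "\<And>t. 2 * \<theta> * prim g t \<le> g t * t" using AR by blast
 obtain t0 where t0: "0 < t0" "0 < prim g t0" using G_pos by blast
 obtain Cg where Cg: "0 < Cg" "\<And>t. \<bar>g t\<bar> \<le> Cg * min (\<bar>t\<bar> powr (q1 - 1)) (\<bar>t\<bar> powr (q2 - 1))" using g_growth by blast
 have gr: "\<bar>g t\<bar> \<le> Cg * \<bar>t\<bar> powr (q1 - 1)" "\<bar>g t\<bar> \<le> Cg * \<bar>t\<bar> powr (q2 - 1)" for t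
  by (rule order_trans[OF Cg(2) mult_left_mono]; use Cg(1) in simp)+
 \<comment> \<open>As \<open>0 powr x\<close> is 0 for every x, the growth bound at t = 0 gives g 0
   = 0; the truncation therefore vanishes on the whole negative axis.\<close>
 have g0: "g 0 = 0" using gr(1)[of 0] by simp
 have "\<exists>eta CK CV. weights N V K (q1 / 2) (q2 / 2) eta CK CV"
 proof (rule weights_from_growth[OF N3 V_cont V_nonneg K_cont K_pos V_bound R1 \<beta>0 K0 R2 \<beta>inf Kinf])
  show "2 < q1 / 2" "2 < q2 / 2" using q1 q2 by auto
  have "q1 < 2 * (2 * \<alpha>0 + 2 * real N - \<beta>0 * (real N + 2)) / (real N - 2)" using q1(2) by (simp add: q0star_def N_def)
  hence "q1 * (real N - 2) < 2 * (2 * \<alpha>0 + 2 * real N - \<beta>0 * (real N + 2))" using n by (simp only: pos_less_divide_eq)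
  thus "(real N - 2) * (q1 / 2) / 2 < \<alpha>0 + real N - \<beta>0 * (real N + 2) / 2" by (simp add: field_simps)
  have "2 * (2 * (\<alpha>inf + real N - 2 * \<beta>inf)) / (real N - 2) < q2" using q2 by (simp add: qinfstar_def N_def)
  hence "2 * (2 * (\<alpha>inf + real N - 2 * \<beta>inf)) < q2 * (real N - 2)" using n by (simp only: pos_divide_less_eq)
  thus "\<alpha>inf + real N - 2 * \<beta>inf < (real N - 2) * (q2 / 2) / 2" by (simp add: field_simps)
 qed
 then obtain eta CK CV where w: "weights N V K (q1 / 2) (q2 / 2) eta CK CV" by blast
 define gp where "gp t = g (max 0 t)" for t
 have nl: "nonlin g (q1 / 2) (q2 / 2) Cg \<theta> t0"
  by unfold_locales (use g_cont \<theta> t0 q1 q2 Cg(1) gr in auto)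
 have pp: "prim gp t = (if 0 \<le> t then prim g t else 0)" for t
  using prim_truncate[of g t] g0 by (simp add: gp_def[abs_def])
 have nlp: "nonlin gp (q1 / 2) (q2 / 2) Cg \<theta> t0"
 proof
  show "continuous_on UNIV gp" unfolding gp_def[abs_def]
   by (intro continuous_on_compose2[OF g_cont] continuous_intros) auto
  show "0 \<le> 2 * \<theta> * prim gp t" "2 * \<theta> * prim gp t \<le> gp t * t" for t
   using \<theta>(2)[of t] \<theta>(3)[of t] g0 by (auto simp: pp gp_def max_def)
  show "\<bar>gp t\<bar> \<le> Cg * \<bar>t\<bar> powr (2 * (q1 / 2) - 1)" "\<bar>gp t\<bar> \<le> Cg * \<bar>t\<bar> powr (2 * (q2 / 2) - 1)" for t
   using gr[of t] g0 Cg(1) by (auto simp: gp_def max_def)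
 qed (use \<theta> t0 q1 q2 Cg(1) in \<open>auto simp: pp\<close>)
 interpret p: radial_problem gp "q1 / 2" "q2 / 2" Cg \<theta> t0 N V K eta CK CV
  by (rule radial_problem.intro[OF nlp w])
 interpret r: radial_problem g "q1 / 2" "q2 / 2" Cg \<theta> t0 N V K eta CK CV
  by (rule radial_problem.intro[OF nl w])
 obtain U W S where sol: "p.is_radial_solution U W S" and ne: "\<exists>r>0. U r \<noteq> 0" using p.radial_solution_exists by blast
 have U0: "0 \<le> U r" if "0 < r" for r
  by (rule p.radial_solution_nonneg[OF sol _ that]) (simp add: gp_def max_def g0)
 \<comment> \<open>Since U \<ge> 0, also f(U) \<ge> 0, where the truncation agrees with g: the
   solution of the truncated problem solves the original one, and the critical point belongs to the
   functional of g itself.\<close>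
 have "r.wf s (U s) = p.wf s (U s)" if "0 < s" for s
  using fODE_nonneg[OF U0[OF that]] by (simp add: r.wf_def p.wf_def mfun_def gp_def)
 hence sol': "r.is_radial_solution U W S"
  using sol by (simp add: r.is_radial_solution_def p.is_radial_solution_def)
 interpret c: radial_critical g "q1 / 2" "q2 / 2" Cg \<theta> t0 N V K eta CK CV U W S "\<lambda>x::'a. U (norm x)"
  by unfold_locales (simp_all add: N_def[symmetric] sol')
 have "AE x in lebesgue. 0 \<le> U (norm (x::'a))" using AE_nonzero by eventually_elim (simp add: U0)
 thus ?thesis using c.u_Espace c.u_critical c.u_not_AE_zero ne by blast
qed

end
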